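(* Let $\alpha\in\mathbb{R}\setminus\mathbb{Q}$, let $\gamma\in(0,1)$, and let $\Phi\in \mathscr{C}^2(\mathbb{T}\setminus\{0\})$, $\Phi>0$, satisfy $$\lim_{x\to 0^{\pm}}\frac{\Phi''(x)}{|x|^{-2-\gamma}}=N_{\pm},\qquad N_+=N_-\neq 0 .$$ Let $(K_t)_{t\in\mathbb{R}}$ be the special flow over the rotation $R_\alpha$ and under the roof function $\Phi$ (a Kochergin flow on $\mathbb{T}^2$ with one fixed point). Then $(K_t)_{t\in\mathbb{R}}$ is mixing of all orders.
   Context: $\mathbb{T}=\mathbb{R}/\mathbb{Z}$ with Lebesgue measure, and $R_\alpha x=x+\alpha$. The roof $\Phi$ is normalized so that $\int_{\mathbb{T}}\Phi=1$. The suspension space is $\mathbb{T}^{\Phi}=\{(x,r)\in \mathbb{T}\times\mathbb{R}:0\le r\le\Phi(x)\}/\sim$, where $(x,\Phi(x))\sim(R_\alpha x,0)$, with the probability measure $\mu$ given by the restriction of the product of Lebesgue measure on $\mathbb{T}$ and Lebesgue measure on the vertical fibres. The special flow over $R_\alpha$ under $\Phi$ moves every point vertically with unit speed: $K_t(x,r)=(x+n\alpha,\; r+t-S_n\Phi(x))$, where $S_n\Phi$ are the Birkhoff sums of $\Phi$ over $R_\alpha$ and $n=N(x,r,t)$ is the unique integer with $0\le r+t-S_n\Phi(x)<\Phi(x+n\alpha)$. It preserves $\mu$. A measure preserving flow $(K_t)$ of a probability space is mixing of order $k$ if for all measurable $A_0,\dots,A_{k-1}$, $\mu\big(\bigcap_{i=0}^{k-1}K_{t_i}A_i\big)\to\prod_{i=0}^{k-1}\mu(A_i)$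 as $\min_{0<i<k}(t_i-t_{i-1})\to\infty$, over $0=t_0<t_1<\dots<t_{k-1}$. It is mixing of all orders if it is mixing of order $k$ for every $k\ge2$. *)

theory Defs
  imports "HOL-Probability.Probability"
begin

text \<open>
  A function on the circle \<open>\<real>/\<int>\<close> minus the point \<open>0\<close> is represented by a 1-periodic function on the
  real line, of which only the values off \<open>\<int>\<close> are relevant. A point of the circle is represented
  by its representative in \<open>[0,1)\<close>.
\<close>

definition C2_on :: "real set \<Rightarrow> (real \<Rightarrow> real) \<Rightarrow> bool" where
  "C2_on S f \<longleftrightarrow>
     (\<forall>x\<in>S. f field_differentiable at x) \<and>
     (\<forall>x\<in>S. deriv f field_differentiable at x) \<and>
     continuous_on S (deriv (deriv f))"

definition birkhoff_sum :: "real \<Rightarrow> (real \<Rightarrow> real) \<Rightarrow> int \<Rightarrow> real \<Rightarrow> real" where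
  "birkhoff_sum \<alpha> \<Phi> n x =
     (if 0 \<le> n then (\<Sum>k\<in>{0..<n}. \<Phi> (x + of_int k * \<alpha>))
      else - (\<Sum>k\<in>{n..<0}. \<Phi> (x + of_int k * \<alpha>)))"

text \<open>
  Each class of the suspension space has exactly one representative \<open>(x, r)\<close> with \<open>0 \<le> r < \<Phi> x\<close>.
  Since the roof is not defined at \<open>0\<close>, the (countable, hence null) set of base points whose
  orbit under the rotation meets \<open>0\<close> is removed; on the remaining points the flow is defined for all times.
\<close>

definition suspension_space :: "real \<Rightarrow> (real \<Rightarrow> real) \<Rightarrow> (real \<times> real) set" where
  "suspension_space \<alpha> \<Phi> =
     {(x, r). 0 \<le> x \<and> x < 1 \<and> (\<forall>k::int. x + of_int k * \<alpha> \<notin> \<int>) \<and> 0 \<le> r \<and> r < \<Phi> x}"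

definition suspension_measure :: "real \<Rightarrow> (real \<Rightarrow> real) \<Rightarrow> (real \<times> real) measure" where
  "suspension_measure \<alpha> \<Phi> = restrict_space (lborel \<Otimes>\<^sub>M lborel) (suspension_space \<alpha> \<Phi>)"

definition crossings :: "real \<Rightarrow> (real \<Rightarrow> real) \<Rightarrow> real \<Rightarrow> real \<Rightarrow> real \<Rightarrow> int" where
  "crossings \<alpha> \<Phi> x r t =
     (THE n. 0 \<le> r + t - birkhoff_sum \<alpha> \<Phi> n x \<and>
             r + t - birkhoff_sum \<alpha> \<Phi> n x < \<Phi> (x + of_int n * \<alpha>))"

definition special_flow :: "real \<Rightarrow> (real \<Rightarrow> real) \<Rightarrow> real \<Rightarrow> real \<times> real \<Rightarrow> real \<times> real" where
  "special_flow \<alpha> \<Phi> t = (\<lambda>(x, r).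
     let n = crossings \<alpha> \<Phi> x r t
     in (frac (x + of_int n * \<alpha>), r + t - birkhoff_sum \<alpha> \<Phi> n x))"

definition measure_preserving_flow :: "'a measure \<Rightarrow> (real \<Rightarrow> 'a \<Rightarrow> 'a) \<Rightarrow> bool" where
  "measure_preserving_flow M K \<longleftrightarrow>
     (\<forall>t. K t \<in> M \<rightarrow>\<^sub>M M \<and> distr M M (K t) = M) \<and>
     (\<forall>x\<in>space M. K 0 x = x) \<and>
     (\<forall>s t. \<forall>x\<in>space M. K (s + t) x = K s (K t x))"

definition mixing_of_order :: "nat \<Rightarrow> 'a measure \<Rightarrow> (real \<Rightarrow> 'a \<Rightarrow> 'a) \<Rightarrow> bool" where
  "mixing_of_order k M K \<longleftrightarrow>
     prob_space M \<and> measure_preserving_flow M K \<and>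
     (\<forall>A :: nat \<Rightarrow> 'a set. (\<forall>i<k. A i \<in> sets M) \<longrightarrow>
        ((\<lambda>t :: nat \<Rightarrow> real. measure M (\<Inter>i<k. K (t i) ` A i)) \<longlongrightarrow> (\<Prod>i<k. measure M (A i)))
          (inf (filtercomap (\<lambda>t. MIN i\<in>{0<..<k}. t i - t (i - 1)) at_top)
               (principal {t. t 0 = 0 \<and> (\<forall>i\<in>{0<..<k}. t (i - 1) < t i)})))"

definition mixing_of_all_orders :: "'a measure \<Rightarrow> (real \<Rightarrow> 'a \<Rightarrow> 'a) \<Rightarrow> bool" where
  "mixing_of_all_orders M K \<longleftrightarrow> (\<forall>k\<ge>2. mixing_of_order k M K)"

end

theory Submission
  imports Defs "HOL-Analysis.Kronecker_Approximation_Theorem"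
begin

text \<open>
  Mixing of order \<open>n + 1\<close> is deduced from mixing of order \<open>n\<close> by shearing. Near a typical point, moving
  by \<open>y\<close> along the base changes the position at time \<open>t\<^sub>i\<close> by the flow time \<open>- v\<^sub>i y\<close>, where \<open>v\<^sub>i\<close> is the
  derivative of the Birkhoff sum of the roof up to time \<open>t\<^sub>i\<close>. Put \<open>P = max \<bar>v\<^sub>i\<bar>\<close> and \<open>c\<^sub>i = v\<^sub>i / P\<close>. Since
  \<open>P\<close> is nearly constant on the scale \<open>R / P\<close>, the integral of a function fixed at time \<open>0\<close> against
  \<open>\<Prod>\<^sub>i f\<^sub>i (K\<^bsub>t\<^sub>i\<^esub> z)\<close>, with \<open>f\<^sub>i\<close> of mean zero, is close to the one against the average over \<open>0 \<le> s \<le> R\<close> of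
  \<open>\<Prod>\<^sub>i f\<^sub>i (K\<^bsub>t\<^sub>i - c\<^sub>i s\<^esub> z)\<close>. The \<open>c\<^sub>i\<close> are almost invariant under \<open>K\<^bsub>u\<^esub>\<close> for fixed \<open>u\<close> and some \<open>\<bar>c\<^sub>i\<bar>\<close> is \<open>1\<close>, so by
  mixing of orders \<open>n\<close> and \<open>2\<close> the values at far apart \<open>s\<close> decorrelate and the average is small in mean square.
  For \<open>n = 1\<close> the average is an ergodic average.

  The shear is effective when \<open>v\<^sup>2\<close> dominates the second derivative of the Birkhoff sum. As that second
  derivative is large and of one sign, the exceptional set is
  porous at the scale given by the second derivative and hence has small measure.
\<close>

text \<open>Since the two one-sided limits agree, the first derivative of the roof blows up with
  opposite signs on the two sides of the singularity. Its Birkhoff sums cancel and vanish at some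
  points, so the shear has no pointwise lower bound. What does not cancel is \<open>V\<close>, the
  Birkhoff sum of \<open>\<bar>x\<bar> powr (-2-\<gamma>)\<close>. It bounds the growth of the shear
  from below and the Taylor errors from above, and every length is compared with it: bad points are
  separated at the scale \<open>1 / sqrt V\<close>, and where \<open>P^2 >= A * V\<close> a move by
  \<open>R / P\<close> has a Taylor remainder of order \<open>V * (R / P)^2 <= R^2 / A\<close>,
  small for large \<open>A\<close>. Such moves do not meet the singularity, which stays at distance
  \<open>V powr (-1/(2+\<gamma>))\<close> or more, larger than \<open>1 / sqrt V\<close> by a
  positive power of \<open>V\<close> because \<open>\<gamma> > 0\<close>. A move also changes the
  number of crossings, but only by some \<open>k\<close> that does not depend on \<open>V\<close>.
  Therefore constants are chosen in a fixed order: \<open>A\<close> and \<open>k\<close>, then the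
  distance \<open>\<eta>\<close> kept from the singularity near the end of the orbit segment, then
  the number \<open>n0\<close> of crossings.\<close>

definition gaps :: "nat \<Rightarrow> real \<Rightarrow> (nat \<Rightarrow> real) \<Rightarrow> bool" where
  "gaps n T t \<longleftrightarrow> (\<forall>i. Suc i < n \<longrightarrow> t i + T \<le> t (Suc i))"

lemma gaps_mono: "gaps n T t \<Longrightarrow> T' \<le> T \<Longrightarrow> gaps n T' t"
  unfolding gaps_def by (smt (verit))

lemma gaps_fun_upd:
  assumes "gaps n (T + \<bar>u\<bar>) t" shows "gaps n T (t(j := t j + u))"
  unfolding gaps_def
proof (intro allI impI)
  fix i assume i: "Suc i < n"
  have "t i + (T + \<bar>u\<bar>) \<le> t (Suc i)" using assms i by (auto simp: gaps_def)
  then show "(t(j := t j + u)) i + T \<le> (t(j := t j + u)) (Suc i)" by auto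
qed

lemma abs_prod_le_1:
  fixes f :: "'b \<Rightarrow> real"
  assumes "\<And>i. i \<in> A \<Longrightarrow> \<bar>f i\<bar> \<le> 1"
  shows "\<bar>\<Prod>i\<in>A. f i\<bar> \<le> 1"
proof -
  have "\<bar>\<Prod>i\<in>A. f i\<bar> = (\<Prod>i\<in>A. \<bar>f i\<bar>)" by (rule abs_prod)
  also have "\<dots> \<le> (\<Prod>i\<in>A. 1)" by (intro prod_mono) (use assms in auto)
  finally show ?thesis by simp
qed

lemma abs_prod_diff_le:
  fixes f g :: "'b \<Rightarrow> real"
  assumes "finite A" "\<And>i. i \<in> A \<Longrightarrow> \<bar>f i\<bar> \<le> 1" "\<And>i. i \<in> A \<Longrightarrow> \<bar>g i\<bar> \<le> 1"
  shows "\<bar>(\<Prod>i\<in>A. f i) - (\<Prod>i\<in>A. g i)\<bar> \<le> (\<Sum>i\<in>A. \<bar>f i - g i\<bar>)"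
  using norm_prod_diff[of A f g] assms by simp

section \<open>Measure preserving flows and correlations of several functions\<close>

locale mp_flow = prob_space M for M :: "'a measure" +
  fixes K :: "real \<Rightarrow> 'a \<Rightarrow> 'a"
  assumes K_measurable [measurable]: "K t \<in> M \<rightarrow>\<^sub>M M"
    and K_distr: "distr M M (K t) = M"
    and K_0: "x \<in> space M \<Longrightarrow> K 0 x = x"
    and K_add: "x \<in> space M \<Longrightarrow> K (s + t) x = K s (K t x)"
begin

text \<open>The bound 1, rather than just any bound, makes the class closed under products and lets
  changes of single factors of a product add up without constants.\<close>

definition unit_bounded :: "('a \<Rightarrow> real) set" where
  "unit_bounded = {f \<in> borel_measurable M. \<forall>x\<in>space M. \<bar>f x\<bar> \<le> 1}"

definition corr :: "nat \<Rightarrow> (nat \<Rightarrow> 'a \<Rightarrow> real) \<Rightarrow> (nat \<Rightarrow> real) \<Rightarrow> real" where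
  "corr n f t = (\<integral>x. (\<Prod>i<n. f i (K (t i) x)) \<partial>M)"

abbreviation means :: "nat \<Rightarrow> (nat \<Rightarrow> 'a \<Rightarrow> real) \<Rightarrow> real" where
  "means n f \<equiv> (\<Prod>i<n. \<integral>x. f i x \<partial>M)"

abbreviation defect :: "nat \<Rightarrow> (nat \<Rightarrow> 'a \<Rightarrow> real) \<Rightarrow> (nat \<Rightarrow> real) \<Rightarrow> real" where
  "defect n f t \<equiv> \<bar>corr n f t - means n f\<bar>"

text \<open>The estimate is uniform over all time vectors with large gaps. The first time is left
  free, which is harmless because the flow preserves the measure.\<close>

definition mixes :: "nat \<Rightarrow> (nat \<Rightarrow> 'a \<Rightarrow> real) \<Rightarrow> bool" where
  "mixes n f \<longleftrightarrow>
     (\<forall>\<epsilon>>0. \<exists>T. \<forall>t. gaps n T t \<longrightarrow> defect n f t < \<epsilon>)"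

lemma K_space: "x \<in> space M \<Longrightarrow> K t x \<in> space M"
  using K_measurable[of t] by (rule measurable_space)

lemma integral_K: "f \<in> borel_measurable M \<Longrightarrow> (\<integral>x. f (K t x) \<partial>M) = (\<integral>x. f x \<partial>M)" for f :: "'a \<Rightarrow> real"
  using integral_distr[OF K_measurable, of f t] by (simp add: K_distr)

lemma integrable_K: "integrable M f \<Longrightarrow> integrable M (\<lambda>x. f (K t x))" for f :: "'a \<Rightarrow> real"
  using integrable_distr_eq[OF K_measurable, of f t] by (simp add: K_distr)

lemma unit_boundedD:
  assumes "f \<in> unit_bounded"
  shows "f \<in> borel_measurable M" "x \<in> space M \<Longrightarrow> \<bar>f x\<bar> \<le> 1" "integrable M f" "\<bar>\<integral>x. f x \<partial>M\<bar> \<le> 1"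
proof -
  show m: "f \<in> borel_measurable M" and b: "x \<in> space M \<Longrightarrow> \<bar>f x\<bar> \<le> 1" for x using assms by (auto simp: unit_bounded_def)
  show i: "integrable M f" by (rule integrable_const_bound[where B = 1]) (use m b in auto)
  have "\<bar>\<integral>x. f x \<partial>M\<bar> \<le> (\<integral>x. \<bar>f x\<bar> \<partial>M)" by (rule integral_abs_bound)
  also have "\<dots> \<le> (\<integral>x. 1 \<partial>M)" by (intro integral_mono) (use i b in auto)
  finally show "\<bar>\<integral>x. f x \<partial>M\<bar> \<le> 1" by (simp add: prob_space)
qed

lemma unit_boundedI:
  "f \<in> borel_measurable M \<Longrightarrow> (\<And>x. x \<in> space M \<Longrightarrow> \<bar>f x\<bar> \<le> 1) \<Longrightarrow> f \<in> unit_bounded" by (auto simp: unit_bounded_def)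

lemma unit_bounded_K: "f \<in> unit_bounded \<Longrightarrow> (\<lambda>x. f (K t x)) \<in> unit_bounded"
  by (auto simp: unit_bounded_def K_space)

lemma unit_bounded_mult:
  "f \<in> unit_bounded \<Longrightarrow> g \<in> unit_bounded \<Longrightarrow> (\<lambda>x. f x * g x) \<in> unit_bounded"
  by (auto simp: unit_bounded_def abs_mult intro!: mult_le_one)

lemma unit_bounded_prod:
  "(\<And>i. i \<in> A \<Longrightarrow> f i \<in> unit_bounded) \<Longrightarrow> (\<lambda>x. \<Prod>i\<in>A. f i x) \<in> unit_bounded"
  by (intro unit_boundedI borel_measurable_prod abs_prod_le_1) (auto simp: unit_bounded_def)

lemma integral_mult_bounded:
  fixes g :: "'a \<Rightarrow> real"
  assumes g: "integrable M g" and w: "w \<in> unit_bounded"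
  shows "integrable M (\<lambda>x. g x * w x)" "\<bar>\<integral>x. g x * w x \<partial>M\<bar> \<le> (\<integral>x. \<bar>g x\<bar> \<partial>M)"
proof -
  have [measurable]: "g \<in> borel_measurable M" "w \<in> borel_measurable M" using g unit_boundedD[OF w] by auto
  have le: "\<bar>g x * w x\<bar> \<le> \<bar>g x\<bar>" if "x \<in> space M" for x
    using mult_left_mono[OF unit_boundedD(2)[OF w that], of "\<bar>g x\<bar>"] by (simp add: abs_mult)
  show i: "integrable M (\<lambda>x. g x * w x)" by (rule Bochner_Integration.integrable_bound[OF g]) (use le in auto)
  have "\<bar>\<integral>x. g x * w x \<partial>M\<bar> \<le> (\<integral>x. \<bar>g x * w x\<bar> \<partial>M)" by (rule integral_abs_bound)
  also have "\<dots> \<le> (\<integral>x. \<bar>g x\<bar> \<partial>M)" by (intro integral_mono) (use g i le in auto)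
  finally show "\<bar>\<integral>x. g x * w x \<partial>M\<bar> \<le> (\<integral>x. \<bar>g x\<bar> \<partial>M)" .
qed

text \<open>Applied with \<open>g\<close> the product at the unsheared times and \<open>h\<close>
  its average over the shear: shearing controls the first term on the right, decorrelation the
  second.\<close>

lemma integral_perturb_le:
  assumes f: "f \<in> unit_bounded" and g: "g \<in> unit_bounded" and h: "integrable M h"
  shows "\<bar>\<integral>x. f x * g x \<partial>M\<bar> \<le> \<bar>\<integral>x. f x * (g x - h x) \<partial>M\<bar> + (\<integral>x. \<bar>h x\<bar> \<partial>M)"
proof -
  have "integrable M (\<lambda>x. f x * g x)" by (rule unit_boundedD(3)[OF unit_bounded_mult[OF f g]])
  moreover have hf: "integrable M (\<lambda>x. f x * h x)" "\<bar>\<integral>x. f x * h x \<partial>M\<bar> \<le> (\<integral>x. \<bar>h x\<bar> \<partial>M)"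
    using integral_mult_bounded[OF h f] by (simp_all add: mult.commute)
  ultimately have "(\<integral>x. f x * (g x - h x) \<partial>M) = (\<integral>x. f x * g x \<partial>M) - (\<integral>x. f x * h x \<partial>M)"
    by (simp add: right_diff_distrib)
  then show ?thesis using hf(2) by linarith
qed

text \<open>Nonnegativity of the variance of \<open>\<bar>f\<bar>\<close>.\<close>

lemma integral_square_le:
  fixes f :: "'a \<Rightarrow> real"
  assumes "integrable M f" "integrable M (\<lambda>x. (f x)\<^sup>2)"
  shows "(\<integral>x. \<bar>f x\<bar> \<partial>M)\<^sup>2 \<le> (\<integral>x. (f x)\<^sup>2 \<partial>M)"
proof -
  define m where "m = (\<integral>x. \<bar>f x\<bar> \<partial>M)"
  have "0 \<le> (\<integral>x. (\<bar>f x\<bar> - m)\<^sup>2 \<partial>M)" by simp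
  also have "\<dots> = (\<integral>x. (f x)\<^sup>2 - 2 * m * \<bar>f x\<bar> + m\<^sup>2 \<partial>M)"
    by (intro Bochner_Integration.integral_cong) (auto simp: power2_eq_square algebra_simps)
  also have "\<dots> = (\<integral>x. (f x)\<^sup>2 \<partial>M) - 2 * m * m + m\<^sup>2" using assms by (simp add: m_def prob_space)
  finally show ?thesis by (simp add: m_def power2_eq_square)
qed

subsection \<open>Correlations as functions of one slot\<close>

lemma corr_fun_upd:
  assumes "j < n"
  shows "corr n (f(j := g)) t = (\<integral>x. g (K (t j) x) * (\<Prod>i\<in>{..<n} - {j}. f i (K (t i) x)) \<partial>M)"
  unfolding corr_def using assms
  by (intro Bochner_Integration.integral_cong refl) (simp add: prod.remove[of "{..<n}" j])

lemma prod_mean_fun_upd: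
  fixes j n :: nat
  assumes "j < n"
  shows "means n (f(j := g)) = (\<integral>x. g x \<partial>M) * (\<Prod>i\<in>{..<n} - {j}. \<integral>x. f i x \<partial>M)"
proof -
  have "means n (f(j := g))
      = (\<integral>x. (f(j := g)) j x \<partial>M) * (\<Prod>i\<in>{..<n} - {j}. \<integral>x. (f(j := g)) i x \<partial>M)"
    using assms by (intro prod.remove finite_lessThan) auto
  also have "(\<Prod>i\<in>{..<n} - {j}. \<integral>x. (f(j := g)) i x \<partial>M) = (\<Prod>i\<in>{..<n} - {j}. \<integral>x. f i x \<partial>M)" by (rule prod.cong) auto
  finally show ?thesis by simp
qed

context
  fixes n j :: nat and f :: "nat \<Rightarrow> 'a \<Rightarrow> real"
  assumes j: "j < n" and f: "\<And>i. i < n \<Longrightarrow> i \<noteq> j \<Longrightarrow> f i \<in> unit_bounded"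
begin

lemma slot_rest_bounded: "(\<lambda>x. \<Prod>i\<in>{..<n} - {j}. f i (K (t i) x)) \<in> unit_bounded"
  by (rule unit_bounded_prod) (use f unit_bounded_K in auto)

lemma slot_mean_bounded: "\<bar>\<Prod>i\<in>{..<n} - {j}. \<integral>x. f i x \<partial>M\<bar> \<le> 1"
  by (rule abs_prod_le_1) (use f unit_boundedD in auto)

text \<open>With the other slots fixed, \<open>mixes\<close> becomes a property of the function in
  slot \<open>j\<close>, which need only be integrable. This lemma and the next three show that the
  property passes to sums, multiples, limits in \<open>L^1\<close> and translates along the flow;
  these are the closure conditions of \<open>integrable_dense_induct\<close>.\<close>

lemma mixes_slot_add:
  assumes g: "integrable M g" "mixes n (f(j := g))" and h: "integrable M h" "mixes n (f(j := h))"
  shows "mixes n (f(j := \<lambda>x. g x + h x))"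
  unfolding mixes_def
proof (intro allI impI)
  fix \<epsilon> :: real assume "\<epsilon> > 0"
  then have e: "\<epsilon>/2 > 0" by simp
  obtain T1 where T1: "\<And>t. gaps n T1 t \<Longrightarrow> defect n (f(j := g)) t < \<epsilon>/2"
    using g(2) e unfolding mixes_def by blast
  obtain T2 where T2: "\<And>t. gaps n T2 t \<Longrightarrow> defect n (f(j := h)) t < \<epsilon>/2"
    using h(2) e unfolding mixes_def by blast
  show "\<exists>T. \<forall>t. gaps n T t \<longrightarrow> defect n (f(j := \<lambda>x. g x + h x)) t < \<epsilon>"
  proof (intro exI[of _ "max T1 T2"] allI impI)
    fix t assume t: "gaps n (max T1 T2) t"
    have 1: "corr n (f(j := \<lambda>x. g x + h x)) t = corr n (f(j := g)) t + corr n (f(j := h)) t"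
      unfolding corr_fun_upd[OF j] distrib_right
      by (intro Bochner_Integration.integral_add integral_mult_bounded(1) slot_rest_bounded integrable_K g h)
    have 2: "means n (f(j := \<lambda>x. g x + h x))
      = means n (f(j := g)) + means n (f(j := h))"
      unfolding prod_mean_fun_upd[OF j] using g(1) h(1) by (simp add: distrib_right)
    show "defect n (f(j := \<lambda>x. g x + h x)) t < \<epsilon>"
      unfolding 1 2 using T1[OF gaps_mono[OF t]] T2[OF gaps_mono[OF t]] by linarith
  qed
qed

lemma mixes_slot_scale:
  assumes g: "mixes n (f(j := g))"
  shows "mixes n (f(j := \<lambda>x. c * g x))"
  unfolding mixes_def
proof (intro allI impI)
  fix \<epsilon> :: real assume "\<epsilon> > 0"
  then have e: "\<epsilon> / (\<bar>c\<bar> + 1) > 0" by simp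
  obtain T1 where T1: "\<And>t. gaps n T1 t \<Longrightarrow>
      defect n (f(j := g)) t < \<epsilon> / (\<bar>c\<bar> + 1)" using g e unfolding mixes_def by blast
  have "defect n (f(j := \<lambda>x. c * g x)) t < \<epsilon>"
    if t: "gaps n T1 t" for t
  proof -
    have 1: "corr n (f(j := \<lambda>x. c * g x)) t = c * corr n (f(j := g)) t"
      unfolding corr_fun_upd[OF j] by (simp add: mult.assoc)
    have 2: "means n (f(j := \<lambda>x. c * g x)) = c * means n (f(j := g))"
      unfolding prod_mean_fun_upd[OF j] by simp
    let ?d = "defect n (f(j := g)) t"
    have "\<bar>c\<bar> * ?d \<le> (\<bar>c\<bar> + 1) * ?d" by (simp add: algebra_simps)
    also have "\<dots> < \<epsilon>" using T1[OF t] by (simp add: pos_less_divide_eq mult.commute add_pos_nonneg)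
    finally show ?thesis unfolding 1 2 by (simp add: right_diff_distrib[symmetric] abs_mult)
  qed
  then show "\<exists>T. \<forall>t. gaps n T t \<longrightarrow> defect n (f(j := \<lambda>x. c * g x)) t < \<epsilon>" by blast
qed

text \<open>The remaining factors are bounded by 1 and the flow preserves the integral of
  \<open>\<bar>g - h\<bar>\<close>, so the error of replacing \<open>g\<close> by \<open>h\<close>
  is uniform in \<open>t\<close>. The three thirds pay for the correlation, for \<open>h\<close>
  itself and for the means.\<close>

lemma mixes_slot_lim:
  assumes g: "integrable M g"
    and lim: "\<And>\<epsilon>. \<epsilon> > 0 \<Longrightarrow> \<exists>h. integrable M h \<and> mixes n (f(j := h)) \<and> (\<integral>x. \<bar>g x - h x\<bar> \<partial>M) < \<epsilon>"
  shows "mixes n (f(j := g))"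
  unfolding mixes_def
proof (intro allI impI)
  fix \<epsilon> :: real assume "\<epsilon> > 0"
  then have e: "\<epsilon>/3 > 0" by simp
  obtain h where h: "integrable M h" "mixes n (f(j := h))" "(\<integral>x. \<bar>g x - h x\<bar> \<partial>M) < \<epsilon>/3" using lim[OF e] by blast
  obtain T where T: "\<And>t. gaps n T t \<Longrightarrow> defect n (f(j := h)) t < \<epsilon>/3"
    using h(2) e unfolding mixes_def by blast
  have "defect n (f(j := g)) t < \<epsilon>" if t: "gaps n T t" for t
  proof -
    let ?w = "\<lambda>x. \<Prod>i\<in>{..<n} - {j}. f i (K (t i) x)"
    have gh: "integrable M (\<lambda>x. g x - h x)" using g h(1) by simp
    have "corr n (f(j := g)) t - corr n (f(j := h)) t = (\<integral>x. (g (K (t j) x) - h (K (t j) x)) * ?w x \<partial>M)"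
      unfolding corr_fun_upd[OF j] left_diff_distrib
      by (intro Bochner_Integration.integral_diff[symmetric] integral_mult_bounded(1) slot_rest_bounded integrable_K g h)
    also have "\<bar>\<dots>\<bar> \<le> (\<integral>x. \<bar>g (K (t j) x) - h (K (t j) x)\<bar> \<partial>M)"
      by (rule integral_mult_bounded(2)[OF integrable_K[OF gh] slot_rest_bounded])
    also have "\<dots> = (\<integral>x. \<bar>g x - h x\<bar> \<partial>M)" using g h(1) by (intro integral_K[where f = "\<lambda>x. \<bar>g x - h x\<bar>"]) auto
    finally have 1: "\<bar>corr n (f(j := g)) t - corr n (f(j := h)) t\<bar> < \<epsilon>/3" using h(3) by simp
    let ?m = "\<Prod>i\<in>{..<n} - {j}. \<integral>x. f i x \<partial>M"
    have "\<bar>means n (f(j := g)) - means n (f(j := h))\<bar>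
      = \<bar>\<integral>x. g x - h x \<partial>M\<bar> * \<bar>?m\<bar>" unfolding prod_mean_fun_upd[OF j] using g h(1)
      by (simp add: left_diff_distrib[symmetric] abs_mult)
    also have "\<dots> \<le> \<bar>\<integral>x. g x - h x \<partial>M\<bar>" by (rule mult_left_le) (use slot_mean_bounded in auto)
    also have "\<dots> \<le> (\<integral>x. \<bar>g x - h x\<bar> \<partial>M)" by (rule integral_abs_bound)
    finally show ?thesis using 1 T[OF t] h(3) by linarith
  qed
  then show "\<exists>T. \<forall>t. gaps n T t \<longrightarrow> defect n (f(j := g)) t < \<epsilon>" by blast
qed

text \<open>Composing slot \<open>j\<close> with \<open>K u\<close> amounts to moving
  \<open>t j\<close> by \<open>u\<close>, which shortens a gap by at most
  \<open>\<bar>u\<bar>\<close>.\<close>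

lemma mixes_slot_K:
  assumes gm: "g \<in> borel_measurable M" and g: "mixes n (f(j := g))"
  shows "mixes n (f(j := \<lambda>x. g (K u x)))"
  unfolding mixes_def
proof (intro allI impI)
  fix \<epsilon> :: real assume e: "\<epsilon> > 0"
  obtain T where T: "\<And>t. gaps n T t \<Longrightarrow> defect n (f(j := g)) t < \<epsilon>"
    using g e unfolding mixes_def by blast
  have "defect n (f(j := \<lambda>x. g (K u x))) t < \<epsilon>"
    if t: "gaps n (T + \<bar>u\<bar>) t" for t
  proof -
    have "(\<Prod>i\<in>{..<n} - {j}. f i (K ((t(j := t j + u)) i) x)) = (\<Prod>i\<in>{..<n} - {j}. f i (K (t i) x))" for x
      by (rule prod.cong) auto
    then have 1: "corr n (f(j := \<lambda>x. g (K u x))) t = corr n (f(j := g)) (t(j := t j + u))"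
      unfolding corr_fun_upd[OF j]
      by (intro Bochner_Integration.integral_cong refl) (simp add: K_add[symmetric] add.commute)
    have 2: "means n (f(j := \<lambda>x. g (K u x))) = means n (f(j := g))"
      unfolding prod_mean_fun_upd[OF j] integral_K[OF gm] ..
    show ?thesis unfolding 1 2 by (rule T[OF gaps_fun_upd[OF t]])
  qed
  then show "\<exists>T. \<forall>t. gaps n T t \<longrightarrow> defect n (f(j := \<lambda>x. g (K u x))) t < \<epsilon>" by blast
qed

end

text \<open>Multilinear extension, one slot at a time: in the induction the slots below
  \<open>m\<close> have already been enlarged to \<open>\<B>\<close> and the others are still in
  \<open>\<A>\<close>.\<close>

lemma mixes_slots:
  assumes base: "\<And>f. (\<And>i. i < n \<Longrightarrow> f i \<in> \<A>) \<Longrightarrow> mixes n f"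
    and sub: "\<A> \<subseteq> unit_bounded" "\<B> \<subseteq> unit_bounded"
    and step: "\<And>f j b. j < n \<Longrightarrow> (\<And>i. i < n \<Longrightarrow> i \<noteq> j \<Longrightarrow> f i \<in> unit_bounded)
      \<Longrightarrow> (\<And>a. a \<in> \<A> \<Longrightarrow> mixes n (f(j := a))) \<Longrightarrow> b \<in> \<B> \<Longrightarrow> mixes n (f(j := b))"
    and f: "\<And>i. i < n \<Longrightarrow> f i \<in> \<B>"
  shows "mixes n f"
proof -
  have "mixes n f" if "m \<le> n" "\<And>i. i < m \<Longrightarrow> f i \<in> \<B>" "\<And>i. m \<le> i \<Longrightarrow> i < n \<Longrightarrow> f i \<in> \<A>" for m f using that
  proof (induction m arbitrary: f)
    case 0
    then show ?case by (intro base) auto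
  next
    case (Suc m)
    have u: "f i \<in> unit_bounded" if "i < n" for i
      using sub Suc.prems(2)[of i] Suc.prems(3)[of i] that by (cases "i < Suc m") auto
    have "mixes n (f(m := f m))"
    proof (rule step)
      show "m < n" "f m \<in> \<B>" using Suc.prems by auto
      show "f i \<in> unit_bounded" if "i < n" for i using u that by simp
      show "mixes n (f(m := a))" if a: "a \<in> \<A>" for a using Suc.prems a by (intro Suc.IH) auto
    qed
    then show ?case by simp
  qed
  from this[of n f] f show ?thesis by auto
qed

lemma mixes_one: "f 0 \<in> borel_measurable M \<Longrightarrow> mixes 1 f"
  by (simp add: mixes_def corr_def integral_K)

text \<open>A constant slot only deletes one time from the list. Through this lemma the lower order
  of mixing takes care of the mean values that are split off from a slot.\<close>

lemma mixes_remove_slot: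
  assumes j: "j \<le> n" and f: "\<And>i. i \<le> n \<Longrightarrow> f i \<in> unit_bounded" and fj: "f j = (\<lambda>x. 1)"
    and mix: "\<And>g. (\<And>i. i < n \<Longrightarrow> g i \<in> unit_bounded) \<Longrightarrow> mixes n g"
  shows "mixes (Suc n) f"
proof -
  define \<sigma> where "\<sigma> i = (if i < j then i else Suc i)" for i
  have bij: "bij_betw \<sigma> {..<n} ({..<Suc n} - {j})" unfolding bij_betw_def
  proof
    show "inj_on \<sigma> {..<n}" by (auto simp: inj_on_def \<sigma>_def split: if_splits)
    show "\<sigma> ` {..<n} = {..<Suc n} - {j}"
    proof (intro equalityI subsetI)
      fix x assume x: "x \<in> {..<Suc n} - {j}"
      have "x = \<sigma> (if x < j then x else x - 1)" using x by (auto simp: \<sigma>_def)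
      moreover have "(if x < j then x else x - 1) \<in> {..<n}" using x j by auto
      ultimately show "x \<in> \<sigma> ` {..<n}" by blast
    qed (use j in \<open>auto simp: \<sigma>_def split: if_splits\<close>)
  qed
  have prod_eq: "(\<Prod>i<Suc n. F i) = F j * (\<Prod>i<n. F (\<sigma> i))" for F :: "nat \<Rightarrow> real"
  proof -
    have "(\<Prod>i<Suc n. F i) = F j * prod F ({..<Suc n} - {j})" using j by (intro prod.remove finite_lessThan) auto
    also have "prod F ({..<Suc n} - {j}) = (\<Prod>i<n. F (\<sigma> i))" by (rule prod.reindex_bij_betw[OF bij, symmetric])
    finally show ?thesis .
  qed
  have m: "mixes n (f \<circ> \<sigma>)" by (rule mix) (use f in \<open>auto simp: \<sigma>_def\<close>)
  have c: "corr (Suc n) f t = corr n (f \<circ> \<sigma>) (t \<circ> \<sigma>)" for t unfolding corr_def prod_eq by (simp add: fj)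
  have p: "(\<Prod>i<Suc n. \<integral>x. f i x \<partial>M) = means n (f \<circ> \<sigma>)" unfolding prod_eq by (simp add: fj prob_space)
  \<comment> \<open>At the omitted index two gaps are added up. Their sum is at least
    \<open>T\<close> only if the gaps are also nonnegative, hence \<open>max T 0\<close>.\<close>
  have g: "gaps n T (t \<circ> \<sigma>)" if t: "gaps (Suc n) (max T 0) t" for T t unfolding gaps_def
  proof (intro allI impI)
    fix i assume i: "Suc i < n"
    have s: "t l + max T 0 \<le> t (Suc l)" if "l < n" for l using t that by (auto simp: gaps_def)
    show "(t \<circ> \<sigma>) i + T \<le> (t \<circ> \<sigma>) (Suc i)" using s[of i] s[of "Suc i"] i by (auto simp: \<sigma>_def)
  qed
  show ?thesis unfolding mixes_def c p
  proof (intro allI impI)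
    fix \<epsilon> :: real assume "\<epsilon> > 0"
    then obtain T where T: "\<And>t. gaps n T t \<Longrightarrow> defect n (f \<circ> \<sigma>) t < \<epsilon>"
      using m unfolding mixes_def by blast
    show "\<exists>T. \<forall>t. gaps (Suc n) T t \<longrightarrow> \<bar>corr n (f \<circ> \<sigma>) (t \<circ> \<sigma>) - means n (f \<circ> \<sigma>)\<bar> < \<epsilon>"
      by (intro exI[of _ "max T 0"] allI impI T g)
  qed
qed

end

subsection \<open>Decorrelation along slowly varying speeds\<close>

definition gap_filter :: "nat \<Rightarrow> (nat \<Rightarrow> real) filter" where
  "gap_filter n = (INF T. principal {t. gaps n T t})"

text \<open>In contrast to \<open>gap_filter\<close> the first time must be large too: these are
  times relative to one more function, which sits at time 0.\<close>

definition far_filter :: "nat \<Rightarrow> (nat \<Rightarrow> real) filter" where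
  "far_filter n = (INF T. principal {t. gaps n T t \<and> T \<le> t 0})"

lemma eventually_gap_filter: "eventually P (gap_filter n) \<longleftrightarrow> (\<exists>T. \<forall>t. gaps n T t \<longrightarrow> P t)"
  unfolding gap_filter_def
proof (subst eventually_INF_base)
  show "\<exists>x\<in>UNIV. principal {t. gaps n x t} \<le> inf (principal {t. gaps n a t}) (principal {t. gaps n b t})"
    for a b by (rule bexI[of _ "max a b"]) (auto intro: gaps_mono)
qed (auto simp: eventually_principal)

lemma eventually_far_filter:
  "eventually P (far_filter n) \<longleftrightarrow> (\<exists>T. \<forall>t. gaps n T t \<and> T \<le> t 0 \<longrightarrow> P t)" unfolding far_filter_def
proof (subst eventually_INF_base)
  show "\<exists>x\<in>UNIV. principal {t. gaps n x t \<and> x \<le> t 0}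
      \<le> inf (principal {t. gaps n a t \<and> a \<le> t 0}) (principal {t. gaps n b t \<and> b \<le> t 0})"
    for a b by (rule bexI[of _ "max a b"]) (auto intro: gaps_mono)
qed (auto simp: eventually_principal)

lemma far_filter_le: "far_filter n \<le> gap_filter n"
  by (rule filter_leI) (auto simp: eventually_gap_filter eventually_far_filter)

text \<open>The hat function of half-width \<open>1/N\<close> around the grid point
  \<open>a/N\<close>. It is Lipschitz with constant \<open>N\<close>, so composing it with a slow
  function gives a slow function.\<close>

definition tent :: "int \<Rightarrow> int \<Rightarrow> real \<Rightarrow> real" where
  "tent N a c = max 0 (1 - \<bar>of_int N * c - of_int a\<bar>)"

lemma tent_bounds: "0 \<le> tent N a c" "tent N a c \<le> 1"
  by (auto simp: tent_def)

lemma tent_lipschitz: "\<bar>tent N a c - tent N a d\<bar> \<le> \<bar>of_int N\<bar> * \<bar>c - d\<bar>"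
proof -
  have "\<bar>tent N a c - tent N a d\<bar> \<le> \<bar>(of_int N * c - of_int a) - (of_int N * d - of_int a)\<bar>"
    unfolding tent_def by linarith
  also have "\<dots> = \<bar>of_int N\<bar> * \<bar>c - d\<bar>" by (simp add: abs_mult[symmetric] algebra_simps)
  finally show ?thesis .
qed

lemma tent_support:
  assumes "N > 0" "tent N a c \<noteq> 0" shows "\<bar>c - of_int a / of_int N\<bar> \<le> 1 / of_int N"
proof -
  have "\<bar>of_int N * c - of_int a\<bar> \<le> 1" using assms(2) by (auto simp: tent_def)
  moreover have "c - of_int a / of_int N = (of_int N * c - of_int a) / of_int N"
    using assms(1) by (simp add: field_simps)
  ultimately show ?thesis using assms(1) by (simp add: abs_divide divide_right_mono)
qed

text \<open>Only the two grid points next to \<open>N * c\<close> contribute, with weights that are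
  linear in \<open>c\<close>.\<close>

lemma sum_tent:
  assumes "N > 0" "\<bar>c\<bar> \<le> 1" shows "(\<Sum>a\<in>{-N..N}. tent N a c) = 1"
proof -
  let ?y = "of_int N * c :: real"
  define b where "b = \<lfloor>?y\<rfloor>"
  have b: "of_int b \<le> ?y" "?y < of_int b + 1" by (auto simp: b_def)
  have "\<bar>?y\<bar> \<le> of_int N" using assms mult_left_le[of "\<bar>c\<bar>" "of_int N"] by (simp add: abs_mult)
  then have y: "- of_int N \<le> ?y" "?y \<le> of_int N" by auto
  have bN: "-N \<le> b" "b \<le> N" using y by (auto simp: b_def le_floor_iff floor_le_iff)
  have z: "tent N a c = 0" if "a \<noteq> b" "a \<noteq> b + 1" for a
  proof -
    have "a \<le> b - 1 \<or> a \<ge> b + 2" using that by linarith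
    then have "(of_int a :: real) \<le> of_int b - 1 \<or> (of_int a :: real) \<ge> of_int b + 2" by linarith
    then show ?thesis using b by (auto simp: tent_def)
  qed
  have t0: "tent N b c = 1 - (?y - of_int b)" and t1: "tent N (b + 1) c = ?y - of_int b"
    using b by (auto simp: tent_def)
  show ?thesis
  proof (cases "b = N")
    \<comment> \<open>At the right end \<open>b + 1\<close> lies outside of the range of summation,
      but there \<open>N * c = b\<close> and its tent vanishes.\<close>
    case True
    then have "?y = of_int b" using b y by linarith
    moreover have "(\<Sum>a\<in>{-N..N}. tent N a c) = (\<Sum>a\<in>{b}. tent N a c)"
      by (rule sum.mono_neutral_right) (use True bN z assms in auto)
    ultimately show ?thesis using t0 by simp
  next
    case False
    have "(\<Sum>a\<in>{-N..N}. tent N a c) = (\<Sum>a\<in>{b, b + 1}. tent N a c)"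
      by (rule sum.mono_neutral_right) (use False bN z in auto)
    then show ?thesis using t0 t1 by simp
  qed
qed

text \<open>A convex combination is controlled by its terms of nonzero weight, that is, by the
  values of \<open>h\<close> at grid points within \<open>1/N\<close> of \<open>c\<close>.\<close>

lemma sum_tent_bound:
  fixes h :: "int \<Rightarrow> real"
  assumes "N > 0" "\<bar>c\<bar> \<le> 1" "\<And>a. a \<in> {-N..N} \<Longrightarrow> tent N a c \<noteq> 0 \<Longrightarrow> \<bar>h a\<bar> \<le> e"
  shows "\<bar>\<Sum>a\<in>{-N..N}. tent N a c * h a\<bar> \<le> e"
proof -
  have "\<bar>\<Sum>a\<in>{-N..N}. tent N a c * h a\<bar> \<le> (\<Sum>a\<in>{-N..N}. \<bar>tent N a c * h a\<bar>)" by (rule sum_abs)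
  also have "\<dots> \<le> (\<Sum>a\<in>{-N..N}. tent N a c * e)"
  proof (rule sum_mono)
    fix a assume "a \<in> {-N..N}"
    then show "\<bar>tent N a c * h a\<bar> \<le> tent N a c * e" using assms(3)[of a] tent_bounds(1)[of N a c]
      by (cases "tent N a c = 0") (auto simp: abs_mult intro: mult_left_mono)
  qed
  also have "\<dots> = e" using sum_tent[OF assms(1,2)] by (simp add: sum_distrib_right[symmetric])
  finally show ?thesis .
qed

context mp_flow
begin

lemma mixes_iff_tendsto:
  "mixes n f \<longleftrightarrow> (corr n f \<longlongrightarrow> means n f) (gap_filter n)"
  by (simp add: mixes_def tendsto_iff eventually_gap_filter dist_real_def)

text \<open>Asymptotic invariance in \<open>L^1\<close> under each fixed \<open>K u\<close>. The
  directions of the shear depend on the point and on the times, but have this property.\<close>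

definition slow :: "nat \<Rightarrow> ((nat \<Rightarrow> real) \<Rightarrow> 'a \<Rightarrow> real) \<Rightarrow> bool" where
  "slow n G \<longleftrightarrow> (\<forall>t. G t \<in> unit_bounded) \<and>
     (\<forall>u. ((\<lambda>t. \<integral>x. \<bar>G t (K u x) - G t x\<bar> \<partial>M) \<longlongrightarrow> 0) (far_filter n))"

lemma integral_pair_K:
  fixes f g :: "'a \<Rightarrow> real"
  assumes "f \<in> borel_measurable M" "g \<in> borel_measurable M"
  shows "(\<integral>x. f (K u x) * g (K v x) \<partial>M) = (\<integral>x. f x * g (K (v - u) x) \<partial>M)"
proof -
  have "(\<integral>x. f x * g (K (v - u) x) \<partial>M) = (\<integral>x. f (K u x) * g (K (v - u) (K u x)) \<partial>M)"
    using assms by (intro integral_K[symmetric]) auto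
  also have "\<dots> = (\<integral>x. f (K u x) * g (K v x) \<partial>M)"
    by (intro Bochner_Integration.integral_cong refl) (simp add: K_add[symmetric])
  finally show ?thesis ..
qed

text \<open>Both signs of \<open>a\<close> are covered because the autocorrelation is an even
  function of \<open>a\<close>.\<close>

lemma mixes_two_autocorrelation:
  assumes mix2: "mixes 2 (\<lambda>_. f)" and f: "f \<in> unit_bounded" and e: "\<epsilon> > 0"
  shows "\<exists>U>0. \<forall>a. U \<le> \<bar>a\<bar> \<longrightarrow> \<bar>(\<integral>x. f x * f (K a x) \<partial>M) - (\<integral>x. f x \<partial>M)\<^sup>2\<bar> < \<epsilon>"
proof -
  have [measurable]: "f \<in> borel_measurable M" using unit_boundedD[OF f] by auto
  obtain T where T: "\<And>t. gaps 2 T t \<Longrightarrow> \<bar>corr 2 (\<lambda>_. f) t - (\<Prod>i<2::nat. \<integral>x. f x \<partial>M)\<bar> < \<epsilon>"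
    using mix2 e unfolding mixes_def by blast
  have pos: "\<bar>(\<integral>x. f x * f (K a x) \<partial>M) - (\<integral>x. f x \<partial>M)\<^sup>2\<bar> < \<epsilon>" if "T \<le> a" for a
  proof -
    let ?t = "\<lambda>i::nat. if i = 0 then 0 else a"
    have "corr 2 (\<lambda>_. f) ?t = (\<integral>x. f x * f (K a x) \<partial>M)" unfolding corr_def
      by (intro Bochner_Integration.integral_cong refl) (simp add: numeral_2_eq_2 K_0)
    moreover have "gaps 2 T ?t" using that by (auto simp: gaps_def)
    ultimately show ?thesis using T[of ?t] by (simp add: numeral_2_eq_2 power2_eq_square)
  qed
  have "\<bar>(\<integral>x. f x * f (K a x) \<partial>M) - (\<integral>x. f x \<partial>M)\<^sup>2\<bar> < \<epsilon>" if "max 1 T \<le> \<bar>a\<bar>" for a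
  proof (cases "a \<ge> 0")
    case True then show ?thesis using pos[of a] that by auto
  next
    case False
    have "(\<integral>x. f x * f (K a x) \<partial>M) = (\<integral>x. f (K 0 x) * f (K a x) \<partial>M)"
      by (intro Bochner_Integration.integral_cong refl) (simp add: K_0)
    also have "\<dots> = (\<integral>x. f (K a x) * f (K 0 x) \<partial>M)" by (simp add: mult.commute)
    also have "\<dots> = (\<integral>x. f x * f (K (- a) x) \<partial>M)" by (subst integral_pair_K) auto
    finally show ?thesis using pos[of "-a"] that False by auto
  qed
  then show ?thesis by (intro exI[of _ "max 1 T"]) auto
qed

lemma average_square_le:
  fixes h :: "nat \<Rightarrow> 'a \<Rightarrow> real"
  assumes J: "J > 0" and h: "\<And>j. j < J \<Longrightarrow> integrable M (\<lambda>x. h j x)"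
    and hh: "\<And>j l. j < J \<Longrightarrow> l < J \<Longrightarrow> integrable M (\<lambda>x. h j x * h l x)"
  shows "(\<integral>x. \<bar>(\<Sum>j<J. h j x) / real J\<bar> \<partial>M)\<^sup>2 \<le> (\<Sum>j<J. \<Sum>l<J. \<integral>x. h j x * h l x \<partial>M) / (real J)\<^sup>2"
proof -
  have sq: "((\<Sum>j<J. h j x) / real J)\<^sup>2 = (\<Sum>j<J. \<Sum>l<J. h j x * h l x) / (real J)\<^sup>2" for x
    by (simp add: power_divide power2_eq_square sum_product)
  have "(\<integral>x. \<bar>(\<Sum>j<J. h j x) / real J\<bar> \<partial>M)\<^sup>2 \<le> (\<integral>x. ((\<Sum>j<J. h j x) / real J)\<^sup>2 \<partial>M)"
    by (rule integral_square_le) (use h hh in \<open>auto simp: sq intro!: Bochner_Integration.integrable_sum\<close>)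
  also have "\<dots> = (\<Sum>j<J. \<Sum>l<J. \<integral>x. h j x * h l x \<partial>M) / (real J)\<^sup>2"
  proof -
    have "(\<integral>x. (\<Sum>j<J. \<Sum>l<J. h j x * h l x) \<partial>M) = (\<Sum>j<J. \<integral>x. (\<Sum>l<J. h j x * h l x) \<partial>M)"
      by (rule Bochner_Integration.integral_sum) (auto intro!: hh)
    also have "\<dots> = (\<Sum>j<J. \<Sum>l<J. \<integral>x. h j x * h l x \<partial>M)"
      by (intro sum.cong refl Bochner_Integration.integral_sum) (auto intro!: hh)
    finally show ?thesis by (simp add: sq)
  qed
  finally show ?thesis .
qed

text \<open>Each row has at most \<open>2 * q\<close> entries near the diagonal, bounded by 1, and
  its other entries are at most \<open>e\<close>. The condition on \<open>q\<close> bounds the first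
  contribution by \<open>e * real J\<close>.\<close>

lemma banded_sum_le:
  fixes a :: "nat \<Rightarrow> nat \<Rightarrow> real"
  assumes a1: "\<And>j l. j < J \<Longrightarrow> l < J \<Longrightarrow> a j l \<le> 1"
    and a2: "\<And>j l. j < J \<Longrightarrow> l < J \<Longrightarrow> q \<le> \<bar>int j - int l\<bar> \<Longrightarrow> a j l \<le> e"
    and e: "0 \<le> e" and q: "2 * of_int q \<le> e * real J" "0 \<le> q"
  shows "(\<Sum>j<J. \<Sum>l<J. a j l) \<le> 2 * e * (real J)\<^sup>2"
proof -
  have "(\<Sum>l<J. a j l) \<le> 2 * e * real J" if j: "j < J" for j
  proof -
    let ?B = "{l. \<bar>int j - int l\<bar> < q}"
    have "(\<Sum>l<J. a j l) \<le> (\<Sum>l<J. e + indicator ?B l)"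
      using a1[OF j] a2[OF j] e by (intro sum_mono) (auto simp: indicator_def not_less intro: add_increasing)
    also have "\<dots> = e * real J + real (card ({..<J} \<inter> ?B))" by (simp add: sum.distrib sum.If_cases indicator_def)
    also have "card ({..<J} \<inter> ?B) \<le> card {j - nat q..<j + nat q}" by (rule card_mono) (use q in auto)
    also have "\<dots> \<le> 2 * nat q" by simp
    finally show ?thesis using q by simp
  qed
  then have "(\<Sum>j<J. \<Sum>l<J. a j l) \<le> (\<Sum>j<J. 2 * e * real J)" by (intro sum_mono) auto
  then show ?thesis by (simp add: power2_eq_square mult_ac)
qed

text \<open>After expanding the square of the average one is left with the mean of all pairwise
  correlations, of which only those in a narrow diagonal band can be large.\<close>

lemma decorrelated_average_le:
  fixes h :: "nat \<Rightarrow> 'a \<Rightarrow> real"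
  assumes J: "J > 0" and h: "\<And>j. h j \<in> unit_bounded"
    and corr: "\<And>j l. j < J \<Longrightarrow> l < J \<Longrightarrow> q \<le> \<bar>int j - int l\<bar> \<Longrightarrow> (\<integral>x. h j x * h l x \<partial>M) \<le> e"
    and e: "0 \<le> e" and q: "2 * of_int q \<le> e * real J" "0 \<le> q"
  shows "(\<integral>x. \<bar>(\<Sum>j<J. h j x) / real J\<bar> \<partial>M) \<le> sqrt (2 * e)"
proof (rule real_le_rsqrt)
  have "(\<integral>x. \<bar>(\<Sum>j<J. h j x) / real J\<bar> \<partial>M)\<^sup>2 \<le> (\<Sum>j<J. \<Sum>l<J. \<integral>x. h j x * h l x \<partial>M) / (real J)\<^sup>2"
    by (rule average_square_le[OF J]) (use h unit_bounded_mult unit_boundedD(3) in blast)+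
  also have "\<dots> \<le> 2 * e * (real J)\<^sup>2 / (real J)\<^sup>2"
  proof (intro divide_right_mono banded_sum_le[OF _ corr e q])
    show "(\<integral>x. h j x * h l x \<partial>M) \<le> 1" for j l
      using unit_boundedD(4)[OF unit_bounded_mult[OF h[of j] h[of l]]] by linarith
  qed auto
  finally show "(\<integral>x. \<bar>(\<Sum>j<J. h j x) / real J\<bar> \<partial>M)\<^sup>2 \<le> 2 * e" using J by simp
qed

text \<open>The weight \<open>G\<close> hardly changes when it is replaced by its average along the flow over widely spaced
  times; moving the average to the other factor makes that factor small in \<open>L\<^sup>2\<close>.\<close>

lemma slow_decorrelation:
  assumes F: "\<And>i. i < n \<Longrightarrow> F i \<in> unit_bounded"
    and mix: "\<And>g. (\<And>i. i < n \<Longrightarrow> g i \<in> unit_bounded) \<Longrightarrow> mixes n g"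
    and mix2: "\<And>g. g \<in> unit_bounded \<Longrightarrow> mixes 2 (\<lambda>_. g)"
    and G: "slow n G" and n: "n > 0"
  shows "((\<lambda>t. (\<integral>x. G t x * (\<Prod>i<n. F i (K (t i) x)) \<partial>M)
             - (\<integral>x. G t x \<partial>M) * means n F) \<longlongrightarrow> 0) (far_filter n)"
proof -
  define p where "p = means n F"
  define H where "H t x = (\<Prod>i<n. F i (K (t i) x)) - p" for t x
  have Gu: "G t \<in> unit_bounded" for t using G by (simp add: slow_def)
  have Pu: "(\<lambda>x. \<Prod>i<n. F i (K (t i) x)) \<in> unit_bounded" for t
    by (rule unit_bounded_prod) (use F unit_bounded_K in auto)
  have p1: "\<bar>p\<bar> \<le> 1" unfolding p_def by (rule abs_prod_le_1) (use F unit_boundedD in auto)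
  have [measurable]: "(\<lambda>x. \<Prod>i<n. F i (K (t i) x)) \<in> borel_measurable M" for t using unit_boundedD(1)[OF Pu] .
  have [measurable]: "G t \<in> borel_measurable M" for t using unit_boundedD(1)[OF Gu] .
  have Hm [measurable]: "H t \<in> borel_measurable M" for t unfolding H_def[abs_def] by measurable
  have H2: "\<bar>H t x\<bar> \<le> 2" if "x \<in> space M" for t x
    using unit_boundedD(2)[OF Pu that, of t] p1 unfolding H_def by linarith
  have iH: "integrable M (\<lambda>x. H t (K u x))" for t u
    by (rule integrable_const_bound[where B = 2]) (use H2 K_space in auto)
  \<comment> \<open>The limit of the correlation of \<open>H t\<close> along \<open>K u\<close> with
    \<open>H t\<close> along \<open>K v\<close>. Since \<open>K u\<close> commutes with
    \<open>K (t i)\<close>, mixing of order \<open>n\<close> for the functions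
    \<open>F i (K u x) * F i (K v x)\<close> produces the product of the autocorrelations of the
    \<open>F i\<close>.\<close>
  define \<kappa> where "\<kappa> u v = (\<Prod>i<n. \<integral>x. F i (K u x) * F i (K v x) \<partial>M) - p\<^sup>2" for u v
  have corr_HH: "((\<lambda>t. \<integral>x. H t (K u x) * H t (K v x) \<partial>M) \<longlongrightarrow> \<kappa> u v) (far_filter n)" for u v
  proof -
    have HK: "H t (K u x) = (\<Prod>i<n. F i (K u (K (t i) x))) - p" if "x \<in> space M" for t u x
      using that by (simp add: H_def K_add[symmetric] add.commute)
    have FK: "(\<lambda>x. F i (K u x)) \<in> unit_bounded" if "i < n" for i u using F that unit_bounded_K by auto
    have Qu: "(\<lambda>x. \<Prod>i<n. F i (K u (K (t i) x))) \<in> unit_bounded" for t u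
      by (rule unit_bounded_prod) (use FK unit_bounded_K[where f = "\<lambda>x. F _ (K u x)"] in auto)
    have eq: "(\<integral>x. H t (K u x) * H t (K v x) \<partial>M)
       = corr n (\<lambda>i x. F i (K u x) * F i (K v x)) t - p * corr n (\<lambda>i x. F i (K u x)) t
         - p * corr n (\<lambda>i x. F i (K v x)) t + p\<^sup>2" for t
    proof -
      let ?A = "\<lambda>u x. \<Prod>i<n. F i (K u (K (t i) x))"
      have "(\<integral>x. H t (K u x) * H t (K v x) \<partial>M) = (\<integral>x. ?A u x * ?A v x - p * ?A u x - p * ?A v x + p\<^sup>2 \<partial>M)"
        by (intro Bochner_Integration.integral_cong refl) (simp add: HK algebra_simps power2_eq_square)
      also have "\<dots> = (\<integral>x. ?A u x * ?A v x \<partial>M) - p * (\<integral>x. ?A u x \<partial>M) - p * (\<integral>x. ?A v x \<partial>M) + p\<^sup>2"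
        using unit_boundedD(3)[OF Qu] unit_boundedD(3)[OF unit_bounded_mult[OF Qu Qu]] by (simp add: prob_space)
      finally show ?thesis by (simp add: corr_def prod.distrib)
    qed
    have m: "(corr n g \<longlongrightarrow> means n g) (far_filter n)"
      if "\<And>i. i < n \<Longrightarrow> g i \<in> unit_bounded" for g
    proof -
      have "mixes n g" by (rule mix) (rule that)
      then show ?thesis unfolding mixes_iff_tendsto by (rule tendsto_mono[OF far_filter_le])
    qed
    have pK: "(\<Prod>i<n. \<integral>x. F i (K u x) \<partial>M) = p" for u
      unfolding p_def by (intro prod.cong refl integral_K) (use F unit_boundedD in auto)
    have "((\<lambda>t. corr n (\<lambda>i x. F i (K u x) * F i (K v x)) t - p * corr n (\<lambda>i x. F i (K u x)) t
         - p * corr n (\<lambda>i x. F i (K v x)) t + p\<^sup>2)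
        \<longlongrightarrow> (\<Prod>i<n. \<integral>x. F i (K u x) * F i (K v x) \<partial>M) - p * p - p * p + p\<^sup>2) (far_filter n)"
      by (intro tendsto_intros m[of "\<lambda>i x. F i (K u x) * F i (K v x)"]
          m[of "\<lambda>i x. F i (K u x)", unfolded pK] m[of "\<lambda>i x. F i (K v x)", unfolded pK])
         (use FK unit_bounded_mult in auto)
    then show ?thesis unfolding eq \<kappa>_def by (simp add: power2_eq_square)
  qed
  \<comment> \<open>By mixing of order 2 each autocorrelation tends to the square of the mean of
    \<open>F i\<close>, and the product of these squares is \<open>p^2\<close>.\<close>
  have small: "\<exists>U>0. \<forall>u v. U \<le> \<bar>u - v\<bar> \<longrightarrow> \<kappa> u v < e" if "e > 0" for e
  proof -
    have e: "e / real n > 0" using that n by simp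
    have "\<exists>U>0. \<forall>a. U \<le> \<bar>a\<bar> \<longrightarrow> \<bar>(\<integral>x. F i x * F i (K a x) \<partial>M) - (\<integral>x. F i x \<partial>M)\<^sup>2\<bar> < e / real n"
      if "i < n" for i using mixes_two_autocorrelation[OF mix2 _ e, of "F i"] F[OF that] by blast
    then obtain U where U: "\<And>i. i < n \<Longrightarrow> U i > 0" "\<And>i a. i < n \<Longrightarrow> U i \<le> \<bar>a\<bar> \<Longrightarrow>
        \<bar>(\<integral>x. F i x * F i (K a x) \<partial>M) - (\<integral>x. F i x \<partial>M)\<^sup>2\<bar> < e / real n" by metis
    define U' where "U' = Max (U ` {..<n})"
    have U': "U i \<le> U'" if "i < n" for i unfolding U'_def using that by (intro Max_ge) auto
    have "U' > 0" using U'[of 0] U(1)[of 0] n by linarith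
    moreover have "\<kappa> u v < e" if uv: "U' \<le> \<bar>u - v\<bar>" for u v
    proof -
      have eq: "(\<integral>x. F i (K u x) * F i (K v x) \<partial>M) = (\<integral>x. F i x * F i (K (v - u) x) \<partial>M)" if "i < n" for i
        using F[OF that] by (intro integral_pair_K) (auto dest: unit_boundedD)
      have "\<kappa> u v = (\<Prod>i<n. \<integral>x. F i x * F i (K (v - u) x) \<partial>M) - (\<Prod>i<n. (\<integral>x. F i x \<partial>M)\<^sup>2)"
        unfolding \<kappa>_def p_def using eq by (simp add: prod_power_distrib)
      also have "\<dots> \<le> (\<Sum>i<n. \<bar>(\<integral>x. F i x * F i (K (v - u) x) \<partial>M) - (\<integral>x. F i x \<partial>M)\<^sup>2\<bar>)"
      proof (rule order_trans[OF abs_ge_self abs_prod_diff_le])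
        show "\<bar>\<integral>x. F i x * F i (K (v - u) x) \<partial>M\<bar> \<le> 1" if "i \<in> {..<n}" for i
          using that F by (intro unit_boundedD(4) unit_bounded_mult unit_bounded_K) auto
        show "\<bar>(\<integral>x. F i x \<partial>M)\<^sup>2\<bar> \<le> 1" if "i \<in> {..<n}" for i
          using that F unit_boundedD(4)[of "F i"] by (simp add: abs_square_le_1)
      qed auto
      also have "\<dots> < (\<Sum>i<n. e / real n)"
      proof (rule sum_strict_mono)
        fix i assume i: "i \<in> {..<n}"
        then have "U i \<le> \<bar>v - u\<bar>" using U'[of i] uv by (simp add: abs_minus_commute)
        then show "\<bar>(\<integral>x. F i x * F i (K (v - u) x) \<partial>M) - (\<integral>x. F i x \<partial>M)\<^sup>2\<bar> < e / real n" using U(2)[of i] i by simp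
      qed (use n in auto)
      also have "\<dots> = e" using n by simp
      finally show ?thesis .
    qed
    ultimately show ?thesis by blast
  qed
  have "((\<lambda>t. \<integral>x. G t x * H t x \<partial>M) \<longlongrightarrow> 0) (far_filter n)" unfolding tendsto_iff
  proof (intro allI impI)
    fix \<epsilon> :: real assume \<epsilon>: "\<epsilon> > 0"
    \<comment> \<open>With this value \<open>sqrt (2 * e) = \<epsilon>/4\<close>, which is the bound
      for the average of the functions \<open>H t / 2\<close>. Halving makes them bounded by 1 and
      divides correlations by 4, whence the \<open>4 * e\<close> below.\<close>
    define e where "e = \<epsilon>\<^sup>2 / 32"
    have e: "e > 0" using \<epsilon> by (simp add: e_def)
    obtain U where U: "U > 0" "\<And>u v. U \<le> \<bar>u - v\<bar> \<Longrightarrow> \<kappa> u v < 4 * e" using small[of "4 * e"] e by auto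
    define J where "J = nat \<lceil>2 / e\<rceil> + 1"
    have J: "J > 0" "2 / e \<le> real J" unfolding J_def by linarith+
    define u where "u j = real j * U" for j :: nat
    have ev1: "\<forall>\<^sub>F t in far_filter n. \<forall>j\<in>{..<J}. \<forall>l\<in>{..<J}. j \<noteq> l \<longrightarrow> (\<integral>x. H t (K (u j) x) * H t (K (u l) x) \<partial>M) < 4 * e"
    proof (intro eventually_ball_finite finite_lessThan ballI)
      fix j l :: nat
      show "\<forall>\<^sub>F t in far_filter n. j \<noteq> l \<longrightarrow> (\<integral>x. H t (K (u j) x) * H t (K (u l) x) \<partial>M) < 4 * e"
      proof (cases "j = l")
        case False
        then have "1 \<le> \<bar>real j - real l\<bar>" by linarith
        then have "U \<le> \<bar>real j - real l\<bar> * U" using U(1) by simp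
        also have "\<dots> = \<bar>u j - u l\<bar>" using U(1) by (simp add: u_def left_diff_distrib[symmetric] abs_mult)
        finally have "\<kappa> (u j) (u l) < 4 * e" by (rule U(2))
        from order_tendstoD(2)[OF corr_HH this] show ?thesis by eventually_elim simp
      qed simp
    qed
    have ev2: "\<forall>\<^sub>F t in far_filter n. \<forall>j\<in>{..<J}. (\<integral>x. \<bar>G t (K (u j) x) - G t x\<bar> \<partial>M) < \<epsilon>/8"
    proof (intro eventually_ball_finite finite_lessThan ballI)
      fix j
      show "\<forall>\<^sub>F t in far_filter n. (\<integral>x. \<bar>G t (K (u j) x) - G t x\<bar> \<partial>M) < \<epsilon>/8"
        using G \<epsilon> order_tendstoD(2)[of "\<lambda>t. \<integral>x. \<bar>G t (K (u j) x) - G t x\<bar> \<partial>M" 0 "far_filter n" "\<epsilon>/8"]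
        by (auto simp: slow_def)
    qed
    show "\<forall>\<^sub>F t in far_filter n. dist (\<integral>x. G t x * H t x \<partial>M) 0 < \<epsilon>" using ev1 ev2
    proof eventually_elim
      case (elim t)
      let ?I = "\<integral>x. G t x * H t x \<partial>M"
      let ?A = "\<lambda>x. (\<Sum>j<J. H t (K (u j) x)) / real J"
      have GH: "integrable M (\<lambda>x. H t (K a x) * G t (K b x))" for a b
        by (rule integral_mult_bounded(1)[OF iH unit_bounded_K[OF Gu]])
      have GH0: "integrable M (\<lambda>x. H t (K a x) * G t x)" for a by (rule integral_mult_bounded(1)[OF iH Gu])
      \<comment> \<open>Translate the whole integrand by \<open>K (u j)\<close>, then drop the
        translation from the slow factor \<open>G t\<close>; the other factor is at most 2.\<close>
      have close: "\<bar>?I - (\<integral>x. H t (K (u j) x) * G t x \<partial>M)\<bar> \<le> \<epsilon>/4" if "j < J" for j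
      proof -
        have "?I = (\<integral>x. H t (K (u j) x) * G t (K (u j) x) \<partial>M)"
          by (subst integral_K[of "\<lambda>x. H t x * G t x"]) (auto simp: mult.commute)
        then have "?I - (\<integral>x. H t (K (u j) x) * G t x \<partial>M)
            = (\<integral>x. H t (K (u j) x) * (G t (K (u j) x) - G t x) \<partial>M)" using GH GH0 by (simp add: right_diff_distrib)
        also have "\<bar>\<dots>\<bar> \<le> (\<integral>x. \<bar>H t (K (u j) x) * (G t (K (u j) x) - G t x)\<bar> \<partial>M)" by (rule integral_abs_bound)
        also have "\<dots> \<le> (\<integral>x. 2 * \<bar>G t (K (u j) x) - G t x\<bar> \<partial>M)"
        proof (rule integral_mono)
          show "integrable M (\<lambda>x. \<bar>H t (K (u j) x) * (G t (K (u j) x) - G t x)\<bar>)"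
            using GH GH0 by (simp add: right_diff_distrib)
          show "integrable M (\<lambda>x. 2 * \<bar>G t (K (u j) x) - G t x\<bar>)"
            using unit_boundedD(3)[OF Gu] unit_boundedD(3)[OF unit_bounded_K[OF Gu]] by simp
          show "\<bar>H t (K (u j) x) * (G t (K (u j) x) - G t x)\<bar> \<le> 2 * \<bar>G t (K (u j) x) - G t x\<bar>"
            if "x \<in> space M" for x unfolding abs_mult using H2[OF K_space[OF that]] by (intro mult_right_mono) auto
        qed
        also have "\<dots> \<le> \<epsilon>/4" using bspec[OF elim(2), of j] that by simp
        finally show ?thesis .
      qed
      have "(\<integral>x. \<bar>(\<Sum>j<J. H t (K (u j) x) / 2) / real J\<bar> \<partial>M) \<le> sqrt (2 * e)"
      proof (rule decorrelated_average_le[OF J(1), where q = 1])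
        show "(\<lambda>x. H t (K (u j) x) / 2) \<in> unit_bounded" for j using H2[OF K_space] by (intro unit_boundedI) auto
        show "(\<integral>x. H t (K (u j) x) / 2 * (H t (K (u l) x) / 2) \<partial>M) \<le> e" if "j < J" "l < J" "1 \<le> \<bar>int j - int l\<bar>" for j l
          using bspec[OF bspec[OF elim(1), of j], of l] that by (auto intro!: less_imp_le)
        show "2 * of_int 1 \<le> e * real J" using J(2) e by (simp add: field_simps)
      qed (use e in simp_all)
      then have A: "(\<integral>x. \<bar>?A x\<bar> \<partial>M) \<le> \<epsilon>/2"
        using \<epsilon> by (simp add: e_def real_sqrt_divide mult.commute flip: sum_divide_distrib)
      have iA: "integrable M ?A" using iH by auto
      have "(\<integral>x. ?A x * G t x \<partial>M) = (\<Sum>j<J. \<integral>x. H t (K (u j) x) * G t x \<partial>M) / real J"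
        using GH0 by (simp add: sum_distrib_right Bochner_Integration.integral_sum)
      then have "?I - (\<integral>x. ?A x * G t x \<partial>M) = (\<Sum>j<J. ?I - (\<integral>x. H t (K (u j) x) * G t x \<partial>M)) / real J"
        using J(1) by (simp add: sum_subtractf field_simps)
      also have "\<bar>\<dots>\<bar> \<le> (\<Sum>j<J. \<bar>?I - (\<integral>x. H t (K (u j) x) * G t x \<partial>M)\<bar>) / real J" by (simp add: divide_right_mono)
      also have "\<dots> \<le> (\<Sum>j<J. \<epsilon>/4) / real J" by (intro divide_right_mono sum_mono close) auto
      also have "\<dots> = \<epsilon>/4" using J(1) by simp
      finally have "\<bar>?I - (\<integral>x. ?A x * G t x \<partial>M)\<bar> \<le> \<epsilon>/4" .
      moreover have "\<bar>\<integral>x. ?A x * G t x \<partial>M\<bar> \<le> \<epsilon>/2" using integral_mult_bounded(2)[OF iA Gu, of t] A by linarith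
      ultimately show ?case using \<epsilon> unfolding dist_real_def by linarith
    qed
  qed
  moreover have "(\<integral>x. G t x * H t x \<partial>M) = (\<integral>x. G t x * (\<Prod>i<n. F i (K (t i) x)) \<partial>M) - (\<integral>x. G t x \<partial>M) * p" for t
    using unit_boundedD(3)[OF unit_bounded_mult[OF Gu Pu]] unit_boundedD(3)[OF Gu]
    by (simp add: H_def right_diff_distrib)
  ultimately show ?thesis unfolding p_def by simp
qed

end

lemma tent_measurable [measurable]: "tent N a \<in> borel_measurable borel"
  unfolding tent_def[abs_def] by measurable

context mp_flow
begin

text \<open>Slowness survives Lipschitz functions and products of factors bounded by 1.\<close>

lemma slow_prod_tent:
  assumes c: "\<And>i. i < n \<Longrightarrow> slow n (\<lambda>t. c t i)"
  shows "slow n (\<lambda>t x. \<Prod>i<n. tent N (q i) (c t i x))" (is "slow n ?G") unfolding slow_def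
proof (intro conjI allI)
  have cu: "c t i \<in> unit_bounded" if "i < n" for t i using c[OF that] by (simp add: slow_def)
  have Gu: "?G t \<in> unit_bounded" for t by (intro unit_bounded_prod unit_boundedI)
       (use cu unit_boundedD(1)[OF cu] tent_bounds in \<open>auto simp: abs_le_iff intro: order_trans[OF _ tent_bounds(1)]\<close>)
  then show "?G t \<in> unit_bounded" for t .
  fix u
  let ?d = "\<lambda>t. \<Sum>i<n. \<bar>of_int N\<bar> * (\<integral>x. \<bar>c t i (K u x) - c t i x\<bar> \<partial>M)"
  have lim: "(?d \<longlongrightarrow> (\<Sum>i<n. \<bar>of_int N\<bar> * 0)) (far_filter n)" by (intro tendsto_intros) (use c in \<open>auto simp: slow_def\<close>)
  show "((\<lambda>t. \<integral>x. \<bar>?G t (K u x) - ?G t x\<bar> \<partial>M) \<longlongrightarrow> 0)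
      (far_filter n)"
  proof (rule tendsto_sandwich[OF _ _ tendsto_const])
    show "(?d \<longlongrightarrow> 0) (far_filter n)" using lim by simp
    show "\<forall>\<^sub>F t in far_filter n. (\<integral>x. \<bar>?G t (K u x) - ?G t x\<bar> \<partial>M) \<le> ?d t"
    proof (rule always_eventually, rule allI)
      fix t
      have i1: "integrable M (\<lambda>x. \<bar>c t i (K u x) - c t i x\<bar>)" if "i < n" for i
        using unit_boundedD(3)[OF cu[OF that]] unit_boundedD(3)[OF unit_bounded_K[OF cu[OF that]]] by simp
      have "(\<integral>x. \<bar>?G t (K u x) - ?G t x\<bar> \<partial>M)
         \<le> (\<integral>x. (\<Sum>i<n. \<bar>of_int N\<bar> * \<bar>c t i (K u x) - c t i x\<bar>) \<partial>M)"
      proof (rule integral_mono)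
        show "integrable M (\<lambda>x. \<bar>?G t (K u x) - ?G t x\<bar>)"
          using unit_boundedD(3)[OF Gu[of t]] unit_boundedD(3)[OF unit_bounded_K[OF Gu[of t], of u]] by simp
        show "integrable M (\<lambda>x. \<Sum>i<n. \<bar>of_int N\<bar> * \<bar>c t i (K u x) - c t i x\<bar>)" using i1 by auto
        fix x
        have "\<bar>?G t (K u x) - ?G t x\<bar>
          \<le> (\<Sum>i<n. \<bar>tent N (q i) (c t i (K u x)) - tent N (q i) (c t i x)\<bar>)"
          by (rule abs_prod_diff_le) (auto simp: tent_bounds abs_le_iff intro: order_trans[OF _ tent_bounds(1)])
        also have "\<dots> \<le> (\<Sum>i<n. \<bar>of_int N\<bar> * \<bar>c t i (K u x) - c t i x\<bar>)" by (intro sum_mono tent_lipschitz)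
        finally show "\<bar>?G t (K u x) - ?G t x\<bar>
          \<le> (\<Sum>i<n. \<bar>of_int N\<bar> * \<bar>c t i (K u x) - c t i x\<bar>)" .
      qed
      also have "\<dots> = (\<Sum>i<n. \<integral>x. \<bar>of_int N\<bar> * \<bar>c t i (K u x) - c t i x\<bar> \<partial>M)"
        by (rule Bochner_Integration.integral_sum) (use i1 in auto)
      also have "\<dots> = ?d t" by simp
      finally show "(\<integral>x. \<bar>?G t (K u x) - ?G t x\<bar> \<partial>M) \<le> ?d t" .
    qed
  qed simp
qed

text \<open>A partition of unity by tents in the values of the speeds \<open>c\<close> reduces the claim to constant speeds.\<close>

lemma speed_decorrelation:
  assumes f: "\<And>i. i < n \<Longrightarrow> f i \<in> unit_bounded" and f0: "\<And>i. i < n \<Longrightarrow> (\<integral>x. f i x \<partial>M) = 0"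
    and lip: "\<And>i x a b. i < n \<Longrightarrow> x \<in> space M \<Longrightarrow> \<bar>f i (K a x) - f i (K b x)\<bar> \<le> \<Lambda> * \<bar>a - b\<bar>"
    and joint: "\<And>i a. i < n \<Longrightarrow> a \<in> borel_measurable M \<Longrightarrow> (\<lambda>x. f i (K (a x) x)) \<in> borel_measurable M"
    and c: "\<And>i. i < n \<Longrightarrow> slow n (\<lambda>t. c t i)"
    and c1: "((\<lambda>t. prob {x \<in> space M. \<forall>i<n. \<bar>c t i x\<bar> \<noteq> 1}) \<longlongrightarrow> 0) (far_filter n)"
    and mix: "\<And>g. (\<And>i. i < n \<Longrightarrow> g i \<in> unit_bounded) \<Longrightarrow> mixes n g"
    and mix2: "\<And>g. g \<in> unit_bounded \<Longrightarrow> mixes 2 (\<lambda>_. g)"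
    and n: "n > 0" and \<epsilon>: "\<epsilon> > 0"
  shows "\<exists>S>0. \<forall>s s'. S \<le> \<bar>s - s'\<bar> \<longrightarrow> (\<forall>\<^sub>F t in far_filter n.
     (\<integral>x. (\<Prod>i<n. f i (K (t i - c t i x * s) x)) * (\<Prod>i<n. f i (K (t i - c t i x * s') x)) \<partial>M) \<le> \<epsilon>)"
proof -
  have cu: "c t i \<in> unit_bounded" if "i < n" for t i using c[OF that] by (simp add: slow_def)
  have cm: "c t i \<in> borel_measurable M" if "i < n" for t i using cu[OF that] by (auto dest: unit_boundedD)
  have fm: "f i \<in> borel_measurable M" if "i < n" for i using f[OF that] by (auto dest: unit_boundedD)
  have "\<exists>U>0. \<forall>a. U \<le> \<bar>a\<bar> \<longrightarrow> \<bar>(\<integral>x. f i x * f i (K a x) \<partial>M)\<bar> < \<epsilon>/4" if "i < n" for i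
    using mixes_two_autocorrelation[OF mix2[OF f[OF that]] f[OF that], of "\<epsilon>/4"] \<epsilon> f0[OF that] by simp
  then obtain U where U: "\<And>i. i < n \<Longrightarrow> U i > 0"
     "\<And>i a. i < n \<Longrightarrow> U i \<le> \<bar>a\<bar> \<Longrightarrow> \<bar>(\<integral>x. f i x * f i (K a x) \<partial>M)\<bar> < \<epsilon>/4" by metis
  define S where "S = Max (U ` {..<n})"
  have S: "U i \<le> S" if "i < n" for i unfolding S_def using that by (intro Max_ge) auto
  have S0: "S > 0" using S[of 0] U(1)[of 0] n by linarith
  have "\<forall>\<^sub>F t in far_filter n.
     (\<integral>x. (\<Prod>i<n. f i (K (t i - c t i x * s) x)) * (\<Prod>i<n. f i (K (t i - c t i x * s') x)) \<partial>M) \<le> \<epsilon>"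
    if ss: "S \<le> \<bar>s - s'\<bar>" for s s'
  proof -
    \<comment> \<open>The \<open>i\<close>-th pair of factors with a constant \<open>q\<close> in
      place of the speed, to be evaluated at \<open>K (t i) x\<close>; \<open>\<psi> i q\<close> is
      its mean.\<close>
    define \<phi> where "\<phi> i q x = f i (K (- (q * s)) x) * f i (K (- (q * s')) x)" for i q x
    define \<psi> where "\<psi> i q = (\<integral>x. \<phi> i q x \<partial>M)" for i q
    have \<phi>u: "\<phi> i q \<in> unit_bounded" if "i < n" for i q
      unfolding \<phi>_def by (intro unit_bounded_mult unit_bounded_K f that)
    have \<psi>1: "\<bar>\<psi> i q\<bar> \<le> 1" if "i < n" for i q unfolding \<psi>_def using unit_boundedD(4)[OF \<phi>u[OF that]] .
    have L0: "0 \<le> \<Lambda>"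
    proof -
      obtain x where "x \<in> space M" using not_empty by blast
      from lip[OF n this, of 1 0] show ?thesis by simp
    qed
    define D where "D = \<Lambda> * (\<bar>s\<bar> + \<bar>s'\<bar>)"
    have D0: "D \<ge> 0" using L0 by (simp add: D_def)
    have \<phi>lip: "\<bar>\<phi> i q x - \<phi> i q' x\<bar> \<le> D * \<bar>q - q'\<bar>" if i: "i < n" and x: "x \<in> space M" for i q q' x
    proof -
      have b: "\<bar>f i (K a x)\<bar> \<le> 1" for a using unit_boundedD(2)[OF f[OF i] K_space[OF x]] .
      have "\<phi> i q x - \<phi> i q' x = (f i (K (- (q * s)) x) - f i (K (- (q' * s)) x)) * f i (K (- (q * s')) x)
         + f i (K (- (q' * s)) x) * (f i (K (- (q * s')) x) - f i (K (- (q' * s')) x))"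
        by (simp add: \<phi>_def algebra_simps)
      also have "\<bar>\<dots>\<bar> \<le> \<bar>f i (K (- (q * s)) x) - f i (K (- (q' * s)) x)\<bar> * 1
         + 1 * \<bar>f i (K (- (q * s')) x) - f i (K (- (q' * s')) x)\<bar>"
        by (intro order_trans[OF abs_triangle_ineq] add_mono)
           (auto simp: abs_mult intro!: mult_left_le mult_right_le_one_le mult_left_le_one_le b)
      also have "\<dots> \<le> \<Lambda> * \<bar>- (q * s) - - (q' * s)\<bar> * 1 + 1 * (\<Lambda> * \<bar>- (q * s') - - (q' * s')\<bar>)"
        by (intro add_mono mult_left_mono mult_right_mono lip i x) auto
      also have "\<dots> = D * \<bar>q - q'\<bar>"
      proof -
        have eq: "\<bar>- (q * r) - - (q' * r)\<bar> = \<bar>q - q'\<bar> * \<bar>r\<bar>" for r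
          unfolding abs_mult[symmetric] left_diff_distrib by (simp add: abs_minus_commute)
        show ?thesis unfolding eq by (simp add: D_def distrib_left distrib_right mult_ac)
      qed
      finally show ?thesis .
    qed
    \<comment> \<open>A grid so fine that rounding all \<open>n\<close> speeds to grid values costs
      at most \<open>\<epsilon>/4\<close>.\<close>
    define N where "N = \<lceil>real n * D * 4 / \<epsilon>\<rceil> + 1"
    have "0 \<le> real n * D * 4 / \<epsilon>" using D0 \<epsilon> by simp
    then have N: "N > 0" "real n * D * 4 / \<epsilon> \<le> of_int N" unfolding N_def by linarith+
    have ND: "real n * (D / of_int N) \<le> \<epsilon>/4" using N \<epsilon> by (simp add: field_simps)
    \<comment> \<open>\<open>Y\<close> is the integrand, \<open>A\<close> interpolates its
      dependence on the speeds between grid values, and \<open>B\<close> replaces the functions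
      occurring in \<open>A\<close> by their means.\<close>
    define Y where "Y t x = (\<Prod>i<n. \<phi> i (c t i x) (K (t i) x))" for t x
    define A where "A t x = (\<Prod>i<n. \<Sum>a\<in>{-N..N}. tent N a (c t i x) * \<phi> i (of_int a / of_int N) (K (t i) x))" for t x
    define B where "B t x = (\<Prod>i<n. \<Sum>a\<in>{-N..N}. tent N a (c t i x) * \<psi> i (of_int a / of_int N))" for t x
    define Q where "Q = PiE {..<n} (\<lambda>_. {-N..N})"
    define G where "G q t x = (\<Prod>i<n. tent N (q i) (c t i x))" for q t x
    have Qfin: "finite Q" unfolding Q_def by (intro finite_PiE) auto
    have Gs: "slow n (G q)" for q unfolding G_def[abs_def] by (rule slow_prod_tent[OF c])
    have Gu: "G q t \<in> unit_bounded" for q t using Gs[of q] by (simp add: slow_def)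
    have c_le: "\<bar>c t i x\<bar> \<le> 1" if "i < n" "x \<in> space M" for t i x using unit_boundedD(2)[OF cu] that by auto
    have Pu: "(\<lambda>x. \<Prod>i<n. \<phi> i (of_int (q i) / of_int N) (K (t i) x)) \<in> unit_bounded" for q t
      by (rule unit_bounded_prod) (use \<phi>u unit_bounded_K in auto)
    \<comment> \<open>Multiplied out, the coefficients are products of tents of the speeds. They are
      slow, so \<open>slow_decorrelation\<close> applies to each term separately.\<close>
    have A_eq: "A t x = (\<Sum>q\<in>Q. G q t x * (\<Prod>i<n. \<phi> i (of_int (q i) / of_int N) (K (t i) x)))" for t x
      unfolding A_def Q_def G_def by (subst prod_sum_PiE) (auto simp: prod.distrib)
    have B_eq: "B t x = (\<Sum>q\<in>Q. G q t x * (\<Prod>i<n. \<psi> i (of_int (q i) / of_int N)))" for t x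
      unfolding B_def Q_def G_def by (subst prod_sum_PiE) (auto simp: prod.distrib)
    have iA: "integrable M (\<lambda>x. A t x)" for t
      unfolding A_eq by (intro Bochner_Integration.integrable_sum unit_boundedD(3) unit_bounded_mult Gu Pu)
    have iB: "integrable M (\<lambda>x. B t x)" for t
      unfolding B_eq by (intro Bochner_Integration.integrable_sum integrable_mult_left unit_boundedD(3) Gu)
    have lim: "((\<lambda>t. (\<integral>x. A t x \<partial>M) - (\<integral>x. B t x \<partial>M)) \<longlongrightarrow> 0) (far_filter n)"
    proof -
      have "(\<integral>x. A t x \<partial>M) - (\<integral>x. B t x \<partial>M) = (\<Sum>q\<in>Q. (\<integral>x. G q t x * (\<Prod>i<n. \<phi> i (of_int (q i) / of_int N) (K (t i) x)) \<partial>M)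
          - (\<integral>x. G q t x \<partial>M) * (\<Prod>i<n. \<integral>x. \<phi> i (of_int (q i) / of_int N) x \<partial>M))" for t
      proof -
        have "(\<integral>x. A t x \<partial>M) = (\<Sum>q\<in>Q. \<integral>x. G q t x * (\<Prod>i<n. \<phi> i (of_int (q i) / of_int N) (K (t i) x)) \<partial>M)"
          unfolding A_eq by (intro Bochner_Integration.integral_sum unit_boundedD(3) unit_bounded_mult Gu Pu)
        moreover have "(\<integral>x. B t x \<partial>M) = (\<Sum>q\<in>Q. \<integral>x. G q t x * (\<Prod>i<n. \<psi> i (of_int (q i) / of_int N)) \<partial>M)"
          unfolding B_eq by (intro Bochner_Integration.integral_sum integrable_mult_left unit_boundedD(3) Gu)
        ultimately show ?thesis by (simp add: sum_subtractf \<psi>_def)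
      qed
      moreover have "((\<lambda>t. \<Sum>q\<in>Q. (\<integral>x. G q t x * (\<Prod>i<n. \<phi> i (of_int (q i) / of_int N) (K (t i) x)) \<partial>M)
          - (\<integral>x. G q t x \<partial>M) * (\<Prod>i<n. \<integral>x. \<phi> i (of_int (q i) / of_int N) x \<partial>M)) \<longlongrightarrow> (\<Sum>q\<in>Q. 0)) (far_filter n)"
        by (intro tendsto_sum slow_decorrelation \<phi>u mix mix2 Gs n)
      ultimately show ?thesis by simp
    qed
    have Yeq: "(\<Prod>i<n. f i (K (t i - c t i x * s) x)) * (\<Prod>i<n. f i (K (t i - c t i x * s') x)) = Y t x"
      if x: "x \<in> space M" for t x unfolding Y_def \<phi>_def prod.distrib using x
      by (intro arg_cong2[where f = "(*)"] prod.cong refl) (simp_all add: K_add[symmetric] add.commute)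
    have \<phi>1: "\<bar>\<phi> i q (K v x)\<bar> \<le> 1" if "i < n" "x \<in> space M" for i q v x
      using unit_boundedD(2)[OF \<phi>u[OF that(1)] K_space[OF that(2)]] .
    have YA: "\<bar>Y t x - A t x\<bar> \<le> \<epsilon>/4" if x: "x \<in> space M" for t x
    proof -
      have "\<bar>Y t x - A t x\<bar> \<le> (\<Sum>i<n. \<bar>\<phi> i (c t i x) (K (t i) x)
          - (\<Sum>a\<in>{-N..N}. tent N a (c t i x) * \<phi> i (of_int a / of_int N) (K (t i) x))\<bar>)" unfolding Y_def A_def
      proof (rule abs_prod_diff_le)
        show "\<bar>\<Sum>a\<in>{-N..N}. tent N a (c t i x) * \<phi> i (of_int a / of_int N) (K (t i) x)\<bar> \<le> 1" if "i \<in> {..<n}" for i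
          by (rule sum_tent_bound) (use N c_le \<phi>1 x that in auto)
      qed (use \<phi>1 x in auto)
      also have "\<dots> \<le> (\<Sum>i<n. D / of_int N)"
      proof (rule sum_mono)
        fix i assume i: "i \<in> {..<n}"
        have "\<phi> i (c t i x) (K (t i) x) = (\<Sum>a\<in>{-N..N}. tent N a (c t i x)) * \<phi> i (c t i x) (K (t i) x)"
          using sum_tent[of N "c t i x"] N c_le[of i x t] i x by simp
        then have "\<phi> i (c t i x) (K (t i) x) - (\<Sum>a\<in>{-N..N}. tent N a (c t i x) * \<phi> i (of_int a / of_int N) (K (t i) x))
          = (\<Sum>a\<in>{-N..N}. tent N a (c t i x) * (\<phi> i (c t i x) (K (t i) x) - \<phi> i (of_int a / of_int N) (K (t i) x)))"
          by (simp add: sum_distrib_right right_diff_distrib sum_subtractf)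
        also have "\<bar>\<dots>\<bar> \<le> D / of_int N"
        proof (rule sum_tent_bound)
          fix a assume a: "tent N a (c t i x) \<noteq> 0"
          have "\<bar>\<phi> i (c t i x) (K (t i) x) - \<phi> i (of_int a / of_int N) (K (t i) x)\<bar> \<le> D * \<bar>c t i x - of_int a / of_int N\<bar>"
            using \<phi>lip i K_space x by auto
          also have "\<dots> \<le> D * (1 / of_int N)" by (intro mult_left_mono tent_support D0) (use N a in auto)
          finally show "\<bar>\<phi> i (c t i x) (K (t i) x) - \<phi> i (of_int a / of_int N) (K (t i) x)\<bar> \<le> D / of_int N" by simp
        qed (use N c_le i x in auto)
        finally show "\<bar>\<phi> i (c t i x) (K (t i) x)
          - (\<Sum>a\<in>{-N..N}. tent N a (c t i x) * \<phi> i (of_int a / of_int N) (K (t i) x))\<bar> \<le> D / of_int N" .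
      qed
      also have "\<dots> \<le> \<epsilon>/4" using ND by simp
      finally show ?thesis .
    qed
    have Ym: "(\<lambda>x. Y t x) \<in> borel_measurable M" for t
    proof -
      have "(\<lambda>x. (\<Prod>i<n. f i (K (t i - c t i x * s) x)) * (\<Prod>i<n. f i (K (t i - c t i x * s') x))) \<in> borel_measurable M"
        by (intro borel_measurable_times borel_measurable_prod joint borel_measurable_diff) (auto intro!: borel_measurable_times cm)
      then show ?thesis by (subst measurable_cong[OF Yeq[symmetric]])
    qed
    have iY: "integrable M (\<lambda>x. Y t x)" for t
    proof (rule integrable_const_bound[where B = 1])
      show "AE x in M. norm (Y t x) \<le> 1" by (rule AE_I2) (auto intro!: abs_prod_le_1 \<phi>1 simp: Y_def)
    qed (rule Ym)
    have B1: "\<bar>B t x\<bar> \<le> 1" if x: "x \<in> space M" for t x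
      unfolding B_def by (intro abs_prod_le_1 sum_tent_bound) (use N c_le x \<psi>1 in auto)
    \<comment> \<open>A speed of modulus 1 is itself a grid value: one tent is 1, the others are 0.
      The remaining mean, \<open>\<psi> i\<close> at 1 or -1, is an autocorrelation of
      \<open>f i\<close> at time distance \<open>\<bar>s - s'\<bar>\<close>, hence small.\<close>
    have Bsmall: "\<bar>B t x\<bar> \<le> \<epsilon>/4" if x: "x \<in> space M" and i: "i < n" "\<bar>c t i x\<bar> = 1" for t x i
    proof -
      let ?s = "\<lambda>i. \<Sum>a\<in>{-N..N}. tent N a (c t i x) * \<psi> i (of_int a / of_int N)"
      have "\<bar>?s i\<bar> \<le> \<epsilon>/4"
      proof (rule sum_tent_bound)
        fix a assume a: "tent N a (c t i x) \<noteq> 0"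
        have r: "real_of_int N * c t i x = of_int (if c t i x = 1 then N else - N)"
        proof -
          have "c t i x = 1 \<or> c t i x = - 1" using i(2) by linarith
          then show ?thesis by auto
        qed
        have "\<bar>of_int N * c t i x - of_int a\<bar> < 1" using a by (auto simp: tent_def)
        then have "\<bar>real_of_int ((if c t i x = 1 then N else - N) - a)\<bar> < 1" unfolding r by simp
        then have "a = (if c t i x = 1 then N else - N)" by linarith
        then have ca: "of_int a / of_int N = c t i x" using N i(2) by auto
        have "\<psi> i (c t i x) = (\<integral>y. f i y * f i (K (- (c t i x * s') - - (c t i x * s)) y) \<partial>M)"
          unfolding \<psi>_def \<phi>_def by (rule integral_pair_K[OF fm fm]) (use i in auto)
        moreover have "\<bar>- (c t i x * s') - - (c t i x * s)\<bar> = \<bar>s - s'\<bar>"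
          using i(2) by (simp add: abs_mult[symmetric] right_diff_distrib[symmetric] flip: abs_mult)
             (simp add: abs_mult)
        ultimately show "\<bar>\<psi> i (of_int a / of_int N)\<bar> \<le> \<epsilon>/4"
          using U(2)[of i "- (c t i x * s') - - (c t i x * s)"] S[of i] ss i unfolding ca by force
      qed (use N c_le i x in auto)
      moreover have "B t x = ?s i * (\<Prod>i\<in>{..<n} - {i}. ?s i)" unfolding B_def by (rule prod.remove) (use i in auto)
      moreover have "\<bar>\<Prod>i\<in>{..<n} - {i}. ?s i\<bar> \<le> 1" by (intro abs_prod_le_1 sum_tent_bound) (use N c_le x \<psi>1 in auto)
      ultimately show ?thesis using mult_left_le[of "\<bar>\<Prod>i\<in>{..<n} - {i}. ?s i\<bar>" "\<bar>?s i\<bar>"] by (simp add: abs_mult)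
    qed
    define Z where "Z t = {x \<in> space M. \<forall>i<n. \<bar>c t i x\<bar> \<noteq> 1}" for t
    have [measurable]: "Z t \<in> sets M" for t
    proof -
      have [measurable]: "c t i \<in> borel_measurable M" if "i \<in> {..<n}" for i using cm that by auto
      have "Z t = {x \<in> space M. \<forall>i\<in>{..<n}. \<bar>c t i x\<bar> \<noteq> 1}" by (auto simp: Z_def)
      also have "\<dots> \<in> sets M" by measurable
      finally show ?thesis .
    qed
    have Bint: "(\<integral>x. B t x \<partial>M) \<le> \<epsilon>/4 + prob (Z t)" for t
    proof -
      have "(\<integral>x. B t x \<partial>M) \<le> (\<integral>x. \<epsilon>/4 + indicator (Z t) x \<partial>M)"
      proof (rule integral_mono[OF iB])
        show "integrable M (\<lambda>x. \<epsilon>/4 + indicator (Z t) x)" by (simp add: less_top[symmetric])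
        fix x assume x: "x \<in> space M"
        show "B t x \<le> \<epsilon>/4 + indicator (Z t) x"
        proof (cases "x \<in> Z t")
          case True
          then show ?thesis using B1[OF x, of t] \<epsilon> by auto
        next
          case False
          then obtain i where "i < n" "\<bar>c t i x\<bar> = 1" using x by (auto simp: Z_def)
          from Bsmall[OF x this] False show ?thesis by auto
        qed
      qed
      then show ?thesis by (simp add: prob_space less_top[symmetric])
    qed
    have "\<forall>\<^sub>F t in far_filter n. prob (Z t) < \<epsilon>/4" using order_tendstoD(2)[OF c1, of "\<epsilon>/4"] \<epsilon> by (simp add: Z_def)
    moreover have "\<forall>\<^sub>F t in far_filter n. (\<integral>x. A t x \<partial>M) - (\<integral>x. B t x \<partial>M) < \<epsilon>/4"
      using order_tendstoD(2)[OF lim, of "\<epsilon>/4"] \<epsilon> by simp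
    \<comment> \<open>The four quarters of \<open>\<epsilon>\<close>: interpolation from
      \<open>Y\<close> to \<open>A\<close>, decorrelation from \<open>A\<close> to \<open>B\<close>,
      the size of \<open>B\<close> where some speed has modulus 1, and the measure of the remaining
      set \<open>Z t\<close>.\<close>
    ultimately show ?thesis
    proof eventually_elim
      case (elim t)
      have "(\<integral>x. (\<Prod>i<n. f i (K (t i - c t i x * s) x)) * (\<Prod>i<n. f i (K (t i - c t i x * s') x)) \<partial>M) = (\<integral>x. Y t x \<partial>M)"
        by (intro Bochner_Integration.integral_cong refl Yeq)
      also have "\<dots> \<le> (\<integral>x. A t x + \<epsilon>/4 \<partial>M)"
      proof (rule integral_mono[OF iY])
        fix x assume "x \<in> space M"
        from YA[OF this, of t] show "Y t x \<le> A t x + \<epsilon>/4" by linarith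
      qed (use iA in auto)
      also have "\<dots> = (\<integral>x. A t x \<partial>M) + \<epsilon>/4" using iA by (simp add: prob_space)
      finally show ?case using elim Bint[of t] by linarith
    qed
  qed
  then show ?thesis using S0 by blast
qed

end

subsection \<open>The circle and its rotation\<close>

definition periodic1 :: "(real \<Rightarrow> 'a) \<Rightarrow> bool" where
  "periodic1 f \<longleftrightarrow> (\<forall>x. f (x + 1) = f x)"

lemma periodic1_add_nat: "periodic1 f \<Longrightarrow> f (x + real n) = f x"
proof (induction n)
  case (Suc n)
  have "f (x + real (Suc n)) = f ((x + real n) + 1)" by (simp add: algebra_simps)
  then show ?case using Suc by (simp add: periodic1_def)
qed simp

lemma periodic1_add_int:
  assumes "periodic1 f" shows "f (x + of_int m) = f x"
proof (cases "m \<ge> 0")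
  case True
  then show ?thesis using periodic1_add_nat[OF assms, of x "nat m"] by simp
next
  case False
  then show ?thesis using periodic1_add_nat[OF assms, of "x + of_int m" "nat (- m)"] by simp
qed

lemma periodic1_frac: "periodic1 f \<Longrightarrow> f (frac x) = f x"
  using periodic1_add_int[of f x "- \<lfloor>x\<rfloor>"] by (simp add: frac_def)

text \<open>Lebesgue measure of the circle, carried by the unit interval of the real line. Functions
  on the circle are periodic functions on the line, so that displaced points such as
  \<open>x + s / P x\<close> are formed without reduction modulo 1.\<close>

definition circ :: "real measure" where
  "circ = density lborel (indicator {0..<1})"

lemma sets_circ [simp, measurable_cong]: "sets circ = sets borel"
  by (simp add: circ_def)

lemma space_circ [simp]: "space circ = UNIV"
  by (simp add: circ_def)

lemma nn_integral_circ:
  "f \<in> borel_measurable borel \<Longrightarrow> (\<integral>\<^sup>+x. f x \<partial>circ) = (\<integral>\<^sup>+x. indicator {0..<1} x * f x \<partial>lborel)"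
  by (simp add: circ_def nn_integral_density)

lemma emeasure_circ: "A \<in> sets borel \<Longrightarrow> emeasure circ A = emeasure lborel ({0..<1} \<inter> A)"
  by (simp add: circ_def emeasure_density indicator_inter_arith[symmetric])

interpretation circ: prob_space circ by standard (simp add: emeasure_circ)

lemma measure_circ_UNIV [simp]: "measure circ UNIV = 1"
  using circ.prob_space by simp

lemma integral_circ:
  fixes f :: "real \<Rightarrow> real"
  shows "f \<in> borel_measurable borel \<Longrightarrow> (\<integral>x. f x \<partial>circ) = (\<integral>x. indicator {0..<1} x * f x \<partial>lborel)"
  unfolding circ_def ennreal_indicator[symmetric] by (subst integral_density) auto

lemma integrable_circ:
  fixes f :: "real \<Rightarrow> real"
  shows "f \<in> borel_measurable borel \<Longrightarrow> integrable circ f \<longleftrightarrow> integrable lborel (\<lambda>x. indicator {0..<1} x * f x)"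
  unfolding circ_def ennreal_indicator[symmetric] by (subst integrable_density) auto

lemma AE_circ: "(AE x in lborel. P x) \<Longrightarrow> (AE x in circ. P x)"
  unfolding circ_def by (subst AE_density) auto

lemma AE_circ_unit: "AE x in circ. 0 \<le> x \<and> x < 1"
  unfolding circ_def by (subst AE_density) (auto simp: indicator_def)

text \<open>Translation by the fractional part \<open>b\<close> moves the window to
  \<open>{b..<1+b}\<close>. Cut it at 1; the right piece returns to \<open>{0..<b}\<close> by
  periodicity.\<close>

lemma nn_integral_circ_shift:
  assumes G [measurable]: "G \<in> borel_measurable borel" and per: "periodic1 G"
  shows "(\<integral>\<^sup>+x. G (x + a) \<partial>circ) = (\<integral>\<^sup>+x. G x \<partial>circ)"
proof -
  define b where "b = frac a"
  have b: "0 \<le> b" "b < 1" by (auto simp: b_def frac_lt_1)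
  have Gb: "G (x + a) = G (b + x)" for x
    using periodic1_add_int[OF per, of "b + x" "\<lfloor>a\<rfloor>"] by (simp add: b_def frac_def algebra_simps)
  have "(\<integral>\<^sup>+x. G (x + a) \<partial>circ) = (\<integral>\<^sup>+x. indicator {b..<1+b} (b + x) * G (b + x) \<partial>lborel)"
    by (subst nn_integral_circ) (auto simp: Gb intro!: nn_integral_cong split: split_indicator)
  also have "\<dots> = (\<integral>\<^sup>+x. indicator {b..<1+b} x * G x \<partial>lborel)"
    using nn_integral_real_affine[of "\<lambda>x. indicator {b..<1+b} x * G x" 1 b] by simp
  also have "\<dots> = (\<integral>\<^sup>+x. indicator {b..<1} x * G x + indicator {1..<1+b} x * G x \<partial>lborel)"
    using b by (intro nn_integral_cong) (auto split: split_indicator)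
  also have "\<dots> = (\<integral>\<^sup>+x. indicator {b..<1} x * G x \<partial>lborel) + (\<integral>\<^sup>+x. indicator {1..<1+b} x * G x \<partial>lborel)"
    by (rule nn_integral_add) auto
  also have "(\<integral>\<^sup>+x. indicator {1..<1+b} x * G x \<partial>lborel) = (\<integral>\<^sup>+x. indicator {1..<1+b} (1 + x) * G (1 + x) \<partial>lborel)"
    using nn_integral_real_affine[of "\<lambda>x. indicator {1..<1+b} x * G x" 1 1] by simp
  also have "\<dots> = (\<integral>\<^sup>+x. indicator {0..<b} x * G x \<partial>lborel)"
    using per by (intro nn_integral_cong) (auto simp: periodic1_def add.commute split: split_indicator)
  also have "(\<integral>\<^sup>+x. indicator {b..<1} x * G x \<partial>lborel) + \<dots>
     = (\<integral>\<^sup>+x. indicator {b..<1} x * G x + indicator {0..<b} x * G x \<partial>lborel)"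
    by (rule nn_integral_add[symmetric]) auto
  also have "\<dots> = (\<integral>\<^sup>+x. G x \<partial>circ)"
    using b by (subst nn_integral_circ) (auto intro!: nn_integral_cong split: split_indicator)
  finally show ?thesis .
qed

lemma distr_circ_shift: "distr circ borel (\<lambda>x. frac (x + a)) = circ"
proof (rule measure_eqI)
  fix A assume "A \<in> sets (distr circ borel (\<lambda>x. frac (x + a)))"
  then have [measurable]: "A \<in> sets borel" by simp
  have [measurable]: "(\<lambda>x::real. frac (x + a)) \<in> borel_measurable borel" unfolding frac_def by measurable
  have [measurable]: "(\<lambda>x. indicator A (frac x) :: ennreal) \<in> borel_measurable borel" unfolding frac_def by measurable
  have "emeasure (distr circ borel (\<lambda>x. frac (x + a))) A = (\<integral>\<^sup>+x. indicator A (frac (x + a)) \<partial>circ)"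
    by (subst nn_integral_distr[symmetric, where f = "indicator A" and M' = borel]) auto
  also have "\<dots> = (\<integral>\<^sup>+x. indicator A (frac x) \<partial>circ)" by (rule nn_integral_circ_shift[of "\<lambda>x. indicator A (frac x)"])
       (auto simp: periodic1_def frac_1_eq)
  also have "\<dots> = (\<integral>\<^sup>+x. indicator A x \<partial>circ)"
  proof (rule nn_integral_cong_AE)
    show "AE x in circ. indicator A (frac x) = (indicator A x :: ennreal)"
      using AE_circ_unit by eventually_elim (simp add: frac_eq)
  qed
  finally show "emeasure (distr circ borel (\<lambda>x. frac (x + a))) A = emeasure circ A" by simp
qed simp

lemma integral_circ_shift:
  fixes g :: "real \<Rightarrow> real"
  assumes [measurable]: "g \<in> borel_measurable borel" and per: "periodic1 g"
  shows "(\<integral>x. g (x + a) \<partial>circ) = (\<integral>x. g x \<partial>circ)"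
    and "integrable circ (\<lambda>x. g (x + a)) \<longleftrightarrow> integrable circ g"
proof -
  have [measurable]: "(\<lambda>x::real. frac (x + a)) \<in> borel_measurable borel" unfolding frac_def by measurable
  have "(\<integral>x. g x \<partial>distr circ borel (\<lambda>x. frac (x + a))) = (\<integral>x. g (frac (x + a)) \<partial>circ)" by (rule integral_distr) auto
  then show "(\<integral>x. g (x + a) \<partial>circ) = (\<integral>x. g x \<partial>circ)" by (simp add: distr_circ_shift periodic1_frac[OF per])
  have "integrable (distr circ borel (\<lambda>x. frac (x + a))) g \<longleftrightarrow> integrable circ (\<lambda>x. g (frac (x + a)))"
    by (rule integrable_distr_eq) auto
  then show "integrable circ (\<lambda>x. g (x + a)) \<longleftrightarrow> integrable circ g"
    by (simp add: distr_circ_shift periodic1_frac[OF per])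
qed

section \<open>Continuous periodic functions and equidistribution of the rotation\<close>

lemma periodic1_bounded_uniform:
  fixes g :: "real \<Rightarrow> real"
  assumes g: "continuous_on UNIV g" and per: "periodic1 g"
  shows "\<exists>B>0. \<forall>x. \<bar>g x\<bar> \<le> B"
    and "e > 0 \<Longrightarrow> \<exists>d>0. \<forall>x y. \<bar>x - y\<bar> < d \<longrightarrow> \<bar>g x - g y\<bar> < e"
proof -
  have g': "continuous_on {-1..2} g" using g continuous_on_subset by blast
  have "bounded (g ` {-1..2})" by (intro compact_imp_bounded compact_continuous_image g') auto
  then obtain B where B: "B > 0" "\<And>x. x \<in> {-1..2} \<Longrightarrow> \<bar>g x\<bar> \<le> B" unfolding bounded_pos by auto
  have "\<bar>g x\<bar> \<le> B" for x
  proof -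
    have "frac x \<in> {-1..2}" unfolding atLeastAtMost_iff using frac_ge_0[of x] frac_lt_1[of x] by linarith
    then have "\<bar>g (frac x)\<bar> \<le> B" by (rule B)
    then show ?thesis by (simp add: periodic1_frac[OF per])
  qed
  then show "\<exists>B>0. \<forall>x. \<bar>g x\<bar> \<le> B" using B by blast
  assume e: "e > 0"
  have "uniformly_continuous_on {-1..2} g" by (intro compact_uniformly_continuous g') auto
  then obtain d where d: "d > 0" "\<And>x y. x \<in> {-1..2} \<Longrightarrow> y \<in> {-1..2} \<Longrightarrow> dist y x < d \<Longrightarrow> dist (g y) (g x) < e"
    using e unfolding uniformly_continuous_on_def by metis
  have "\<bar>g x - g y\<bar> < e" if xy: "\<bar>x - y\<bar> < min d 1" for x y
  proof -
    have "frac x \<in> {-1..2}" "y - of_int \<lfloor>x\<rfloor> \<in> {-1..2}" unfolding atLeastAtMost_iff frac_def using xy by linarith+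
    moreover have "dist (frac x) (y - of_int \<lfloor>x\<rfloor>) < d" using xy by (auto simp: dist_real_def frac_def)
    ultimately have "dist (g (frac x)) (g (y - of_int \<lfloor>x\<rfloor>)) < e" using d(2) by blast
    then show ?thesis
      using periodic1_add_int[OF per, of y "- \<lfloor>x\<rfloor>"] by (simp add: dist_real_def periodic1_frac[OF per])
  qed
  then show "\<exists>d>0. \<forall>x y. \<bar>x - y\<bar> < d \<longrightarrow> \<bar>g x - g y\<bar> < e" using d(1) by (intro exI[of _ "min d 1"]) auto
qed

text \<open>The number of steps is uniform in the target \<open>y\<close>, because it is enough to
  come near \<open>N\<close> equally spaced points.\<close>

lemma rotation_dense:
  assumes "\<alpha> \<notin> \<rat>" and e: "e > 0"
  shows "\<exists>J::nat. \<forall>y. \<exists>j<J. \<exists>m::int. \<bar>real j * \<alpha> - y - of_int m\<bar> < e"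
proof -
  obtain N :: nat where N: "N > 0" "1 / real N < e/2"
    using e by (metis half_gt_zero_iff inverse_eq_divide real_arch_inverse neq0_conv)
  have "\<exists>k::nat. \<bar>frac (real k * \<alpha>) - real l / real N\<bar> < e/2" if "l < N" for l
    using Kronecker_approx_1_explicit[OF assms(1), of "real l / real N" "e/2"] that e N by (auto simp: field_simps)
  then obtain k :: "nat \<Rightarrow> nat" where k: "\<And>l. l < N \<Longrightarrow> \<bar>frac (real (k l) * \<alpha>) - real l / real N\<bar> < e/2" by metis
  show ?thesis
  proof (rule exI[of _ "Suc (Max (k ` {..<N}))"], rule allI)
    fix y
    define l where "l = nat \<lfloor>frac y * real N\<rfloor>"
    have fy: "0 \<le> frac y" "frac y < 1" by (auto simp: frac_lt_1)
    have "frac y * real N < real N" using fy N by simp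
    then have lN: "l < N" using fy N unfolding l_def by (simp add: nat_less_iff floor_less_iff)
    have l: "real l \<le> frac y * real N" "frac y * real N < real l + 1"
      using fy unfolding l_def by (simp_all add: of_nat_nat)
    then have "\<bar>(frac y * real N - real l) / real N\<bar> \<le> 1 / real N"
      unfolding abs_divide by (simp add: divide_right_mono)
    then have "\<bar>frac y - real l / real N\<bar> \<le> 1 / real N" using N by (simp add: diff_divide_distrib)
    then have "\<bar>frac (real (k l) * \<alpha>) - frac y\<bar> < e" using k[OF lN] N by linarith
    then have "\<bar>real (k l) * \<alpha> - y - of_int (\<lfloor>real (k l) * \<alpha>\<rfloor> - \<lfloor>y\<rfloor>)\<bar> < e" by (simp add: frac_def algebra_simps)
    moreover have "k l < Suc (Max (k ` {..<N}))" using lN by (simp add: less_Suc_eq_le)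
    ultimately show "\<exists>j<Suc (Max (k ` {..<N})). \<exists>m::int. \<bar>real j * \<alpha> - y - of_int m\<bar> < e" by blast
  qed
qed

text \<open>Birkhoff sums from \<open>x\<close> and from \<open>y\<close> are almost equal:
  \<open>j < J\<close> steps lead from \<open>x\<close> to a point near \<open>y\<close>. These
  steps exchange at most \<open>J\<close> terms at either end of the sum, an error of
  \<open>2 * J * B\<close> independent of \<open>n\<close>, and afterwards the sums are compared
  term by term by uniform continuity. Integrating over \<open>y\<close> gives the mean.\<close>

lemma uniform_equidistribution:
  fixes g :: "real \<Rightarrow> real"
  assumes \<alpha>: "\<alpha> \<notin> \<rat>" and g: "continuous_on UNIV g" and per: "periodic1 g" and e: "e > 0"
  shows "\<exists>n0. \<forall>n\<ge>n0. \<forall>x. \<bar>(\<Sum>k<n. g (x + real k * \<alpha>)) - real n * (\<integral>x. g x \<partial>circ)\<bar> \<le> e * real n"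
proof -
  have [measurable]: "g \<in> borel_measurable borel" by (intro borel_measurable_continuous_onI g)
  define S where "S n x = (\<Sum>k<n. g (x + real k * \<alpha>))" for n x
  obtain B where B: "B > 0" "\<And>x. \<bar>g x\<bar> \<le> B" using periodic1_bounded_uniform(1)[OF g per] by blast
  have "e/2 > 0" using e by simp
  from periodic1_bounded_uniform(2)[OF g per this]
  obtain d where d: "d > 0" "\<And>x y. \<bar>x - y\<bar> < d \<Longrightarrow> \<bar>g x - g y\<bar> < e/2" by blast
  obtain J where J: "\<And>y. \<exists>j<J. \<exists>m::int. \<bar>real j * \<alpha> - y - of_int m\<bar> < d" using rotation_dense[OF \<alpha> d(1)] by blast
  have Sdiff: "\<bar>S n x - S n y\<bar> \<le> real n * (e/2) + 2 * real J * B" for n x y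
  proof -
    obtain j m where j: "j < J" "\<bar>real j * \<alpha> - (y - x) - of_int m\<bar> < d" using J by blast
    have "\<bar>S n (x + real j * \<alpha>) - S n y\<bar> \<le> (\<Sum>k<n. \<bar>g (x + real j * \<alpha> + real k * \<alpha>) - g (y + real k * \<alpha>)\<bar>)"
      unfolding S_def sum_subtractf[symmetric] by (rule sum_abs)
    also have "\<dots> \<le> (\<Sum>k<n. e/2)"
    proof (rule sum_mono)
      fix k
      have "\<bar>(x + real j * \<alpha> + real k * \<alpha>) - (y + real k * \<alpha> + of_int m)\<bar> < d" using j(2) by (simp add: algebra_simps)
      from d(2)[OF this] show "\<bar>g (x + real j * \<alpha> + real k * \<alpha>) - g (y + real k * \<alpha>)\<bar> \<le> e/2"
        by (simp add: periodic1_add_int[OF per])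
    qed
    finally have 1: "\<bar>S n (x + real j * \<alpha>) - S n y\<bar> \<le> real n * (e/2)" by simp
    have "S n (x + real j * \<alpha>) = (\<Sum>k<n. g (x + real (j + k) * \<alpha>))" unfolding S_def by (simp add: algebra_simps)
    also have "\<dots> = (\<Sum>k<j+n. g (x + real k * \<alpha>)) - (\<Sum>k<j. g (x + real k * \<alpha>))"
      by (induction n) (auto simp: algebra_simps)
    also have "(\<Sum>k<j+n. g (x + real k * \<alpha>)) = S n x + (\<Sum>k<j. g (x + real (n + k) * \<alpha>))"
      unfolding S_def by (induction j) (auto simp: algebra_simps)
    finally have "S n (x + real j * \<alpha>) - S n x = (\<Sum>k<j. g (x + real (n + k) * \<alpha>)) - (\<Sum>k<j. g (x + real k * \<alpha>))"
      by simp
    moreover have "\<bar>\<Sum>k<j. g (x + real (n + k) * \<alpha>)\<bar> \<le> real j * B" "\<bar>\<Sum>k<j. g (x + real k * \<alpha>)\<bar> \<le> real j * B"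
      using sum_bounded_above[of "{..<j}" "\<lambda>k. \<bar>g (x + real (n + k) * \<alpha>)\<bar>" B]
        sum_bounded_above[of "{..<j}" "\<lambda>k. \<bar>g (x + real k * \<alpha>)\<bar>" B] B(2) by (auto intro: order_trans[OF sum_abs])
    moreover have "real j * B \<le> real J * B" using j(1) B(1) by simp
    ultimately show ?thesis using 1 by linarith
  qed
  have gi: "integrable circ (\<lambda>x. g (x + a))" for a by (rule circ.integrable_const_bound[where B = B]) (use B in auto)
  have Sint: "integrable circ (S n)" "(\<integral>y. S n y \<partial>circ) = real n * (\<integral>x. g x \<partial>circ)" for n
    unfolding S_def[abs_def] using gi integral_circ_shift(1)[of g] per by (auto simp: Bochner_Integration.integral_sum)
  have main: "\<bar>S n x - real n * (\<integral>x. g x \<partial>circ)\<bar> \<le> real n * (e/2) + 2 * real J * B" for n x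
  proof -
    have "S n x - real n * (\<integral>x. g x \<partial>circ) = (\<integral>y. S n x - S n y \<partial>circ)" using Sint by (simp add: circ.prob_space)
    also have "\<bar>\<dots>\<bar> \<le> (\<integral>y. \<bar>S n x - S n y\<bar> \<partial>circ)" by (rule integral_abs_bound)
    also have "\<dots> \<le> (\<integral>y. real n * (e/2) + 2 * real J * B \<partial>circ)" by (intro integral_mono Sdiff) (use Sint in auto)
    finally show ?thesis by (simp add: circ.prob_space)
  qed
  define n0 where "n0 = nat \<lceil>4 * real J * B / e\<rceil>"
  have "\<bar>S n x - real n * (\<integral>x. g x \<partial>circ)\<bar> \<le> e * real n" if "n \<ge> n0" for n x
  proof -
    have "4 * real J * B / e \<le> real n" using that unfolding n0_def by linarith
    then have "2 * real J * B \<le> real n * (e/2)" using e by (simp add: field_simps)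
    then show ?thesis using main[of n x] by (simp add: algebra_simps)
  qed
  then show ?thesis unfolding S_def by blast
qed

text \<open>Convergence in \<open>L^1\<close> instead of uniform convergence, for use with the roof:
  it is unbounded, so its Birkhoff averages cannot converge uniformly.\<close>

lemma L1_equidistribution:
  fixes g :: "real \<Rightarrow> real"
  assumes \<alpha>: "\<alpha> \<notin> \<rat>" and g: "g \<in> borel_measurable borel" "periodic1 g" "integrable circ g"
    and approx: "\<And>e. e > 0 \<Longrightarrow> \<exists>h. continuous_on UNIV h \<and> periodic1 h \<and> (\<integral>x. \<bar>g x - h x\<bar> \<partial>circ) \<le> e"
    and e: "e > 0"
  shows "\<exists>n0. \<forall>n\<ge>n0. (\<integral>x. \<bar>(\<Sum>k<n. g (x + real k * \<alpha>)) - real n * (\<integral>x. g x \<partial>circ)\<bar> \<partial>circ) \<le> e * real n"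
proof -
  have [measurable]: "g \<in> borel_measurable borel" by fact
  obtain h where h: "continuous_on UNIV h" "periodic1 h" "(\<integral>x. \<bar>g x - h x\<bar> \<partial>circ) \<le> e/3"
    using approx[of "e/3"] e by auto
  have hm [measurable]: "h \<in> borel_measurable borel" by (intro borel_measurable_continuous_onI h)
  obtain B where B: "B > 0" "\<And>x. \<bar>h x\<bar> \<le> B" using periodic1_bounded_uniform(1)[OF h(1,2)] by blast
  have hi: "integrable circ h" by (rule circ.integrable_const_bound[where B = B]) (use B in auto)
  define d where "d x = \<bar>g x - h x\<bar>" for x
  have d: "d \<in> borel_measurable borel" "periodic1 d" "integrable circ d"
    unfolding d_def[abs_def] using g h hi by (auto simp: periodic1_def)
  obtain n0 where n0: "\<And>n x. n \<ge> n0 \<Longrightarrow> \<bar>(\<Sum>k<n. h (x + real k * \<alpha>)) - real n * (\<integral>x. h x \<partial>circ)\<bar> \<le> e/3 * real n"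
    using uniform_equidistribution[OF \<alpha> h(1,2), of "e/3"] e by auto
  have "(\<integral>x. \<bar>(\<Sum>k<n. g (x + real k * \<alpha>)) - real n * (\<integral>x. g x \<partial>circ)\<bar> \<partial>circ) \<le> e * real n" if n: "n \<ge> n0" for n
  proof -
    have "\<bar>(\<integral>x. h x \<partial>circ) - (\<integral>x. g x \<partial>circ)\<bar> \<le> e/3"
    proof -
      have "\<bar>\<integral>x. g x - h x \<partial>circ\<bar> \<le> (\<integral>x. \<bar>g x - h x\<bar> \<partial>circ)" by (rule integral_abs_bound)
      then show ?thesis using h(3) g(3) hi by (simp add: abs_minus_commute)
    qed
    then have "real n * \<bar>(\<integral>x. h x \<partial>circ) - (\<integral>x. g x \<partial>circ)\<bar> \<le> real n * (e/3)" by (intro mult_left_mono) auto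
    then have m: "\<bar>real n * (\<integral>x. h x \<partial>circ) - real n * (\<integral>x. g x \<partial>circ)\<bar> \<le> e/3 * real n"
      unfolding right_diff_distrib[symmetric] abs_mult by (simp add: mult.commute)
    have gi: "integrable circ (\<lambda>x. g (x + a))" and di: "integrable circ (\<lambda>x. d (x + a))" for a
      using integral_circ_shift(2)[of g a] integral_circ_shift(2)[of d a] g d by auto
    have "(\<integral>x. \<bar>(\<Sum>k<n. g (x + real k * \<alpha>)) - real n * (\<integral>x. g x \<partial>circ)\<bar> \<partial>circ)
       \<le> (\<integral>x. (\<Sum>k<n. d (x + real k * \<alpha>)) + (e/3 * real n + e/3 * real n) \<partial>circ)"
    proof (rule integral_mono)
      fix x
      have "\<bar>(\<Sum>k<n. g (x + real k * \<alpha>)) - (\<Sum>k<n. h (x + real k * \<alpha>))\<bar> \<le> (\<Sum>k<n. d (x + real k * \<alpha>))"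
        unfolding d_def sum_subtractf[symmetric] by (rule sum_abs)
      then show "\<bar>(\<Sum>k<n. g (x + real k * \<alpha>)) - real n * (\<integral>x. g x \<partial>circ)\<bar>
        \<le> (\<Sum>k<n. d (x + real k * \<alpha>)) + (e/3 * real n + e/3 * real n)" using n0[OF n, of x] m by linarith
    qed (use gi di in auto)
    also have "\<dots> = (\<integral>x. (\<Sum>k<n. d (x + real k * \<alpha>)) \<partial>circ) + 2 * e/3 * real n" using di by (simp add: circ.prob_space)
    also have "(\<integral>x. (\<Sum>k<n. d (x + real k * \<alpha>)) \<partial>circ) = (\<Sum>k<n. \<integral>x. d (x + real k * \<alpha>) \<partial>circ)"
      by (rule Bochner_Integration.integral_sum) (use di in auto)
    also have "\<dots> = real n * (\<integral>x. d x \<partial>circ)" using integral_circ_shift(1)[OF d(1,2)] by simp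
    also have "\<dots> \<le> real n * (e/3)" unfolding d_def by (intro mult_left_mono h) auto
    finally show ?thesis by (simp add: algebra_simps)
  qed
  then show ?thesis by blast
qed

text \<open>Vitali covering: near each of its points, at scale \<open>\<rho>\<close>, the set \<open>b\<close> fills only the fraction \<open>e\<close>.\<close>

lemma porous_measure_le:
  fixes b :: "real set"
  assumes b [measurable]: "b \<in> sets borel" and sub: "b \<subseteq> {0..1}" and e: "0 < e"
    and \<rho>: "\<And>x. x \<in> b \<Longrightarrow> 0 < \<rho> x \<and> \<rho> x \<le> 1"
    and por: "\<And>x y. x \<in> b \<Longrightarrow> y \<in> b \<Longrightarrow> \<bar>y - x\<bar> \<le> \<rho> x \<Longrightarrow> \<bar>y - x\<bar> \<le> e * \<rho> x"
  shows "emeasure lborel b \<le> ennreal (15 * e)"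
proof -
  show ?thesis
  \<comment> \<open>For \<open>e > 1/5\<close> the bound exceeds the measure of the unit interval.
    Otherwise the balls of radius \<open>e * \<rho>\<close> lie in the disjoint Vitali balls of
    radius \<open>\<rho> / 5\<close>. The factor 15 is 5, from comparing these radii, times the
    length 3 of \<open>{-1..2}\<close>, which contains the Vitali balls.\<close>
  proof (cases "e \<le> 1/5")
    case False
    have "emeasure lborel b \<le> emeasure lborel {0..1::real}" by (rule emeasure_mono) (use sub in auto)
    also have "\<dots> \<le> ennreal (15 * e)" using False by simp
    finally show ?thesis .
  next
    case True
    have cov: "b \<subseteq> (\<Union>x\<in>b. cball x (\<rho> x / 5))" using \<rho> by fastforce
    have r: "0 < \<rho> x / 5 \<and> \<rho> x / 5 \<le> 1" if "x \<in> b" for x using \<rho>[OF that] by simp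
    obtain C where C: "countable C" "C \<subseteq> b"
       "pairwise (\<lambda>i j. disjnt (cball i (\<rho> i / 5)) (cball j (\<rho> j / 5))) C"
       "b \<subseteq> (\<Union>i\<in>C. cball i (5 * (\<rho> i / 5)))" using Vitali_covering_lemma_cballs[OF cov r] by blast
    have disj: "disjoint_family_on (\<lambda>i. cball i (\<rho> i / 5)) C"
      using C(3) by (auto simp: disjoint_family_on_def pairwise_def disjnt_def)
    have "cball i (e * \<rho> i) \<subseteq> cball i (\<rho> i / 5)" if "i \<in> C" for i
      using \<rho>[of i] that C(2) mult_right_mono[OF True, of "\<rho> i"] by (intro subset_cball) auto
    then have disj': "disjoint_family_on (\<lambda>i. cball i (e * \<rho> i)) C"
      using disj unfolding disjoint_family_on_def by blast
    have "emeasure lborel b \<le> emeasure lborel (\<Union>i\<in>C. cball i (e * \<rho> i))"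
    proof (rule emeasure_mono)
      show "b \<subseteq> (\<Union>i\<in>C. cball i (e * \<rho> i))"
      proof
        fix y assume y: "y \<in> b"
        then obtain i where i: "i \<in> C" "y \<in> cball i (\<rho> i)" using C(4) by auto
        then have "\<bar>y - i\<bar> \<le> e * \<rho> i" using por[of i y] C(2) y by (auto simp: dist_real_def abs_minus_commute)
        then show "y \<in> (\<Union>i\<in>C. cball i (e * \<rho> i))" using i(1) by (auto simp: dist_real_def abs_minus_commute)
      qed
      show "(\<Union>i\<in>C. cball i (e * \<rho> i)) \<in> sets lborel" using C(1) by (auto intro!: sets.countable_UN')
    qed
    also have "\<dots> = (\<integral>\<^sup>+i. emeasure lborel (cball i (e * \<rho> i)) \<partial>count_space C)"
      by (rule emeasure_UN_countable) (use C disj' in auto)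
    also have "\<dots> \<le> (\<integral>\<^sup>+i. ennreal (5 * e) * emeasure lborel (cball i (\<rho> i / 5)) \<partial>count_space C)"
    proof (rule nn_integral_mono)
      fix i assume "i \<in> space (count_space C)"
      then have i: "0 < \<rho> i" using C(2) \<rho> by auto
      have ball: "emeasure lborel (cball i r) = ennreal (2 * r)" if "r > 0" for i r :: real
        using that by (simp add: cball_eq_atLeastAtMost)
      show "emeasure lborel (cball i (e * \<rho> i)) \<le> ennreal (5 * e) * emeasure lborel (cball i (\<rho> i / 5))"
        using i e by (subst (1 2) ball) (auto simp: ennreal_mult[symmetric])
    qed
    also have "\<dots> = ennreal (5 * e) * emeasure lborel (\<Union>i\<in>C. cball i (\<rho> i / 5))"
      using C(1) disj by (subst emeasure_UN_countable) (auto simp: nn_integral_cmult)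
    also have "\<dots> \<le> ennreal (5 * e) * emeasure lborel {-1..2::real}"
    proof (intro mult_left_mono emeasure_mono subsetI)
      fix x assume "x \<in> (\<Union>i\<in>C. cball i (\<rho> i / 5))"
      then obtain i where i: "i \<in> C" "\<bar>i - x\<bar> \<le> \<rho> i / 5" by (auto simp: dist_real_def)
      moreover have "0 \<le> i" "i \<le> 1" "\<rho> i \<le> 1" using i(1) C(2) sub \<rho> by auto
      ultimately show "x \<in> {-1..2}" unfolding atLeastAtMost_iff by linarith
    qed auto
    also have "\<dots> = ennreal (15 * e)" using e by (simp add: ennreal_mult''[symmetric] flip: ennreal_numeral) 
    finally show ?thesis .
  qed
qed

section \<open>Averaging a periodic function over displacements of slowly varying size\<close>

lemma integrable_indicator_Icc: "integrable lborel (indicator {p..q} :: real \<Rightarrow> real)" for p q :: real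
  by (rule integrable_real_indicator) (auto simp: emeasure_lborel_Icc_eq)

lemma bounded_integral_Icc:
  fixes F :: "real \<Rightarrow> real"
  assumes F: "F \<in> borel_measurable borel" "\<And>s. \<bar>F s\<bar> \<le> 1"
  shows "integrable lborel (\<lambda>s. F s * indicator {p..q} s)"
    and "p \<le> q \<Longrightarrow> \<bar>\<integral>s. F s * indicator {p..q} s \<partial>lborel\<bar> \<le> q - p"
proof -
  have le: "\<bar>F s * indicator {p..q} s\<bar> \<le> indicator {p..q} s" for s using F(2)[of s] by (simp add: indicator_def)
  have [measurable]: "F \<in> borel_measurable borel" by (rule F)
  show i: "integrable lborel (\<lambda>s. F s * indicator {p..q} s)"
    by (rule Bochner_Integration.integrable_bound[OF integrable_indicator_Icc[of p q]]) (use le in auto)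
  assume "p \<le> q"
  have "\<bar>\<integral>s. F s * indicator {p..q} s \<partial>lborel\<bar> \<le> (\<integral>s. \<bar>F s * indicator {p..q} s\<bar> \<partial>lborel)" by (rule integral_abs_bound)
  also have "\<dots> \<le> (\<integral>s. indicator {p..q} s \<partial>lborel)"
    by (intro integral_mono integrable_abs i integrable_indicator_Icc le)
  finally show "\<bar>\<integral>s. F s * indicator {p..q} s \<partial>lborel\<bar> \<le> q - p" using \<open>p \<le> q\<close> by simp
qed

text \<open>For constant \<open>P\<close> this is translation invariance. In general substitute
  \<open>d = s / P x\<close> and then \<open>y = x + d\<close>: the total weight given to
  \<open>F y\<close> is the integral of \<open>P (y - d)\<close> over those \<open>d\<close> for
  which \<open>P (y - d) * d\<close> lies in \<open>{0..R}\<close>. It is about \<open>R\<close>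
  when \<open>P\<close> is nearly constant on the scale \<open>R / P y\<close>. For nonnegative
  \<open>F\<close> the points outside of \<open>G\<close> can just be dropped.\<close>

lemma slow_scale_average_nn:
  fixes P F :: "real \<Rightarrow> real"
  assumes Pm [measurable]: "P \<in> borel_measurable borel" and P: "\<And>x. P x > 0" "periodic1 P"
    and Fm [measurable]: "F \<in> borel_measurable borel" and F: "\<And>x. 0 \<le> F x" "periodic1 F"
    and R: "R > 0" and e: "0 < e" "e < 1"
    and Gm [measurable]: "G \<in> sets borel"
    and G: "\<And>y. y \<in> G \<Longrightarrow> AE d in lborel. 0 \<le> d \<and> d * P y \<le> R \<longrightarrow> \<bar>P (y - d) - P y\<bar> \<le> e * P y"
  shows "(\<integral>\<^sup>+x. ennreal ((1 - 2 * e) * R) * (indicator G x * ennreal (F x)) \<partial>circ)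
     \<le> (\<integral>\<^sup>+x. \<integral>\<^sup>+s. ennreal (F (x + s / P x)) * indicator {0..R} s \<partial>lborel \<partial>circ)"
proof -
  interpret pair_sigma_finite circ lborel by standard
  have "(\<integral>\<^sup>+x. \<integral>\<^sup>+s. ennreal (F (x + s / P x)) * indicator {0..R} s \<partial>lborel \<partial>circ)
     = (\<integral>\<^sup>+x. \<integral>\<^sup>+d. ennreal (P x) * (ennreal (F (x + d)) * indicator {0..R} (P x * d)) \<partial>lborel \<partial>circ)"
  proof (rule nn_integral_cong)
    fix x
    have "(\<integral>\<^sup>+s. ennreal (F (x + s / P x)) * indicator {0..R} s \<partial>lborel)
      = ennreal \<bar>P x\<bar> * (\<integral>\<^sup>+d. ennreal (F (x + (0 + P x * d) / P x)) * indicator {0..R} (0 + P x * d) \<partial>lborel)"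
      by (rule nn_integral_real_affine) (use P(1)[of x] in auto)
    also have "\<dots> = (\<integral>\<^sup>+d. ennreal (P x) * (ennreal (F (x + d)) * indicator {0..R} (P x * d)) \<partial>lborel)"
      using P(1)[of x] by (simp add: nn_integral_cmult)
    finally show "(\<integral>\<^sup>+s. ennreal (F (x + s / P x)) * indicator {0..R} s \<partial>lborel)
      = (\<integral>\<^sup>+d. ennreal (P x) * (ennreal (F (x + d)) * indicator {0..R} (P x * d)) \<partial>lborel)" .
  qed
  also have "\<dots> = (\<integral>\<^sup>+d. \<integral>\<^sup>+x. ennreal (P x) * (ennreal (F (x + d)) * indicator {0..R} (P x * d)) \<partial>circ \<partial>lborel)"
    by (rule Fubini'[symmetric]) (simp add: split_beta')
  also have "\<dots> = (\<integral>\<^sup>+d. \<integral>\<^sup>+y. ennreal (P (y - d)) * (ennreal (F y) * indicator {0..R} (P (y - d) * d)) \<partial>circ \<partial>lborel)"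
  proof (rule nn_integral_cong)
    fix d
    have Pp: "P (x + 1 - d) = P (x - d)" for x
      using P(2)[unfolded periodic1_def, rule_format, of "x - d"] by (simp add: algebra_simps)
    show "(\<integral>\<^sup>+x. ennreal (P x) * (ennreal (F (x + d)) * indicator {0..R} (P x * d)) \<partial>circ)
      = (\<integral>\<^sup>+y. ennreal (P (y - d)) * (ennreal (F y) * indicator {0..R} (P (y - d) * d)) \<partial>circ)"
      using nn_integral_circ_shift[of "\<lambda>y. ennreal (P (y - d)) * (ennreal (F y) * indicator {0..R} (P (y - d) * d))" d]
        F(2) by (simp add: periodic1_def Pp)
  qed
  also have "\<dots> = (\<integral>\<^sup>+y. \<integral>\<^sup>+d. ennreal (P (y - d)) * (ennreal (F y) * indicator {0..R} (P (y - d) * d)) \<partial>lborel \<partial>circ)"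
    by (rule Fubini') (simp add: split_beta')
  also have "\<dots> \<ge> (\<integral>\<^sup>+x. ennreal ((1 - 2 * e) * R) * (indicator G x * ennreal (F x)) \<partial>circ)"
  proof (rule nn_integral_mono)
    fix y
    show "ennreal ((1 - 2 * e) * R) * (indicator G y * ennreal (F y))
      \<le> (\<integral>\<^sup>+d. ennreal (P (y - d)) * (ennreal (F y) * indicator {0..R} (P (y - d) * d)) \<partial>lborel)"
    proof (cases "y \<in> G")
      case True
      define Py where "Py = P y"
      have Py: "Py > 0" using P(1) by (simp add: Py_def)
      \<comment> \<open>On this interval \<open>d * P y <= R\<close>, so that
        \<open>P (y - d)\<close> lies between \<open>(1 - e) * P y\<close> and
        \<open>(1 + e) * P y\<close>. The factor \<open>1 + e\<close> in the denominator then keeps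
        \<open>P (y - d) * d\<close> below \<open>R\<close>.\<close>
      let ?I = "{0..R / ((1 + e) * Py)}"
      have "ennreal ((1 - 2 * e) * R) \<le> ennreal ((1 - e) * Py * (R / ((1 + e) * Py)))"
      proof (rule ennreal_leI)
        have "(1 - 2 * e) * (1 + e) \<le> 1 - e" using e by (simp add: algebra_simps)
        then have "(1 - 2 * e) \<le> (1 - e) / (1 + e)" using e by (simp add: field_simps)
        moreover have "(1 - e) * Py * (R / ((1 + e) * Py)) = (1 - e) / (1 + e) * R" using Py e by simp
        ultimately show "(1 - 2 * e) * R \<le> (1 - e) * Py * (R / ((1 + e) * Py))"
          using mult_right_mono[of "1 - 2 * e" "(1 - e) / (1 + e)" R] R by simp
      qed
      also have "\<dots> = ennreal ((1 - e) * Py) * emeasure lborel ?I"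
      proof -
        have "0 \<le> R / ((1 + e) * Py)" using e R Py by simp
        then show ?thesis by (simp only: emeasure_lborel_Icc diff_zero) (rule ennreal_mult'')
      qed
      also have "\<dots> = (\<integral>\<^sup>+d. ennreal ((1 - e) * Py) * indicator ?I d \<partial>lborel)" by (simp add: nn_integral_cmult)
      also have "\<dots> \<le> (\<integral>\<^sup>+d. ennreal (P (y - d)) * indicator {0..R} (P (y - d) * d) \<partial>lborel)"
      proof (rule nn_integral_mono_AE)
        show "AE d in lborel. ennreal ((1 - e) * Py) * indicator ?I d \<le> ennreal (P (y - d)) * indicator {0..R} (P (y - d) * d)"
          using G[OF True]
        proof eventually_elim
          case (elim d)
          show ?case
          proof (cases "d \<in> ?I")
            case True
            then have d: "0 \<le> d" "d * ((1 + e) * Py) \<le> R" using e Py by (auto simp: pos_le_divide_eq)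
            have "d * Py \<le> d * ((1 + e) * Py)" using d(1) e Py by (intro mult_left_mono) (auto simp: algebra_simps)
            then have "d * P y \<le> R" using d(2) by (simp add: Py_def)
            then have p: "\<bar>P (y - d) - Py\<bar> \<le> e * Py" using elim d(1) by (simp add: Py_def)
            then have p': "(1 - e) * Py \<le> P (y - d)" "P (y - d) \<le> (1 + e) * Py" by (auto simp: algebra_simps abs_le_iff)
            have "P (y - d) * d \<le> (1 + e) * Py * d" using p'(2) d(1) by (rule mult_right_mono)
            then have "P (y - d) * d \<le> R" using d(2) by (simp add: mult.commute)
            moreover have "0 \<le> P (y - d) * d" using P(1)[of "y - d"] d(1) by simp
            ultimately show ?thesis using True p'(1) by (simp add: ennreal_leI)
          qed simp
        qed
      qed
      finally have "ennreal ((1 - 2 * e) * R) * ennreal (F y)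
        \<le> (\<integral>\<^sup>+d. ennreal (P (y - d)) * indicator {0..R} (P (y - d) * d) \<partial>lborel) * ennreal (F y)"
        by (rule mult_right_mono) simp
      also have "\<dots> = (\<integral>\<^sup>+d. ennreal (P (y - d)) * indicator {0..R} (P (y - d) * d) * ennreal (F y) \<partial>lborel)"
        by (rule nn_integral_multc[symmetric]) measurable
      finally show ?thesis using True by (simp add: mult_ac)
    qed simp
  qed
  finally show ?thesis .
qed

text \<open>The one-sided estimate is used for the nonnegative functions \<open>1 + F\<close> and
  \<open>1 - F\<close>. These are at most 2, which turns \<open>2 * e\<close> into
  \<open>4 * e\<close> and explains the 2 in front of the measure.\<close>

lemma slow_scale_average:
  fixes P F :: "real \<Rightarrow> real"
  assumes Pm [measurable]: "P \<in> borel_measurable borel" and P: "\<And>x. P x > 0" "periodic1 P"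
    and Fm [measurable]: "F \<in> borel_measurable borel" and F: "\<And>x. \<bar>F x\<bar> \<le> 1" "periodic1 F"
    and R: "R > 0" and e: "0 < e" "e < 1"
    and Gm [measurable]: "G \<in> sets borel"
    and G: "\<And>y. y \<in> G \<Longrightarrow> AE d in lborel. 0 \<le> d \<and> d * P y \<le> R \<longrightarrow> \<bar>P (y - d) - P y\<bar> \<le> e * P y"
  shows "\<bar>(\<integral>x. F x \<partial>circ) - (\<integral>x. (\<integral>s. F (x + s / P x) * indicator {0..R} s \<partial>lborel) / R \<partial>circ)\<bar>
     \<le> 4 * e + 2 * measure circ (- G)"
proof -
  define I where "I x = (\<integral>s. F (x + s / P x) * indicator {0..R} s \<partial>lborel)" for x
  have Fi: "integrable circ F" by (rule circ.integrable_const_bound[where B = 1]) (use F in auto)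
  have ri: "integrable lborel (indicat_real {0..R})" by (rule integrable_indicator_Icc)
  have si: "integrable lborel (\<lambda>s. F (x + s / P x) * indicator {0..R} s)" for x
    by (rule bounded_integral_Icc) (use F in auto)
  have Ib: "\<bar>I x\<bar> \<le> R" for x unfolding I_def using bounded_integral_Icc(2)[of "\<lambda>s. F (x + s / P x)" 0 R] F R by simp
  have Im [measurable]: "I \<in> borel_measurable borel" unfolding I_def by measurable
  have Ii: "integrable circ I" by (rule circ.integrable_const_bound[where B = R]) (use Ib in auto)
  have one_sided: "(\<integral>x. \<sigma> * F x \<partial>circ) - (\<integral>x. \<sigma> * I x / R \<partial>circ) \<le> 4 * e + 2 * measure circ (- G)"
    if \<sigma>: "\<sigma> = 1 \<or> \<sigma> = - 1" for \<sigma> :: real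
  proof -
    define F1 where "F1 x = 1 + \<sigma> * F x" for x
    have [measurable]: "F1 \<in> borel_measurable borel" by (simp add: F1_def[abs_def])
    have F1: "0 \<le> F1 x" "F1 x \<le> 2" for x using F(1)[of x] \<sigma> by (auto simp: F1_def)
    have F1p: "periodic1 F1" using F(2) by (simp add: F1_def periodic1_def)
    have F1i: "integrable circ F1" unfolding F1_def[abs_def] using Fi by simp
    have I1: "(\<integral>\<^sup>+s. ennreal (F1 (x + s / P x)) * indicator {0..R} s \<partial>lborel) = ennreal (R + \<sigma> * I x)" for x
    proof -
      have "(\<integral>\<^sup>+s. ennreal (F1 (x + s / P x)) * indicator {0..R} s \<partial>lborel)
         = (\<integral>\<^sup>+s. ennreal (indicator {0..R} s + \<sigma> * (F (x + s / P x) * indicator {0..R} s)) \<partial>lborel)"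
        by (rule nn_integral_cong) (auto simp: F1_def split: split_indicator)
      also have "\<dots> = ennreal (\<integral>s. indicator {0..R} s + \<sigma> * (F (x + s / P x) * indicator {0..R} s) \<partial>lborel)"
        by (rule nn_integral_eq_integral)
           (use si ri F1 in \<open>auto simp: F1_def split: split_indicator\<close>)
      also have "(\<integral>s. indicator {0..R} s + \<sigma> * (F (x + s / P x) * indicator {0..R} s) \<partial>lborel) = R + \<sigma> * I x"
        using si ri R by (simp add: I_def)
      finally show ?thesis .
    qed
    have "ennreal (\<integral>x. (1 - 2 * e) * R * (indicator G x * F1 x) \<partial>circ)
       \<le> (\<integral>\<^sup>+x. ennreal ((1 - 2 * e) * R * (indicator G x * F1 x)) \<partial>circ)"
    \<comment> \<open>For \<open>e > 1/2\<close> the factor \<open>1 - 2 * e\<close> is negative and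
      the left-hand side is at most 0.\<close>
    proof (cases "e \<le> 1/2")
      case True
      have "integrable circ (\<lambda>x. (1 - 2 * e) * R * (indicator G x * F1 x))"
        by (rule circ.integrable_const_bound[where B = "\<bar>(1 - 2 * e) * R\<bar> * 2"])
           (use F1 in \<open>auto simp: abs_mult split: split_indicator intro!: mult_left_mono\<close>)
      then show ?thesis using True R F1 by (subst nn_integral_eq_integral) auto
    next
      case False
      have "(\<integral>x. (1 - 2 * e) * R * (indicator G x * F1 x) \<partial>circ) = (1 - 2 * e) * R * (\<integral>x. indicator G x * F1 x \<partial>circ)"
        by (simp add: mult.assoc)
      also have "\<dots> \<le> 0"
        by (intro mult_nonpos_nonneg Bochner_Integration.integral_nonneg) (use False R F1 in \<open>auto simp: mult_nonpos_nonneg\<close>)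
      finally show ?thesis by (simp add: ennreal_neg)
    qed
    also have "\<dots> \<le> (\<integral>\<^sup>+x. ennreal ((1 - 2 * e) * R) * (indicator G x * ennreal (F1 x)) \<partial>circ)"
    proof (rule nn_integral_mono)
      fix x
      show "ennreal ((1 - 2 * e) * R * (indicator G x * F1 x)) \<le> ennreal ((1 - 2 * e) * R) * (indicator G x * ennreal (F1 x))"
        using F1[of x] by (auto simp: ennreal_mult'' split: split_indicator)
    qed
    also have "\<dots> \<le> (\<integral>\<^sup>+x. \<integral>\<^sup>+s. ennreal (F1 (x + s / P x)) * indicator {0..R} s \<partial>lborel \<partial>circ)"
      by (rule slow_scale_average_nn) (use P F1 F1p R e G in auto)
    also have "\<dots> = (\<integral>\<^sup>+x. ennreal (R + \<sigma> * I x) \<partial>circ)" by (simp add: I1)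
    also have "\<dots> = ennreal (\<integral>x. R + \<sigma> * I x \<partial>circ)"
    proof (rule nn_integral_eq_integral)
      show "AE x in circ. 0 \<le> R + \<sigma> * I x"
      proof (rule AE_I2)
        fix x show "0 \<le> R + \<sigma> * I x" using Ib[of x] \<sigma> by auto
      qed
    qed (use Ii in auto)
    finally have le: "(\<integral>x. (1 - 2 * e) * R * (indicator G x * F1 x) \<partial>circ) \<le> (\<integral>x. R + \<sigma> * I x \<partial>circ)"
    proof (subst (asm) ennreal_le_iff)
      show "0 \<le> (\<integral>x. R + \<sigma> * I x \<partial>circ)"
      proof (rule Bochner_Integration.integral_nonneg)
        fix x show "0 \<le> R + \<sigma> * I x" using Ib[of x] \<sigma> by auto
      qed
    qed
    have iG: "integrable circ (\<lambda>x. indicator (- G) x :: real)" by (simp add: less_top[symmetric] circ.emeasure_finite)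
    have "(\<integral>x. F1 x \<partial>circ) - (4 * e + 2 * measure circ (- G)) = (\<integral>x. F1 x - (4 * e + 2 * indicator (- G) x) \<partial>circ)"
      using F1i iG by simp
    also have "\<dots> \<le> (\<integral>x. (1 - 2 * e) * (indicator G x * F1 x) \<partial>circ)"
    proof (rule integral_mono)
      show "integrable circ (\<lambda>x. (1 - 2 * e) * (indicator G x * F1 x))"
        by (rule circ.integrable_const_bound[where B = "\<bar>1 - 2 * e\<bar> * 2"])
           (use F1 in \<open>auto simp: abs_mult split: split_indicator intro!: mult_left_mono\<close>)
      fix x
      have "2 * e * F1 x \<le> 2 * e * 2" using F1[of x] e by (intro mult_left_mono) auto
      then show "F1 x - (4 * e + 2 * indicator (- G) x) \<le> (1 - 2 * e) * (indicator G x * F1 x)"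
        using F1[of x] e by (auto simp: algebra_simps split: split_indicator)
    qed (use F1i iG in auto)
    also have "\<dots> = (\<integral>x. (1 - 2 * e) * R * (indicator G x * F1 x) \<partial>circ) / R" using R by (simp add: mult.assoc)
    also have "\<dots> \<le> (\<integral>x. R + \<sigma> * I x \<partial>circ) / R" by (rule divide_right_mono[OF le]) (use R in simp)
    also have "\<dots> = 1 + (\<integral>x. \<sigma> * I x / R \<partial>circ)" using Ii R by (simp add: add_divide_distrib)
    finally show ?thesis using Fi by (simp add: F1_def)
  qed
  from one_sided[of 1] one_sided[of "-1"] show ?thesis
    unfolding I_def[symmetric] using Ii Fi by (auto simp: abs_le_iff)
qed

subsection \<open>Roof functions with a power singularity\<close>

definition int_dist :: "real \<Rightarrow> real" where
  "int_dist x = \<bar>x - of_int (round x)\<bar>"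

lemma int_dist_le: "int_dist x \<le> \<bar>x - of_int m\<bar>"
  unfolding int_dist_def by (rule round_diff_minimal)

lemma int_dist_nonneg [simp]: "0 \<le> int_dist x"
  by (simp add: int_dist_def)

lemma int_dist_le_half: "int_dist x \<le> 1/2"
  using of_int_round_abs_le[of x] by (simp add: int_dist_def abs_minus_commute)

lemma int_dist_lipschitz: "\<bar>int_dist x - int_dist y\<bar> \<le> \<bar>x - y\<bar>"
proof -
  have "int_dist x \<le> \<bar>x - y\<bar> + int_dist y" for x y
    using int_dist_le[of x "round y"] unfolding int_dist_def[of y] by linarith
  from this[of x y] this[of y x] show ?thesis by linarith
qed

lemma int_dist_add_int [simp]: "int_dist (x + of_int m) = int_dist x"
proof -
  have "int_dist (x + of_int m) \<le> int_dist x" for x m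
    using int_dist_le[of "x + of_int m" "round x + m"] by (simp add: int_dist_def)
  from this[of x m] this[of "x + of_int m" "-m"] show ?thesis by simp
qed

lemma int_dist_pos_iff: "0 < int_dist x \<longleftrightarrow> x \<notin> \<int>"
proof
  assume "0 < int_dist x"
  then show "x \<notin> \<int>" by (auto simp: int_dist_def elim!: Ints_cases)
next
  assume "x \<notin> \<int>"
  then have "x \<noteq> of_int (round x)" by (metis Ints_of_int)
  then show "0 < int_dist x" by (simp add: int_dist_def)
qed

lemma int_dist_small:
  assumes "\<bar>x\<bar> \<le> 1/2" shows "int_dist x = \<bar>x\<bar>"
proof (rule antisym)
  show "int_dist x \<le> \<bar>x\<bar>" using int_dist_le[of x 0] by simp
  show "\<bar>x\<bar> \<le> int_dist x"
  proof (cases "round x = 0")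
    case False
    then have "1 \<le> \<bar>real_of_int (round x)\<bar>" by linarith
    then show ?thesis using assms unfolding int_dist_def by linarith
  qed (simp add: int_dist_def)
qed

lemma int_dist_continuous: "continuous_on UNIV int_dist"
proof (rule continuous_onI)
  fix x e :: real assume e: "e > 0"
  have "dist (int_dist y) (int_dist x) \<le> e" if "dist y x < e" for y
    using int_dist_lipschitz[of y x] that unfolding dist_real_def by linarith
  then show "\<exists>d>0. \<forall>x'\<in>UNIV. dist x' x < d \<longrightarrow> dist (int_dist x') (int_dist x) \<le> e" using e by blast
qed

lemma int_dist_measurable [measurable]: "int_dist \<in> borel_measurable borel"
  by (rule borel_measurable_continuous_onI[OF int_dist_continuous])

lemma ex_signed_representative:
  "\<exists>m::int. x = of_int m + int_dist x \<or> x = of_int m - int_dist x"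
  by (intro exI[of _ "round x"]) (auto simp: int_dist_def)

text \<open>Subtract \<open>k * x powr (-\<gamma>)\<close>, where
  \<open>k = a / (\<gamma> * (1 + \<gamma>))\<close> makes its second derivative equal to
  \<open>a * x powr (-2-\<gamma>)\<close>. The rest is convex and lies above its tangent at
  \<open>\<rho>/2\<close>, which is bounded on the interval.\<close>

lemma ge_power_singularity:
  fixes f f' f'' :: "real \<Rightarrow> real"
  assumes \<gamma>: "0 < \<gamma>" and \<rho>: "0 < \<rho>"
    and f': "\<And>x. 0 < x \<Longrightarrow> x < \<rho> \<Longrightarrow> (f has_field_derivative f' x) (at x)"
    and f'': "\<And>x. 0 < x \<Longrightarrow> x < \<rho> \<Longrightarrow> (f' has_field_derivative f'' x) (at x)"
    and ge: "\<And>x. 0 < x \<Longrightarrow> x < \<rho> \<Longrightarrow> f'' x \<ge> a * x powr (-2-\<gamma>)"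
  shows "\<exists>b. \<forall>x. 0 < x \<and> x < \<rho> \<longrightarrow> f x \<ge> a / (\<gamma> * (1 + \<gamma>)) * x powr (-\<gamma>) - b"
proof -
  define k where "k = a / (\<gamma> * (1 + \<gamma>))"
  define g where "g x = f x - k * x powr (-\<gamma>)" for x
  define g' where "g' x = f' x + k * \<gamma> * x powr (-\<gamma>-1)" for x
  define g'' where "g'' x = f'' x - a * x powr (-2-\<gamma>)" for x
  have "k * (\<gamma> * (1 + \<gamma>)) = a" using \<gamma> by (simp add: k_def)
  then have k: "k * \<gamma> * (\<gamma> + 1) = a" by (simp add: algebra_simps)
  have g': "(g has_field_derivative g' x) (at x)" if "x \<in> {0<..<\<rho>}" for x unfolding g_def[abs_def] g'_def using that
    by (auto intro!: derivative_eq_intros f')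
  have g'': "(g' has_field_derivative g'' x) (at x)" if "x \<in> {0<..<\<rho>}" for x
  proof -
    have e: "-\<gamma>-1-1 = -2-\<gamma>" by simp
    have "(g' has_field_derivative f'' x + k * \<gamma> * ((-\<gamma>-1) * x powr (-\<gamma>-1-1))) (at x)"
      unfolding g'_def[abs_def] using that by (auto intro!: derivative_eq_intros f'')
    moreover have "f'' x + k * \<gamma> * ((-\<gamma>-1) * x powr (-\<gamma>-1-1)) = g'' x"
    proof -
      have "k * \<gamma> * ((-\<gamma>-1) * x powr (-\<gamma>-1-1)) = - (k * \<gamma> * (\<gamma> + 1)) * x powr (-2-\<gamma>)"
        unfolding e by (simp add: algebra_simps)
      then show ?thesis unfolding k g''_def by simp
    qed
    ultimately show ?thesis by simp
  qed
  have cvx: "convex_on {0<..<\<rho>} g" by (rule f''_ge0_imp_convex[OF _ g' g'']) (use ge in \<open>auto simp: g''_def\<close>)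
  define y where "y = \<rho>/2"
  have y: "y \<in> {0<..<\<rho>}" using \<rho> by (simp add: y_def)
  have "f x \<ge> k * x powr (-\<gamma>) - (\<bar>g y\<bar> + \<bar>g' y\<bar> * \<rho>)" if x: "0 < x" "x < \<rho>" for x
  proof -
    have "g x - g y \<ge> g' y * (x - y)"
      by (rule convex_on_imp_above_tangent[OF cvx]) (use x y g'[OF y] in \<open>auto intro: has_field_derivative_at_within\<close>)
    moreover have "\<bar>g' y * (x - y)\<bar> \<le> \<bar>g' y\<bar> * \<rho>" unfolding abs_mult using x y by (intro mult_left_mono) auto
    ultimately have "g x \<ge> - (\<bar>g y\<bar> + \<bar>g' y\<bar> * \<rho>)" by linarith
    then show ?thesis by (simp add: g_def)
  qed
  then show ?thesis unfolding k_def by blast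
qed

lemma powr_neg_at_zero:
  assumes "0 < \<gamma>" "0 < (k::real)"
  shows "\<exists>\<delta>>0. \<forall>x. 0 < x \<and> x < \<delta> \<longrightarrow> k * x powr (-\<gamma>) > B"
proof -
  have "filterlim (\<lambda>x. k * x powr (-\<gamma>)) at_top (at_right 0)" using assms by real_asymp
  then have "eventually (\<lambda>x. k * x powr (-\<gamma>) > B) (at_right 0)" by (simp add: filterlim_at_top_dense)
  then show ?thesis by (auto simp: eventually_at_right_field)
qed

text \<open>Both one-sided limits are given by the single constant \<open>N\<close>; its sign is
  derived in \<open>N_pos\<close>.\<close>

locale power_roof =
  fixes \<alpha> \<gamma> N :: real and \<Phi> :: "real \<Rightarrow> real"
  assumes irrational: "\<alpha> \<notin> \<rat>"
    and gamma: "0 < \<gamma>" "\<gamma> < 1"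
    and roof_periodic: "\<And>x. x \<notin> \<int> \<Longrightarrow> \<Phi> (x + 1) = \<Phi> x"
    and roof_C2: "C2_on (- \<int>) \<Phi>"
    and roof_pos: "\<And>x. x \<notin> \<int> \<Longrightarrow> \<Phi> x > 0"
    and roof_mean: "(LINT x:{0<..<1}|lborel. \<Phi> x) = 1"
    and right: "((\<lambda>x. deriv (deriv \<Phi>) x / \<bar>x\<bar> powr (- 2 - \<gamma>)) \<longlongrightarrow> N) (at_right 0)"
    and left: "((\<lambda>x. deriv (deriv \<Phi>) x / \<bar>x\<bar> powr (- 2 - \<gamma>)) \<longlongrightarrow> N) (at_left 0)"
    and N_nonzero: "N \<noteq> 0"
begin

abbreviation D2 :: "real \<Rightarrow> real" where "D2 \<equiv> deriv (deriv \<Phi>)"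

text \<open>The singular part of the second derivative without its constant, made periodic. In
  contrast to the second derivative it is nonnegative everywhere (0 at integers, by the convention
  for \<open>powr\<close>), so its Birkhoff sums increase with the number of terms.\<close>

definition sing :: "real \<Rightarrow> real" where
  "sing x = int_dist x powr (-2-\<gamma>)"

lemma open_nonint: "open (- \<int> :: real set)"
  using closed_Ints by blast

lemma roof_deriv:
  assumes "x \<notin> \<int>"
  shows "(\<Phi> has_field_derivative deriv \<Phi> x) (at x)"
    and "(deriv \<Phi> has_field_derivative D2 x) (at x)"
  using roof_C2 assms by (auto simp: C2_on_def field_differentiable_derivI)

lemma nonint_add_int: "x + of_int m \<notin> \<int> \<longleftrightarrow> x \<notin> \<int>"
  by (metis Ints_add Ints_diff Ints_of_int add_diff_cancel_right')

lemma deriv_periodic: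
  fixes f :: "real \<Rightarrow> real"
  assumes per: "\<And>x. x \<notin> \<int> \<Longrightarrow> f (x + 1) = f x"
    and d: "\<And>x. x \<notin> \<int> \<Longrightarrow> (f has_field_derivative f' x) (at x)" and x: "x \<notin> \<int>"
  shows "f' (x + 1) = f' x"
proof -
  have x1: "x + 1 \<notin> \<int>" using nonint_add_int[of x 1] x by simp
  have "((\<lambda>x. f (x + 1)) has_field_derivative f' (x + 1)) (at x)" using d[OF x1] by (simp add: DERIV_shift)
  then have "(f has_field_derivative f' (x + 1)) (at x)"
    by (rule has_field_derivative_transform_within_open[OF _ open_nonint]) (use x per in auto)
  then show ?thesis using d[OF x] DERIV_unique by blast
qed

lemma periodic_off_int:
  fixes f :: "real \<Rightarrow> real"
  assumes per: "\<And>x. x \<notin> \<int> \<Longrightarrow> f (x + 1) = f x" and x: "x \<notin> \<int>"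
  shows "f (x + of_int m) = f x"
proof -
  have "periodic1 (\<lambda>x. if x \<in> \<int> then 0 else f x)" using per nonint_add_int[of _ 1] by (auto simp: periodic1_def)
  from periodic1_add_int[OF this, of x m] show ?thesis using x nonint_add_int[of x m] by simp
qed

lemma roof_add_int:
  assumes "x \<notin> \<int>"
  shows "\<Phi> (x + of_int m) = \<Phi> x" "deriv \<Phi> (x + of_int m) = deriv \<Phi> x"
    "D2 (x + of_int m) = D2 x"
proof -
  have p2: "deriv \<Phi> (x + 1) = deriv \<Phi> x" if "x \<notin> \<int>" for x
    by (rule deriv_periodic[where f = \<Phi>]) (use roof_periodic roof_deriv that in auto)
  have p3: "D2 (x + 1) = D2 x" if "x \<notin> \<int>" for x
    by (rule deriv_periodic[where f = "deriv \<Phi>"]) (use p2 roof_deriv that in auto)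
  show "\<Phi> (x + of_int m) = \<Phi> x" by (rule periodic_off_int[where f = \<Phi>]) (use roof_periodic assms in auto)
  show "deriv \<Phi> (x + of_int m) = deriv \<Phi> x" by (rule periodic_off_int[where f = "deriv \<Phi>"]) (use p2 assms in auto)
  show "D2 (x + of_int m) = D2 x"
    by (rule periodic_off_int[where f = D2]) (use p3 assms in auto)
qed

lemma roof_continuous: "continuous_on (- \<int>) \<Phi>" "continuous_on (- \<int>) (deriv \<Phi>)" "continuous_on (- \<int>) D2"
  using roof_deriv roof_C2 by (auto simp: C2_on_def intro!: continuous_at_imp_continuous_on DERIV_isCont)

lemma roof_measurable [measurable]:
  "\<Phi> \<in> borel_measurable borel" "deriv \<Phi> \<in> borel_measurable borel" "D2 \<in> borel_measurable borel"
  using roof_continuous countable_int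
  by (auto intro!: borel_measurable_continuous_countable_exceptions[of "\<int>"] simp: Ints_def)

text \<open>The sign \<open>s\<close> allows the two sides of the singularity to be treated by the
  same argument.\<close>

lemma signed_bounds:
  assumes s: "s = 1 \<or> s = (-1::real)"
  shows "\<exists>\<rho>>0. \<forall>x. 0 < x \<and> x < \<rho> \<longrightarrow> \<bar>D2 (s * x) - N * x powr (-2-\<gamma>)\<bar> \<le> \<bar>N\<bar> / 2 * x powr (-2-\<gamma>)"
proof -
  have "((\<lambda>x. D2 (s * x) / x powr (-2-\<gamma>)) \<longlongrightarrow> N) (at_right 0)"
  proof (cases "s = 1")
    case True
    show ?thesis using right True
      by (rule_tac Lim_transform_eventually[OF right]) (auto simp: eventually_at_right_field intro!: exI[of _ 1])
  next
    case False
    have "((\<lambda>x. D2 (- x) / \<bar>- x\<bar> powr (- 2 - \<gamma>)) \<longlongrightarrow> N) (at_right 0)"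
      using left by (simp add: filterlim_at_left_to_right)
    then show ?thesis using False s
      by (rule_tac Lim_transform_eventually) (auto simp: eventually_at_right_field intro!: exI[of _ 1])
  qed
  from tendstoD[OF this, of "\<bar>N\<bar>/2"] N_nonzero
  have "eventually (\<lambda>x. dist (D2 (s * x) / x powr (-2-\<gamma>)) N < \<bar>N\<bar>/2) (at_right 0)" by simp
  then obtain \<rho> where \<rho>: "\<rho> > 0" "\<And>x. 0 < x \<Longrightarrow> x < \<rho> \<Longrightarrow> \<bar>D2 (s * x) / x powr (-2-\<gamma>) - N\<bar> < \<bar>N\<bar>/2"
    by (auto simp: eventually_at_right_field dist_real_def)
  have "\<bar>D2 (s * x) - N * x powr (-2-\<gamma>)\<bar> \<le> \<bar>N\<bar> / 2 * x powr (-2-\<gamma>)" if x: "0 < x" "x < \<rho>" for x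
  proof -
    let ?p = "x powr (-2-\<gamma>)"
    have p: "?p > 0" using x by simp
    have "\<bar>D2 (s * x) - N * ?p\<bar> = \<bar>(D2 (s * x) / ?p - N) * ?p\<bar>"
      using x by (simp add: left_diff_distrib)
    also have "\<dots> = \<bar>D2 (s * x) / ?p - N\<bar> * ?p" using p by (simp add: abs_mult)
    also have "\<dots> \<le> \<bar>N\<bar>/2 * ?p" by (intro mult_right_mono less_imp_le[OF \<rho>(2)] x) auto
    finally show ?thesis .
  qed
  then show ?thesis using \<rho>(1) by blast
qed

lemma near_bounds:
  "\<exists>\<rho>>0. \<rho> < 1/2 \<and> (\<forall>s x. (s = 1 \<or> s = (-1::real)) \<and> 0 < x \<and> x < \<rho>
     \<longrightarrow> \<bar>D2 (s * x) - N * x powr (-2-\<gamma>)\<bar> \<le> \<bar>N\<bar> / 2 * x powr (-2-\<gamma>))"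
proof -
  obtain \<rho>1 where 1: "\<rho>1 > 0" "\<And>x. 0 < x \<Longrightarrow> x < \<rho>1 \<Longrightarrow> \<bar>D2 (1 * x) - N * x powr (-2-\<gamma>)\<bar> \<le> \<bar>N\<bar> / 2 * x powr (-2-\<gamma>)"
    using signed_bounds[of 1] by auto
  obtain \<rho>2 where 2: "\<rho>2 > 0" "\<And>x. 0 < x \<Longrightarrow> x < \<rho>2 \<Longrightarrow> \<bar>D2 (-1 * x) - N * x powr (-2-\<gamma>)\<bar> \<le> \<bar>N\<bar> / 2 * x powr (-2-\<gamma>)"
    using signed_bounds[of "-1"] by auto
  show ?thesis by (rule exI[of _ "min (min \<rho>1 \<rho>2) (1/4)"]) (use 1 2 in auto)
qed

lemma signed_nonint: "s = 1 \<or> s = (-1::real) \<Longrightarrow> 0 < x \<Longrightarrow> x < 1/2 \<Longrightarrow> s * x \<notin> \<int>"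
  using int_dist_pos_iff[of "s * x"] int_dist_small[of "s * x"] by auto

lemma signed_ge_power:
  assumes s: "s = 1 \<or> s = (-1::real)" and \<sigma>: "\<sigma> = 1 \<or> \<sigma> = (-1::real)"
    and \<rho>: "0 < \<rho>" "\<rho> < 1/2"
    and ge: "\<And>x. 0 < x \<Longrightarrow> x < \<rho> \<Longrightarrow> \<sigma> * D2 (s * x) \<ge> a * x powr (-2-\<gamma>)"
  shows "\<exists>b. \<forall>x. 0 < x \<and> x < \<rho> \<longrightarrow> \<sigma> * \<Phi> (s * x) \<ge> a / (\<gamma> * (1 + \<gamma>)) * x powr (-\<gamma>) - b"
proof (rule ge_power_singularity[where f' = "\<lambda>x. \<sigma> * (s * deriv \<Phi> (s * x))" and f'' = "\<lambda>x. \<sigma> * D2 (s * x)"])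
  fix x assume x: "0 < x" "x < \<rho>"
  then have sx: "s * x \<notin> \<int>" using signed_nonint[OF s] \<rho> by auto
  have c1: "((\<lambda>x. \<Phi> (s * x)) has_field_derivative deriv \<Phi> (s * x) * s) (at x)"
    by (rule DERIV_chain'[where f = "\<lambda>x. s * x" and g = \<Phi>])
       (use roof_deriv(1)[OF sx] in \<open>auto intro!: derivative_eq_intros\<close>)
  have c2: "((\<lambda>x. deriv \<Phi> (s * x)) has_field_derivative D2 (s * x) * s) (at x)"
    by (rule DERIV_chain'[where f = "\<lambda>x. s * x" and g = "deriv \<Phi>"])
       (use roof_deriv(2)[OF sx] in \<open>auto intro!: derivative_eq_intros\<close>)
  show "((\<lambda>x. \<sigma> * \<Phi> (s * x)) has_field_derivative \<sigma> * (s * deriv \<Phi> (s * x))) (at x)"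
    using DERIV_cmult[OF c1, of \<sigma>] by (simp add: mult_ac)
  show "((\<lambda>x. \<sigma> * (s * deriv \<Phi> (s * x))) has_field_derivative \<sigma> * D2 (s * x)) (at x)"
  proof -
    have eq: "s * (D2 (s * x) * s) = D2 (s * x)" using s by auto
    show ?thesis using DERIV_cmult[OF DERIV_cmult[OF c2, of s], of \<sigma>] unfolding eq .
  qed
qed (use gamma \<rho> ge in auto)

text \<open>For \<open>N < 0\<close> integrating twice would give \<open>- \<Phi> x\<close> at least
  a positive multiple of \<open>x powr (-\<gamma>)\<close> minus a constant, against
  \<open>\<Phi> > 0\<close>.\<close>

lemma N_pos: "N > 0"
proof (rule ccontr)
  assume "\<not> N > 0"
  then have N: "N < 0" using N_nonzero by simp
  obtain \<rho> where \<rho>: "\<rho> > 0" "\<rho> < 1/2" "\<And>x. 0 < x \<Longrightarrow> x < \<rho> \<Longrightarrow>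
      \<bar>D2 (1 * x) - N * x powr (-2-\<gamma>)\<bar> \<le> \<bar>N\<bar> / 2 * x powr (-2-\<gamma>)" using near_bounds by blast
  have "\<exists>b. \<forall>x. 0 < x \<and> x < \<rho> \<longrightarrow> -1 * \<Phi> (1 * x) \<ge> (-N/2) / (\<gamma> * (1 + \<gamma>)) * x powr (-\<gamma>) - b"
  proof (rule signed_ge_power)
    fix x assume "0 < x" "x < \<rho>"
    then show "(-N/2) * x powr (-2-\<gamma>) \<le> -1 * D2 (1 * x)" using \<rho>(3)[of x] N by (simp add: abs_le_iff)
  qed (use \<rho> in auto)
  then obtain b where b: "\<And>x. 0 < x \<Longrightarrow> x < \<rho> \<Longrightarrow> - \<Phi> x \<ge> (-N/2) / (\<gamma> * (1 + \<gamma>)) * x powr (-\<gamma>) - b" by auto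
  have "(-N/2) / (\<gamma> * (1 + \<gamma>)) > 0" using N gamma by (intro divide_pos_pos mult_pos_pos) auto
  from powr_neg_at_zero[OF gamma(1) this, of b]
  obtain \<delta> where \<delta>: "\<delta> > 0" "\<And>x. 0 < x \<Longrightarrow> x < \<delta> \<Longrightarrow> (-N/2) / (\<gamma> * (1 + \<gamma>)) * x powr (-\<gamma>) > b" by blast
  define x where "x = min \<delta> \<rho> / 2"
  have x: "0 < x" "x < \<delta>" "x < \<rho>" using \<delta> \<rho> by (auto simp: x_def)
  have "\<Phi> x > 0" using roof_pos signed_nonint[of 1 x] x \<rho> by auto
  then show False using b[of x] \<delta>(2)[of x] x by auto
qed

lemma roof_blowup: "\<exists>\<delta>>0. \<forall>x. x \<notin> \<int> \<and> int_dist x < \<delta> \<longrightarrow> \<Phi> x \<ge> B"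
proof -
  obtain \<rho> where \<rho>: "\<rho> > 0" "\<rho> < 1/2" "\<And>s x. s = 1 \<or> s = (-1::real) \<Longrightarrow> 0 < x \<Longrightarrow> x < \<rho> \<Longrightarrow>
      \<bar>D2 (s * x) - N * x powr (-2-\<gamma>)\<bar> \<le> \<bar>N\<bar> / 2 * x powr (-2-\<gamma>)" using near_bounds by blast
  have "\<exists>\<delta>>0. \<forall>x. 0 < x \<and> x < \<delta> \<longrightarrow> \<Phi> (s * x) \<ge> B" if s: "s = 1 \<or> s = (-1::real)" for s
  proof -
    have "\<exists>b. \<forall>x. 0 < x \<and> x < \<rho> \<longrightarrow> 1 * \<Phi> (s * x) \<ge> (N/2) / (\<gamma> * (1 + \<gamma>)) * x powr (-\<gamma>) - b"
    proof (rule signed_ge_power[OF s])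
      fix x assume "0 < x" "x < \<rho>"
      then have "\<bar>D2 (s * x) - N * x powr (-2-\<gamma>)\<bar> \<le> (N * x powr (-2-\<gamma>)) / 2"
        using \<rho>(3)[of s x] N_pos s by simp
      then have "(N * x powr (-2-\<gamma>)) / 2 \<le> D2 (s * x)" by linarith
      then show "N/2 * x powr (-2-\<gamma>) \<le> 1 * D2 (s * x)" by simp
    qed (use \<rho> in auto)
    then obtain b where b: "\<And>x. 0 < x \<Longrightarrow> x < \<rho> \<Longrightarrow> \<Phi> (s * x) \<ge> (N/2) / (\<gamma> * (1 + \<gamma>)) * x powr (-\<gamma>) - b" by auto
    have "(N/2) / (\<gamma> * (1 + \<gamma>)) > 0" using N_pos gamma by simp
    from powr_neg_at_zero[OF gamma(1) this, of "B + b"]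
    obtain \<delta> where \<delta>: "\<delta> > 0" "\<And>x. 0 < x \<Longrightarrow> x < \<delta> \<Longrightarrow> (N/2) / (\<gamma> * (1 + \<gamma>)) * x powr (-\<gamma>) > B + b" by blast
    have "\<Phi> (s * x) \<ge> B" if "0 < x" "x < min \<delta> \<rho>" for x using b[of x] \<delta>(2)[of x] that by auto
    then show ?thesis using \<delta>(1) \<rho>(1) by (intro exI[of _ "min \<delta> \<rho>"]) auto
  qed
  from this[of 1] this[of "-1"] obtain \<delta>1 \<delta>2 where \<delta>: "\<delta>1 > 0" "\<And>x. 0 < x \<Longrightarrow> x < \<delta>1 \<Longrightarrow> \<Phi> x \<ge> B"
     "\<delta>2 > 0" "\<And>x. 0 < x \<Longrightarrow> x < \<delta>2 \<Longrightarrow> \<Phi> (- x) \<ge> B" by auto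
  have "\<Phi> x \<ge> B" if x: "x \<notin> \<int>" "int_dist x < min \<delta>1 \<delta>2" for x
  proof -
    have p: "0 < int_dist x" using x int_dist_pos_iff by simp
    obtain m where m: "x = of_int m + int_dist x \<or> x = of_int m - int_dist x" using ex_signed_representative by blast
    have y: "x + of_int (-m) \<notin> \<int>" using x nonint_add_int by blast
    then have "\<Phi> x = \<Phi> (x + of_int (-m))" using roof_add_int(1)[OF x(1), of "-m"] by simp
    moreover have "x + of_int (-m) = int_dist x \<or> x + of_int (-m) = - int_dist x" using m by auto
    ultimately show ?thesis using \<delta>(2)[OF p] \<delta>(4)[OF p] x(2) by auto
  qed
  then show ?thesis using \<delta> by (intro exI[of _ "min \<delta>1 \<delta>2"]) auto
qed

text \<open>Up to integer translations the points at distance at least \<open>\<eta>\<close> from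
  the integers form a compact set.\<close>

lemma compact_bound:
  assumes f: "continuous_on (- \<int>) f" and per: "\<And>x m. x \<notin> \<int> \<Longrightarrow> f (x + of_int m) = f x" and \<eta>: "0 < \<eta>"
  shows "\<exists>B::real. \<forall>x. \<eta> \<le> int_dist x \<longrightarrow> \<bar>f x\<bar> \<le> B"
proof -
  let ?S = "{x. \<eta> \<le> int_dist x} \<inter> {-1/2..1/2}"
  have "closed {x. \<eta> \<le> int_dist x}" by (rule closed_Collect_le[OF continuous_on_const int_dist_continuous])
  then have comp: "compact ?S" by (intro closed_Int_compact) auto
  have sub: "?S \<subseteq> - \<int>"
  proof
    fix x assume "x \<in> ?S"
    then have "0 < int_dist x" using \<eta> by auto
    then show "x \<in> - \<int>" using int_dist_pos_iff by blast
  qed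
  have "bounded (f ` ?S)" by (intro compact_imp_bounded compact_continuous_image continuous_on_subset[OF f sub] comp)
  then obtain B where "\<forall>y\<in>f ` ?S. norm y \<le> B" unfolding bounded_iff by blast
  then have B: "\<And>x. x \<in> ?S \<Longrightarrow> \<bar>f x\<bar> \<le> B" by auto
  have "\<bar>f x\<bar> \<le> B" if x: "\<eta> \<le> int_dist x" for x
  proof -
    have xi: "x \<notin> \<int>" using x \<eta> int_dist_pos_iff[of x] by simp
    have "\<bar>x + of_int (- round x)\<bar> \<le> 1/2" using int_dist_le_half[of x] by (simp add: int_dist_def)
    then have "- (1/2) \<le> x + of_int (- round x)" "x + of_int (- round x) \<le> 1/2" by linarith+
    then have "x + of_int (- round x) \<in> ?S" using x unfolding Int_iff mem_Collect_eq int_dist_add_int by auto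
    from B[OF this] show ?thesis by (simp only: per[OF xi])
  qed
  then show ?thesis by blast
qed

lemma roof_bounded_away:
  assumes "0 < \<eta>"
  shows "\<exists>B>0. \<forall>x. \<eta> \<le> int_dist x \<longrightarrow> \<bar>\<Phi> x\<bar> \<le> B \<and> \<bar>deriv \<Phi> x\<bar> \<le> B \<and> \<bar>D2 x\<bar> \<le> B \<and> sing x \<le> B"
proof -
  obtain B1 B2 B3 where B: "\<And>x. \<eta> \<le> int_dist x \<Longrightarrow> \<bar>\<Phi> x\<bar> \<le> B1" "\<And>x. \<eta> \<le> int_dist x \<Longrightarrow> \<bar>deriv \<Phi> x\<bar> \<le> B2"
      "\<And>x. \<eta> \<le> int_dist x \<Longrightarrow> \<bar>D2 x\<bar> \<le> B3"
    using compact_bound[OF roof_continuous(1) roof_add_int(1) assms] compact_bound[OF roof_continuous(2) roof_add_int(2) assms]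
      compact_bound[OF roof_continuous(3) roof_add_int(3) assms] by blast
  have s: "sing x \<le> \<eta> powr (-2-\<gamma>)" if "\<eta> \<le> int_dist x" for x
    unfolding sing_def using that assms gamma by (intro powr_mono2') auto
  define B where "B = Max {1, B1, B2, B3, \<eta> powr (-2-\<gamma>)}"
  have le: "1 \<le> B" "B1 \<le> B" "B2 \<le> B" "B3 \<le> B" "\<eta> powr (-2-\<gamma>) \<le> B" unfolding B_def by auto
  show ?thesis using le B s by (intro exI[of _ B]) (force intro: order_trans)
qed

lemma sing_ge_1: "x \<notin> \<int> \<Longrightarrow> 1 \<le> sing x"
proof -
  assume "x \<notin> \<int>"
  then have "0 < int_dist x" using int_dist_pos_iff by simp
  then have "1 powr (-2-\<gamma>) \<le> int_dist x powr (-2-\<gamma>)" using gamma int_dist_le_half[of x] by (intro powr_mono2') auto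
  then show ?thesis by (simp add: sing_def)
qed

lemma sing_nonneg [simp]: "0 \<le> sing x" by (simp add: sing_def)

text \<open>Near the singularity both bounds come from the limit \<open>N\<close>. Away from it
  \<open>D2\<close> is bounded and \<open>sing\<close> is at least 1: above, \<open>D2\<close> is
  absorbed by \<open>C * sing\<close>; below, its sign is unknown and the constant \<open>B\<close>
  has to be subtracted.\<close>

lemma roof_second_deriv_bounds:
  "\<exists>c C B. 0 < c \<and> 0 < C \<and> 0 < B \<and> (\<forall>x. x \<notin> \<int> \<longrightarrow> c * sing x - B \<le> D2 x \<and> \<bar>D2 x\<bar> \<le> C * sing x)"
proof -
  obtain \<rho> where \<rho>: "\<rho> > 0" "\<rho> < 1/2" "\<And>s x. s = 1 \<or> s = (-1::real) \<Longrightarrow> 0 < x \<Longrightarrow> x < \<rho> \<Longrightarrow>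
      \<bar>D2 (s * x) - N * x powr (-2-\<gamma>)\<bar> \<le> \<bar>N\<bar> / 2 * x powr (-2-\<gamma>)" using near_bounds by blast
  obtain B where B: "B > 0" "\<And>x. \<rho> \<le> int_dist x \<Longrightarrow> \<bar>D2 x\<bar> \<le> B \<and> sing x \<le> B"
    using roof_bounded_away[OF \<rho>(1)] by blast
  have "N/2 * sing x - (B + N/2 * B) \<le> D2 x \<and> \<bar>D2 x\<bar> \<le> (3*N/2 + B) * sing x" if x: "x \<notin> \<int>" for x
  proof (cases "int_dist x < \<rho>")
    case True
    have p: "0 < int_dist x" using x int_dist_pos_iff by simp
    obtain m where m: "x = of_int m + int_dist x \<or> x = of_int m - int_dist x" using ex_signed_representative by blast
    have "D2 x = D2 (x + of_int (-m))" using roof_add_int(3)[OF x(1), of "-m"] by simp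
    moreover have "x + of_int (-m) = 1 * int_dist x \<or> x + of_int (-m) = -1 * int_dist x" using m by auto
    ultimately have "\<bar>D2 x - N * sing x\<bar> \<le> \<bar>N\<bar> / 2 * sing x"
      unfolding sing_def using \<rho>(3)[of 1, OF _ p True] \<rho>(3)[of "-1", OF _ p True] by auto
    then have "\<bar>D2 x - N * sing x\<bar> \<le> (N * sing x) / 2" using N_pos by simp
    moreover have "0 \<le> B * sing x" "0 \<le> B + N/2 * B" "0 \<le> N * sing x" using B N_pos by auto
    moreover have "N/2 * sing x = (N * sing x) / 2" "(3*N/2 + B) * sing x = 3 * (N * sing x) / 2 + B * sing x"
      by (auto simp: algebra_simps)
    ultimately show ?thesis by linarith
  next
    case False
    then have b: "\<bar>D2 x\<bar> \<le> B" "sing x \<le> B" using B(2)[of x] by auto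
    have "N/2 * sing x \<le> N/2 * B" using b N_pos by (intro mult_left_mono) auto
    moreover have "B * 1 \<le> B * sing x" using B sing_ge_1[OF x] by (intro mult_left_mono) auto
    moreover have "0 \<le> 3*N/2 * sing x" using N_pos by simp
    ultimately show ?thesis using b by (auto simp: abs_le_iff algebra_simps)
  qed
  then show ?thesis using N_pos B(1) by (intro exI[of _ "N/2"] exI[of _ "3*N/2 + B"] exI[of _ "B + N/2 * B"]) (auto intro: add_pos_pos)
qed

text \<open>The roof blows up near the singularity, and away from it \<open>1 / \<Phi>\<close> is
  bounded by compactness.\<close>

lemma roof_lower_bound: "\<exists>c>0. \<forall>x. x \<notin> \<int> \<longrightarrow> c \<le> \<Phi> x"
proof -
  obtain \<delta> where \<delta>: "\<delta> > 0" "\<And>x. x \<notin> \<int> \<Longrightarrow> int_dist x < \<delta> \<Longrightarrow> \<Phi> x \<ge> 1" using roof_blowup[of 1] by blast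
  have cont: "continuous_on (- \<int>) (\<lambda>x. inverse (\<Phi> x))"
    using roof_pos by (intro continuous_on_inverse roof_continuous(1)) force
  obtain B where B: "\<And>x. \<delta> \<le> int_dist x \<Longrightarrow> \<bar>inverse (\<Phi> x)\<bar> \<le> B"
    using compact_bound[OF cont _ \<delta>(1)] roof_add_int(1) by auto
  have "inverse (max B 1) \<le> \<Phi> x" if x: "x \<notin> \<int>" for x
  proof (cases "int_dist x < \<delta>")
    case True
    have "inverse (max B 1) \<le> 1" by (simp add: inverse_le_1_iff)
    then show ?thesis using \<delta>(2)[OF x True] by linarith
  next
    case False
    then have "inverse (\<Phi> x) \<le> max B 1" using B[of x] roof_pos[OF x] by auto
    then have "inverse (max B 1) \<le> inverse (inverse (\<Phi> x))" using roof_pos[OF x] by (intro le_imp_inverse_le) auto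
    then show ?thesis by simp
  qed
  then show ?thesis by (intro exI[of _ "inverse (max B 1)"]) auto
qed

text \<open>The value 0 at integers makes the roof periodic and nonnegative on the whole
  line.\<close>

definition roof0 :: "real \<Rightarrow> real" where
  "roof0 x = (if x \<in> \<int> then 0 else \<Phi> x)"

lemma Ints_measurable [measurable]: "(\<int> :: real set) \<in> sets borel"
  using closed_Ints by (rule borel_closed)

lemma roof0_measurable [measurable]: "roof0 \<in> borel_measurable borel"
  unfolding roof0_def[abs_def] by measurable

lemma roof0_periodic: "periodic1 roof0"
  using roof_periodic nonint_add_int[of _ 1] by (auto simp: periodic1_def roof0_def)

lemma roof0_integral: "integrable circ roof0" "(\<integral>x. roof0 x \<partial>circ) = 1"
proof -
  have si: "integrable lborel (\<lambda>x. indicator {0<..<1} x * \<Phi> x)"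
  proof (rule ccontr)
    \<comment> \<open>Integrability is hidden in the normalization: a function that is not
      integrable has integral 0 by convention, not 1.\<close>
    assume "\<not> ?thesis"
    then have "(LINT x:{0<..<1}|lborel. \<Phi> x) = 0" by (simp add: set_lebesgue_integral_def not_integrable_integral_eq)
    then show False using roof_mean by simp
  qed
  have "AE x in lborel. x \<noteq> (0::real)" by (rule AE_lborel_singleton)
  then have ae: "AE x in lborel. indicator {0..<1} x * roof0 x = indicator {0<..<1} x * \<Phi> x"
  proof eventually_elim
    case (elim x)
    show ?case
    proof (cases "0 < x \<and> x < 1")
      case True
      have "x \<notin> \<int>"
      proof
        assume "x \<in> \<int>"
        then obtain m where "x = of_int m" by (rule Ints_cases)
        then show False using True by auto
      qed
      then show ?thesis using True by (simp add: roof0_def indicator_def)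
    next
      case False
      then have "x < 0 \<or> 1 \<le> x" using elim by auto
      then show ?thesis by (auto simp: indicator_def)
    qed
  qed
  show "integrable circ roof0" unfolding integrable_circ[OF roof0_measurable]
    by (subst integrable_cong_AE[OF _ _ ae]) (use si in auto)
  have "(\<integral>x. roof0 x \<partial>circ) = (\<integral>x. indicator {0<..<1} x * \<Phi> x \<partial>lborel)"
    unfolding integral_circ[OF roof0_measurable] by (rule integral_cong_AE[OF _ _ ae]) auto
  then show "(\<integral>x. roof0 x \<partial>circ) = 1" using roof_mean by (simp add: set_lebesgue_integral_def)
qed

lemma roof0_nonneg [simp]: "0 \<le> roof0 x"
  using roof_pos[of x] by (auto simp: roof0_def)

text \<open>Truncate the roof at \<open>M\<close>. It exceeds \<open>M\<close> near the integers, so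
  the truncation is constant there and extends continuously.\<close>

lemma roof0_L1_approx:
  assumes "e > 0"
  shows "\<exists>h. continuous_on UNIV h \<and> periodic1 h \<and> (\<integral>x. \<bar>roof0 x - h x\<bar> \<partial>circ) \<le> e"
proof -
  define h where "h M x = (if x \<in> \<int> then real M else min (\<Phi> x) (real M))" for M :: nat and x
  have per: "periodic1 (h M)" for M using roof_periodic nonint_add_int[of _ 1] by (auto simp: periodic1_def h_def)
  have cont: "continuous_on UNIV (h M)" for M
  proof (rule continuous_at_imp_continuous_on, rule ballI)
    fix x :: real
    show "isCont (h M) x"
    proof (cases "x \<in> \<int>")
      case True
      obtain \<delta> where \<delta>: "\<delta> > 0" "\<And>y. y \<notin> \<int> \<Longrightarrow> int_dist y < \<delta> \<Longrightarrow> \<Phi> y \<ge> real M" using roof_blowup[of "real M"] by blast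
      have "h M y = real M" if "y \<in> ball x \<delta>" for y
      proof -
        have "int_dist y < \<delta>"
          using int_dist_lipschitz[of y x] int_dist_pos_iff[of x] True that by (auto simp: dist_real_def)
        then show ?thesis using \<delta>(2)[of y] by (auto simp: h_def)
      qed
      then have "eventually (\<lambda>y. h M y = real M) (nhds x)"
        using \<delta>(1) by (intro eventually_nhds_in_open[THEN eventually_mono, of "ball x \<delta>"]) auto
      then show ?thesis using isCont_cong[of "h M" "\<lambda>_. real M" x] by simp
    next
      case False
      have "eventually (\<lambda>y. h M y = min (\<Phi> y) (real M)) (nhds x)"
        using open_nonint False by (intro eventually_nhds_in_open[THEN eventually_mono, of "- \<int>"]) (auto simp: h_def)
      moreover have "isCont (\<lambda>y. min (\<Phi> y) (real M)) x"
        using DERIV_isCont[OF roof_deriv(1)[OF False]] by (intro continuous_intros)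
      ultimately show ?thesis using isCont_cong[of "h M" "\<lambda>y. min (\<Phi> y) (real M)" x] by simp
    qed
  qed
  have [measurable]: "h M \<in> borel_measurable borel" for M by (intro borel_measurable_continuous_onI cont)
  have aeZ: "AE x in circ. x \<notin> \<int>"
    by (rule AE_circ) (rule AE_not_in, auto intro!: countable_imp_null_set_lborel simp: countable_int Ints_def)
  have "(\<lambda>M. \<integral>x. \<bar>roof0 x - h M x\<bar> \<partial>circ) \<longlonglongrightarrow> (\<integral>x. 0 \<partial>circ)"
  proof (rule integral_dominated_convergence[where w = roof0])
    show "AE x in circ. (\<lambda>M. \<bar>roof0 x - h M x\<bar>) \<longlonglongrightarrow> 0" using aeZ
    proof eventually_elim
      case (elim x)
      obtain M0 :: nat where "\<Phi> x \<le> real M0" using real_arch_simple by blast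
      then have "eventually (\<lambda>M. \<bar>roof0 x - h M x\<bar> = 0) sequentially"
        unfolding eventually_sequentially using elim by (intro exI[of _ M0]) (auto simp: roof0_def h_def)
      then show ?case by (rule tendsto_eventually)
    qed
    show "AE x in circ. norm \<bar>roof0 x - h M x\<bar> \<le> roof0 x" for M using aeZ
    proof eventually_elim
      case (elim x)
      then show ?case using roof_pos[OF elim] by (auto simp: roof0_def h_def min_def)
    qed
  qed (auto simp: roof0_integral)
  then have "eventually (\<lambda>M. (\<integral>x. \<bar>roof0 x - h M x\<bar> \<partial>circ) < e) sequentially"
    using assms by (intro order_tendstoD(2)) auto
  then obtain M where "(\<integral>x. \<bar>roof0 x - h M x\<bar> \<partial>circ) < e" by (auto simp: eventually_sequentially)
  then show ?thesis using per cont by (intro exI[of _ "h M"]) auto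
qed

end

subsection \<open>The special flow\<close>

context power_roof
begin

definition regular :: "real \<Rightarrow> bool" where
  "regular x \<longleftrightarrow> (\<forall>k::int. x + of_int k * \<alpha> \<notin> \<int>)"

abbreviation S :: "int \<Rightarrow> real \<Rightarrow> real" where
  "S \<equiv> birkhoff_sum \<alpha> \<Phi>"

definition roof_min :: real where
  "roof_min = (SOME c. c > 0 \<and> (\<forall>x. x \<notin> \<int> \<longrightarrow> c \<le> \<Phi> x))"

lemma roof_min: "roof_min > 0" "x \<notin> \<int> \<Longrightarrow> roof_min \<le> \<Phi> x"
  using someI_ex[OF roof_lower_bound] by (auto simp: roof_min_def)

lemma regular_nonint: "regular x \<Longrightarrow> x + of_int k * \<alpha> \<notin> \<int>"
  by (simp add: regular_def)

lemma regular_nonint0: "regular x \<Longrightarrow> x \<notin> \<int>"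
  using regular_nonint[of x 0] by simp

lemma regular_rotate [simp]: "regular (x + of_int k * \<alpha>) \<longleftrightarrow> regular x"
proof -
  have r: "regular x \<Longrightarrow> regular (x + of_int k * \<alpha>)" for x k unfolding regular_def
  proof
    fix l assume r: "\<forall>k::int. x + of_int k * \<alpha> \<notin> \<int>"
    have "x + of_int k * \<alpha> + of_int l * \<alpha> = x + of_int (k + l) * \<alpha>" by (simp add: algebra_simps)
    then show "x + of_int k * \<alpha> + of_int l * \<alpha> \<notin> \<int>" using r by metis
  qed
  from r[of x k] r[of "x + of_int k * \<alpha>" "-k"] show ?thesis by (auto simp: algebra_simps)
qed

lemma regular_add_int [simp]: "regular (x + of_int m) \<longleftrightarrow> regular x"
proof -
  have "x + of_int m + of_int k * \<alpha> \<notin> \<int> \<longleftrightarrow> x + of_int k * \<alpha> \<notin> \<int>" for k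
    using nonint_add_int[of "x + of_int k * \<alpha>" m] by (simp add: add_ac)
  then show ?thesis by (simp add: regular_def)
qed

lemma regular_frac [simp]: "regular (frac x) \<longleftrightarrow> regular x"
  using regular_add_int[of x "- \<lfloor>x\<rfloor>"] by (simp add: frac_def)

lemma countable_irregular: "countable {x. \<not> regular x}"
proof -
  have "{x. \<not> regular x} \<subseteq> range (\<lambda>(k::int, m::int). of_int m - of_int k * \<alpha>)"
  proof
    fix x assume "x \<in> {x. \<not> regular x}"
    then obtain k m :: int where "x + of_int k * \<alpha> = of_int m" by (auto simp: regular_def elim!: Ints_cases)
    then have "x = (\<lambda>(k::int, m::int). of_int m - of_int k * \<alpha>) (k, m)" by simp
    then show "x \<in> range (\<lambda>(k::int, m::int). of_int m - of_int k * \<alpha>)" by blast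
  qed
  then show ?thesis by (rule countable_subset) auto
qed

lemma regular_measurable [measurable]: "Measurable.pred borel regular"
proof -
  have "{x. \<not> regular x} \<in> sets borel" using countable_irregular by (rule sets.countable[rotated]) auto
  then have [measurable]: "Measurable.pred borel (\<lambda>x. \<not> regular x)" by (simp add: pred_def)
  have "Measurable.pred borel (\<lambda>x. \<not> \<not> regular x)" by measurable
  then show ?thesis by simp
qed

lemma AE_regular: "AE x in lborel. regular x"
  using AE_not_in[OF countable_imp_null_set_lborel[OF countable_irregular]] by simp

lemma AE_regular_circ: "AE x in circ. regular x"
  by (rule AE_circ[OF AE_regular])

lemma birkhoff_0 [simp]: "birkhoff_sum \<alpha> \<psi> 0 x = 0"
  by (simp add: birkhoff_sum_def)

lemma birkhoff_Suc: "birkhoff_sum \<alpha> \<psi> (n + 1) x = birkhoff_sum \<alpha> \<psi> n x + \<psi> (x + of_int n * \<alpha>)"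
proof (cases "n \<ge> 0")
  case True
  then have "{0..<n + 1} = insert n {0..<n}" by auto
  then show ?thesis using True by (simp add: birkhoff_sum_def)
next
  case False
  then have e: "{n..<0} = insert n {n + 1..<0}" by auto
  show ?thesis
  proof (cases "n = -1")
    case True
    have "{-1..<0::int} = {-1}" by auto
    then show ?thesis using True by (simp add: birkhoff_sum_def)
  next
    case F2: False
    then show ?thesis using False by (simp add: birkhoff_sum_def e)
  qed
qed

lemma birkhoff_add:
  "birkhoff_sum \<alpha> \<psi> (m + n) x = birkhoff_sum \<alpha> \<psi> m x + birkhoff_sum \<alpha> \<psi> n (x + of_int m * \<alpha>)"
proof (induction n rule: int_induct[where k = 0])
  case (step1 n)
  have "birkhoff_sum \<alpha> \<psi> (m + (n + 1)) x = birkhoff_sum \<alpha> \<psi> (m + n) x + \<psi> (x + of_int (m + n) * \<alpha>)"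
    using birkhoff_Suc[of \<psi> "m + n" x] by (simp add: add.assoc)
  then show ?case using step1 birkhoff_Suc[of \<psi> n "x + of_int m * \<alpha>"] by (simp add: algebra_simps)
next
  case (step2 n)
  have "birkhoff_sum \<alpha> \<psi> (m + n) x = birkhoff_sum \<alpha> \<psi> (m + (n - 1)) x + \<psi> (x + of_int (m + (n - 1)) * \<alpha>)"
    using birkhoff_Suc[of \<psi> "m + (n - 1)" x] by (simp add: algebra_simps)
  moreover have "birkhoff_sum \<alpha> \<psi> n (x + of_int m * \<alpha>)
      = birkhoff_sum \<alpha> \<psi> (n - 1) (x + of_int m * \<alpha>) + \<psi> (x + of_int m * \<alpha> + of_int (n - 1) * \<alpha>)"
    using birkhoff_Suc[of \<psi> "n - 1" "x + of_int m * \<alpha>"] by simp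
  ultimately show ?case using step2 by (simp add: algebra_simps)
qed simp

lemma birkhoff_nat: "birkhoff_sum \<alpha> \<psi> (int n) x = (\<Sum>k<n. \<psi> (x + real k * \<alpha>))"
  by (induction n) (use birkhoff_Suc[of \<psi> "int _" x] in \<open>auto simp: add.commute\<close>)

lemma birkhoff_add_int:
  assumes "regular x" and per: "\<And>y. y \<notin> \<int> \<Longrightarrow> \<psi> (y + of_int m) = \<psi> y"
  shows "birkhoff_sum \<alpha> \<psi> n (x + of_int m) = birkhoff_sum \<alpha> \<psi> n x"
proof -
  have "\<psi> (x + of_int m + of_int k * \<alpha>) = \<psi> (x + of_int k * \<alpha>)" for k
    using per[OF regular_nonint[OF assms(1), of k]] by (simp add: add_ac)
  then show ?thesis by (simp add: birkhoff_sum_def)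
qed

lemma birkhoff_measurable:
  assumes [measurable]: "\<psi> \<in> borel_measurable borel"
  shows "birkhoff_sum \<alpha> \<psi> n \<in> borel_measurable borel"
  unfolding birkhoff_sum_def[abs_def] by measurable

lemma birkhoff_measurable' [measurable (raw)]:
  assumes [measurable]: "\<psi> \<in> borel_measurable borel" "f \<in> borel_measurable L" and h: "h \<in> L \<rightarrow>\<^sub>M count_space UNIV"
  shows "(\<lambda>z. birkhoff_sum \<alpha> \<psi> (h z) (f z)) \<in> borel_measurable L"
proof (rule measurable_compose_countable[of "\<lambda>n z. birkhoff_sum \<alpha> \<psi> n (f z)" L borel h, OF _ h])
  show "(\<lambda>z. birkhoff_sum \<alpha> \<psi> n (f z)) \<in> borel_measurable L" for n
    by (rule measurable_compose[OF _ birkhoff_measurable]) measurable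
qed

lemmas S_Suc = birkhoff_Suc[of \<Phi>]
lemmas S_add = birkhoff_add[of \<Phi>]

lemma S_add_int: "regular x \<Longrightarrow> S n (x + of_int m) = S n x"
  by (rule birkhoff_add_int) (use roof_add_int(1) in auto)

lemma S_mono:
  assumes r: "regular x" and "m \<le> n"
  shows "roof_min * of_int (n - m) \<le> S n x - S m x"
  using \<open>m \<le> n\<close>
proof (induction n rule: int_ge_induct)
  case (step n)
  have "roof_min \<le> \<Phi> (x + of_int n * \<alpha>)" using roof_min(2) regular_nonint[OF r] by blast
  then show ?case using step S_Suc[of n x] by (simp add: algebra_simps)
qed simp

lemma crossing_unique:
  assumes r: "regular x"
    and "S m x \<le> u" "u < S (m + 1) x" "S n x \<le> u" "u < S (n + 1) x"
  shows "m = n"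
proof -
  have False if "m < n" "S n x \<le> u" "u < S (m + 1) x" for m n :: int
  proof -
    have "0 \<le> roof_min * of_int (n - (m + 1))" using roof_min(1) that by simp
    then show False using S_mono[OF r, of "m + 1" n] that by linarith
  qed
  from this[of m n] this[of n m] assms show ?thesis by (meson linorder_neqE)
qed

lemma crossing_exists:
  assumes r: "regular x"
  shows "\<exists>n. S n x \<le> u \<and> u < S (n + 1) x"
proof -
  define q where "q = \<lceil>\<bar>u\<bar> / roof_min\<rceil> + 1"
  have "\<bar>u\<bar> / roof_min < of_int q" unfolding q_def by linarith
  then have q: "\<bar>u\<bar> < roof_min * of_int q" using roof_min(1) by (simp add: field_simps)
  have "0 \<le> \<bar>u\<bar> / roof_min" using roof_min(1) by simp
  then have "q \<ge> 0" unfolding q_def by linarith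
  then have lo: "S (-q) x \<le> u" and hi: "u < S q x" using S_mono[OF r, of "-q" 0] S_mono[OF r, of 0 q] q by auto
  define k where "k = (LEAST k::nat. u < S (-q + int k + 1) x)"
  have ex: "\<exists>k::nat. u < S (-q + int k + 1) x"
  proof (cases "q = 0")
    case False
    then show ?thesis using hi \<open>q \<ge> 0\<close> by (intro exI[of _ "nat (2 * q - 1)"]) (simp add: algebra_simps)
  qed (use lo hi in auto)
  have k: "u < S (-q + int k + 1) x" unfolding k_def by (rule LeastI_ex[OF ex])
  have "S (-q + int k) x \<le> u"
  proof (cases k)
    case 0 then show ?thesis using lo by simp
  next
    case (Suc j)
    then have "\<not> u < S (-q + int j + 1) x" using not_less_Least[of j "\<lambda>k. u < S (-q + int k + 1) x"] by (simp add: k_def)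
    then show ?thesis using Suc by (simp add: algebra_simps)
  qed
  then show ?thesis using k by blast
qed

text \<open>The crossing number as a function of the total height \<open>u = r + t\<close> over the
  base point, for every real \<open>u\<close>. At irregular points it is set to 0.\<close>

definition cr :: "real \<Rightarrow> real \<Rightarrow> int" where
  "cr x u = (if regular x then THE n. S n x \<le> u \<and> u < S (n + 1) x else 0)"

lemma cr_bounds:
  assumes r: "regular x" shows "S (cr x u) x \<le> u" "u < S (cr x u + 1) x"
proof -
  have "\<exists>!n. S n x \<le> u \<and> u < S (n + 1) x" using crossing_exists[OF r] crossing_unique[OF r] by blast
  from theI'[OF this] show "S (cr x u) x \<le> u" "u < S (cr x u + 1) x" using r by (auto simp: cr_def)
qed

lemma cr_eqI: "regular x \<Longrightarrow> S n x \<le> u \<Longrightarrow> u < S (n + 1) x \<Longrightarrow> cr x u = n"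
  using crossing_unique cr_bounds by metis

text \<open>Turns comparisons of crossing numbers into comparisons of heights; monotonicity and
  nonnegativity of \<open>cr\<close> are read off from it.\<close>

lemma cr_le_iff: "regular x \<Longrightarrow> n \<le> cr x u \<longleftrightarrow> S n x \<le> u"
proof
  assume r: "regular x"
  have rm: "0 < roof_min" by (rule roof_min)
  show "S n x \<le> u" if "n \<le> cr x u"
  proof -
    have "0 \<le> roof_min * of_int (cr x u - n)" using rm that by simp
    then show ?thesis using S_mono[OF r that] cr_bounds[OF r, of u] by linarith
  qed
  show "n \<le> cr x u" if "S n x \<le> u"
  proof (rule ccontr)
    assume "\<not> n \<le> cr x u"
    then have l: "cr x u + 1 \<le> n" by simp
    then have "0 \<le> roof_min * of_int (n - (cr x u + 1))" using rm by simp
    then show False using S_mono[OF r l] cr_bounds[OF r, of u] that by linarith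
  qed
qed

lemma cr_mono: "regular x \<Longrightarrow> u \<le> u' \<Longrightarrow> cr x u \<le> cr x u'"
  using cr_le_iff[of x "cr x u" u'] cr_bounds(1)[of x u] by simp

lemma cr_0: "regular x \<Longrightarrow> 0 \<le> r \<Longrightarrow> r < \<Phi> x \<Longrightarrow> cr x r = 0"
  using S_Suc[of 0 x] by (intro cr_eqI) auto

lemma cr_nonneg: "regular x \<Longrightarrow> 0 \<le> u \<Longrightarrow> 0 \<le> cr x u"
  by (simp add: cr_le_iff)

text \<open>A crossing takes at least the time \<open>roof_min\<close>, so a height difference
  \<open>d\<close> makes room for \<open>d / roof_min\<close> crossings, up to one.\<close>

lemma cr_diff_le:
  assumes r: "regular x" and "S m x \<le> u + d" and "u < S (n + 1) x" and d: "0 \<le> d"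
  shows "of_int (m - n) \<le> d / roof_min + 1"
proof (cases "n + 1 \<le> m")
  case True
  have "roof_min * of_int (m - (n + 1)) \<le> d" using S_mono[OF r True] assms by linarith
  then have "of_int (m - (n + 1)) \<le> d / roof_min" using roof_min(1) by (simp add: field_simps)
  then show ?thesis by simp
next
  case False
  then have "(of_int (m - n) :: real) \<le> 0" by simp
  moreover have "0 \<le> d / roof_min" using d roof_min(1) by simp
  ultimately show ?thesis by linarith
qed

lemma cr_rotate:
  assumes r: "regular x" shows "cr (x + of_int k * \<alpha>) (u - S k x) = cr x u - k"
proof (rule cr_eqI)
  have e: "S n (x + of_int k * \<alpha>) = S (k + n) x - S k x" for n using S_add[of k n x] by simp
  show "S (cr x u - k) (x + of_int k * \<alpha>) \<le> u - S k x" "u - S k x < S (cr x u - k + 1) (x + of_int k * \<alpha>)"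
    unfolding e using cr_bounds[OF r, of u] by (simp_all add: algebra_simps)
qed (use r in simp)

lemma cr_add_int [simp]: "cr (x + of_int m) u = cr x u"
proof (cases "regular x")
  case True
  show ?thesis by (rule cr_eqI) (use True cr_bounds[OF True] S_add_int[OF True] in auto)
qed (simp add: cr_def)

lemma cr_frac [simp]: "cr (frac x) u = cr x u"
  using cr_add_int[of x "- \<lfloor>x\<rfloor>" u] by (simp add: frac_def)

lemma cr_eq_iff: "regular x \<Longrightarrow> cr x u = n \<longleftrightarrow> S n x \<le> u \<and> u < S (n + 1) x"
  using cr_eqI cr_bounds by metis

lemma cr_measurable: "(\<lambda>z. cr (fst z) (snd z)) \<in> borel \<Otimes>\<^sub>M borel \<rightarrow>\<^sub>M count_space UNIV"
proof -
  have "(\<lambda>z. cr (fst z) (snd z)) -` {n} \<inter> space (borel \<Otimes>\<^sub>M borel) \<in> sets (borel \<Otimes>\<^sub>M borel)" for n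
  proof -
    have "(\<lambda>z. cr (fst z) (snd z)) -` {n} \<inter> space (borel \<Otimes>\<^sub>M borel)
       = {z \<in> space (borel \<Otimes>\<^sub>M borel). if regular (fst z) then S n (fst z) \<le> snd z \<and> snd z < S (n + 1) (fst z) else n = 0}"
    proof (rule set_eqI)
      fix z :: "real \<times> real"
      show "z \<in> (\<lambda>z. cr (fst z) (snd z)) -` {n} \<inter> space (borel \<Otimes>\<^sub>M borel) \<longleftrightarrow>
        z \<in> {z \<in> space (borel \<Otimes>\<^sub>M borel). if regular (fst z) then S n (fst z) \<le> snd z \<and> snd z < S (n + 1) (fst z) else n = 0}"
      proof (cases "regular (fst z)")
        case True
        then show ?thesis using cr_eq_iff[OF True, of "snd z" n] by (simp add: space_pair_measure)
      next
        case False
        then show ?thesis by (auto simp: space_pair_measure cr_def)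
      qed
    qed
    also have "\<dots> \<in> sets (borel \<Otimes>\<^sub>M borel)" by measurable
    finally show ?thesis .
  qed
  then show ?thesis by (subst measurable_count_space_eq_countable) auto
qed

lemma cr_measurable' [measurable (raw)]:
  "f \<in> borel_measurable L \<Longrightarrow> g \<in> borel_measurable L \<Longrightarrow> (\<lambda>z. cr (f z) (g z)) \<in> L \<rightarrow>\<^sub>M count_space UNIV"
  using measurable_compose[OF measurable_Pair cr_measurable, of f L g] by simp

text \<open>The function \<open>f\<close> read along the vertical line over \<open>x\<close>,
  continued through all crossings. For periodic \<open>f\<close> these are the values of
  \<open>f\<close> along the flow (\<open>lift_K\<close>), but the base coordinate is not reduced
  modulo 1, so \<open>x\<close> is a real variable that may be moved across integers.\<close>

definition lift :: "(real \<times> real \<Rightarrow> 'b) \<Rightarrow> real \<Rightarrow> real \<Rightarrow> 'b" where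
  "lift f x u = f (x + of_int (cr x u) * \<alpha>, u - S (cr x u) x)"

lemma lift_measurable [measurable (raw)]:
  assumes F: "F \<in> borel_measurable (borel :: (real \<times> real) measure)"
    and f [measurable]: "f \<in> borel_measurable L" and g [measurable]: "g \<in> borel_measurable L"
  shows "(\<lambda>z. lift F (f z) (g z)) \<in> borel_measurable L"
proof -
  have c [measurable]: "(\<lambda>z. cr (f z) (g z)) \<in> L \<rightarrow>\<^sub>M count_space UNIV" by measurable
  have "(\<lambda>z. (f z + of_int (cr (f z) (g z)) * \<alpha>, g z - S (cr (f z) (g z)) (f z))) \<in> L \<rightarrow>\<^sub>M borel"
    by (rule measurable_compose_countable[of "\<lambda>n z. (f z + of_int n * \<alpha>, g z - S n (f z))" L borel, OF _ c])
       (intro borel_measurable_Pair; measurable)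
  from measurable_compose[OF this F] show ?thesis unfolding lift_def .
qed

subsection \<open>The flow preserves the suspension measure\<close>

abbreviation \<Omega> :: "(real \<times> real) set" where "\<Omega> \<equiv> suspension_space \<alpha> \<Phi>"
abbreviation \<mu> :: "(real \<times> real) measure" where "\<mu> \<equiv> suspension_measure \<alpha> \<Phi>"
abbreviation K :: "real \<Rightarrow> real \<times> real \<Rightarrow> real \<times> real" where "K \<equiv> special_flow \<alpha> \<Phi>"

lemma space_iff: "(x, r) \<in> \<Omega> \<longleftrightarrow> 0 \<le> x \<and> x < 1 \<and> regular x \<and> 0 \<le> r \<and> r < \<Phi> x"
  by (auto simp: suspension_space_def regular_def)

lemma sets_plane: "sets (lborel \<Otimes>\<^sub>M lborel :: (real \<times> real) measure) = sets borel"
  by (subst lborel_prod) simp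

lemma space_measurable [measurable]: "\<Omega> \<in> sets borel"
proof -
  have "\<Omega> = {z \<in> space (borel \<Otimes>\<^sub>M borel). 0 \<le> fst z \<and> fst z < 1 \<and> regular (fst z) \<and> 0 \<le> snd z \<and> snd z < \<Phi> (fst z)}"
    using space_iff by (auto simp: space_pair_measure)
  also have "\<dots> \<in> sets (borel \<Otimes>\<^sub>M borel)" by measurable
  also have "sets (borel \<Otimes>\<^sub>M borel) = sets (borel :: (real \<times> real) measure)" by (subst borel_prod) simp
  finally show ?thesis .
qed

lemma space_mu [simp]: "space \<mu> = \<Omega>"
  by (simp add: suspension_measure_def space_restrict_space space_pair_measure)

lemma sets_mu: "A \<in> sets \<mu> \<longleftrightarrow> A \<subseteq> \<Omega> \<and> A \<in> sets borel"
proof -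
  have s: "sets (lborel \<Otimes>\<^sub>M lborel :: (real \<times> real) measure) = sets borel" by (rule sets_plane)
  have "\<Omega> \<inter> space (lborel \<Otimes>\<^sub>M lborel) \<in> sets (lborel \<Otimes>\<^sub>M lborel)"
    unfolding s using space_measurable by (simp add: space_pair_measure)
  then show ?thesis unfolding suspension_measure_def by (subst sets_restrict_space_iff) (auto simp only: s)
qed

lemma measurable_mu: "f \<in> borel \<rightarrow>\<^sub>M L \<Longrightarrow> f \<in> \<mu> \<rightarrow>\<^sub>M L"
proof -
  assume "f \<in> borel \<rightarrow>\<^sub>M L"
  then have "f \<in> (lborel \<Otimes>\<^sub>M lborel) \<rightarrow>\<^sub>M L" by (simp add: measurable_cong_sets[OF sets_plane refl])
  then show ?thesis unfolding suspension_measure_def by (rule measurable_restrict_space1)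
qed

lemma Collect_mu: "Measurable.pred \<mu> P \<Longrightarrow> {z \<in> \<Omega>. P z} \<in> sets \<mu>"
  using measurable_sets[of P \<mu> "count_space UNIV" "{True}"] by (simp add: vimage_def Int_def conj_commute)

lemma fst_snd_measurable_mu [measurable]: "fst \<in> borel_measurable \<mu>" "snd \<in> borel_measurable \<mu>"
  by (auto intro!: measurable_mu borel_measurable_continuous_onI continuous_intros)

lemma nn_integral_mu:
  assumes [measurable]: "f \<in> borel_measurable borel"
  shows "(\<integral>\<^sup>+z. f z \<partial>\<mu>) = (\<integral>\<^sup>+x. \<integral>\<^sup>+r. f (x, r) * indicator \<Omega> (x, r) \<partial>lborel \<partial>circ)"
proof -
  have m [measurable]: "(\<lambda>z. f z * indicator \<Omega> z) \<in> borel_measurable (lborel \<Otimes>\<^sub>M lborel)"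
    by (simp add: measurable_cong_sets[OF sets_plane refl])
  have "(\<integral>\<^sup>+z. f z \<partial>\<mu>) = (\<integral>\<^sup>+z. f z * indicator \<Omega> z \<partial>(lborel \<Otimes>\<^sub>M lborel))" unfolding suspension_measure_def
    by (rule nn_integral_restrict_space)
       (use space_measurable in \<open>simp add: space_pair_measure sets_plane[simplified]\<close>)
  also have "\<dots> = (\<integral>\<^sup>+x. \<integral>\<^sup>+r. f (x, r) * indicator \<Omega> (x, r) \<partial>lborel \<partial>lborel)"
    by (rule lborel.nn_integral_fst[symmetric]) measurable
  also have "\<dots> = (\<integral>\<^sup>+x. indicator {0..<1} x * (\<integral>\<^sup>+r. f (x, r) * indicator \<Omega> (x, r) \<partial>lborel) \<partial>lborel)"
  proof (rule nn_integral_cong)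
    fix x :: real
    have "(\<integral>\<^sup>+r. f (x, r) * indicator \<Omega> (x, r) \<partial>lborel) = 0" if "x \<notin> {0..<1}"
    proof -
      have "indicator \<Omega> (x, r) = (0::ennreal)" for r using that by (auto simp: indicator_def space_iff)
      then show ?thesis by simp
    qed
    then show "(\<integral>\<^sup>+r. f (x, r) * indicator \<Omega> (x, r) \<partial>lborel) = indicator {0..<1} x * (\<integral>\<^sup>+r. f (x, r) * indicator \<Omega> (x, r) \<partial>lborel)"
      by (cases "x \<in> {0..<1}") auto
  qed
  also have "\<dots> = (\<integral>\<^sup>+x. \<integral>\<^sup>+r. f (x, r) * indicator \<Omega> (x, r) \<partial>lborel \<partial>circ)"
    by (rule nn_integral_circ[symmetric]) (use lborel.borel_measurable_nn_integral_fst[OF m] in simp)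
  finally show ?thesis .
qed

lemma emeasure_mu:
  assumes "A \<in> sets \<mu>"
  shows "emeasure \<mu> A = (\<integral>\<^sup>+x. emeasure lborel {r. (x, r) \<in> A} \<partial>circ)"
proof -
  have A: "A \<subseteq> \<Omega>" and [measurable]: "A \<in> sets borel" using assms sets_mu by auto
  have s: "{r. (x, r) \<in> A} \<in> sets borel" for x
  proof -
    have "Pair x -` A \<in> sets lborel" by (rule sets_Pair1[of A lborel lborel]) (simp only: sets_plane \<open>A \<in> sets borel\<close>)
    then show ?thesis by (simp add: vimage_def)
  qed
  have "emeasure \<mu> A = (\<integral>\<^sup>+z. indicator A z \<partial>\<mu>)" using assms by simp
  also have "\<dots> = (\<integral>\<^sup>+x. \<integral>\<^sup>+r. indicator A (x, r) * indicator \<Omega> (x, r) \<partial>lborel \<partial>circ)" by (rule nn_integral_mu) simp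
  also have "\<dots> = (\<integral>\<^sup>+x. emeasure lborel {r. (x, r) \<in> A} \<partial>circ)"
  proof (rule nn_integral_cong)
    fix x
    have "(\<integral>\<^sup>+r. indicator A (x, r) * indicator \<Omega> (x, r) \<partial>lborel) = (\<integral>\<^sup>+r. indicator {r. (x, r) \<in> A} r \<partial>lborel)"
      using A by (intro nn_integral_cong) (auto simp: indicator_def)
    also have "\<dots> = emeasure lborel {r. (x, r) \<in> A}" using s by (simp add: nn_integral_indicator)
    finally show "(\<integral>\<^sup>+r. indicator A (x, r) * indicator \<Omega> (x, r) \<partial>lborel) = emeasure lborel {r. (x, r) \<in> A}" .
  qed
  finally show ?thesis .
qed

lemma prob_space_mu: "prob_space \<mu>"
proof
  have "emeasure \<mu> (space \<mu>) = (\<integral>\<^sup>+x. emeasure lborel {r. (x, r) \<in> \<Omega>} \<partial>circ)"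
    by (subst emeasure_mu) (auto simp: sets_mu)
  also have "\<dots> = (\<integral>\<^sup>+x. ennreal (roof0 x) \<partial>circ)"
  proof (rule nn_integral_cong_AE)
    show "AE x in circ. emeasure lborel {r. (x, r) \<in> \<Omega>} = ennreal (roof0 x)" using AE_regular_circ AE_circ_unit
    proof eventually_elim
      case (elim x)
      have "{r. (x, r) \<in> \<Omega>} = {0..<\<Phi> x}" using elim by (auto simp: space_iff)
      moreover have "x \<notin> \<int>" using elim regular_nonint0 by auto
      ultimately show ?case using roof_pos[of x] by (simp add: roof0_def)
    qed
  qed
  also have "\<dots> = ennreal (\<integral>x. roof0 x \<partial>circ)" by (rule nn_integral_eq_integral) (use roof0_integral in auto)
  finally show "emeasure \<mu> (space \<mu>) = 1" by (simp add: roof0_integral)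
qed

lemma crossings_eq: "regular x \<Longrightarrow> crossings \<alpha> \<Phi> x r t = cr x (r + t)"
  unfolding crossings_def cr_def by (simp add: S_Suc algebra_simps)

lemma K_eq:
  "regular x \<Longrightarrow> K t (x, r) = (frac (x + of_int (cr x (r + t)) * \<alpha>), r + t - S (cr x (r + t)) x)"
  by (simp add: special_flow_def crossings_eq Let_def)

lemma K_in_space: "regular x \<Longrightarrow> K t (x, r) \<in> \<Omega>"
proof -
  assume r: "regular x"
  let ?n = "cr x (r + t)"
  have "\<Phi> (frac (x + of_int ?n * \<alpha>)) = \<Phi> (x + of_int ?n * \<alpha>)"
    using roof_add_int(1)[OF regular_nonint[OF r, of ?n], of "- \<lfloor>x + of_int ?n * \<alpha>\<rfloor>"] by (simp add: frac_def)
  then show ?thesis unfolding K_eq[OF r] space_iff using r cr_bounds[OF r, of "r + t"] by (simp add: frac_lt_1 S_Suc)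
qed

lemma K_flow_0: "z \<in> \<Omega> \<Longrightarrow> K 0 z = z"
  by (cases z) (auto simp: space_iff K_eq cr_0 frac_eq)

lemma K_flow_add:
  assumes "z \<in> \<Omega>" shows "K (s + t) z = K s (K t z)"
proof -
  obtain x r where z: "z = (x, r)" by (cases z)
  then have rx: "regular x" using assms space_iff by auto
  define n where "n = cr x (r + t)"
  define y where "y = x + of_int n * \<alpha>"
  have ry: "regular (frac y)" "regular y" using rx by (auto simp: y_def)
  have c: "cr y (r + t - S n x + s) = cr x (r + t + s) - n"
    using cr_rotate[OF rx, of n "r + t + s"] by (simp add: y_def algebra_simps)
  have Sy: "S m (frac y) = S m y" for m using S_add_int[OF ry(2), of m "- \<lfloor>y\<rfloor>"] by (simp add: frac_def)
  have fr: "frac (frac y + a) = frac (y + a)" for a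
  proof -
    have "frac y + a = (y + a) + of_int (- \<lfloor>y\<rfloor>)" by (simp add: frac_def)
    then show ?thesis by (simp only: frac_add_of_int_right)
  qed
  define m where "m = cr x (r + t + s)"
  have "K s (K t z) = (frac (frac y + of_int (m - n) * \<alpha>), r + t - S n x + s - S (m - n) (frac y))"
    unfolding z K_eq[OF rx] n_def[symmetric] y_def[symmetric] K_eq[OF ry(1)] cr_frac c m_def ..
  also have "\<dots> = (frac (x + of_int m * \<alpha>), r + t + s - S m x)"
    unfolding fr Sy using S_add[of n "m - n" x] by (simp add: y_def algebra_simps)
  also have "\<dots> = K (s + t) z" unfolding z K_eq[OF rx] m_def by (simp add: add_ac)
  finally show ?thesis ..
qed

lemma K_flow_measurable: "K t \<in> \<mu> \<rightarrow>\<^sub>M \<mu>"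
proof -
  have c [measurable]: "(\<lambda>z. cr (fst z) (snd z + t)) \<in> \<mu> \<rightarrow>\<^sub>M count_space UNIV" by measurable
  have "(\<lambda>z. (frac (fst z + of_int (cr (fst z) (snd z + t)) * \<alpha>), snd z + t - S (cr (fst z) (snd z + t)) (fst z))) \<in> borel_measurable \<mu>"
  proof (rule measurable_compose_countable[of "\<lambda>n z. (frac (fst z + of_int n * \<alpha>), snd z + t - S n (fst z))" \<mu> borel, OF _ c])
    show "(\<lambda>z. (frac (fst z + of_int n * \<alpha>), snd z + t - S n (fst z))) \<in> borel_measurable \<mu>" for n
      unfolding frac_def by (intro borel_measurable_Pair) measurable
  qed
  then have "K t \<in> \<mu> \<rightarrow>\<^sub>M borel"
    by (subst measurable_cong[where g = "\<lambda>z. (frac (fst z + of_int (cr (fst z) (snd z + t)) * \<alpha>), snd z + t - S (cr (fst z) (snd z + t)) (fst z))"])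
       (auto simp: space_iff K_eq)
  then have "K t \<in> \<mu> \<rightarrow>\<^sub>M (lborel \<Otimes>\<^sub>M lborel)" by (simp add: measurable_cong_sets[OF refl sets_plane])
  then show ?thesis unfolding suspension_measure_def[of \<alpha> \<Phi>]
    by (intro measurable_restrict_space2) (auto simp: suspension_measure_def[symmetric] space_iff intro!: K_in_space)
qed

text \<open>Decompose by the crossing number: \<open>D n\<close> consists of the points that reach
  \<open>A\<close> with crossing number \<open>n\<close>, and \<open>E n\<close> of the points of
  \<open>A\<close> whose crossing number on the way back is \<open>- n\<close>. From
  \<open>D n\<close> to \<open>E n\<close> the flow is a rotation of the base together with a
  translation of each fibre, and both preserve Lebesgue measure.\<close>

lemma K_flow_distr: "distr \<mu> \<mu> (K t) = \<mu>"
proof (rule measure_eqI)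
  fix A assume "A \<in> sets (distr \<mu> \<mu> (K t))"
  then have A: "A \<in> sets \<mu>" by simp
  have A\<Omega>: "A \<subseteq> \<Omega>" and Am [measurable]: "A \<in> sets borel" using A sets_mu by auto
  define E where "E n = {z \<in> A. cr (fst z) (snd z - t) = - n}" for n
  define D where "D n = {z \<in> \<Omega>. cr (fst z) (snd z + t) = n \<and> K t z \<in> A}" for n
  have Es: "E n \<in> sets \<mu>" for n
  proof -
    have [measurable]: "A \<in> sets \<mu>" by (rule A)
    have "E n = {z \<in> \<Omega>. z \<in> A \<and> cr (fst z) (snd z - t) = - n}" using A\<Omega> by (auto simp: E_def)
    then show ?thesis by (simp add: Collect_mu)
  qed
  have Ds: "D n \<in> sets \<mu>" for n
  proof -
    have [measurable]: "A \<in> sets \<mu>" "K t \<in> \<mu> \<rightarrow>\<^sub>M \<mu>" by (rule A, rule K_flow_measurable)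
    show ?thesis unfolding D_def by (rule Collect_mu) measurable
  qed
  have DE: "(x, r) \<in> D n \<longleftrightarrow> (frac (x + of_int n * \<alpha>), r + t - S n x) \<in> E n"
    if x: "0 \<le> x" "x < 1" and rx: "regular x" for x r n
  proof -
    let ?y = "x + of_int n * \<alpha>" and ?s = "r + t - S n x"
    have cy: "cr (frac ?y) (?s - t) = cr x r - n" using cr_rotate[OF rx, of n r] by (simp add: algebra_simps)
    have Py: "\<Phi> (frac ?y) = \<Phi> ?y"
      using roof_add_int(1)[OF regular_nonint[OF rx, of n], of "- \<lfloor>?y\<rfloor>"] by (simp add: frac_def)
    show ?thesis
    proof
      assume "(x, r) \<in> D n"
      then have a: "(x, r) \<in> \<Omega>" "cr x (r + t) = n" "K t (x, r) \<in> A" by (auto simp: D_def)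
      have "cr x r = 0" using a(1) by (auto simp: space_iff intro: cr_0)
      then show "(frac ?y, ?s) \<in> E n" using a cy by (simp add: E_def K_eq[OF rx])
    next
      assume "(frac ?y, ?s) \<in> E n"
      then have a: "(frac ?y, ?s) \<in> A" "cr (frac ?y) (?s - t) = - n" by (auto simp: E_def)
      then have "0 \<le> ?s" "?s < \<Phi> ?y" using A\<Omega> Py by (auto simp: space_iff)
      then have n: "cr x (r + t) = n" by (intro cr_eqI[OF rx]) (auto simp: S_Suc)
      have "cr x r = 0" using a(2) cy by simp
      then have "0 \<le> r" "r < \<Phi> x" using cr_bounds[OF rx, of r] S_Suc[of 0 x] by auto
      then show "(x, r) \<in> D n" using a n x rx by (simp add: D_def space_iff K_eq[OF rx])
    qed
  qed
  have "emeasure \<mu> (D n) = emeasure \<mu> (E n)" for n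
  proof -
    let ?g = "\<lambda>y. emeasure lborel {s. (y, s) \<in> E n}"
    have Eb: "E n \<in> sets (borel \<Otimes>\<^sub>M lborel)"
    proof -
      have "E n \<in> sets borel" using Es sets_mu by auto
      then show ?thesis using sets_plane by (simp add: sets_pair_measure_cong[of borel lborel lborel lborel])
    qed
    have gm [measurable]: "?g \<in> borel_measurable borel"
      using lborel.measurable_emeasure_Pair[OF Eb] by (simp add: vimage_def)
    have "emeasure \<mu> (D n) = (\<integral>\<^sup>+x. emeasure lborel {r. (x, r) \<in> D n} \<partial>circ)" by (rule emeasure_mu[OF Ds])
    also have "\<dots> = (\<integral>\<^sup>+x. ?g (frac (x + of_int n * \<alpha>)) \<partial>circ)"
    proof (rule nn_integral_cong_AE)
      show "AE x in circ. emeasure lborel {r. (x, r) \<in> D n} = ?g (frac (x + of_int n * \<alpha>))"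
        using AE_regular_circ AE_circ_unit
      proof eventually_elim
        case (elim x)
        let ?B = "{s. (frac (x + of_int n * \<alpha>), s) \<in> E n}"
        have [measurable]: "?B \<in> sets borel"
          using sets_Pair1[OF Eb, of "frac (x + of_int n * \<alpha>)"] by (simp add: vimage_def)
        have "emeasure lborel {r. (x, r) \<in> D n} = (\<integral>\<^sup>+r. indicator ?B ((t - S n x) + 1 * r) \<partial>lborel)"
        proof -
          have B: "{r. (x, r) \<in> D n} = (\<lambda>r. (t - S n x) + 1 * r) -` ?B \<inter> space lborel"
            using elim DE[of x _ n] by (auto simp: algebra_simps)
          have "(\<lambda>r. (t - S n x) + 1 * r) -` ?B \<inter> space lborel \<in> sets lborel" by measurable
          then have "{r. (x, r) \<in> D n} \<in> sets lborel" unfolding B .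
          then have "emeasure lborel {r. (x, r) \<in> D n} = (\<integral>\<^sup>+r. indicator {r. (x, r) \<in> D n} r \<partial>lborel)"
            by (rule nn_integral_indicator[symmetric])
          also have "\<dots> = (\<integral>\<^sup>+r. indicator ?B ((t - S n x) + 1 * r) \<partial>lborel)"
            unfolding B by (intro nn_integral_cong) (auto simp: indicator_def)
          finally show ?thesis .
        qed
        also have "\<dots> = (\<integral>\<^sup>+r. indicator ?B r \<partial>lborel)"
          using nn_integral_real_affine[of "indicator ?B" 1 "t - S n x"] by simp
        also have "\<dots> = emeasure lborel ?B" by simp
        finally show ?case .
      qed
    qed
    also have "\<dots> = (\<integral>\<^sup>+x. ?g (frac x) \<partial>circ)"
    proof (rule nn_integral_circ_shift[of "\<lambda>x. ?g (frac x)"])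
      have [measurable]: "(frac :: real \<Rightarrow> real) \<in> borel_measurable borel" unfolding frac_def by measurable
      show "(\<lambda>x. ?g (frac x)) \<in> borel_measurable borel" by measurable
    qed (simp add: periodic1_def frac_1_eq)
    also have "\<dots> = (\<integral>\<^sup>+x. ?g x \<partial>circ)"
    proof (rule nn_integral_cong_AE)
      show "AE x in circ. ?g (frac x) = ?g x" using AE_circ_unit by eventually_elim (simp add: frac_eq)
    qed
    also have "\<dots> = emeasure \<mu> (E n)" by (rule emeasure_mu[OF Es, symmetric])
    finally show ?thesis .
  qed
  moreover have "emeasure \<mu> (\<Union>n\<in>UNIV. D n) = (\<integral>\<^sup>+n. emeasure \<mu> (D n) \<partial>count_space UNIV)"
    by (rule emeasure_UN_countable) (use Ds in \<open>auto simp: disjoint_family_on_def D_def\<close>)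
  moreover have "emeasure \<mu> (\<Union>n\<in>UNIV. E n) = (\<integral>\<^sup>+n. emeasure \<mu> (E n) \<partial>count_space UNIV)"
    by (rule emeasure_UN_countable) (use Es in \<open>auto simp: disjoint_family_on_def E_def\<close>)
  moreover have "(\<Union>n\<in>UNIV. E n) = A"
  proof
    show "A \<subseteq> (\<Union>n\<in>UNIV. E n)"
    proof
      fix z assume "z \<in> A"
      then have "z \<in> E (- cr (fst z) (snd z - t))" by (simp add: E_def)
      then show "z \<in> (\<Union>n\<in>UNIV. E n)" by blast
    qed
  qed (auto simp: E_def)
  moreover have "(\<Union>n\<in>UNIV. D n) = K t -` A \<inter> space \<mu>" by (auto simp: D_def)
  ultimately have "emeasure \<mu> (K t -` A \<inter> space \<mu>) = emeasure \<mu> A" by simp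
  then show "emeasure (distr \<mu> \<mu> (K t)) A = emeasure \<mu> A" using emeasure_distr[OF K_flow_measurable A] by simp
qed simp

sublocale mp_flow \<mu> K
proof -
  interpret prob_space \<mu> by (rule prob_space_mu)
  show "mp_flow \<mu> K" by standard (auto simp: K_flow_measurable K_flow_distr K_flow_0 K_flow_add)
qed

lemma lift_K:
  assumes per: "\<And>x r m. f (x + of_int m, r) = f (x, r)" and z: "(x, r) \<in> \<Omega>"
  shows "f (K t (x, r)) = lift f x (r + t)"
proof -
  have "f (frac y, s) = f (y, s)" for y s using per[of y "- \<lfloor>y\<rfloor>" s] by (simp add: frac_def)
  then show ?thesis using z by (simp add: space_iff K_eq lift_def)
qed

end

subsection \<open>Second order control of Birkhoff sums\<close>

context power_roof
begin

abbreviation DS :: "int \<Rightarrow> real \<Rightarrow> real" where "DS \<equiv> birkhoff_sum \<alpha> (deriv \<Phi>)"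
abbreviation DDS :: "int \<Rightarrow> real \<Rightarrow> real" where "DDS \<equiv> birkhoff_sum \<alpha> D2"
abbreviation V :: "int \<Rightarrow> real \<Rightarrow> real" where "V \<equiv> birkhoff_sum \<alpha> sing"

lemma sing_measurable [measurable]: "sing \<in> borel_measurable borel"
  unfolding sing_def[abs_def] by measurable

lemma birkhoff_pos: "0 \<le> n \<Longrightarrow> birkhoff_sum \<alpha> \<psi> n x = (\<Sum>k\<in>{0..<n}. \<psi> (x + of_int k * \<alpha>))"
  by (simp add: birkhoff_sum_def)

lemma birkhoff_abs_le:
  assumes "\<And>j. \<bar>j\<bar> \<le> \<bar>m\<bar> \<Longrightarrow> \<bar>\<psi> (z + of_int j * \<alpha>)\<bar> \<le> B"
  shows "\<bar>birkhoff_sum \<alpha> \<psi> m z\<bar> \<le> of_int \<bar>m\<bar> * B"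
proof (cases "0 \<le> m")
  case True
  have "\<bar>birkhoff_sum \<alpha> \<psi> m z\<bar> \<le> (\<Sum>k\<in>{0..<m}. \<bar>\<psi> (z + of_int k * \<alpha>)\<bar>)"
    using True by (simp add: birkhoff_sum_def sum_abs)
  also have "\<dots> \<le> of_nat (card {0..<m}) * B" by (rule sum_bounded_above) (use assms in auto)
  finally show ?thesis using True by simp
next
  case False
  have "\<bar>birkhoff_sum \<alpha> \<psi> m z\<bar> \<le> (\<Sum>k\<in>{m..<0}. \<bar>\<psi> (z + of_int k * \<alpha>)\<bar>)"
    using False by (simp add: birkhoff_sum_def sum_abs)
  also have "\<dots> \<le> of_nat (card {m..<0}) * B" by (rule sum_bounded_above) (use assms in auto)
  finally show ?thesis using False by simp
qed

text \<open>The two sums differ by at most \<open>k\<close> terms, all taken within \<open>k\<close>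
  steps of the index \<open>n\<close>.\<close>

lemma birkhoff_diff_le:
  assumes k: "\<bar>n' - n\<bar> \<le> k" and B: "\<And>j. \<bar>j\<bar> \<le> k \<Longrightarrow> \<bar>\<psi> (y + of_int (n + j) * \<alpha>)\<bar> \<le> B"
  shows "\<bar>birkhoff_sum \<alpha> \<psi> n' y - birkhoff_sum \<alpha> \<psi> n y\<bar> \<le> of_int k * B"
proof -
  have "birkhoff_sum \<alpha> \<psi> n' y - birkhoff_sum \<alpha> \<psi> n y = birkhoff_sum \<alpha> \<psi> (n' - n) (y + of_int n * \<alpha>)"
    using birkhoff_add[of \<psi> n "n' - n" y] by simp
  also have "\<bar>\<dots>\<bar> \<le> of_int \<bar>n' - n\<bar> * B"
  proof (rule birkhoff_abs_le)
    fix j assume "\<bar>j\<bar> \<le> \<bar>n' - n\<bar>"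
    then have "\<bar>\<psi> (y + of_int (n + j) * \<alpha>)\<bar> \<le> B" using k by (intro B) simp
    then show "\<bar>\<psi> (y + of_int n * \<alpha> + of_int j * \<alpha>)\<bar> \<le> B" by (simp add: algebra_simps)
  qed
  also have "\<dots> \<le> of_int k * B"
  proof (rule mult_right_mono)
    show "0 \<le> B" using B[of 0] k by (metis abs_ge_zero abs_zero order_trans)
  qed (use k in simp)
  finally show ?thesis .
qed

text \<open>Fixed witnesses for the constants of \<open>roof_second_deriv_bounds\<close>, from which
  later constants are built.\<close>

definition hess :: "real \<times> real \<times> real" where
  "hess = (SOME p. case p of (c, C, B) \<Rightarrow> 0 < c \<and> 0 < C \<and> 0 < B \<and>
     (\<forall>x. x \<notin> \<int> \<longrightarrow> c * sing x - B \<le> D2 x \<and> \<bar>D2 x\<bar> \<le> C * sing x))"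
definition hess_lo :: real where "hess_lo = fst hess"
definition hess_hi :: real where "hess_hi = fst (snd hess)"
definition hess_shift :: real where "hess_shift = snd (snd hess)"

lemma hess: "0 < hess_lo" "0 < hess_hi" "0 < hess_shift"
  "x \<notin> \<int> \<Longrightarrow> hess_lo * sing x - hess_shift \<le> D2 x"
  "x \<notin> \<int> \<Longrightarrow> \<bar>D2 x\<bar> \<le> hess_hi * sing x"
proof -
  have "\<exists>p. case p of (c, C, B) \<Rightarrow> 0 < c \<and> 0 < C \<and> 0 < B \<and>
     (\<forall>x. x \<notin> \<int> \<longrightarrow> c * sing x - B \<le> D2 x \<and> \<bar>D2 x\<bar> \<le> C * sing x)"
    using roof_second_deriv_bounds by auto
  from someI_ex[OF this]
  have "case hess of (c, C, B) \<Rightarrow> 0 < c \<and> 0 < C \<and> 0 < B \<and>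
     (\<forall>x. x \<notin> \<int> \<longrightarrow> c * sing x - B \<le> D2 x \<and> \<bar>D2 x\<bar> \<le> C * sing x)" unfolding hess_def .
  then show "0 < hess_lo" "0 < hess_hi" "0 < hess_shift"
    "x \<notin> \<int> \<Longrightarrow> hess_lo * sing x - hess_shift \<le> D2 x"
    "x \<notin> \<int> \<Longrightarrow> \<bar>D2 x\<bar> \<le> hess_hi * sing x"
    by (auto simp: hess_lo_def hess_hi_def hess_shift_def split: prod.splits)
qed

definition clear :: "int \<Rightarrow> real \<Rightarrow> bool" where
  "clear n x \<longleftrightarrow> (\<forall>k\<in>{0..<n}. x + of_int k * \<alpha> \<notin> \<int>)"

lemma regular_clear: "regular x \<Longrightarrow> clear n x"
  by (auto simp: clear_def regular_nonint)

lemma clear_mono: "clear n x \<Longrightarrow> m \<le> n \<Longrightarrow> clear m x"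
  by (auto simp: clear_def)

text \<open>The factor 2 preserves at every step at least half of the distance to the singularity,
  so between \<open>x\<close> and \<open>y\<close> each term of \<open>V\<close> changes at most by
  the factor \<open>2 powr (2 + \<gamma>)\<close>, which is below 8.\<close>

definition near :: "int \<Rightarrow> real \<Rightarrow> real \<Rightarrow> bool" where
  "near n x y \<longleftrightarrow> clear n x \<and> (\<forall>k\<in>{0..<n}. 2 * \<bar>y - x\<bar> \<le> int_dist (x + of_int k * \<alpha>))"

lemma near_between:
  assumes "near n x y" "\<bar>z - x\<bar> \<le> \<bar>y - x\<bar>" shows "near n x z"
  unfolding near_def
proof (intro conjI ballI)
  show "clear n x" using assms by (simp add: near_def)
  fix k assume "k \<in> {0..<n}"
  then have "2 * \<bar>y - x\<bar> \<le> int_dist (x + of_int k * \<alpha>)" using assms by (auto simp: near_def)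
  then show "2 * \<bar>z - x\<bar> \<le> int_dist (x + of_int k * \<alpha>)" by (rule order_trans[rotated]) (use assms(2) in simp)
qed

lemma near_int_dist:
  assumes "near n x y" "k \<in> {0..<n}"
  shows "int_dist (x + of_int k * \<alpha>) / 2 \<le> int_dist (y + of_int k * \<alpha>)"
    "int_dist (y + of_int k * \<alpha>) \<le> 2 * int_dist (x + of_int k * \<alpha>)" "0 < int_dist (x + of_int k * \<alpha>)"
proof -
  have l: "\<bar>int_dist (y + of_int k * \<alpha>) - int_dist (x + of_int k * \<alpha>)\<bar> \<le> \<bar>y - x\<bar>"
    using int_dist_lipschitz[of "y + of_int k * \<alpha>" "x + of_int k * \<alpha>"] by simp
  have m: "2 * \<bar>y - x\<bar> \<le> int_dist (x + of_int k * \<alpha>)" using assms by (auto simp: near_def)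
  have half: "a / 2 \<le> b \<and> b \<le> 2 * a" if "\<bar>b - a\<bar> \<le> d" "2 * d \<le> a" for a b d :: real using that by linarith
  show "int_dist (x + of_int k * \<alpha>) / 2 \<le> int_dist (y + of_int k * \<alpha>)"
    "int_dist (y + of_int k * \<alpha>) \<le> 2 * int_dist (x + of_int k * \<alpha>)" using half[OF l m] by simp_all
  show "0 < int_dist (x + of_int k * \<alpha>)" using assms by (auto simp: near_def clear_def int_dist_pos_iff)
qed

lemma near_clear: "near n x y \<Longrightarrow> clear n y"
  unfolding clear_def
proof
  fix k assume n: "near n x y" and k: "k \<in> {0..<n}"
  have "0 < int_dist (y + of_int k * \<alpha>)" using near_int_dist[OF n k] by linarith
  then show "y + of_int k * \<alpha> \<notin> \<int>" by (simp add: int_dist_pos_iff)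
qed

lemma powr_neg_half_le:
  assumes "0 < a" "a / 2 \<le> b" shows "b powr (-2-\<gamma>) \<le> 8 * a powr (-2-\<gamma>)"
proof -
  have "b powr (-2-\<gamma>) \<le> (a/2) powr (-2-\<gamma>)" using assms gamma by (intro powr_mono2') auto
  also have "\<dots> = a powr (-2-\<gamma>) * 2 powr (2 + \<gamma>)"
    using assms by (simp add: powr_divide powr_minus_divide field_simps flip: powr_minus)
      (simp add: powr_minus field_simps powr_diff powr_add)
  also have "\<dots> \<le> a powr (-2-\<gamma>) * 2 powr 3" using gamma by (intro mult_left_mono powr_mono) auto
  finally show ?thesis by simp
qed

lemma near_V:
  assumes "near n x y" "0 \<le> n" shows "V n y \<le> 8 * V n x" "V n x \<le> 8 * V n y"
proof -
  have "sing (y + of_int k * \<alpha>) \<le> 8 * sing (x + of_int k * \<alpha>)" "sing (x + of_int k * \<alpha>) \<le> 8 * sing (y + of_int k * \<alpha>)"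
    if "k \<in> {0..<n}" for k
  proof -
    note d = near_int_dist[OF assms(1) that]
    show "sing (y + of_int k * \<alpha>) \<le> 8 * sing (x + of_int k * \<alpha>)"
      unfolding sing_def by (rule powr_neg_half_le) (use d in auto)
    show "sing (x + of_int k * \<alpha>) \<le> 8 * sing (y + of_int k * \<alpha>)"
      unfolding sing_def by (rule powr_neg_half_le) (use d in auto)
  qed
  then show "V n y \<le> 8 * V n x" "V n x \<le> 8 * V n y"
    using assms(2) by (auto simp: birkhoff_pos sum_distrib_left intro!: sum_mono)
qed

lemma V_mono: "0 \<le> m \<Longrightarrow> m \<le> n \<Longrightarrow> V m x \<le> V n x"
  by (auto simp: birkhoff_pos intro!: sum_mono2)

lemma V_ge: "clear n x \<Longrightarrow> 0 \<le> n \<Longrightarrow> of_int n \<le> V n x"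
proof -
  assume c: "clear n x" and n: "0 \<le> n"
  have "(\<Sum>k\<in>{0..<n}. 1) \<le> V n x"
    unfolding birkhoff_pos[OF n] by (rule sum_mono) (use c in \<open>auto simp: clear_def intro: sing_ge_1\<close>)
  then show ?thesis using n by simp
qed

text \<open>This is \<open>1/2 - 1/(2+\<gamma>)\<close>, the exponent by which the distance
  \<open>V powr (-1/(2+\<gamma>))\<close> to the singularity exceeds the working scale
  \<open>1 / sqrt V\<close>.\<close>

definition beta :: real where "beta = \<gamma> / (2 * (2 + \<gamma>))"

lemma beta_pos: "0 < beta" using gamma by (simp add: beta_def)

text \<open>A single term of \<open>V n x\<close> is at most the whole sum, which keeps the orbit
  segment at distance at least \<open>V n x powr (-1/(2+\<gamma>))\<close> from the singularity. The
  condition on \<open>\<kappa>\<close> makes this at least twice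
  \<open>\<kappa> / sqrt (V n x)\<close>.\<close>

lemma nearI:
  assumes c: "clear n x" and n: "0 < n" and y: "\<bar>y - x\<bar> \<le> \<kappa> / sqrt (V n x)" and \<kappa>: "2 * \<kappa> \<le> V n x powr beta"
  shows "near n x y"
  unfolding near_def
proof (intro conjI ballI c)
  fix k assume k: "k \<in> {0..<n}"
  let ?i = "int_dist (x + of_int k * \<alpha>)"
  have i: "?i > 0" using c k by (auto simp: clear_def int_dist_pos_iff)
  have "1 \<le> n" using n by simp
  then have V1: "1 \<le> V n x" using V_ge[OF c] n by (metis less_imp_le of_int_1_le_iff order_trans)
  have g: "2 + \<gamma> > 0" using gamma by simp
  have "sing (x + of_int k * \<alpha>) \<le> V n x"
    unfolding birkhoff_pos[OF less_imp_le[OF n]] by (rule member_le_sum[OF k]) auto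
  then have "(V n x) powr (- 1 / (2 + \<gamma>)) \<le> (?i powr (-2-\<gamma>)) powr (- 1 / (2 + \<gamma>))"
    using g i unfolding sing_def by (intro powr_mono2') auto
  also have "\<dots> = ?i"
  proof -
    have "(-2-\<gamma>) * (- 1 / (2 + \<gamma>)) = 1" using g by (simp add: field_simps)
    then show ?thesis using i by (simp add: powr_powr)
  qed
  finally have *: "(V n x) powr (- 1 / (2 + \<gamma>)) \<le> ?i" .
  have "2 * \<bar>y - x\<bar> \<le> (2 * \<kappa>) / sqrt (V n x)" using y by simp
  also have "\<dots> \<le> V n x powr beta / sqrt (V n x)" using \<kappa> V1 by (intro divide_right_mono) auto
  also have "\<dots> = V n x powr (beta - 1/2)" using V1 by (simp add: powr_diff powr_half_sqrt)
  also have "beta - 1/2 = - 1 / (2 + \<gamma>)" using g by (simp add: beta_def field_simps)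
  finally show "2 * \<bar>y - x\<bar> \<le> ?i" using * by simp
qed

lemma birkhoff_deriv:
  assumes c: "clear n x" and n: "0 \<le> n"
  shows "(S n has_field_derivative DS n x) (at x)" "(DS n has_field_derivative DDS n x) (at x)"
proof -
  have d: "((\<lambda>x. \<Phi> (x + of_int k * \<alpha>)) has_field_derivative deriv \<Phi> (x + of_int k * \<alpha>)) (at x)"
    "((\<lambda>x. deriv \<Phi> (x + of_int k * \<alpha>)) has_field_derivative D2 (x + of_int k * \<alpha>)) (at x)"
    if "k \<in> {0..<n}" for k using c that roof_deriv[of "x + of_int k * \<alpha>"] by (auto simp: clear_def DERIV_shift)
  have e: "birkhoff_sum \<alpha> \<psi> n = (\<lambda>x. \<Sum>k\<in>{0..<n}. \<psi> (x + of_int k * \<alpha>))" for \<psi>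
    using n by (simp add: birkhoff_sum_def fun_eq_iff)
  show "(S n has_field_derivative DS n x) (at x)" "(DS n has_field_derivative DDS n x) (at x)"
    unfolding e using d by (auto intro!: derivative_eq_intros)
qed

lemma DDS_bounds:
  assumes c: "clear n x" and n: "0 \<le> n"
  shows "\<bar>DDS n x\<bar> \<le> hess_hi * V n x" "hess_lo * V n x - hess_shift * of_int n \<le> DDS n x"
proof -
  have b: "\<bar>D2 (x + of_int k * \<alpha>)\<bar> \<le> hess_hi * sing (x + of_int k * \<alpha>)"
    "hess_lo * sing (x + of_int k * \<alpha>) - hess_shift \<le> D2 (x + of_int k * \<alpha>)" if "k \<in> {0..<n}" for k
    using c that hess(4,5) by (auto simp: clear_def)
  have "\<bar>DDS n x\<bar> \<le> (\<Sum>k\<in>{0..<n}. \<bar>D2 (x + of_int k * \<alpha>)\<bar>)" unfolding birkhoff_pos[OF n] by (rule sum_abs)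
  also have "\<dots> \<le> (\<Sum>k\<in>{0..<n}. hess_hi * sing (x + of_int k * \<alpha>))" by (rule sum_mono[OF b(1)])
  finally show "\<bar>DDS n x\<bar> \<le> hess_hi * V n x" unfolding birkhoff_pos[OF n] by (simp add: sum_distrib_left)
  have "(\<Sum>k\<in>{0..<n}. hess_lo * sing (x + of_int k * \<alpha>) - hess_shift) \<le> DDS n x"
    unfolding birkhoff_pos[OF n] by (rule sum_mono[OF b(2)])
  then show "hess_lo * V n x - hess_shift * of_int n \<le> DDS n x"
    unfolding birkhoff_pos[OF n] using n by (simp add: sum_subtractf sum_distrib_left mult.commute)
qed

lemma mean_value_abs:
  fixes f f' :: "real \<Rightarrow> real"
  assumes d: "\<And>z. \<bar>z - x\<bar> \<le> \<bar>y - x\<bar> \<Longrightarrow> (f has_field_derivative f' z) (at z)"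
  shows "\<exists>z. \<bar>z - x\<bar> \<le> \<bar>y - x\<bar> \<and> f y - f x = f' z * (y - x)"
proof (cases x y rule: linorder_cases)
  case less
  have "\<exists>z. x < z \<and> z < y \<and> f y - f x = (y - x) * f' z" by (rule MVT2[OF less]) (use d less in auto)
  then obtain z where "x < z" "z < y" "f y - f x = (y - x) * f' z" by blast
  then show ?thesis by (intro exI[of _ z]) (auto simp: mult.commute)
next
  case greater
  have "\<exists>z. y < z \<and> z < x \<and> f x - f y = (x - y) * f' z" by (rule MVT2[OF greater]) (use d greater in auto)
  then obtain z where "y < z" "z < x" "f x - f y = (x - y) * f' z" by blast
  then show ?thesis by (intro exI[of _ z]) (auto simp: algebra_simps)
qed (intro exI[of _ x], auto)

text \<open>Taylor expansion of the Birkhoff sum and of its derivative. The bounds contain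
  \<open>V n x\<close> for every \<open>m <= n\<close>, so that the largest number of crossings
  controls all times at once.\<close>

lemma near_DS:
  assumes near: "near n x y" and m: "0 \<le> m" "m \<le> n"
  shows "\<bar>DS m y - DS m x\<bar> \<le> 8 * hess_hi * V n x * \<bar>y - x\<bar>"
    "\<bar>S m y - S m x - DS m x * (y - x)\<bar> \<le> 8 * hess_hi * V n x * \<bar>y - x\<bar> * \<bar>y - x\<bar>"
proof -
  have cl: "clear m z" if "\<bar>z - x\<bar> \<le> \<bar>y - x\<bar>" for z
    using near_clear[OF near_between[OF near that]] clear_mono m by blast
  have V0: "0 \<le> V n x" using m by (simp add: birkhoff_pos sum_nonneg)
  have Vz: "hess_hi * V m z \<le> 8 * hess_hi * V n x" if z: "\<bar>z - x\<bar> \<le> \<bar>y - x\<bar>" for z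
  proof -
    have "V m z \<le> 8 * V n x" using near_V(1)[OF near_between[OF near z]] V_mono[OF m, of z] m by linarith
    from mult_left_mono[OF this, of hess_hi] show ?thesis using hess(2) by simp
  qed
  have DSz: "\<bar>DS m w - DS m x\<bar> \<le> 8 * hess_hi * V n x * \<bar>w - x\<bar>" if w: "\<bar>w - x\<bar> \<le> \<bar>y - x\<bar>" for w
  proof -
    obtain z where z: "\<bar>z - x\<bar> \<le> \<bar>w - x\<bar>" "DS m w - DS m x = DDS m z * (w - x)"
      using mean_value_abs[of x w "DS m" "DDS m"] birkhoff_deriv(2)[OF cl m(1)] w by (meson order_trans)
    have "\<bar>DDS m z\<bar> \<le> 8 * hess_hi * V n x" using DDS_bounds(1)[OF cl m(1)] Vz z(1) w by (meson order_trans)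
    then show ?thesis unfolding z(2) abs_mult by (rule mult_right_mono) simp
  qed
  then show "\<bar>DS m y - DS m x\<bar> \<le> 8 * hess_hi * V n x * \<bar>y - x\<bar>" by simp
  obtain z where z: "\<bar>z - x\<bar> \<le> \<bar>y - x\<bar>" "S m y - S m x = DS m z * (y - x)"
    using mean_value_abs[of x y "S m" "DS m"] birkhoff_deriv(1)[OF cl m(1)] by blast
  have "\<bar>DS m z - DS m x\<bar> \<le> 8 * hess_hi * V n x * \<bar>y - x\<bar>"
  proof -
    have "8 * hess_hi * V n x * \<bar>z - x\<bar> \<le> 8 * hess_hi * V n x * \<bar>y - x\<bar>"
      using z(1) V0 hess(2) by (intro mult_left_mono) auto
    then show ?thesis using DSz[OF z(1)] by linarith
  qed
  then have "\<bar>DS m z - DS m x\<bar> * \<bar>y - x\<bar> \<le> 8 * hess_hi * V n x * \<bar>y - x\<bar> * \<bar>y - x\<bar>" by (rule mult_right_mono) simp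
  then show "\<bar>S m y - S m x - DS m x * (y - x)\<bar> \<le> 8 * hess_hi * V n x * \<bar>y - x\<bar> * \<bar>y - x\<bar>"
    unfolding z(2) left_diff_distrib[symmetric] abs_mult .
qed

text \<open>The function \<open>sing\<close> is not integrable: cut off at distance \<open>a\<close>
  it is continuous and its integral is at least \<open>a * a powr (-2-\<gamma>)\<close>, which is at
  least \<open>1 / a\<close>. Uniform equidistribution of the cut-off function bounds
  \<open>V n x\<close> from below, uniformly in \<open>x\<close>.\<close>

lemma V_superlinear: "\<exists>n0::int. 0 < n0 \<and> (\<forall>n\<ge>n0. \<forall>x. clear n x \<longrightarrow> Q * of_int n \<le> V n x)"
proof -
  define a where "a = 1 / (max Q 1 + 1)"
  have a: "0 < a" "a \<le> 1/2" by (auto simp: a_def field_simps)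
  have aQ: "Q + 1 \<le> 1 / a" by (simp add: a_def)
  define g where "g x = max (int_dist x) a powr (-2-\<gamma>)" for x
  have gc: "continuous_on UNIV g"
    unfolding g_def[abs_def] using a by (intro continuous_intros int_dist_continuous) (auto simp: max_def)
  have gp: "periodic1 g" using int_dist_add_int[of _ 1] by (simp add: g_def periodic1_def)
  have [measurable]: "g \<in> borel_measurable borel" by (intro borel_measurable_continuous_onI gc)
  obtain Bd where Bd: "Bd > 0" "\<And>x. \<bar>g x\<bar> \<le> Bd" using periodic1_bounded_uniform(1)[OF gc gp] by blast
  have gi: "integrable circ g" by (rule circ.integrable_const_bound[where B = Bd]) (use Bd in auto)
  have int: "Q + 1 \<le> (\<integral>x. g x \<partial>circ)"
  proof -
    have "1 / a = a powr (-1)" using a by (simp add: powr_minus_divide)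
    also have "\<dots> \<le> a powr (-1-\<gamma>)" using a gamma powr_mono'[of "-1-\<gamma>" "-1" a] by auto
    also have "\<dots> = a * a powr (-2-\<gamma>)" using a powr_add[of a 1 "-2-\<gamma>"] by simp
    also have "\<dots> = (\<integral>x. indicator {0..a} x * a powr (-2-\<gamma>) \<partial>circ)"
    proof -
      have "measure circ {0..a} = a"
      proof -
        have "{0..<1} \<inter> {0..a} = {0..a}" using a by auto
        then have "emeasure circ {0..a} = ennreal a" using a by (simp add: emeasure_circ)
        then show ?thesis using a by (simp add: measure_def)
      qed
      then show ?thesis by simp
    qed
    also have "\<dots> \<le> (\<integral>x. g x \<partial>circ)"
    proof (rule integral_mono[OF _ gi])
      show "integrable circ (\<lambda>x. indicator {0..a} x * a powr (-2-\<gamma>))"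
        by (intro integrable_mult_left integrable_real_indicator) (auto simp: circ.emeasure_finite less_top[symmetric])
      fix x
      show "indicator {0..a} x * a powr (-2-\<gamma>) \<le> g x"
      proof (cases "x \<in> {0..a}")
        case True
        then have "int_dist x \<le> a" using int_dist_le[of x 0] by auto
        then show ?thesis using True by (simp add: g_def max_def)
      qed (simp add: g_def)
    qed
    finally show ?thesis using aQ by linarith
  qed
  obtain n0 where n0: "\<And>n x. n \<ge> n0 \<Longrightarrow> \<bar>(\<Sum>k<n. g (x + real k * \<alpha>)) - real n * (\<integral>x. g x \<partial>circ)\<bar> \<le> 1 * real n"
    using uniform_equidistribution[OF irrational gc gp, of 1] by auto
  have "Q * of_int n \<le> V n x" if n: "n \<ge> int n0 + 1" and c: "clear n x" for n x
  proof -
    define m where "m = nat n"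
    have m: "n = int m" "m \<ge> n0" using n by (auto simp: m_def)
    have "g y \<le> sing y" if "y \<notin> \<int>" for y
    proof -
      have "0 < int_dist y" using that int_dist_pos_iff by simp
      then show ?thesis unfolding g_def sing_def using gamma by (intro powr_mono2') auto
    qed
    then have "(\<Sum>k<m. g (x + real k * \<alpha>)) \<le> V n x"
      unfolding m(1) birkhoff_nat using c m by (intro sum_mono) (auto simp: clear_def dest: bspec[of _ _ "int _"])
    moreover have "real m * (Q + 1) \<le> real m * (\<integral>x. g x \<partial>circ)" using int by (intro mult_left_mono) auto
    ultimately show ?thesis using n0[OF m(2), of x] m(1) by (simp add: algebra_simps abs_le_iff)
  qed
  then show ?thesis by (intro exI[of _ "int n0 + 1"]) auto
qed

text \<open>As \<open>V\<close> grows faster than \<open>n\<close>, for large \<open>n\<close> the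
  correction \<open>hess_shift * n\<close> is at most half of \<open>hess_lo * V\<close>, and the
  second derivative is positive all the way from \<open>x\<close> to \<open>y\<close>. The 16
  consists of this 2 and of the 8 by which \<open>V\<close> may vary.\<close>

lemma near_DS_lower:
  "\<exists>n0::int. 0 < n0 \<and> (\<forall>n\<ge>n0. \<forall>x y. near n x y \<longrightarrow> hess_lo / 16 * V n x * \<bar>y - x\<bar> \<le> \<bar>DS n y - DS n x\<bar>)"
proof -
  obtain n0 where n0: "0 < n0" "\<And>n x. n \<ge> n0 \<Longrightarrow> clear n x \<Longrightarrow> 2 * hess_shift / hess_lo * of_int n \<le> V n x"
    using V_superlinear[of "2 * hess_shift / hess_lo"] by blast
  have "hess_lo / 16 * V n x * \<bar>y - x\<bar> \<le> \<bar>DS n y - DS n x\<bar>" if n: "n \<ge> n0" and near: "near n x y" for n x y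
  proof -
    have n_pos: "0 \<le> n" using n n0(1) by simp
    have cl: "clear n z" if "\<bar>z - x\<bar> \<le> \<bar>y - x\<bar>" for z using near_clear[OF near_between[OF near that]] .
    obtain z where z: "\<bar>z - x\<bar> \<le> \<bar>y - x\<bar>" "DS n y - DS n x = DDS n z * (y - x)"
      using mean_value_abs[of x y "DS n" "DDS n"] birkhoff_deriv(2)[OF cl n_pos] by blast
    have "hess_shift * of_int n \<le> hess_lo / 2 * V n z"
      using n0(2)[OF n cl[OF z(1)]] hess(1) by (simp add: field_simps)
    then have "hess_lo / 2 * V n z \<le> DDS n z" using DDS_bounds(2)[OF cl[OF z(1)] n_pos] by simp
    moreover have "hess_lo / 16 * V n x \<le> hess_lo / 2 * V n z"
      using near_V(2)[OF near_between[OF near z(1)] n_pos] hess(1) by simp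
    ultimately have "hess_lo / 16 * V n x \<le> \<bar>DDS n z\<bar>" by linarith
    then show ?thesis unfolding z(2) abs_mult by (rule mult_right_mono) simp
  qed
  then show ?thesis using n0(1) by blast
qed

subsection \<open>Good points\<close>

text \<open>The orbit stays \<open>\<eta>\<close>-far from the singularity within \<open>k\<close>
  steps of the present crossing. A change of the crossing number by at most \<open>k\<close> then
  changes a Birkhoff sum only by \<open>k\<close> bounded terms.\<close>

definition generic :: "int \<Rightarrow> real \<Rightarrow> real \<Rightarrow> real \<Rightarrow> bool" where
  "generic k \<eta> x u \<longleftrightarrow> (\<forall>j\<in>{-k..k}. \<eta> \<le> int_dist (x + of_int (cr x u + j) * \<alpha>))"

text \<open>The position at height \<open>u\<close> over the base point is at height
  \<open>u - S n x\<close> over its own floor. To first order, moving \<open>x\<close> by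
  \<open>y\<close> therefore has the effect of the flow time \<open>- vel x u * y\<close>.\<close>

definition vel :: "real \<Rightarrow> real \<Rightarrow> real" where
  "vel x u = DS (cr x u) x"

definition curv :: "real \<Rightarrow> real \<Rightarrow> real" where
  "curv x u = V (cr x u) x"

lemma vel_measurable [measurable (raw)]:
  assumes [measurable]: "f \<in> borel_measurable L" "g \<in> borel_measurable L"
  shows "(\<lambda>z. vel (f z) (g z)) \<in> borel_measurable L"
  unfolding vel_def by measurable

lemma curv_measurable [measurable (raw)]:
  assumes [measurable]: "f \<in> borel_measurable L" "g \<in> borel_measurable L"
  shows "(\<lambda>z. curv (f z) (g z)) \<in> borel_measurable L"
  unfolding curv_def by measurable

lemma generic_measurable [measurable (raw)]:
  assumes [measurable]: "f \<in> borel_measurable L" "g \<in> borel_measurable L"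
  shows "Measurable.pred L (\<lambda>z. generic k \<eta> (f z) (g z))"
proof -
  have "(\<lambda>z. int_dist (f z + of_int (cr (f z) (g z) + j) * \<alpha>)) \<in> borel_measurable L" for j
    by (rule measurable_compose_countable[of "\<lambda>n z. int_dist (f z + of_int (n + j) * \<alpha>)" L borel "\<lambda>z. cr (f z) (g z)"]) measurable
  note [measurable] = this
  show ?thesis unfolding generic_def by measurable
qed

lemma generic_mono: "generic k \<eta> x u \<Longrightarrow> k' \<le> k \<Longrightarrow> generic k' \<eta> x u"
  by (auto simp: generic_def)

definition away :: "real \<Rightarrow> real" where
  "away \<eta> = (SOME B. B > 0 \<and> (\<forall>x. \<eta> \<le> int_dist x \<longrightarrow>
     \<bar>\<Phi> x\<bar> \<le> B \<and> \<bar>deriv \<Phi> x\<bar> \<le> B \<and> \<bar>D2 x\<bar> \<le> B \<and> sing x \<le> B))"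

lemma away:
  assumes "0 < \<eta>"
  shows "0 < away \<eta>" "\<eta> \<le> int_dist x \<Longrightarrow> \<bar>\<Phi> x\<bar> \<le> away \<eta>" "\<eta> \<le> int_dist x \<Longrightarrow> \<bar>deriv \<Phi> x\<bar> \<le> away \<eta>"
    "\<eta> \<le> int_dist x \<Longrightarrow> \<bar>sing x\<bar> \<le> away \<eta>"
  using someI_ex[OF roof_bounded_away[OF assms]] unfolding away_def[symmetric] by auto

lemma roof_lipschitz_away:
  assumes \<eta>: "0 < \<eta>" and x: "\<eta> \<le> int_dist x" and y: "\<bar>y - x\<bar> \<le> \<eta>/2"
  shows "\<bar>\<Phi> y - \<Phi> x\<bar> \<le> away (\<eta>/2) * \<bar>y - x\<bar>"
proof -
  have d: "\<eta>/2 \<le> int_dist z" if "\<bar>z - x\<bar> \<le> \<bar>y - x\<bar>" for z using int_dist_lipschitz[of z x] x y that by linarith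
  then have ni: "z \<notin> \<int>" if "\<bar>z - x\<bar> \<le> \<bar>y - x\<bar>" for z
    using that \<eta> int_dist_pos_iff[of z] by (metis half_gt_zero less_le_trans)
  obtain z where z: "\<bar>z - x\<bar> \<le> \<bar>y - x\<bar>" "\<Phi> y - \<Phi> x = deriv \<Phi> z * (y - x)"
    using mean_value_abs[of x y \<Phi> "deriv \<Phi>"] roof_deriv(1)[OF ni] by blast
  have "\<bar>deriv \<Phi> z\<bar> \<le> away (\<eta>/2)" using away(3)[OF _ d[OF z(1)]] \<eta> by simp
  then show ?thesis unfolding z(2) abs_mult by (rule mult_right_mono) simp
qed

lemma generic_near:
  assumes g: "generic k \<eta> x u" and j: "\<bar>j\<bar> \<le> k" and y: "\<bar>y - x\<bar> \<le> \<eta>/2"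
  shows "\<eta>/2 \<le> int_dist (y + of_int (cr x u + j) * \<alpha>)"
proof -
  have "j \<in> {-k..k}" using j by auto
  then have "\<eta> \<le> int_dist (x + of_int (cr x u + j) * \<alpha>)" using g unfolding generic_def by blast
  moreover have "\<bar>int_dist (y + of_int (cr x u + j) * \<alpha>) - int_dist (x + of_int (cr x u + j) * \<alpha>)\<bar> \<le> \<bar>y - x\<bar>"
    using int_dist_lipschitz[of "y + of_int (cr x u + j) * \<alpha>" "x + of_int (cr x u + j) * \<alpha>"] by simp
  ultimately show ?thesis using y by linarith
qed

lemma generic_roof_lipschitz:
  assumes \<eta>: "0 < \<eta>" and g: "generic k \<eta> x u" and j: "\<bar>j\<bar> \<le> k" and y: "\<bar>y - x\<bar> \<le> \<eta>/2"
  shows "\<bar>\<Phi> (y + of_int (cr x u + j) * \<alpha>) - \<Phi> (x + of_int (cr x u + j) * \<alpha>)\<bar> \<le> away (\<eta>/2) * \<bar>y - x\<bar>"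
proof -
  have "j \<in> {-k..k}" using j by auto
  then have "\<eta> \<le> int_dist (x + of_int (cr x u + j) * \<alpha>)" using g unfolding generic_def by blast
  from roof_lipschitz_away[OF \<eta> this, of "y + of_int (cr x u + j) * \<alpha>"] y show ?thesis by simp
qed

text \<open>Going from \<open>x\<close> to \<open>y\<close> displaces the floor of the current
  crossing by at most \<open>L\<close> and its ceiling by at most \<open>L + 1\<close>; each
  crossing takes at least \<open>roof_min\<close>.\<close>

lemma crossing_stable:
  assumes rx: "regular x" and ry: "regular y" and L: "\<bar>S (cr x u) y - S (cr x u) x\<bar> \<le> L"
    and P: "\<bar>\<Phi> (y + of_int (cr x u) * \<alpha>) - \<Phi> (x + of_int (cr x u) * \<alpha>)\<bar> \<le> 1"
    and k: "(L + 1) / roof_min + 1 \<le> of_int k"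
  shows "\<bar>cr y u - cr x u\<bar> \<le> k"
proof -
  let ?n = "cr x u" and ?n' = "cr y u"
  have L0: "0 \<le> L" using L by linarith
  have "of_int (?n - ?n') \<le> L / roof_min + 1"
    by (rule cr_diff_le[OF ry, where u = u]) (use L cr_bounds[OF rx, of u] cr_bounds[OF ry, of u] L0 in auto)
  moreover have "L / roof_min \<le> (L + 1) / roof_min" using roof_min(1) by (simp add: divide_right_mono)
  moreover have "of_int (?n' - ?n) \<le> (L + 1) / roof_min + 1"
  proof (rule cr_diff_le[OF ry, where u = "u - (L + 1)"])
    show "S ?n' y \<le> u - (L + 1) + (L + 1)" using cr_bounds[OF ry, of u] by simp
    show "u - (L + 1) < S (?n + 1) y" using cr_bounds(2)[OF rx, of u] L P S_Suc[of ?n x] S_Suc[of ?n y] by linarith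
  qed (use L0 in simp)
  ultimately show ?thesis using k by linarith
qed

text \<open>Two bad points within \<open>\<kappa>2 / sqrt V\<close> of each other, \<open>V\<close> the size of the second derivative, are within the smaller
  distance \<open>\<kappa>1 / sqrt V\<close>: between them the derivative is at most of order \<open>sqrt V\<close> but grows at rate \<open>V\<close>.\<close>

lemma bad_set:
  assumes A: "A > 0" and \<epsilon>: "\<epsilon> > 0"
  shows "\<exists>k. \<forall>\<eta>>0. \<exists>n0. \<forall>u. emeasure lborel {x \<in> {0..<1}. regular x \<and> generic k \<eta> x u \<and> n0 \<le> cr x u \<and>
     (vel x u)\<^sup>2 < A * curv x u} \<le> ennreal \<epsilon>"
proof -
  define e where "e = \<epsilon> / 15"
  have e: "e > 0" using \<epsilon> by (simp add: e_def)
  define c where "c = hess_lo / 16"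
  have c: "c > 0" using hess(1) by (simp add: c_def)
  \<comment> \<open>The 5 is \<open>1 + 3 + 1\<close>, in units of \<open>sqrt A * sqrt V\<close>:
    the velocity at \<open>x\<close>, the velocity at \<open>y\<close>, where \<open>V\<close> may
    be 9 times as large, and the change of the crossing number. Dividing by the growth rate
    \<open>c\<close> bounds the distance of two bad points. \<open>\<kappa>2\<close> is larger by
    \<open>1 / e\<close>, the ratio for \<open>porous_measure_le\<close>, which then yields
    \<open>15 * e = \<epsilon>\<close>.\<close>
  define \<kappa>1 where "\<kappa>1 = 5 * sqrt A / c"
  define \<kappa>2 where "\<kappa>2 = \<kappa>1 / e"
  have \<kappa>: "\<kappa>1 > 0" "\<kappa>2 > 0" "\<kappa>1 = e * \<kappa>2" using A c e by (auto simp: \<kappa>1_def \<kappa>2_def)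
  \<comment> \<open>A Taylor bound for the change of the Birkhoff sum over the distance
    \<open>\<kappa>2 / sqrt V\<close>. The powers of \<open>V\<close> cancel, so \<open>L\<close>
    and the number \<open>k\<close> of additional crossings depend only on \<open>A\<close> and
    \<open>\<epsilon>\<close>.\<close>
  define L where "L = sqrt A * \<kappa>2 + 8 * hess_hi * \<kappa>2\<^sup>2"
  define k where "k = \<lceil>(L + 1) / roof_min + 1\<rceil>"
  have L0: "0 \<le> L" unfolding L_def using A \<kappa> hess(2) by (intro add_nonneg_nonneg mult_nonneg_nonneg) auto
  have kL: "(L + 1) / roof_min + 1 \<le> of_int k" unfolding k_def by linarith
  have k0: "0 \<le> k"
  proof -
    have "0 \<le> (L + 1) / roof_min + 1" using L0 roof_min(1) by simp
    then have "(0::real) \<le> of_int k" using kL by linarith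
    then show ?thesis by simp
  qed
  obtain n1 where n1: "0 < n1" "\<And>n x y. n \<ge> n1 \<Longrightarrow> near n x y \<Longrightarrow> c * V n x * \<bar>y - x\<bar> \<le> \<bar>DS n y - DS n x\<bar>"
    using near_DS_lower unfolding c_def by blast
  have "\<exists>n0. \<forall>u. emeasure lborel {x \<in> {0..<1}. regular x \<and> generic k \<eta> x u \<and> n0 \<le> cr x u \<and>
     (vel x u)\<^sup>2 < A * curv x u} \<le> ennreal \<epsilon>" if \<eta>: "\<eta> > 0" for \<eta>
  proof -
    define B where "B = away (\<eta>/2)"
    have B: "B > 0" using away(1)[of "\<eta>/2"] \<eta> by (simp add: B_def)
    \<comment> \<open>A lower bound for \<open>V\<close> that provides, in this order:
      \<open>V >= 1\<close>, a radius of at most 1, the hypothesis of \<open>nearI\<close>, distance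
      at most \<open>\<eta>/2\<close>, variation of the roof at most 1, and that \<open>k\<close>
      terms of size \<open>B\<close> are at most \<open>V\<close> and at most
      \<open>sqrt A * sqrt V\<close>.\<close>
    define W where "W = Max {1, \<kappa>2\<^sup>2, (2 * \<kappa>2) powr (1/beta), (2 * \<kappa>2 / \<eta>)\<^sup>2, (B * \<kappa>2)\<^sup>2, of_int k * B, (of_int k * B)\<^sup>2 / A}"
    have W: "1 \<le> W" "\<kappa>2\<^sup>2 \<le> W" "(2 * \<kappa>2) powr (1/beta) \<le> W" "(2 * \<kappa>2 / \<eta>)\<^sup>2 \<le> W" "(B * \<kappa>2)\<^sup>2 \<le> W"
      "of_int k * B \<le> W" "(of_int k * B)\<^sup>2 / A \<le> W" unfolding W_def by (rule Max_ge, simp, blast)+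
    \<comment> \<open>Enough crossings, because \<open>V\<close> is at least their number.\<close>
    define n0 where "n0 = max n1 \<lceil>W\<rceil>"
    have "emeasure lborel {x \<in> {0..<1}. regular x \<and> generic k \<eta> x u \<and> n0 \<le> cr x u \<and>
     (vel x u)\<^sup>2 < A * curv x u} \<le> ennreal \<epsilon>" (is "emeasure lborel ?b \<le> _") for u
    proof -
      have sets: "?b \<in> sets borel"
      proof -
        have "?b = {x \<in> space borel. x \<in> {0..<1} \<and> regular x \<and> generic k \<eta> x u \<and> n0 \<le> cr x u \<and> (vel x u)\<^sup>2 < A * curv x u}" by auto
        also have "\<dots> \<in> sets borel" by measurable
        finally show ?thesis .
      qed
      have props: "regular x" "generic k \<eta> x u" "n1 \<le> cr x u" "0 < cr x u" "W \<le> V (cr x u) x"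
         "\<bar>vel x u\<bar> \<le> sqrt A * sqrt (V (cr x u) x)" if x: "x \<in> ?b" for x
      proof -
        show "regular x" "generic k \<eta> x u" "n1 \<le> cr x u" using x by (auto simp: n0_def)
        then show p: "0 < cr x u" using n1(1) by simp
        have "\<lceil>W\<rceil> \<le> cr x u" using x by (auto simp: n0_def)
        then have "W \<le> of_int (cr x u)" by linarith
        then show "W \<le> V (cr x u) x" using V_ge[OF regular_clear[OF \<open>regular x\<close>], of "cr x u"] p by simp
        have "(vel x u)\<^sup>2 \<le> A * V (cr x u) x" using x by (auto simp: curv_def)
        then have "sqrt ((vel x u)\<^sup>2) \<le> sqrt (A * V (cr x u) x)" by (rule real_sqrt_le_mono)
        then show "\<bar>vel x u\<bar> \<le> sqrt A * sqrt (V (cr x u) x)" by (simp add: real_sqrt_mult)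
      qed
      have sqV: "\<kappa>2 \<le> t * sqrt v" if "(\<kappa>2 / t)\<^sup>2 \<le> v" "0 < t" for v t
      proof -
        have "\<kappa>2 / t \<le> sqrt v" using that(1) by (rule real_le_rsqrt)
        then show ?thesis using that(2) by (simp add: field_simps)
      qed
      have main: "\<bar>y - x\<bar> \<le> e * (\<kappa>2 / sqrt (V (cr x u) x))"
        if x: "x \<in> ?b" and y: "y \<in> ?b" and yx: "\<bar>y - x\<bar> \<le> \<kappa>2 / sqrt (V (cr x u) x)" for x y
      proof -
        define n where "n = cr x u"
        define n' where "n' = cr y u"
        define v where "v = V n x"
        define \<delta> where "\<delta> = \<bar>y - x\<bar>"
        note px = props[OF x, folded n_def] and py = props[OF y, folded n'_def]
        have Wv: "W \<le> v" using px(5) by (simp add: v_def)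
        have v1: "1 \<le> v" using Wv W(1) by linarith
        have sv: "sqrt v > 0" "sqrt v * sqrt v = v" using v1 by auto
        have d: "\<delta> \<le> \<kappa>2 / sqrt v" using yx by (simp add: \<delta>_def v_def n_def)
        have d0: "0 \<le> \<delta>" by (simp add: \<delta>_def)
        have dsv: "sqrt v * \<delta> \<le> \<kappa>2" using d sv(1) by (simp add: field_simps)
        have n0: "0 \<le> n" using px(4) by simp
        have nearxy: "near n x y"
        proof (rule nearI[OF regular_clear[OF px(1)] px(4)])
          show "\<bar>y - x\<bar> \<le> \<kappa>2 / sqrt (V n x)" using d by (simp add: \<delta>_def v_def)
          have "2 * \<kappa>2 = ((2 * \<kappa>2) powr (1/beta)) powr beta" using \<kappa> beta_pos by (simp add: powr_powr)
          also have "\<dots> \<le> v powr beta" using W(3) Wv beta_pos by (intro powr_mono2) auto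
          finally show "2 * \<kappa>2 \<le> V n x powr beta" by (simp add: v_def)
        qed
        have d\<eta>: "\<delta> \<le> \<eta>/2"
        proof -
          have "(\<kappa>2 / (\<eta>/2))\<^sup>2 \<le> v" using W(4) Wv by (simp add: power_divide mult.commute)
          then have "\<kappa>2 \<le> \<eta>/2 * sqrt v" using \<eta> by (intro sqV) auto
          then have "\<kappa>2 / sqrt v \<le> \<eta>/2" using sv(1) by (simp add: field_simps)
          then show ?thesis using d by linarith
        qed
        have Bd: "B * \<delta> \<le> 1"
        proof -
          have "(\<kappa>2 / (1/B))\<^sup>2 \<le> v" using W(5) Wv by (simp add: mult.commute)
          then have "\<kappa>2 \<le> 1/B * sqrt v" using B by (intro sqV) auto
          then have "\<kappa>2 / sqrt v \<le> 1/B" using sv(1) by (simp add: field_simps)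
          then have "\<delta> \<le> 1/B" using d by linarith
          then show ?thesis using B by (simp add: field_simps)
        qed
        have velx: "\<bar>DS n x\<bar> \<le> sqrt A * sqrt v" using px(6) by (simp add: vel_def n_def v_def)
        have SL: "\<bar>S n y - S n x\<bar> \<le> L"
        proof -
          have 1: "\<bar>S n y - S n x - DS n x * (y - x)\<bar> \<le> 8 * hess_hi * v * \<delta> * \<delta>"
            using near_DS(2)[OF nearxy n0 order_refl] by (simp add: v_def \<delta>_def)
          have "8 * hess_hi * v * \<delta> * \<delta> = 8 * hess_hi * ((sqrt v * \<delta>) * (sqrt v * \<delta>))"
            using sv(2) by (metis (no_types, lifting) mult.assoc mult.left_commute)
          also have "\<dots> \<le> 8 * hess_hi * (\<kappa>2 * \<kappa>2)"
            using dsv sv(1) d0 hess(2) \<kappa> by (intro mult_left_mono mult_mono) auto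
          finally have 2: "8 * hess_hi * v * \<delta> * \<delta> \<le> 8 * hess_hi * \<kappa>2\<^sup>2" by (simp add: power2_eq_square)
          have "\<bar>DS n x * (y - x)\<bar> \<le> sqrt A * sqrt v * \<delta>"
            unfolding abs_mult \<delta>_def by (intro mult_right_mono velx) auto
          also have "\<dots> \<le> sqrt A * \<kappa>2" using dsv A by (simp add: mult.assoc mult_left_mono)
          finally show ?thesis using 1 2 unfolding L_def by linarith
        qed
        \<comment> \<open>The bad points \<open>x\<close> and \<open>y\<close> may have different
          crossing numbers. The growth of the derivative is known for the common index
          \<open>n\<close> only, so the derivative at \<open>y\<close> is transferred from
          \<open>n'\<close> to \<open>n\<close> at the cost of \<open>k\<close> bounded
          terms.\<close>
        have nn: "\<bar>n' - n\<bar> \<le> k" unfolding n_def n'_def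
        proof (rule crossing_stable[OF px(1) py(1) _ _ kL])
          show "\<bar>S (cr x u) y - S (cr x u) x\<bar> \<le> L" using SL by (simp add: n_def)
          have "\<bar>\<Phi> (y + of_int (cr x u + 0) * \<alpha>) - \<Phi> (x + of_int (cr x u + 0) * \<alpha>)\<bar> \<le> B * \<delta>"
            unfolding B_def \<delta>_def by (rule generic_roof_lipschitz[OF \<eta> px(2)]) (use k0 d\<eta> in \<open>auto simp: \<delta>_def\<close>)
          then show "\<bar>\<Phi> (y + of_int (cr x u) * \<alpha>) - \<Phi> (x + of_int (cr x u) * \<alpha>)\<bar> \<le> 1" using Bd by simp
        qed
        have gy: "\<eta>/2 \<le> int_dist (y + of_int (n + j) * \<alpha>)" if "\<bar>j\<bar> \<le> k" for j
          unfolding n_def by (rule generic_near[OF px(2) that]) (use d\<eta> in \<open>simp add: \<delta>_def\<close>)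
        have DSd: "\<bar>DS n' y - DS n y\<bar> \<le> of_int k * B"
          by (rule birkhoff_diff_le[OF nn]) (use away(3)[OF _ gy] \<eta> in \<open>auto simp: B_def\<close>)
        have Vd: "\<bar>V n' y - V n y\<bar> \<le> of_int k * B"
          by (rule birkhoff_diff_le[OF nn]) (use away(4)[OF _ gy] \<eta> in \<open>auto simp: B_def\<close>)
        have V9: "V n' y \<le> 9 * v" using Vd near_V(1)[OF nearxy n0] W(6) Wv unfolding v_def by linarith
        have "sqrt (V n' y) \<le> sqrt (9 * v)" by (rule real_sqrt_le_mono[OF V9])
        then have "sqrt (V n' y) \<le> 3 * sqrt v" by (simp add: real_sqrt_mult)
        then have "sqrt A * sqrt (V n' y) \<le> sqrt A * (3 * sqrt v)" using A by (intro mult_left_mono) auto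
        then have vely: "\<bar>DS n' y\<bar> \<le> 3 * (sqrt A * sqrt v)" using py(6) by (simp add: vel_def n'_def)
        have kB: "of_int k * B \<le> sqrt A * sqrt v"
        proof -
          have "(of_int k * B)\<^sup>2 / A \<le> v" using W(7) Wv by linarith
          then have "(of_int k * B)\<^sup>2 \<le> A * v" using A by (simp add: pos_divide_le_eq mult.commute)
          then have "of_int k * B \<le> sqrt (A * v)" by (rule real_le_rsqrt)
          then show ?thesis by (simp add: real_sqrt_mult)
        qed
        have "c * v * \<delta> \<le> \<bar>DS n y - DS n x\<bar>" using n1(2)[OF px(3) nearxy] by (simp add: v_def \<delta>_def)
        also have "\<dots> \<le> 5 * (sqrt A * sqrt v)" using velx vely DSd kB by linarith
        finally have "c * (sqrt v * sqrt v) * \<delta> \<le> 5 * (sqrt A * sqrt v)" unfolding sv(2) .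
        then have "(c * sqrt v * \<delta>) * sqrt v \<le> (5 * sqrt A) * sqrt v" by (simp add: mult_ac)
        then have "c * sqrt v * \<delta> \<le> 5 * sqrt A" by (rule mult_right_le_imp_le[OF _ sv(1)])
        then have "\<delta> \<le> \<kappa>1 / sqrt v" using sv(1) c unfolding \<kappa>1_def by (simp add: field_simps)
        then show ?thesis using \<kappa>(3) by (simp add: \<delta>_def v_def n_def)
      qed
      have "emeasure lborel ?b \<le> ennreal (15 * e)"
      proof (rule porous_measure_le[OF sets _ e])
        show "?b \<subseteq> {0..1}" by auto
        show "0 < \<kappa>2 / sqrt (V (cr x u) x) \<and> \<kappa>2 / sqrt (V (cr x u) x) \<le> 1" if x: "x \<in> ?b" for x
        proof -
          have "W \<le> V (cr x u) x" using props[OF x] by simp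
          then have "\<kappa>2 \<le> 1 * sqrt (V (cr x u) x)" using W(2) by (intro sqV) auto
          moreover have "0 < sqrt (V (cr x u) x)" using \<open>W \<le> V (cr x u) x\<close> W(1) by simp
          ultimately show ?thesis using \<kappa>(2) by simp
        qed
      qed (rule main)
      then show ?thesis by (simp add: e_def)
    qed
    then show ?thesis by blast
  qed
  then show ?thesis by blast
qed

end

section \<open>Measures of the exceptional sets\<close>

lemma (in mp_flow) measure_K:
  assumes "A \<in> sets M" shows "measure M (K t -` A \<inter> space M) = measure M A"
  using measure_distr[OF K_measurable assms, of t] by (simp add: K_distr)

lemma gaps_0_mono:
  assumes g: "gaps n 0 t" and ij: "i \<le> j" "j < n" shows "t i \<le> t j"
  using ij
proof (induction j rule: dec_induct)
  case (step m)
  then have "t m \<le> t (Suc m)" using g by (auto simp: gaps_def)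
  then show ?case using step by simp
qed simp

lemma Max_image_diff_le:
  fixes f g :: "'b \<Rightarrow> real"
  assumes "finite I" "I \<noteq> {}" and d: "\<And>i. i \<in> I \<Longrightarrow> \<bar>f i - g i\<bar> \<le> d"
  shows "\<bar>Max (f ` I) - Max (g ` I)\<bar> \<le> d"
proof -
  have "Max (f ` I) \<le> Max (g ` I) + d" if d: "\<And>i. i \<in> I \<Longrightarrow> \<bar>f i - g i\<bar> \<le> d" for f g :: "'b \<Rightarrow> real"
  proof -
    have "f i \<le> Max (g ` I) + d" if "i \<in> I" for i
    proof -
      have "g i \<le> Max (g ` I)" using assms(1) that by simp
      then show ?thesis using d[OF that] by linarith
    qed
    then show ?thesis using assms by (subst Max_le_iff) auto
  qed
  from this[of f g] this[of g f] d show ?thesis by (auto simp: abs_minus_commute abs_le_iff)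
qed

context power_roof
begin

abbreviation ungeneric :: "int \<Rightarrow> real \<Rightarrow> real \<Rightarrow> real" where
  "ungeneric k \<eta> t \<equiv> measure \<mu> {z \<in> \<Omega>. \<not> generic k \<eta> (fst z) (snd z + t)}"

text \<open>Being generic at time \<open>t\<close> depends only on the position
  \<open>K t z\<close>, so invariance of the measure reduces everything to \<open>t = 0\<close>.
  There the exceptional sets decrease to the empty set as \<open>\<eta>\<close> tends to 0, since
  all points of the space are regular.\<close>

lemma generic_measure:
  assumes "\<epsilon> > 0"
  shows "\<exists>\<eta>>0. \<forall>t. ungeneric k \<eta> t \<le> \<epsilon>"
proof -
  define E where "E \<eta> = {z \<in> \<Omega>. \<exists>j\<in>{-k..k}. int_dist (fst z + of_int j * \<alpha>) < \<eta>}" for \<eta>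
  have Es: "E \<eta> \<in> sets \<mu>" for \<eta>
  proof -
    have "E \<eta> = {z \<in> space \<mu>. \<exists>j\<in>{-k..k}. int_dist (fst z + of_int j * \<alpha>) < \<eta>}" by (simp add: E_def)
    also have "\<dots> \<in> sets \<mu>" by measurable
    finally show ?thesis .
  qed
  have "(\<lambda>m. measure \<mu> (E (1 / real (Suc m)))) \<longlonglongrightarrow> measure \<mu> (\<Inter>m. E (1 / real (Suc m)))"
  proof (rule finite_Lim_measure_decseq)
    show "range (\<lambda>m. E (1 / real (Suc m))) \<subseteq> sets \<mu>" using Es by auto
    show "decseq (\<lambda>m. E (1 / real (Suc m)))"
    proof (rule decseq_SucI)
      fix m
      have "1 / real (Suc (Suc m)) \<le> 1 / real (Suc m)" by (simp add: field_simps)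
      then show "E (1 / real (Suc (Suc m))) \<subseteq> E (1 / real (Suc m))" unfolding E_def by (auto intro: less_le_trans)
    qed
  qed
  moreover have "(\<Inter>m. E (1 / real (Suc m))) = {}"
  proof (rule ccontr)
    assume "(\<Inter>m. E (1 / real (Suc m))) \<noteq> {}"
    then obtain z where z: "\<And>m. z \<in> E (1 / real (Suc m))" by auto
    obtain x r where xr: "z = (x, r)" by (cases z)
    have rx: "regular x" using z[of 0] xr by (auto simp: E_def space_iff)
    define d where "d = Min (insert 1 ((\<lambda>j. int_dist (x + of_int j * \<alpha>)) ` {-k..k}))"
    have "d > 0" unfolding d_def using regular_nonint[OF rx] by (auto simp: int_dist_pos_iff)
    then obtain m where "1 / real (Suc m) < d" by (metis nat_approx_posE)
    moreover obtain j where j: "j \<in> {-k..k}" "int_dist (x + of_int j * \<alpha>) < 1 / real (Suc m)"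
      using z[of m] xr by (auto simp: E_def)
    moreover have "d \<le> int_dist (x + of_int j * \<alpha>)" unfolding d_def using j(1) by (intro Min_le) auto
    ultimately show False by linarith
  qed
  ultimately have "(\<lambda>m. measure \<mu> (E (1 / real (Suc m)))) \<longlonglongrightarrow> 0" by simp
  then have "eventually (\<lambda>m. measure \<mu> (E (1 / real (Suc m))) < \<epsilon>) sequentially" using assms by (rule order_tendstoD)
  then obtain m where m: "measure \<mu> (E (1 / real (Suc m))) < \<epsilon>" by (auto simp: eventually_sequentially)
  let ?\<eta> = "1 / real (Suc m)"
  have "measure \<mu> {z \<in> \<Omega>. \<not> generic k ?\<eta> (fst z) (snd z + t)} \<le> \<epsilon>" for t
  proof -
    have "{z \<in> \<Omega>. \<not> generic k ?\<eta> (fst z) (snd z + t)} = K t -` E ?\<eta> \<inter> space \<mu>"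
    proof (rule set_eqI)
      fix z :: "real \<times> real"
      obtain x r where z: "z = (x, r)" by (cases z)
      show "z \<in> {z \<in> \<Omega>. \<not> generic k ?\<eta> (fst z) (snd z + t)} \<longleftrightarrow> z \<in> K t -` E ?\<eta> \<inter> space \<mu>"
      proof (cases "z \<in> \<Omega>")
        case True
        then have rx: "regular x" using z by (simp add: space_iff)
        let ?n = "cr x (r + t)"
        have "int_dist (frac (x + of_int ?n * \<alpha>) + of_int j * \<alpha>) = int_dist (x + of_int (?n + j) * \<alpha>)" for j
        proof -
          have "frac (x + of_int ?n * \<alpha>) + of_int j * \<alpha> = x + of_int (?n + j) * \<alpha> + of_int (- \<lfloor>x + of_int ?n * \<alpha>\<rfloor>)"
            by (simp add: frac_def algebra_simps)
          then show ?thesis by (simp only: int_dist_add_int)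
        qed
        then have "K t z \<in> E ?\<eta> \<longleftrightarrow> \<not> generic k ?\<eta> x (r + t)"
          using K_in_space[OF rx, of t r] unfolding z E_def generic_def K_eq[OF rx] by (auto simp: not_le)
        then show ?thesis using True z by simp
      qed simp
    qed
    then show ?thesis using measure_K[OF Es, of t ?\<eta>] m by simp
  qed
  then show ?thesis by (intro exI[of _ ?\<eta>]) auto
qed

lemma tail_measure:
  fixes g :: "real \<times> real \<Rightarrow> real"
  assumes [measurable]: "g \<in> borel_measurable \<mu>" and e: "\<epsilon> > 0"
  shows "\<exists>T\<ge>0. measure \<mu> {z \<in> \<Omega>. T < g z} \<le> \<epsilon>"
proof -
  have "(\<lambda>m. measure \<mu> {z \<in> space \<mu>. real m < g z}) \<longlonglongrightarrow> measure \<mu> (\<Inter>m. {z \<in> space \<mu>. real m < g z})"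
  proof (rule finite_Lim_measure_decseq)
    have "{z \<in> space \<mu>. real m < g z} \<in> sets \<mu>" for m by measurable
    then show "range (\<lambda>m. {z \<in> space \<mu>. real m < g z}) \<subseteq> sets \<mu>" by blast
    show "decseq (\<lambda>m. {z \<in> space \<mu>. real m < g z})" by (rule decseq_SucI) auto
  qed
  moreover have "(\<Inter>m. {z \<in> space \<mu>. real m < g z}) = {}"
  proof -
    have "\<exists>m::nat. \<not> real m < g z" for z using real_arch_simple[of "g z"] by (auto simp: not_less)
    then show ?thesis by blast
  qed
  ultimately have "(\<lambda>m. measure \<mu> {z \<in> space \<mu>. real m < g z}) \<longlonglongrightarrow> 0" by simp
  then have "eventually (\<lambda>m. measure \<mu> {z \<in> space \<mu>. real m < g z} < \<epsilon>) sequentially" using e by (rule order_tendstoD)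
  then obtain m where "measure \<mu> {z \<in> space \<mu>. real m < g z} < \<epsilon>" by (auto simp: eventually_sequentially)
  then show ?thesis by (intro exI[of _ "real m"]) simp
qed

text \<open>Fewer than \<open>n0\<close> crossings up to time \<open>t\<close> means that
  \<open>S n0 x\<close> exceeds \<open>t\<close>, a tail event of a fixed function.\<close>

lemma cr_large_measure:
  assumes "\<epsilon> > 0"
  shows "\<exists>T. \<forall>t\<ge>T. measure \<mu> {z \<in> \<Omega>. cr (fst z) (snd z + t) < n0} \<le> \<epsilon>"
proof -
  obtain T where T: "measure \<mu> {z \<in> \<Omega>. T < S n0 (fst z)} \<le> \<epsilon>"
    using tail_measure[of "\<lambda>z. S n0 (fst z)", OF _ assms] birkhoff_measurable'[of \<Phi> fst \<mu> "\<lambda>_. n0"] by auto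
  have "measure \<mu> {z \<in> \<Omega>. cr (fst z) (snd z + t) < n0} \<le> \<epsilon>" if "t \<ge> T" for t
  proof -
    have "measure \<mu> {z \<in> \<Omega>. cr (fst z) (snd z + t) < n0} \<le> measure \<mu> {z \<in> space \<mu>. T < S n0 (fst z)}"
    proof (rule finite_measure_mono)
      show "{z \<in> \<Omega>. cr (fst z) (snd z + t) < n0} \<subseteq> {z \<in> space \<mu>. T < S n0 (fst z)}"
      proof
        fix z assume z: "z \<in> {z \<in> \<Omega>. cr (fst z) (snd z + t) < n0}"
        then have "regular (fst z)" "0 \<le> snd z" by (cases z; simp add: space_iff)+
        then show "z \<in> {z \<in> space \<mu>. T < S n0 (fst z)}" using z cr_le_iff[of "fst z" n0 "snd z + t"] that by auto
      qed
    qed measurable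
    then show ?thesis using T by simp
  qed
  then show ?thesis by blast
qed

lemma strip_sets: "b \<in> sets borel \<Longrightarrow> {z \<in> \<Omega>. snd z < r \<and> (fst z, snd z + t) \<in> b} \<in> sets \<mu>"
proof -
  assume [measurable]: "b \<in> sets borel"
  have [measurable]: "(\<lambda>z. (fst z, snd z + t)) \<in> \<mu> \<rightarrow>\<^sub>M borel" by (intro borel_measurable_Pair) measurable
  show ?thesis by (rule Collect_mu) measurable
qed

text \<open>Slice horizontally: at height \<open>r\<close> the condition concerns only
  \<open>x\<close>, with \<open>u = r + t\<close>. A bound for the slices that is uniform in
  \<open>u\<close> is then integrated over the heights below \<open>r0\<close>.\<close>

lemma strip_measure_le:
  assumes b: "\<And>u. emeasure lborel {x. (x, u) \<in> b} \<le> ennreal \<epsilon>" and bm: "b \<in> sets borel"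
    and r0: "0 \<le> r0" and \<epsilon>: "0 \<le> \<epsilon>"
  shows "measure \<mu> {z \<in> \<Omega>. snd z < r0 \<and> (fst z, snd z + t) \<in> b} \<le> r0 * \<epsilon>"
proof -
  let ?X = "{z \<in> \<Omega>. snd z < r0 \<and> (fst z, snd z + t) \<in> b}"
  have [measurable]: "b \<in> sets borel" by (rule bm)
  have Xs: "?X \<in> sets \<mu>" by (rule strip_sets[OF bm])
  have X: "?X \<subseteq> \<Omega>" "?X \<in> sets (lborel \<Otimes>\<^sub>M lborel)" using Xs sets_mu sets_plane by auto
  have "emeasure \<mu> ?X = emeasure (lborel \<Otimes>\<^sub>M lborel) ?X" unfolding suspension_measure_def
    by (rule emeasure_restrict_space) (use X space_measurable sets_plane in \<open>auto simp: space_pair_measure\<close>)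
  also have "\<dots> = (\<integral>\<^sup>+r. emeasure lborel ((\<lambda>x. (x, r)) -` ?X) \<partial>lborel)"
    by (rule lborel_pair.emeasure_pair_measure_alt2[OF X(2)])
  also have "\<dots> \<le> (\<integral>\<^sup>+r. ennreal \<epsilon> * indicator {0..r0} r \<partial>lborel)"
  proof (rule nn_integral_mono)
    fix r
    show "emeasure lborel ((\<lambda>x. (x, r)) -` ?X) \<le> ennreal \<epsilon> * indicator {0..r0} r"
    proof (cases "r \<in> {0..r0}")
      case True
      have "emeasure lborel ((\<lambda>x. (x, r)) -` ?X) \<le> emeasure lborel {x. (x, r + t) \<in> b}"
      proof (rule emeasure_mono)
        have "(\<lambda>x::real. (x, r + t)) \<in> borel \<rightarrow>\<^sub>M borel" by (intro borel_measurable_Pair) measurable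
        from measurable_sets[OF this bm] show "{x. (x, r + t) \<in> b} \<in> sets lborel" by (simp add: vimage_def)
      qed (auto simp del: space_iff)
      also have "\<dots> \<le> ennreal \<epsilon>" by (rule b)
      also have "\<dots> = ennreal \<epsilon> * indicator {0..r0} r" using True by simp
      finally show ?thesis .
    next
      case False
      then have e: "(\<lambda>x. (x, r)) -` ?X = {}" by (auto simp: space_iff)
      show ?thesis unfolding e by simp
    qed
  qed
  also have "\<dots> = ennreal (r0 * \<epsilon>)" using r0 \<epsilon> by (simp add: nn_integral_cmult ennreal_mult mult.commute)
  finally have "emeasure \<mu> ?X \<le> ennreal (r0 * \<epsilon>)" .
  then show ?thesis unfolding measure_def using r0 \<epsilon> by (simp add: enn2real_leI)
qed

definition good :: "int \<Rightarrow> real \<Rightarrow> int \<Rightarrow> real \<Rightarrow> real \<Rightarrow> real \<Rightarrow> bool" where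
  "good k \<eta> n0 A x u \<longleftrightarrow> generic k \<eta> x u \<and> n0 \<le> cr x u \<and> A * curv x u \<le> (vel x u)\<^sup>2"

lemma good_measurable [measurable (raw)]:
  assumes [measurable]: "f \<in> borel_measurable L" "g \<in> borel_measurable L"
  shows "Measurable.pred L (\<lambda>z. good k \<eta> n0 A (f z) (g z))"
  unfolding good_def by measurable

abbreviation ungood :: "int \<Rightarrow> real \<Rightarrow> int \<Rightarrow> real \<Rightarrow> real \<Rightarrow> real" where
  "ungood k \<eta> n0 A t \<equiv> measure \<mu> {z \<in> \<Omega>. \<not> good k \<eta> n0 A (fst z) (snd z + t)}"

text \<open>Four sets are lost: heights above \<open>r0\<close>, ungeneric points, points with too
  few crossings, and the bad set, whose horizontal slices have measure at most
  \<open>\<epsilon> / (4 * r1)\<close>. The quantifiers allow \<open>k\<close> to be prescribed from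
  below and \<open>n0\<close> to be raised after \<open>\<eta>\<close> is known, as
  \<open>shear_point\<close> requires.\<close>

lemma good_measure:
  assumes A: "A > 0" and \<epsilon>: "\<epsilon> > 0"
  shows "\<exists>k\<ge>k0. \<exists>\<eta>>0. (\<forall>t. ungeneric k \<eta> t \<le> \<epsilon>) \<and>
    (\<forall>n1. \<exists>n0\<ge>n1. \<exists>T. \<forall>t\<ge>T. ungood k \<eta> n0 A t \<le> \<epsilon>)"
proof -
  have e4: "\<epsilon>/4 > 0" using \<epsilon> by simp
  obtain r0 where r0: "r0 \<ge> 0" "measure \<mu> {z \<in> \<Omega>. r0 < snd z} \<le> \<epsilon>/4"
    using tail_measure[OF fst_snd_measurable_mu(2) e4] by auto
  define r1 where "r1 = r0 + 1"
  have r1: "r1 > 0" using r0 by (simp add: r1_def)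
  obtain k1 where k1: "\<And>\<eta>. \<eta> > 0 \<Longrightarrow> \<exists>n0. \<forall>u. emeasure lborel {x \<in> {0..<1}. regular x \<and> generic k1 \<eta> x u \<and> n0 \<le> cr x u \<and>
     (vel x u)\<^sup>2 < A * curv x u} \<le> ennreal (\<epsilon> / (4 * r1))" using bad_set[OF A, of "\<epsilon> / (4 * r1)"] \<epsilon> r1 by auto
  define k where "k = max k0 k1"
  obtain \<eta> where \<eta>: "\<eta> > 0" "\<And>t. ungeneric k \<eta> t \<le> \<epsilon>/4"
    using generic_measure[OF e4] by blast
  obtain n2 where n2: "\<And>u. emeasure lborel {x \<in> {0..<1}. regular x \<and> generic k1 \<eta> x u \<and> n2 \<le> cr x u \<and>
     (vel x u)\<^sup>2 < A * curv x u} \<le> ennreal (\<epsilon> / (4 * r1))" using k1[OF \<eta>(1)] by blast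
  have "\<exists>n0\<ge>n1. \<exists>T. \<forall>t\<ge>T. ungood k \<eta> n0 A t \<le> \<epsilon>" for n1
  proof -
    define n0 where "n0 = max n1 n2"
    obtain T where T: "\<And>t. t \<ge> T \<Longrightarrow> measure \<mu> {z \<in> \<Omega>. cr (fst z) (snd z + t) < n0} \<le> \<epsilon>/4"
      using cr_large_measure[OF e4] by blast
    define b where "b = {z \<in> space (borel \<Otimes>\<^sub>M borel). fst z \<in> {0..<1} \<and> regular (fst z) \<and> generic k1 \<eta> (fst z) (snd z) \<and> n2 \<le> cr (fst z) (snd z) \<and>
     (vel (fst z) (snd z))\<^sup>2 < A * curv (fst z) (snd z)}"
    have "b \<in> sets (borel \<Otimes>\<^sub>M borel)" unfolding b_def by measurable
    also have "sets (borel \<Otimes>\<^sub>M borel) = sets (borel :: (real \<times> real) measure)" by (subst borel_prod) simp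
    finally have bm: "b \<in> sets borel" .
    have "ungood k \<eta> n0 A t \<le> \<epsilon>" if t: "t \<ge> T" for t
    proof -
      let ?X1 = "{z \<in> \<Omega>. r0 < snd z}" and ?X2 = "{z \<in> \<Omega>. \<not> generic k \<eta> (fst z) (snd z + t)}"
      let ?X3 = "{z \<in> \<Omega>. cr (fst z) (snd z + t) < n0}" and ?X4 = "{z \<in> \<Omega>. snd z < r1 \<and> (fst z, snd z + t) \<in> b}"
      have s: "?X1 \<in> sets \<mu>" "?X2 \<in> sets \<mu>" "?X3 \<in> sets \<mu>" unfolding space_mu[symmetric] by measurable
      have s4: "?X4 \<in> sets \<mu>" by (rule strip_sets[OF bm])
      have "ungood k \<eta> n0 A t \<le> measure \<mu> (?X1 \<union> (?X2 \<union> (?X3 \<union> ?X4)))"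
      proof (rule finite_measure_mono)
        show "{z \<in> \<Omega>. \<not> good k \<eta> n0 A (fst z) (snd z + t)} \<subseteq> ?X1 \<union> (?X2 \<union> (?X3 \<union> ?X4))"
        proof
          fix z assume z: "z \<in> {z \<in> \<Omega>. \<not> good k \<eta> n0 A (fst z) (snd z + t)}"
          then have o: "0 \<le> fst z" "fst z < 1" "regular (fst z)" by (cases z; simp add: space_iff)+
          show "z \<in> ?X1 \<union> (?X2 \<union> (?X3 \<union> ?X4))"
          proof (cases "z \<in> ?X1 \<or> z \<in> ?X2 \<or> z \<in> ?X3")
            case False
            then have g: "generic k \<eta> (fst z) (snd z + t)" "n0 \<le> cr (fst z) (snd z + t)" "snd z \<le> r0" using z by auto
            then have "generic k1 \<eta> (fst z) (snd z + t)" "n2 \<le> cr (fst z) (snd z + t)"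
              using generic_mono[OF g(1), of k1] by (auto simp: k_def n0_def)
            moreover have "(vel (fst z) (snd z + t))\<^sup>2 < A * curv (fst z) (snd z + t)"
              using z g by (auto simp: good_def)
            ultimately show ?thesis using o z g(3) by (auto simp: b_def space_pair_measure r1_def)
          qed auto
        qed
        show "?X1 \<union> (?X2 \<union> (?X3 \<union> ?X4)) \<in> sets \<mu>" using s s4 by auto
      qed
      also have "\<dots> \<le> measure \<mu> ?X1 + (measure \<mu> ?X2 + (measure \<mu> ?X3 + measure \<mu> ?X4))"
        using s s4 by (intro order_trans[OF measure_Un_le] add_left_mono) auto
      also have "measure \<mu> ?X4 \<le> r1 * (\<epsilon> / (4 * r1))"
      proof (rule strip_measure_le[OF _ bm])
        show "emeasure lborel {x. (x, u) \<in> b} \<le> ennreal (\<epsilon> / (4 * r1))" for u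
          using n2[of u] by (simp add: b_def space_pair_measure)
      qed (use r1 \<epsilon> in auto)
      finally show ?thesis using r0(2) \<eta>(2)[of t] T[OF t] r1 by simp
    qed
    then show ?thesis by (intro exI[of _ n0]) (auto simp: n0_def)
  qed
  moreover have "ungeneric k \<eta> t \<le> \<epsilon>" for t using \<eta>(2)[of t] \<epsilon> by linarith
  ultimately show ?thesis using \<eta>(1) by (intro exI[of _ k] conjI exI[of _ \<eta>]) (auto simp: k_def)
qed

subsection \<open>Shearing\<close>

text \<open>Test functions concentrated above the floor. The bound \<open>1/2\<close> makes
  \<open>f\<close> minus its mean bounded by 1. The support of height \<open>roof_min / 2\<close>
  stays away from every roof, so that \<open>f\<close> remains Lipschitz along the flow when a
  crossing occurs.\<close>

definition box :: "real \<Rightarrow> (real \<times> real \<Rightarrow> real) \<Rightarrow> bool" where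
  "box \<Lambda> f \<longleftrightarrow> 0 \<le> \<Lambda> \<and> (\<forall>x r m. f (x + of_int m, r) = f (x, r)) \<and>
     (\<forall>x r. r \<notin> {0<..<roof_min / 2} \<longrightarrow> f (x, r) = 0) \<and>
     (\<forall>x r y s. \<bar>f (x, r) - f (y, s)\<bar> \<le> \<Lambda> * (\<bar>x - y\<bar> + \<bar>r - s\<bar>)) \<and> (\<forall>z. \<bar>f z\<bar> \<le> 1/2)"

lemma boxD:
  assumes "box \<Lambda> f"
  shows "0 \<le> \<Lambda>" "f (x + of_int m, r) = f (x, r)" "r \<notin> {0<..<roof_min / 2} \<Longrightarrow> f (x, r) = 0"
    "\<bar>f (x, r) - f (y, s)\<bar> \<le> \<Lambda> * (\<bar>x - y\<bar> + \<bar>r - s\<bar>)" "\<bar>f z\<bar> \<le> 1/2" using assms unfolding box_def by blast+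

text \<open>Slightly before the roof is hit and slightly after, a function supported in the box vanishes;
  this gives room for perturbing the crossing number.\<close>

lemma box_lift:
  assumes f: "box \<Lambda> f" and rx: "regular x"
    and u: "- roof_min / 2 \<le> u - S m x" "u - S m x < \<Phi> (x + of_int m * \<alpha>)"
  shows "lift f x u = f (x + of_int m * \<alpha>, u - S m x)"
proof (cases "0 \<le> u - S m x")
  case True
  then have "cr x u = m" using u by (intro cr_eqI[OF rx]) (auto simp: S_Suc)
  then show ?thesis by (simp add: lift_def)
next
  case False
  have p: "roof_min \<le> \<Phi> (x + of_int (m - 1) * \<alpha>)" using roof_min(2) regular_nonint[OF rx] by blast
  have e: "S m x = S (m - 1) x + \<Phi> (x + of_int (m - 1) * \<alpha>)" using S_Suc[of "m - 1" x] by simp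
  have "cr x u = m - 1" using False u p e roof_min(1) by (intro cr_eqI[OF rx]) auto
  moreover have "u - S (m - 1) x \<notin> {0<..<roof_min / 2}" using u p e roof_min(1) by auto
  moreover have "u - S m x \<notin> {0<..<roof_min / 2}" using False by auto
  ultimately show ?thesis using boxD(3)[OF f] by (simp add: lift_def)
qed

lemma box_lift_lipschitz:
  assumes f: "box \<Lambda> f" and rx: "regular x"
  shows "\<bar>lift f x u - lift f x u'\<bar> \<le> (\<Lambda> + 4 / roof_min) * \<bar>u - u'\<bar>"
proof (cases "\<bar>u - u'\<bar> \<le> roof_min / 4")
  case True
  \<comment> \<open>The crossing number \<open>roof_min / 4\<close> ahead of \<open>u\<close>: with
    this \<open>m\<close> the range allowed in \<open>box_lift\<close> contains both
    \<open>u\<close> and \<open>u'\<close>.\<close>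
  define m where "m = cr x (u + roof_min / 4)"
  have b: "S m x \<le> u + roof_min / 4" "u + roof_min / 4 < S m x + \<Phi> (x + of_int m * \<alpha>)"
    using cr_bounds[OF rx, of "u + roof_min / 4"] by (auto simp: m_def S_Suc)
  have "lift f x u = f (x + of_int m * \<alpha>, u - S m x)" by (rule box_lift[OF f rx]) (use b roof_min(1) in linarith)+
  moreover have "lift f x u' = f (x + of_int m * \<alpha>, u' - S m x)"
    by (rule box_lift[OF f rx]) (use b True roof_min(1) in linarith)+
  ultimately have "\<bar>lift f x u - lift f x u'\<bar> \<le> \<Lambda> * \<bar>u - u'\<bar>"
    using boxD(4)[OF f, of "x + of_int m * \<alpha>" "u - S m x" "x + of_int m * \<alpha>" "u' - S m x"] by simp
  also have "\<dots> \<le> (\<Lambda> + 4 / roof_min) * \<bar>u - u'\<bar>" using roof_min(1) by (intro mult_right_mono) auto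
  finally show ?thesis .
next
  case False
  have "\<bar>lift f x u - lift f x u'\<bar> \<le> 1" using boxD(5)[OF f, of "(x + of_int (cr x u) * \<alpha>, u - S (cr x u) x)"]
      boxD(5)[OF f, of "(x + of_int (cr x u') * \<alpha>, u' - S (cr x u') x)"] by (simp add: lift_def)
  also have "1 \<le> 4 / roof_min * \<bar>u - u'\<bar>" using False roof_min(1) by (simp add: field_simps)
  also have "\<dots> \<le> (\<Lambda> + 4 / roof_min) * \<bar>u - u'\<bar>" using boxD(1)[OF f] by (intro mult_right_mono) auto
  finally show ?thesis .
qed

definition vmax :: "nat \<Rightarrow> (nat \<Rightarrow> real) \<Rightarrow> real \<Rightarrow> real \<Rightarrow> real" where
  "vmax n t x r = Max ((\<lambda>i. \<bar>vel x (r + t i)\<bar>) ` {..<n})"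

text \<open>The scale \<open>P\<close> of the shear. Where the maximum is 0 or the point is
  irregular it is set to 1, so that it can always serve as a divisor.\<close>

definition spd :: "nat \<Rightarrow> (nat \<Rightarrow> real) \<Rightarrow> real \<Rightarrow> real \<Rightarrow> real" where
  "spd n t x r = (if regular x \<and> 0 < vmax n t x r then vmax n t x r else 1)"

definition cdir :: "nat \<Rightarrow> (nat \<Rightarrow> real) \<Rightarrow> nat \<Rightarrow> real \<times> real \<Rightarrow> real" where
  "cdir n t i z = (if regular (fst z) then vel (fst z) (snd z + t i) / spd n t (fst z) (snd z) else 0)"

lemma vel_le_vmax: "i < n \<Longrightarrow> \<bar>vel x (r + t i)\<bar> \<le> vmax n t x r"
  unfolding vmax_def by (rule Max_ge) auto

lemma vmax_attained: "0 < n \<Longrightarrow> \<exists>i<n. vmax n t x r = \<bar>vel x (r + t i)\<bar>"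
proof -
  assume "0 < n"
  then have "vmax n t x r \<in> (\<lambda>i. \<bar>vel x (r + t i)\<bar>) ` {..<n}" unfolding vmax_def by (intro Max_in) auto
  then show ?thesis by auto
qed

lemma spd_pos: "0 < spd n t x r" by (simp add: spd_def)

lemma spd_measurable [measurable (raw)]:
  assumes [measurable]: "f \<in> borel_measurable L" "g \<in> borel_measurable L"
  shows "(\<lambda>z. spd n t (f z) (g z)) \<in> borel_measurable L"
proof -
  have [measurable]: "(\<lambda>z. vmax n t (f z) (g z)) \<in> borel_measurable L"
    unfolding vmax_def by (intro borel_measurable_Max) auto
  show ?thesis unfolding spd_def by measurable
qed

lemma cdir_measurable [measurable (raw)]:
  assumes [measurable]: "f \<in> borel_measurable L" "g \<in> borel_measurable L"
  shows "(\<lambda>z. cdir n t i (f z, g z)) \<in> borel_measurable L"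
  unfolding cdir_def by simp

lemma cdir_le_1: "i < n \<Longrightarrow> \<bar>cdir n t i z\<bar> \<le> 1"
proof -
  assume i: "i < n"
  have "\<bar>vel (fst z) (snd z + t i)\<bar> \<le> spd n t (fst z) (snd z)" if "regular (fst z)"
  proof (cases "0 < vmax n t (fst z) (snd z)")
    case True
    then show ?thesis using vel_le_vmax[OF i, of "fst z" "snd z" t] that by (simp add: spd_def)
  next
    case False
    then show ?thesis using vel_le_vmax[OF i, of "fst z" "snd z" t] that unfolding spd_def by auto
  qed
  then show ?thesis using spd_pos[of n t "fst z" "snd z"] by (simp add: cdir_def)
qed

text \<open>Genericity is asked at all times, dominance of the velocity only at the last one, which
  has the most crossings and thus the largest \<open>V\<close>.\<close>

definition shearable :: "nat \<Rightarrow> (nat \<Rightarrow> real) \<Rightarrow> int \<Rightarrow> real \<Rightarrow> int \<Rightarrow> real \<Rightarrow> real \<Rightarrow> real \<Rightarrow> bool" where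
  "shearable n t k \<eta> n0 A x r \<longleftrightarrow> gaps n 0 t \<and> 0 \<le> r + t 0 \<and> regular x \<and>
     (\<forall>i<n. generic k \<eta> x (r + t i)) \<and> good k \<eta> n0 A x (r + t (n - 1))"

definition shears :: "nat \<Rightarrow> (nat \<Rightarrow> real) \<Rightarrow> real \<Rightarrow> real \<Rightarrow> real \<Rightarrow> real \<Rightarrow> bool" where
  "shears n t r e x y \<longleftrightarrow> \<bar>spd n t y r - spd n t x r\<bar> \<le> e * spd n t x r \<and> \<bar>y - x\<bar> \<le> e \<and>
      (\<forall>i<n. \<forall>f \<Lambda>. box \<Lambda> f \<longrightarrow> \<bar>lift f y (r + t i) - lift f x (r + t i - vel x (r + t i) * (y - x))\<bar> \<le> \<Lambda> * e)"

text \<open>Let \<open>V\<close> belong to the last time and let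
  \<open>\<delta> = \<bar>y - x\<bar>\<close>, so \<open>\<delta> * P <= R\<close>. Then
  \<open>A * V <= P^2\<close> gives \<open>V * \<delta> <= R * P / A\<close> and
  \<open>V * \<delta>^2 <= R^2 / A\<close>: velocities change by a small part of \<open>P\<close>,
  and Birkhoff sums are linear up to a small error. Because \<open>V\<close> increases with the
  number of crossings, this holds at the earlier times too.\<close>

lemma shear_point:
  assumes n: "0 < n" and R: "R > 0" and e: "0 < e" "e < 1"
  shows "\<exists>A>0. \<exists>k0. \<forall>k\<ge>k0. \<forall>\<eta>>0. \<exists>n1. \<forall>n0\<ge>n1. \<forall>t x r y.
    shearable n t k \<eta> n0 A x r \<longrightarrow> regular y \<longrightarrow> \<bar>y - x\<bar> \<le> R / spd n t x r \<longrightarrow> shears n t r e x y"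
proof -
  let ?rm = roof_min
  have rm: "?rm > 0" by (rule roof_min)
  define e1 where "e1 = min (e/4) (?rm/32)"
  have e1: "e1 > 0" "e1 \<le> e/4" "e1 \<le> ?rm/32" using e rm by (auto simp: e1_def)
  define H where "H = hess_hi"
  have H: "H > 0" using hess(2) by (simp add: H_def)
  \<comment> \<open>The term \<open>4 * R^2\<close> is for \<open>near\<close>, the next one for a
    change of the velocities by at most \<open>e/2 * P\<close>, the last one for a Taylor remainder
    of at most \<open>e1\<close>.\<close>
  define A where "A = 1 + 4 * R\<^sup>2 + 16 * H * R / e + 8 * H * R\<^sup>2 / e1"
  have A: "1 \<le> A" "4 * R\<^sup>2 \<le> A" "16 * H * R / e \<le> A" "8 * H * R\<^sup>2 / e1 \<le> A"
    using R H e e1 by (auto simp: A_def intro!: add_nonneg_nonneg)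
  \<comment> \<open>Room for the crossings caused by a displacement of up to \<open>R + 1\<close> in
    flow time, with the margins that \<open>crossing_stable\<close> and \<open>box_lift\<close>
    add.\<close>
  define k0 where "k0 = \<lceil>(R + 2 + ?rm) / ?rm + 1\<rceil>"
  have "\<exists>n1. \<forall>n0\<ge>n1. \<forall>t x r y.
    shearable n t k \<eta> n0 A x r \<longrightarrow> regular y \<longrightarrow> \<bar>y - x\<bar> \<le> R / spd n t x r \<longrightarrow> shears n t r e x y"
    if k: "k \<ge> k0" and \<eta>: "\<eta> > 0" for k \<eta>
  proof -
    have kR: "(R + 2 + ?rm) / ?rm + 1 \<le> of_int k" using k unfolding k0_def by linarith
    have k_pos: "0 \<le> k"
    proof -
      have "0 \<le> (R + 2 + ?rm) / ?rm + 1" using R rm by simp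
      then have "(0::real) \<le> of_int k" using kR by linarith
      then show ?thesis by simp
    qed
    define B where "B = away (\<eta>/2)"
    have B: "B > 0" using away(1)[of "\<eta>/2"] \<eta> by (simp add: B_def)
    \<comment> \<open>A lower bound for \<open>P\<close>, reached because
      \<open>P^2 >= A * V >= V >= n0 >= Q^2\<close>. Its terms make \<open>\<delta>\<close> at most
      \<open>\<eta>/2\<close> and \<open>e1\<close>, the displacement of \<open>k + 1\<close> roofs
      at most \<open>e1\<close>, the displacement of one roof at most 1, and \<open>k\<close> terms
      of size \<open>B\<close> at most \<open>e/2 * P\<close>.\<close>
    define Q where "Q = 1 + 2 * R / \<eta> + R / e1 + R * (of_int k * B + B) / e1 + R * B + 2 * of_int k * B / e"
    have Q: "1 \<le> Q" "2 * R / \<eta> \<le> Q" "R / e1 \<le> Q" "R * (of_int k * B + B) / e1 \<le> Q" "R * B \<le> Q" "2 * of_int k * B / e \<le> Q"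
      using R e1(1) e(1) B k_pos \<eta> by (auto simp: Q_def intro!: add_nonneg_nonneg mult_nonneg_nonneg divide_nonneg_pos)
    have "shears n t r e x y"
      if n0: "n0 \<ge> \<lceil>Q\<^sup>2\<rceil>" and sh: "shearable n t k \<eta> n0 A x r"
        and ry: "regular y" and yx: "\<bar>y - x\<bar> \<le> R / spd n t x r" for n0 t x r y
    proof -
      have g: "gaps n 0 t" and r0: "0 \<le> r + t 0" and rx: "regular x" and gen: "\<And>i. i < n \<Longrightarrow> generic k \<eta> x (r + t i)"
        and gd: "good k \<eta> n0 A x (r + t (n - 1))" using sh by (auto simp: shearable_def)
      define nn where "nn = cr x (r + t (n - 1))"
      define v where "v = V nn x"
      define P where "P = spd n t x r"
      define \<delta> where "\<delta> = \<bar>y - x\<bar>"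
      have "Q\<^sup>2 \<le> of_int nn"
      proof -
        have "\<lceil>Q\<^sup>2\<rceil> \<le> nn" using gd n0 by (auto simp: good_def nn_def)
        then show ?thesis by linarith
      qed
      moreover have "1 \<le> Q\<^sup>2" using Q(1) by simp
      ultimately have nn1: "(1::real) \<le> of_int nn" by linarith
      then have nn0: "0 < nn" by simp
      have vQ: "Q\<^sup>2 \<le> v" using V_ge[OF regular_clear[OF rx], of nn] nn0 \<open>Q\<^sup>2 \<le> of_int nn\<close> by (simp add: v_def)
      have v1: "1 \<le> v" using vQ \<open>1 \<le> Q\<^sup>2\<close> by linarith
      have velA: "A * v \<le> (vel x (r + t (n - 1)))\<^sup>2" using gd by (simp add: good_def curv_def v_def nn_def)
      have vm: "\<bar>vel x (r + t (n - 1))\<bar> \<le> vmax n t x r" by (rule vel_le_vmax) (use n in simp)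
      have "0 < A * v" using A(1) v1 by (simp add: mult_pos_pos)
      then have "0 < \<bar>vel x (r + t (n - 1))\<bar>" using velA by (auto simp: zero_less_abs_iff)
      then have Pv: "P = vmax n t x r" using vm rx by (simp add: P_def spd_def)
      have PA: "A * v \<le> P\<^sup>2" using velA power_mono[OF vm, of 2] by (simp add: Pv)
      have P0: "P > 0" by (simp add: P_def spd_pos)
      have "v \<le> A * v" using A(1) v1 by simp
      then have "Q\<^sup>2 \<le> P\<^sup>2" using PA vQ by linarith
      then have QP: "Q \<le> P" by (rule power2_le_imp_le) (use P0 in simp)
      have d: "\<delta> \<le> R / P" using yx by (simp add: \<delta>_def P_def)
      have d0: "0 \<le> \<delta>" by (simp add: \<delta>_def)
      have dP: "\<delta> * P \<le> R" using d P0 by (simp add: field_simps)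
      have dQ: "\<delta> * q \<le> R" if "q \<le> Q" for q
      proof -
        have "\<delta> * q \<le> \<delta> * P" using that QP d0 by (intro mult_left_mono) auto
        then show ?thesis using dP by linarith
      qed
      have d\<eta>: "\<delta> \<le> \<eta>/2" using dQ[OF Q(2)] R \<eta> by (simp add: field_simps)
      have de1: "\<delta> \<le> e1" using dQ[OF Q(3)] R e1(1) by (simp add: field_simps)
      have dkB: "(of_int k * B + B) * \<delta> \<le> e1"
      proof -
        have "R * ((of_int k * B + B) * \<delta>) \<le> R * e1" using dQ[OF Q(4)] e1(1) by (simp add: field_simps)
        then show ?thesis using R by simp
      qed
      have dB: "B * \<delta> \<le> 1" "B * \<delta> \<le> e1" "of_int k * B * \<delta> \<le> e1"
      proof -
        have "R * (B * \<delta>) \<le> R * 1" using dQ[OF Q(5)] by (simp add: mult_ac)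
        then show "B * \<delta> \<le> 1" using R by simp
        have "0 \<le> of_int k * B * \<delta>" "0 \<le> B * \<delta>" using k_pos B d0 by auto
        then show "B * \<delta> \<le> e1" "of_int k * B * \<delta> \<le> e1" using dkB unfolding distrib_right by linarith+
      qed
      have kBP: "of_int k * B \<le> e/2 * P"
      proof -
        have "2 * of_int k * B / e \<le> P" using Q(6) QP by linarith
        then show ?thesis using e(1) by (simp add: field_simps)
      qed
      have nearxy: "near nn x y"
      proof (rule nearI[OF regular_clear[OF rx] nn0])
        have "sqrt A * sqrt v \<le> P" using PA P0 by (metis real_sqrt_mult real_le_lsqrt less_imp_le)
        then have "R / P \<le> R / (sqrt A * sqrt v)" using R A(1) v1 P0 by (intro divide_left_mono mult_pos_pos) auto
        then show "\<bar>y - x\<bar> \<le> (R / sqrt A) / sqrt (V nn x)" using d by (simp add: \<delta>_def v_def)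
        have "2 * R \<le> sqrt A" using A(2) by (intro real_le_rsqrt) (simp add: power_mult_distrib)
        then have "2 * (R / sqrt A) \<le> 1" using A(1) by (simp add: field_simps)
        also have "1 \<le> v powr beta" using v1 beta_pos by (simp add: ge_one_powr_ge_zero)
        finally show "2 * (R / sqrt A) \<le> V nn x powr beta" by (simp add: v_def)
      qed
      have vd: "v * \<delta> \<le> R * P / A"
      proof -
        have "A * v * \<delta> \<le> P * P * \<delta>" using PA d0 by (intro mult_right_mono) (auto simp: power2_eq_square)
        also have "\<dots> \<le> P * R" using dP P0 by (simp add: mult_ac)
        finally show ?thesis using A(1) by (simp add: field_simps)
      qed
      have hvd: "8 * H * v * \<delta> \<le> e/2 * P"
      proof -
        have "8 * H * (v * \<delta>) \<le> 8 * H * (R * P / A)" using H vd by (intro mult_left_mono) auto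
        also have "\<dots> = (16 * H * R / e) / A * (e/2 * P)" using e A(1) by (simp add: field_simps)
        also have "\<dots> \<le> 1 * (e/2 * P)"
        proof (rule mult_right_mono)
          show "(16 * H * R / e) / A \<le> 1" using A(1,3) by (subst divide_le_eq_1_pos) auto
        qed (use e P0 in simp)
        finally show ?thesis by (simp add: mult.assoc)
      qed
      have hvdd: "8 * H * v * \<delta> * \<delta> \<le> e1"
      proof -
        have "8 * H * (v * \<delta>) * \<delta> \<le> 8 * H * (R * P / A) * \<delta>" using H vd d0 by (intro mult_right_mono mult_left_mono) auto
        also have "\<dots> = 8 * H * R / A * (\<delta> * P)" by simp
        also have "\<dots> \<le> 8 * H * R / A * R" using H R A(1) dP by (intro mult_left_mono) auto
        also have "\<dots> = (8 * H * R\<^sup>2 / e1) / A * e1" using e1(1) by (simp add: power2_eq_square)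
        also have "\<dots> \<le> 1 * e1"
        proof (rule mult_right_mono)
          show "(8 * H * R\<^sup>2 / e1) / A \<le> 1" using A(1,4) by (subst divide_le_eq_1_pos) auto
        qed (use e1(1) in simp)
        finally show ?thesis by (simp add: mult.assoc)
      qed
      have slot: "\<bar>vel y (r + t i) - vel x (r + t i)\<bar> \<le> e * P \<and>
         (\<forall>f \<Lambda>. box \<Lambda> f \<longrightarrow> \<bar>lift f y (r + t i) - lift f x (r + t i - vel x (r + t i) * (y - x))\<bar> \<le> \<Lambda> * e)"
        if i: "i < n" for i
      proof -
        define u where "u = r + t i"
        define m where "m = cr x u"
        define m' where "m' = cr y u"
        have ti: "t 0 \<le> t i" "t i \<le> t (n - 1)" using gaps_0_mono[OF g] i by auto
        have m0: "0 \<le> m" unfolding m_def u_def using r0 ti by (intro cr_nonneg[OF rx]) simp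
        have mn: "m \<le> nn" unfolding m_def nn_def u_def using ti by (intro cr_mono[OF rx]) simp
        have velP: "\<bar>vel x u\<bar> \<le> P" using vel_le_vmax[OF i, of x r t] by (simp add: Pv u_def)
        have DSm: "\<bar>DS m y - DS m x\<bar> \<le> e/2 * P" using near_DS(1)[OF nearxy m0 mn] hvd by (simp add: H_def v_def \<delta>_def)
        have Sm: "\<bar>S m y - S m x - vel x u * (y - x)\<bar> \<le> e1"
          using near_DS(2)[OF nearxy m0 mn] hvdd by (simp add: H_def v_def \<delta>_def vel_def m_def)
        have vel_le: "\<bar>vel x u * (y - x)\<bar> \<le> R"
        proof -
          have "\<bar>vel x u\<bar> * \<delta> \<le> P * \<delta>" using velP d0 by (rule mult_right_mono)
          then show ?thesis using dP by (simp add: abs_mult \<delta>_def mult.commute)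
        qed
        have SL: "\<bar>S m y - S m x\<bar> \<le> R + 1" using Sm vel_le e1(2) e by linarith
        have genu: "generic k \<eta> x u" using gen[OF i] by (simp add: u_def)
        have Pd: "\<bar>\<Phi> (y + of_int (m + j) * \<alpha>) - \<Phi> (x + of_int (m + j) * \<alpha>)\<bar> \<le> B * \<delta>" if "\<bar>j\<bar> \<le> k" for j
          using generic_roof_lipschitz[OF \<eta> genu that, of y] d\<eta> by (simp add: m_def B_def \<delta>_def)
        have mm: "\<bar>m' - m\<bar> \<le> k" unfolding m_def m'_def
        proof (rule crossing_stable[OF rx ry, where L = "R + 1"])
          show "\<bar>S (cr x u) y - S (cr x u) x\<bar> \<le> R + 1" using SL by (simp add: m_def)
          show "\<bar>\<Phi> (y + of_int (cr x u) * \<alpha>) - \<Phi> (x + of_int (cr x u) * \<alpha>)\<bar> \<le> 1"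
            using Pd[of 0] k_pos dB(1) by (simp add: m_def)
          have "(R + 1 + 1) / ?rm \<le> (R + 2 + ?rm) / ?rm" using rm by (intro divide_right_mono) auto
          then show "(R + 1 + 1) / ?rm + 1 \<le> of_int k" using kR by linarith
        qed
        have gy: "\<eta>/2 \<le> int_dist (y + of_int (m + j) * \<alpha>)" if "\<bar>j\<bar> \<le> k" for j
          unfolding m_def by (rule generic_near[OF genu that]) (use d\<eta> in \<open>simp add: \<delta>_def\<close>)
        have "\<bar>DS m' y - DS m y\<bar> \<le> of_int k * B"
          by (rule birkhoff_diff_le[OF mm]) (use away(3)[OF _ gy] \<eta> in \<open>auto simp: B_def\<close>)
        then have "\<bar>vel y u - vel x u\<bar> \<le> e/2 * P + e/2 * P"
          using DSm kBP unfolding vel_def m'_def[symmetric] m_def[symmetric] by linarith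
        moreover have "e/2 * P + e/2 * P = e * P" by (simp add: field_simps)
        ultimately have 1: "\<bar>vel y u - vel x u\<bar> \<le> e * P" by linarith
        have 2: "\<bar>lift f y u - lift f x (u - vel x u * (y - x))\<bar> \<le> \<Lambda> * e" if f: "box \<Lambda> f" for f \<Lambda>
        proof -
          define s where "s = vel x u * (y - x)"
          define w where "w = u - s"
          \<comment> \<open>Height \<open>w\<close> over \<open>x\<close> corresponds to height
            \<open>u\<close> over \<open>y\<close>. The crossing number \<open>l\<close> is read
            \<open>roof_min / 4\<close> ahead of \<open>w\<close>, which leaves a margin: as
            \<open>e1 <= roof_min / 32\<close>, \<open>box_lift\<close> applies with the same
            \<open>l\<close> to \<open>w\<close> over \<open>x\<close> and to \<open>u\<close> over
            \<open>y\<close>, although their true crossing numbers may differ.\<close>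
          define l where "l = cr x (w + ?rm / 4)"
          have sR: "\<bar>s\<bar> \<le> R" using vel_le by (simp add: s_def)
          have lb: "S l x \<le> w + ?rm / 4" "w + ?rm / 4 < S l x + \<Phi> (x + of_int l * \<alpha>)"
            using cr_bounds[OF rx, of "w + ?rm / 4"] by (auto simp: l_def S_Suc)
          have mb: "S m x \<le> u" "u < S (m + 1) x" using cr_bounds[OF rx, of u] by (auto simp: m_def)
          have "of_int (l - m) \<le> (R + ?rm / 4) / ?rm + 1"
            by (rule cr_diff_le[OF rx, where u = u]) (use lb mb sR R rm in \<open>auto simp: w_def\<close>)
          moreover have "of_int (m - l) \<le> R / ?rm + 1"
            by (rule cr_diff_le[OF rx, where u = "w + ?rm / 4"]) (use lb mb sR R rm in \<open>auto simp: w_def S_Suc\<close>)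
          moreover have "(R + ?rm / 4) / ?rm \<le> (R + 2 + ?rm) / ?rm" "R / ?rm \<le> (R + 2 + ?rm) / ?rm"
            using rm by (auto intro!: divide_right_mono)
          ultimately have lm: "\<bar>l - m\<bar> \<le> k" using kR by linarith
          \<comment> \<open>The Taylor estimate is available for the index \<open>m\<close>; passing
            to \<open>l\<close> adds at most \<open>k\<close> differences of the roof, each at most
            \<open>B * \<delta>\<close>.\<close>
          have Sl: "\<bar>S l y - S l x - s\<bar> \<le> 2 * e1"
          proof -
            have sp: "S l z = S m z + S (l - m) (z + of_int m * \<alpha>)" for z using S_add[of m "l - m" z] by simp
            have "S (l - m) (y + of_int m * \<alpha>) - S (l - m) (x + of_int m * \<alpha>)
               = birkhoff_sum \<alpha> (\<lambda>z. \<Phi> (z + (y - x)) - \<Phi> z) (l - m) (x + of_int m * \<alpha>)"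
              by (auto simp: birkhoff_sum_def sum_subtractf algebra_simps)
            also have "\<bar>\<dots>\<bar> \<le> of_int \<bar>l - m\<bar> * (B * \<delta>)"
            proof (rule birkhoff_abs_le)
              fix j assume "\<bar>j\<bar> \<le> \<bar>l - m\<bar>"
              then have "\<bar>j\<bar> \<le> k" using lm by simp
              from Pd[OF this] show "\<bar>\<Phi> (x + of_int m * \<alpha> + of_int j * \<alpha> + (y - x)) - \<Phi> (x + of_int m * \<alpha> + of_int j * \<alpha>)\<bar> \<le> B * \<delta>"
                by (simp add: algebra_simps)
            qed
            also have "\<dots> \<le> of_int k * (B * \<delta>)" using lm B d0 by (intro mult_right_mono) auto
            also have "\<dots> \<le> e1" using dB(3) by (simp add: mult.assoc)
            finally show ?thesis using Sm unfolding sp[of y] sp[of x] s_def by linarith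
          qed
          have Pl: "\<bar>\<Phi> (y + of_int l * \<alpha>) - \<Phi> (x + of_int l * \<alpha>)\<bar> \<le> e1" using Pd[OF lm] dB(2) by simp
          have "lift f x w = f (x + of_int l * \<alpha>, w - S l x)" by (rule box_lift[OF f rx]) (use lb rm in linarith)+
          moreover have "lift f y u = f (y + of_int l * \<alpha>, u - S l y)"
          proof (rule box_lift[OF f ry])
            show "- ?rm / 2 \<le> u - S l y" using lb Sl e1(3) rm by (auto simp: w_def)
            show "u - S l y < \<Phi> (y + of_int l * \<alpha>)" using lb Sl Pl e1(3) rm by (auto simp: w_def)
          qed
          ultimately have "\<bar>lift f y u - lift f x w\<bar> \<le> \<Lambda> * (\<bar>y - x\<bar> + \<bar>(u - S l y) - (w - S l x)\<bar>)"
            using boxD(4)[OF f, of "y + of_int l * \<alpha>" "u - S l y" "x + of_int l * \<alpha>" "w - S l x"] by simp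
          also have "\<dots> \<le> \<Lambda> * e"
          proof (rule mult_left_mono[OF _ boxD(1)[OF f]])
            have "\<bar>(u - S l y) - (w - S l x)\<bar> \<le> 2 * e1" using Sl unfolding w_def by linarith
            then show "\<bar>y - x\<bar> + \<bar>(u - S l y) - (w - S l x)\<bar> \<le> e" using de1 e1(2) unfolding \<delta>_def by linarith
          qed
          finally show ?thesis by (simp add: w_def s_def)
        qed
        show ?thesis using 1 2 by (simp add: u_def)
      qed
      have "\<bar>vmax n t y r - vmax n t x r\<bar> \<le> e * P" unfolding vmax_def
      proof (rule Max_image_diff_le)
        fix i assume "i \<in> {..<n}"
        then have "\<bar>vel y (r + t i) - vel x (r + t i)\<bar> \<le> e * P" using slot by auto
        then show "\<bar>\<bar>vel y (r + t i)\<bar> - \<bar>vel x (r + t i)\<bar>\<bar> \<le> e * P" by linarith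
      qed (use n in auto)
      then have vy: "\<bar>vmax n t y r - P\<bar> \<le> e * P" by (simp add: Pv)
      have "e * P < P" using e P0 by simp
      then have "0 < vmax n t y r" using vy by linarith
      then have "spd n t y r = vmax n t y r" using ry by (simp add: spd_def)
      then show ?thesis using vy slot de1 e1(2) e by (auto simp: shears_def P_def \<delta>_def)
    qed
    then show ?thesis by (intro exI[of _ "\<lceil>Q\<^sup>2\<rceil>"]) blast
  qed
  then show ?thesis using A(1) by (intro exI[of _ A] conjI exI[of _ k0]) auto
qed

end

lemma lipschitz_riemann_sum:
  fixes h :: "real \<Rightarrow> real"
  assumes h: "\<And>s s'. \<bar>h s - h s'\<bar> \<le> l * \<bar>s - s'\<bar>" and d: "d > 0"
  shows "\<bar>(\<integral>s. h s * indicator {0..real J * d} s \<partial>lborel) - (\<Sum>j<J. h (real j * d)) * d\<bar> \<le> l * d * (real J * d)"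
proof -
  have l0: "0 \<le> l" using h[of 1 0] by simp
  have cont: "continuous_on UNIV h"
  proof (rule continuous_onI)
    fix x e :: real assume e: "e > 0"
    have "dist (h y) (h x) \<le> e" if "dist y x < e / (l + 1)" for y
    proof -
      have "\<bar>h y - h x\<bar> \<le> l * \<bar>y - x\<bar>" by (rule h)
      also have "\<dots> \<le> (l + 1) * (e / (l + 1))" using that l0 by (intro mult_mono) (auto simp: dist_real_def)
      finally show ?thesis using l0 by (simp add: dist_real_def)
    qed
    then show "\<exists>d>0. \<forall>x'\<in>UNIV. dist x' x < d \<longrightarrow> dist (h x') (h x) \<le> e"
      using e l0 by (intro exI[of _ "e / (l + 1)"]) auto
  qed
  have [measurable]: "h \<in> borel_measurable borel" by (rule borel_measurable_continuous_onI[OF cont])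
  have int: "integrable lborel (\<lambda>s. h s * indicator {a..<b} s)" for a b
  proof -
    have "integrable lborel (\<lambda>s. indicator {a..b} s *\<^sub>R h s)"
      using borel_integrable_compact[of "{a..b}" h] cont continuous_on_subset by auto
    then have "integrable lborel (\<lambda>s. (indicator {a..b} s *\<^sub>R h s) * indicator {a..<b} s)"
      by (rule Bochner_Integration.integrable_bound) (auto simp: indicator_def)
    then show ?thesis by (rule Bochner_Integration.integrable_cong[THEN iffD1, rotated -1]) (auto simp: indicator_def)
  qed
  have "(\<integral>s. h s * indicator {0..real J * d} s \<partial>lborel) = (\<integral>s. h s * indicator {0..<real J * d} s \<partial>lborel)"
  proof (rule integral_cong_AE)
    show "AE s in lborel. h s * indicator {0..real J * d} s = h s * indicator {0..<real J * d} s"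
      using AE_lborel_singleton[of "real J * d"] by eventually_elim (auto simp: indicator_def)
  qed auto
  moreover have "\<bar>(\<integral>s. h s * indicator {0..<real J * d} s \<partial>lborel) - (\<Sum>j<J. h (real j * d)) * d\<bar> \<le> l * d * (real J * d)"
  proof (induction J)
    case (Suc J)
    define a where "a = real J * d"
    define b where "b = real (Suc J) * d"
    have ab: "0 \<le> a" "a \<le> b" "b - a = d" using d by (auto simp: a_def b_def algebra_simps)
    have split: "h s * indicator {0..<b} s = h s * indicator {0..<a} s + h s * indicator {a..<b} s" for s
      using ab by (cases "s < a"; cases "0 \<le> s") (auto simp: indicator_def)
    have 1: "(\<integral>s. h s * indicator {0..<b} s \<partial>lborel)
      = (\<integral>s. h s * indicator {0..<a} s \<partial>lborel) + (\<integral>s. h s * indicator {a..<b} s \<partial>lborel)"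
      unfolding split by (rule Bochner_Integration.integral_add[OF int int])
    have ri: "integrable lborel (\<lambda>s. c * indicator {a..<b} s :: real)" for c
      by (intro integrable_mult_right integrable_real_indicator) (use ab in auto)
    have ci: "(\<integral>s. c * indicator {a..<b} s \<partial>lborel) = c * d" for c :: real
    proof -
      have "measure lborel {a..<b} = d" using ab by simp
      then show ?thesis by simp
    qed
    have eq: "(\<integral>s. h s * indicator {a..<b} s \<partial>lborel) - h a * d = (\<integral>s. h s * indicator {a..<b} s - h a * indicator {a..<b} s \<partial>lborel)"
      unfolding ci[of "h a", symmetric] by (rule Bochner_Integration.integral_diff[OF int ri, symmetric])
    have "\<bar>\<integral>s. h s * indicator {a..<b} s - h a * indicator {a..<b} s \<partial>lborel\<bar>
      \<le> (\<integral>s. \<bar>h s * indicator {a..<b} s - h a * indicator {a..<b} s\<bar> \<partial>lborel)" by (rule integral_abs_bound)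
    moreover have "(\<integral>s. \<bar>h s * indicator {a..<b} s - h a * indicator {a..<b} s\<bar> \<partial>lborel) \<le> (\<integral>s. (l * d) * indicator {a..<b} s \<partial>lborel)"
    proof (rule integral_mono)
      fix s
      have "\<bar>h s - h a\<bar> \<le> l * d" if "s \<in> {a..<b}" using h[of s a] that ab l0 mult_left_mono[of "\<bar>s - a\<bar>" d l] by auto
      then show "\<bar>h s * indicator {a..<b} s - h a * indicator {a..<b} s\<bar> \<le> (l * d) * indicator {a..<b} s"
        by (auto simp: indicator_def)
    qed (use int ri in auto)
    ultimately have 2: "\<bar>(\<integral>s. h s * indicator {a..<b} s \<partial>lborel) - h a * d\<bar> \<le> l * d * d" unfolding eq ci by linarith
    have e: "l * d * b = l * d * a + l * d * d" by (simp add: a_def b_def algebra_simps)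
    have "(\<Sum>j<Suc J. h (real j * d)) * d = (\<Sum>j<J. h (real j * d)) * d + h a * d" by (simp add: distrib_right a_def)
    then show ?case using Suc.IH 1 2 e unfolding a_def[symmetric] b_def[symmetric] by linarith
  qed simp
  ultimately show ?thesis by simp
qed

lemma (in prob_space) integral_affine_indicator:
  assumes "Z \<in> events"
  shows "integrable M (\<lambda>x. a + b * indicator Z x :: real)" "(\<integral>x. a + b * indicator Z x \<partial>M) = a + b * prob Z"
  using assms prob_space by (simp_all add: less_top[symmetric] emeasure_finite sets.Int_space_eq2)

context power_roof
begin

subsection \<open>The direction of the shear varies slowly\<close>

text \<open>Moving along the flow by \<open>u\<close> shifts the orbit segment over which the
  derivative is summed. Terms are lost or gained at both of its ends, at most \<open>k\<close> at
  each, and bounded by \<open>away \<eta>\<close>; hence genericity at time 0 as well as at time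
  \<open>s\<close>.\<close>

lemma vel_flow:
  assumes z: "(x, r) \<in> \<Omega>" and \<eta>: "0 < \<eta>" and g: "generic k \<eta> x (r + s)" and g0: "generic k \<eta> x (r + 0)"
    and k: "\<bar>u\<bar> / roof_min + 1 \<le> of_int k"
  shows "\<bar>vel (fst (K u (x, r))) (snd (K u (x, r)) + s) - vel x (r + s)\<bar> \<le> 2 * (of_int k * away \<eta>)"
proof -
  have rx: "regular x" and r: "0 \<le> r" "r < \<Phi> x" using z by (auto simp: space_iff)
  have cd: "\<bar>cr x (v + u) - cr x v\<bar> \<le> k" for v
  proof -
    have "of_int (cr x (v + u) - cr x v) \<le> \<bar>u\<bar> / roof_min + 1"
      by (rule cr_diff_le[OF rx, where u = v]) (use cr_bounds[OF rx, of v] cr_bounds[OF rx, of "v + u"] in auto)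
    moreover have "of_int (cr x v - cr x (v + u)) \<le> \<bar>u\<bar> / roof_min + 1"
      by (rule cr_diff_le[OF rx, where u = "v + u"]) (use cr_bounds[OF rx, of v] cr_bounds[OF rx, of "v + u"] in auto)
    ultimately show ?thesis using k by linarith
  qed
  have aw: "\<bar>deriv \<Phi> (x + of_int (cr x v + j) * \<alpha>)\<bar> \<le> away \<eta>" if "\<bar>j\<bar> \<le> k" "generic k \<eta> x v" for v j
  proof -
    have "j \<in> {-k..k}" using that by auto
    then have "\<eta> \<le> int_dist (x + of_int (cr x v + j) * \<alpha>)" using that(2) unfolding generic_def by blast
    then show ?thesis by (rule away(3)[OF \<eta>])
  qed
  define m where "m = cr x (r + u)"
  have c0: "cr x r = 0" by (rule cr_0[OF rx r])
  have 1: "\<bar>DS m x - DS 0 x\<bar> \<le> of_int k * away \<eta>"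
  proof (rule birkhoff_diff_le)
    show "\<bar>m - 0\<bar> \<le> k" using cd[of r] c0 by (simp add: m_def)
    show "\<bar>deriv \<Phi> (x + of_int (0 + j) * \<alpha>)\<bar> \<le> away \<eta>" if "\<bar>j\<bar> \<le> k" for j using aw[OF that g0] c0 by simp
  qed
  have 2: "\<bar>DS (cr x (r + s + u)) x - DS (cr x (r + s)) x\<bar> \<le> of_int k * away \<eta>"
  proof (rule birkhoff_diff_le)
    show "\<bar>cr x (r + s + u) - cr x (r + s)\<bar> \<le> k" by (rule cd)
    show "\<bar>deriv \<Phi> (x + of_int (cr x (r + s) + j) * \<alpha>)\<bar> \<le> away \<eta>" if "\<bar>j\<bar> \<le> k" for j by (rule aw[OF that g])
  qed
  have "vel (frac (x + of_int m * \<alpha>)) (r + u - S m x + s) = DS (cr x (r + s + u) - m) (x + of_int m * \<alpha>)"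
  proof -
    let ?y = "x + of_int m * \<alpha>"
    have c: "cr ?y (r + u - S m x + s) = cr x (r + s + u) - m"
      using cr_rotate[OF rx, of m "r + s + u"] by (simp add: algebra_simps)
    have "DS n (frac ?y) = DS n ?y" for n
    proof -
      have "DS n (?y + of_int (- \<lfloor>?y\<rfloor>)) = DS n ?y"
      proof (rule birkhoff_add_int)
        show "regular ?y" using rx by simp
        show "deriv \<Phi> (y + of_int (- \<lfloor>?y\<rfloor>)) = deriv \<Phi> y" if "y \<notin> \<int>" for y using that by (rule roof_add_int(2))
      qed
      then show ?thesis by (simp add: frac_def)
    qed
    then show ?thesis unfolding vel_def cr_frac c .
  qed
  also have "\<dots> = DS (cr x (r + s + u)) x - DS m x" using birkhoff_add[of "deriv \<Phi>" m "cr x (r + s + u) - m" x] by simp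
  finally show ?thesis using 1 2 unfolding K_eq[OF rx] m_def[symmetric] by (simp add: vel_def)
qed

text \<open>At the last time the squared velocity is at least \<open>V\<close>, which is at least
  the number of crossings and so at least \<open>Q^2\<close>.\<close>

lemma good_vmax:
  assumes n: "0 < n" and rx: "regular x" and g: "good k \<eta> n0 1 x (r + t (n - 1))" and Q: "0 < Q" "Q\<^sup>2 \<le> of_int n0"
  shows "Q \<le> vmax n t x r" "spd n t x r = vmax n t x r"
proof -
  let ?u = "r + t (n - 1)"
  have n0: "Q\<^sup>2 \<le> of_int (cr x ?u)" using g Q by (auto simp: good_def)
  have "0 < Q\<^sup>2" using Q by simp
  then have "0 \<le> cr x ?u" using n0 by (metis less_imp_le of_int_0_le_iff order_trans)
  then have "of_int (cr x ?u) \<le> curv x ?u" unfolding curv_def by (rule V_ge[OF regular_clear[OF rx]])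
  then have "Q\<^sup>2 \<le> \<bar>vel x ?u\<bar>\<^sup>2" using n0 g by (simp add: good_def)
  then have "Q \<le> \<bar>vel x ?u\<bar>" by (rule power2_le_imp_le) simp
  also have "\<dots> \<le> vmax n t x r" by (rule vel_le_vmax) (use n in simp)
  finally show "Q \<le> vmax n t x r" .
  then show "spd n t x r = vmax n t x r" using Q rx by (simp add: spd_def)
qed

lemma cdir_unit_bounded: "i < n \<Longrightarrow> cdir n t i \<in> unit_bounded"
proof (rule unit_boundedI)
  show "cdir n t i \<in> borel_measurable \<mu>" using cdir_measurable[of fst \<mu> snd n t i] by simp
qed (rule cdir_le_1)

lemma far_mono: "gaps n (max T 0) t \<Longrightarrow> max T 0 \<le> t 0 \<Longrightarrow> i < n \<Longrightarrow> T \<le> t i \<and> 0 \<le> t i"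
  using gaps_0_mono[OF gaps_mono[of n "max T 0" t 0], of 0 i] by auto

lemma bad_union_measure:
  assumes g: "\<And>i. i \<in> I \<Longrightarrow> ungeneric k \<eta> (t i) \<le> e"
    and gd: "ungood k \<eta> n0 A s \<le> e" and I: "finite I"
  shows "measure \<mu> {z \<in> \<Omega>. \<not> (good k \<eta> n0 A (fst z) (snd z + s) \<and> (\<forall>i\<in>I. generic k \<eta> (fst z) (snd z + t i)))}
     \<le> (real (card I) + 1) * e"
proof -
  let ?g = "\<lambda>i. {z \<in> \<Omega>. \<not> generic k \<eta> (fst z) (snd z + t i)}"
  let ?b = "{z \<in> \<Omega>. \<not> good k \<eta> n0 A (fst z) (snd z + s)}"
  have s: "?g i \<in> sets \<mu>" "?b \<in> sets \<mu>" for i unfolding space_mu[symmetric] by measurable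
  have eq: "{z \<in> \<Omega>. \<not> (good k \<eta> n0 A (fst z) (snd z + s) \<and> (\<forall>i\<in>I. generic k \<eta> (fst z) (snd z + t i)))} = ?b \<union> (\<Union>i\<in>I. ?g i)"
    by auto
  have 1: "measure \<mu> (?b \<union> (\<Union>i\<in>I. ?g i)) \<le> measure \<mu> ?b + measure \<mu> (\<Union>i\<in>I. ?g i)"
    using s I by (intro measure_Un_le sets.finite_UN) auto
  have 2: "measure \<mu> (\<Union>i\<in>I. ?g i) \<le> (\<Sum>i\<in>I. measure \<mu> (?g i))"
    using s I by (intro finite_measure_subadditive_finite) auto
  have 3: "(\<Sum>i\<in>I. measure \<mu> (?g i)) \<le> real (card I) * e" by (rule sum_bounded_above[OF g])
  show ?thesis unfolding eq distrib_right using 1 2 3 gd by linarith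
qed

text \<open>The index that attains the maximum has direction of modulus 1 unless the maximum is 0,
  which is excluded at points that are good at the last time.\<close>

lemma cdir_attained:
  assumes n: "0 < n"
  shows "((\<lambda>t. measure \<mu> {z \<in> space \<mu>. \<forall>i<n. \<bar>cdir n t i z\<bar> \<noteq> 1}) \<longlongrightarrow> 0) (far_filter n)"
  unfolding tendsto_iff eventually_far_filter
proof (intro allI impI)
  fix \<epsilon> :: real assume "\<epsilon> > 0"
  then have e: "\<epsilon>/2 > 0" by simp
  obtain k \<eta> where gd: "\<forall>n1. \<exists>n0\<ge>n1. \<exists>T. \<forall>t\<ge>T. ungood k \<eta> n0 1 t \<le> \<epsilon>/2"
    using good_measure[OF zero_less_one e] by blast
  obtain n0 T where n0: "n0 \<ge> 1"
    and T: "\<And>t. t \<ge> T \<Longrightarrow> ungood k \<eta> n0 1 t \<le> \<epsilon>/2" using spec[OF gd, of 1] by blast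
  have "measure \<mu> {z \<in> space \<mu>. \<forall>i<n. \<bar>cdir n t i z\<bar> \<noteq> 1} < \<epsilon>"
    if t: "gaps n (max T 0) t" "max T 0 \<le> t 0" for t
  proof -
    have "measure \<mu> {z \<in> space \<mu>. \<forall>i<n. \<bar>cdir n t i z\<bar> \<noteq> 1}
      \<le> measure \<mu> {z \<in> space \<mu>. \<not> good k \<eta> n0 1 (fst z) (snd z + t (n - 1))}"
    proof (rule finite_measure_mono)
      show "{z \<in> space \<mu>. \<not> good k \<eta> n0 1 (fst z) (snd z + t (n - 1))} \<in> sets \<mu>" by measurable
      show "{z \<in> space \<mu>. \<forall>i<n. \<bar>cdir n t i z\<bar> \<noteq> 1} \<subseteq> {z \<in> space \<mu>. \<not> good k \<eta> n0 1 (fst z) (snd z + t (n - 1))}"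
      proof (clarsimp, goal_cases)
        case (1 x r)
        then have rx: "regular x" by (simp add: space_iff)
        have "good k \<eta> n0 1 x (r + t (n - 1))" using 1 by simp
        then have v: "1 \<le> vmax n t x r" "spd n t x r = vmax n t x r"
          using good_vmax[where t = t, OF n rx, of k \<eta> n0 r 1] n0 by auto
        obtain i where "i < n" "vmax n t x r = \<bar>vel x (r + t i)\<bar>" using vmax_attained[OF n] by blast
        then have "\<bar>cdir n t i (x, r)\<bar> = 1" using rx v by (simp add: cdir_def)
        then show ?case using 1 \<open>i < n\<close> by blast
      qed
    qed
    also have "\<dots> \<le> \<epsilon>/2" using T[of "t (n - 1)"] far_mono[OF t, of "n - 1"] n by simp
    finally show ?thesis using \<open>\<epsilon> > 0\<close> by simp
  qed
  then show "\<exists>T. \<forall>t. gaps n T t \<and> T \<le> t 0 \<longrightarrow> dist (measure \<mu> {z \<in> space \<mu>. \<forall>i<n. \<bar>cdir n t i z\<bar> \<noteq> 1}) 0 < \<epsilon>"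
    by (intro exI[of _ "max T 0"]) (simp add: dist_real_def)
qed

text \<open>The flow by a fixed time \<open>u\<close> changes each velocity, and so their maximum,
  by at most a constant \<open>C\<close>, while off a small set the maximum is at least
  \<open>Q\<close>. The quotient changes by at most \<open>2 * C / Q\<close>.\<close>

lemma slow_cdir:
  assumes i: "i < n"
  shows "slow n (\<lambda>t. cdir n t i)"
  unfolding slow_def
proof (intro conjI allI)
  show cu: "cdir n t i \<in> unit_bounded" for t by (rule cdir_unit_bounded[OF i])
  have n: "0 < n" using i by simp
  fix u
  show "((\<lambda>t. \<integral>z. \<bar>cdir n t i (K u z) - cdir n t i z\<bar> \<partial>\<mu>) \<longlongrightarrow> 0) (far_filter n)"
    unfolding tendsto_iff eventually_far_filter
  proof (intro allI impI)
    fix \<epsilon> :: real assume \<epsilon>: "\<epsilon> > 0"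
    \<comment> \<open>The exceptional set consists of \<open>n + 2\<close> sets: genericity at the
      \<open>n\<close> times and at time 0, and goodness at the last time. Together they have
      measure at most \<open>\<epsilon>/8\<close>.\<close>
    define e where "e = \<epsilon> / (8 * (real n + 2))"
    have e: "e > 0" using \<epsilon> by (simp add: e_def)
    obtain k \<eta> where k: "k \<ge> \<lceil>\<bar>u\<bar> / roof_min + 1\<rceil>" and \<eta>: "\<eta> > 0"
      and gen: "\<And>t. ungeneric k \<eta> t \<le> e"
      and gd: "\<And>n1. \<exists>n0\<ge>n1. \<exists>T. \<forall>t\<ge>T. ungood k \<eta> n0 1 t \<le> e"
      using good_measure[OF zero_less_one e, of "\<lceil>\<bar>u\<bar> / roof_min + 1\<rceil>"] by auto
    have ku: "\<bar>u\<bar> / roof_min + 1 \<le> of_int k" using k by linarith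
    define C where "C = 2 * (of_int k * away \<eta>)"
    have "0 \<le> \<bar>u\<bar> / roof_min" using roof_min(1) by simp
    then have "(0::real) \<le> of_int k" using ku by linarith
    then have C0: "C \<ge> 0" using away(1)[OF \<eta>] by (simp add: C_def)
    define Q where "Q = 1 + C + 8 * C / \<epsilon>"
    have Q: "0 < Q" "C < Q" "8 * C / \<epsilon> \<le> Q" using C0 \<epsilon> by (auto simp: Q_def add_pos_nonneg)
    obtain n0 T where n0: "n0 \<ge> \<lceil>Q\<^sup>2\<rceil>"
      and T: "\<And>t. t \<ge> T \<Longrightarrow> ungood k \<eta> n0 1 t \<le> e" using gd[of "\<lceil>Q\<^sup>2\<rceil>"] by blast
    have Q2: "Q\<^sup>2 \<le> of_int n0" using n0 by linarith
    have "(\<integral>z. \<bar>cdir n t i (K u z) - cdir n t i z\<bar> \<partial>\<mu>) < \<epsilon>" if t: "gaps n (max T 0) t" "max T 0 \<le> t 0" for t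
    proof -
      \<comment> \<open>Index \<open>n\<close> stands for time 0, where \<open>vel_flow\<close> also
        asks for genericity.\<close>
      define t' where "t' j = (if j = n then 0 else t j)" for j
      let ?Z = "{z \<in> \<Omega>. \<not> (good k \<eta> n0 1 (fst z) (snd z + t (n - 1)) \<and> (\<forall>j\<in>{..n}. generic k \<eta> (fst z) (snd z + t' j)))}"
      have Zs: "?Z \<in> sets \<mu>" unfolding space_mu[symmetric] by measurable
      have "measure \<mu> ?Z \<le> (real (card {..n}) + 1) * e"
        by (rule bad_union_measure) (use gen T[of "t (n - 1)"] far_mono[OF t, of "n - 1"] n in auto)
      also have "\<dots> = \<epsilon>/8" by (simp add: e_def field_simps)
      finally have Zm: "measure \<mu> ?Z \<le> \<epsilon>/8" .
      have "(\<integral>z. \<bar>cdir n t i (K u z) - cdir n t i z\<bar> \<partial>\<mu>) \<le> (\<integral>z. \<epsilon>/4 + 2 * indicator ?Z z \<partial>\<mu>)"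
      proof (rule integral_mono)
        show "integrable \<mu> (\<lambda>z. \<bar>cdir n t i (K u z) - cdir n t i z\<bar>)"
          using unit_boundedD(3)[OF cu[of t]] unit_boundedD(3)[OF unit_bounded_K[OF cu[of t], of u]] by simp
        show "integrable \<mu> (\<lambda>z. \<epsilon>/4 + 2 * indicator ?Z z)" by (rule integral_affine_indicator(1)[OF Zs])
        fix z assume z: "z \<in> space \<mu>"
        show "\<bar>cdir n t i (K u z) - cdir n t i z\<bar> \<le> \<epsilon>/4 + 2 * indicator ?Z z"
        proof (cases "z \<in> ?Z")
          case True
          have "\<bar>cdir n t i (K u z)\<bar> \<le> 1" "\<bar>cdir n t i z\<bar> \<le> 1" by (rule cdir_le_1[OF i])+
          then show ?thesis using True \<epsilon> by simp
        next
          case False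
          obtain x r where xr: "z = (x, r)" by (cases z)
          then have zO: "(x, r) \<in> \<Omega>" and rx: "regular x" using z by (auto simp: space_iff)
          have g: "good k \<eta> n0 1 x (r + t (n - 1))" "generic k \<eta> x (r + 0)" "\<And>j. j < n \<Longrightarrow> generic k \<eta> x (r + t j)"
            using False z xr by (auto simp: t'_def dest: bspec[of _ _ n] bspec[of "{..n}" _ "_::nat"] split: if_splits)
          define x' r' where "x' = fst (K u z)" and "r' = snd (K u z)"
          have rx': "regular x'" using K_in_space[OF rx, of u r] xr by (cases "K u z") (auto simp: x'_def space_iff)
          have vd: "\<bar>vel x' (r' + t j) - vel x (r + t j)\<bar> \<le> C" if "j < n" for j
            using vel_flow[OF zO \<eta> g(3)[OF that] g(2) ku] xr by (simp add: C_def x'_def r'_def)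
          define P where "P = vmax n t x r"
          define P' where "P' = vmax n t x' r'"
          have P: "Q \<le> P" "spd n t x r = P" using good_vmax[where t = t, OF n rx g(1) Q(1) Q2] by (auto simp: P_def)
          have PP: "\<bar>P' - P\<bar> \<le> C" unfolding P_def P'_def vmax_def
          proof (rule Max_image_diff_le)
            fix j assume "j \<in> {..<n}"
            then have "\<bar>vel x' (r' + t j) - vel x (r + t j)\<bar> \<le> C" using vd by simp
            then show "\<bar>\<bar>vel x' (r' + t j)\<bar> - \<bar>vel x (r + t j)\<bar>\<bar> \<le> C" by linarith
          qed (use n in auto)
          have P'0: "P' > 0" using PP P(1) Q(2) by linarith
          have P0: "P > 0" using P(1) Q(1) by linarith
          have c: "cdir n t i z = vel x (r + t i) / P" using rx P(2) xr by (simp add: cdir_def)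
          have c': "cdir n t i (K u z) = vel x' (r' + t i) / P'"
            using rx' P'0 by (simp add: cdir_def spd_def x'_def r'_def P'_def)
          have vP': "\<bar>vel x' (r' + t i)\<bar> \<le> P'" unfolding P'_def by (rule vel_le_vmax[OF i])
          let ?v = "vel x (r + t i)" and ?v' = "vel x' (r' + t i)"
          have "?v' / P' - ?v / P = (?v' - ?v) / P + (?v' / P') * ((P - P') / P)"
            using P0 P'0 by (simp add: field_simps)
          also have "\<bar>\<dots>\<bar> \<le> \<bar>?v' - ?v\<bar> / P + \<bar>?v' / P'\<bar> * (\<bar>P - P'\<bar> / P)"
            using P0 by (intro order_trans[OF abs_triangle_ineq]) (simp add: abs_mult)
          also have "\<dots> \<le> C / P + 1 * (C / P)"
          proof (intro add_mono mult_mono divide_right_mono)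
            show "\<bar>?v' / P'\<bar> \<le> 1" using vP' P'0 by (simp add: abs_divide)
          qed (use vd[OF i] PP P0 C0 in \<open>auto simp: abs_minus_commute\<close>)
          also have "\<dots> = 2 * C / P" by simp
          also have "\<dots> \<le> \<epsilon>/4"
          proof -
            have "8 * C / \<epsilon> \<le> P" using Q(3) P(1) by linarith
            then show ?thesis using P0 \<epsilon> by (simp add: field_simps)
          qed
          finally show ?thesis using False unfolding c c' by simp
        qed
      qed
      also have "\<dots> = \<epsilon>/4 + 2 * measure \<mu> ?Z" by (rule integral_affine_indicator(2)[OF Zs])
      also have "\<dots> < \<epsilon>" using Zm \<epsilon> by linarith
      finally show ?thesis .
    qed
    then show "\<exists>T. \<forall>t. gaps n T t \<and> T \<le> t 0 \<longrightarrow> dist (\<integral>z. \<bar>cdir n t i (K u z) - cdir n t i z\<bar> \<partial>\<mu>) 0 < \<epsilon>"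
      by (intro exI[of _ "max T 0"]) (simp add: dist_real_def abs_of_nonneg)
  qed
qed

subsection \<open>Averaging along the shear\<close>

abbreviation strip :: "real set" where "strip \<equiv> {0<..<roof_min / 2}"

text \<open>Over every regular base point the strip lies below the roof, so the suspension is a
  product there and Fubini's theorem applies in both orders.\<close>

lemma strip_integral:
  fixes H :: "real \<times> real \<Rightarrow> real"
  assumes Hm [measurable]: "H \<in> borel_measurable borel" and B: "\<And>z. \<bar>H z\<bar> \<le> B"
  shows "(\<integral>z. indicator strip (snd z) * H z \<partial>\<mu>) = (\<integral>r. indicator strip r * (\<integral>x. H (x, r) \<partial>circ) \<partial>lborel)"
    and "integrable lborel (\<lambda>r. indicator strip r * (\<integral>x. H (x, r) \<partial>circ))"
    and "(\<integral>z. indicator strip (snd z) * H z \<partial>\<mu>) = (\<integral>x. (\<integral>r. indicator strip r * H (x, r) \<partial>lborel) \<partial>circ)"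
proof -
  have Hp [measurable]: "H \<in> borel_measurable (lborel \<Otimes>\<^sub>M lborel)"
    using Hm by (simp add: measurable_cong_sets[OF sets_plane refl])
  define G where "G x r = indicator {0..<1} x * (indicator strip r * H (x, r))" for x r
  have Gm [measurable]: "(\<lambda>(x, r). G x r) \<in> borel_measurable (lborel \<Otimes>\<^sub>M lborel)" unfolding G_def by measurable
  have Gi: "integrable (lborel \<Otimes>\<^sub>M lborel) (\<lambda>(x, r). G x r)"
  proof (rule Bochner_Integration.integrable_bound)
    have "emeasure (lborel \<Otimes>\<^sub>M lborel) ({0..1::real} \<times> {0..roof_min / 2}) < \<infinity>"
      using roof_min(1) by (subst lborel.emeasure_pair_measure_Times) (auto simp: ennreal_mult_less_top)
    then show "integrable (lborel \<Otimes>\<^sub>M lborel) (\<lambda>z. B * indicator ({0..1::real} \<times> {0..roof_min / 2}) z)"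
      by (intro integrable_mult_right integrable_real_indicator) auto
    show "AE z in lborel \<Otimes>\<^sub>M lborel. norm (case z of (x, r) \<Rightarrow> G x r) \<le> norm (B * indicator ({0..1::real} \<times> {0..roof_min / 2}) z)"
    proof (rule AE_I2)
      fix z :: "real \<times> real"
      obtain x r where z: "z = (x, r)" by (cases z)
      have "\<bar>H (x, r)\<bar> \<le> \<bar>B\<bar>" using B[of "(x, r)"] by linarith
      then show "norm (case z of (x, r) \<Rightarrow> G x r) \<le> norm (B * indicator ({0..1} \<times> {0..roof_min / 2}) z)"
        unfolding z G_def by (auto simp: indicator_def)
    qed
  qed measurable
  have "(\<integral>z. indicator strip (snd z) * H z \<partial>\<mu>)
      = (\<integral>z. indicator \<Omega> z *\<^sub>R (indicator strip (snd z) * H z) \<partial>(lborel \<Otimes>\<^sub>M lborel))" unfolding suspension_measure_def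
    by (rule integral_restrict_space) (use space_measurable in \<open>simp add: space_pair_measure sets_plane[simplified]\<close>)
  also have "\<dots> = (\<integral>z. (case z of (x, r) \<Rightarrow> G x r) \<partial>(lborel \<Otimes>\<^sub>M lborel))"
  proof (rule integral_cong_AE)
    have [measurable]: "\<Omega> \<in> sets (lborel \<Otimes>\<^sub>M lborel)" by (simp only: sets_plane space_measurable)
    show "(\<lambda>z. indicator \<Omega> z *\<^sub>R (indicator strip (snd z) * H z)) \<in> borel_measurable (lborel \<Otimes>\<^sub>M lborel)" by measurable
    have "AE z in lborel \<Otimes>\<^sub>M lborel. regular (fst z)"
    proof (rule lborel_pair.AE_pair_measure)
      show "AE x in lborel. AE y in lborel. regular (fst (x, y))" using AE_regular by eventually_elim simp
    qed measurable
    then show "AE z in lborel \<Otimes>\<^sub>M lborel. indicator \<Omega> z *\<^sub>R (indicator strip (snd z) * H z) = (case z of (x, r) \<Rightarrow> G x r)"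
    proof eventually_elim
      case (elim z)
      obtain x r where z: "z = (x, r)" by (cases z)
      have "roof_min \<le> \<Phi> x" using roof_min(2) regular_nonint0 elim z by auto
      then show ?case using elim roof_min(1) unfolding z G_def by (auto simp: indicator_def space_iff)
    qed
  qed measurable
  finally have 0: "(\<integral>z. indicator strip (snd z) * H z \<partial>\<mu>) = (\<integral>z. (case z of (x, r) \<Rightarrow> G x r) \<partial>(lborel \<Otimes>\<^sub>M lborel))" .
  then have 1: "(\<integral>z. indicator strip (snd z) * H z \<partial>\<mu>) = (\<integral>r. (\<integral>x. G x r \<partial>lborel) \<partial>lborel)"
    using lborel_pair.integral_snd[OF Gi] by simp
  have 2: "(\<integral>x. G x r \<partial>lborel) = indicator strip r * (\<integral>x. H (x, r) \<partial>circ)" for r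
  proof -
    have [measurable]: "(\<lambda>x. H (x, r)) \<in> borel_measurable borel"
      by (rule measurable_compose[OF _ Hm]) (intro borel_measurable_Pair; simp)
    show ?thesis unfolding G_def by (subst integral_circ) (auto simp: mult_ac indicator_def)
  qed
  show "(\<integral>z. indicator strip (snd z) * H z \<partial>\<mu>) = (\<integral>r. indicator strip r * (\<integral>x. H (x, r) \<partial>circ) \<partial>lborel)"
    unfolding 1 2 ..
  show "integrable lborel (\<lambda>r. indicator strip r * (\<integral>x. H (x, r) \<partial>circ))"
    using lborel_pair.integrable_snd[OF Gi] unfolding 2 by simp
  have [measurable]: "(\<lambda>x. \<integral>r. indicator strip r * H (x, r) \<partial>lborel) \<in> borel_measurable borel" by measurable
  have "(\<integral>x. (\<integral>r. indicator strip r * H (x, r) \<partial>lborel) \<partial>circ) = (\<integral>x. (\<integral>r. G x r \<partial>lborel) \<partial>lborel)"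
    unfolding G_def by (subst integral_circ) simp_all
  then show "(\<integral>z. indicator strip (snd z) * H z \<partial>\<mu>) = (\<integral>x. (\<integral>r. indicator strip r * H (x, r) \<partial>lborel) \<partial>circ)"
    using 0 lborel_pair.integral_fst'[OF Gi] by simp
qed

lemma lift_periodic: "regular x \<Longrightarrow> box \<Lambda> f \<Longrightarrow> lift f (x + 1) u = lift f x u"
proof -
  assume r: "regular x" and f: "box \<Lambda> f"
  have c: "cr (x + 1) u = cr x u" using cr_add_int[of x 1 u] by simp
  have s: "S n (x + 1) = S n x" for n using S_add_int[OF r, of n 1] by simp
  have "f (x + 1 + of_int (cr x u) * \<alpha>, h) = f (x + of_int (cr x u) * \<alpha>, h)" for h
    using boxD(2)[OF f, of "x + of_int (cr x u) * \<alpha>" 1 h] by (simp add: algebra_simps)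
  then show ?thesis by (simp add: lift_def c s)
qed

lemma vel_periodic: "regular x \<Longrightarrow> vel (x + 1) u = vel x u"
  using cr_add_int[of x 1 u] birkhoff_add_int[of x "deriv \<Phi>" 1 "cr x u"] roof_add_int(2)[of _ 1]
  by (simp add: vel_def)

text \<open>The irregular points are countable, so almost every displacement leads to a regular
  point, as \<open>shear_point\<close> asks of \<open>y\<close>.\<close>

lemma AE_regular_diff: "AE d in lborel. regular (y + c * d)" if "c \<noteq> 0" for y c
proof -
  have "{d. \<not> regular (y + c * d)} \<subseteq> (\<lambda>x. (x - y) / c) ` {x. \<not> regular x}"
  proof
    fix d assume "d \<in> {d. \<not> regular (y + c * d)}"
    then have "y + c * d \<in> {x. \<not> regular x}" "d = (\<lambda>x. (x - y) / c) (y + c * d)" using that by auto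
    then show "d \<in> (\<lambda>x. (x - y) / c) ` {x. \<not> regular x}" by blast
  qed
  then have "countable {d. \<not> regular (y + c * d)}"
    by (rule countable_subset[OF _ countable_image[OF countable_irregular]])
  from AE_not_in[OF countable_imp_null_set_lborel[OF this]] show ?thesis by (rule AE_mp) (rule AE_I2, blast)
qed

end

context power_roof
begin

text \<open>The product at the sheared times \<open>t i - cdir n t i z * s\<close>. It is expressed
  through \<open>lift\<close>, so that it makes sense for base points outside of the unit interval;
  \<open>m i\<close> will be the mean of \<open>f i\<close>.\<close>

definition sheared :: "nat \<Rightarrow> (nat \<Rightarrow> real \<times> real \<Rightarrow> real) \<Rightarrow> (nat \<Rightarrow> real) \<Rightarrow> (nat \<Rightarrow> real) \<Rightarrow> real \<Rightarrow> real \<times> real \<Rightarrow> real"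
  where "sheared n f m t s z = (\<Prod>i<n. lift (f i) (fst z) (snd z + t i - cdir n t i z * s) - m i)"

lemma box_continuous: "box \<Lambda> f \<Longrightarrow> continuous_on UNIV f"
proof (rule continuous_onI)
  fix z :: "real \<times> real" and e :: real assume f: "box \<Lambda> f" and e: "e > 0"
  define \<delta> where "\<delta> = e / (2 * (\<Lambda> + 1))"
  have L: "\<Lambda> \<ge> 0" by (rule boxD(1)[OF f])
  have "dist (f w) (f z) \<le> e" if d: "dist w z < \<delta>" for w
  proof -
    have "\<bar>fst w - fst z\<bar> \<le> dist w z" "\<bar>snd w - snd z\<bar> \<le> dist w z"
      using dist_fst_le[of w z] dist_snd_le[of w z] by (simp_all add: dist_real_def)
    then have "\<bar>fst w - fst z\<bar> + \<bar>snd w - snd z\<bar> \<le> 2 * \<delta>" using d by linarith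
    then have "\<Lambda> * (\<bar>fst w - fst z\<bar> + \<bar>snd w - snd z\<bar>) \<le> (\<Lambda> + 1) * (2 * \<delta>)" using L by (intro mult_mono) auto
    moreover have "(\<Lambda> + 1) * (2 * \<delta>) = e" using L unfolding \<delta>_def by (simp add: field_simps)
    ultimately show ?thesis using boxD(4)[OF f, of "fst w" "snd w" "fst z" "snd z"] by (simp add: dist_real_def)
  qed
  then show "\<exists>d>0. \<forall>x'\<in>UNIV. dist x' z < d \<longrightarrow> dist (f x') (f z) \<le> e"
    using e L by (intro exI[of _ \<delta>]) (auto simp: \<delta>_def)
qed

lemma box_measurable: "box \<Lambda> f \<Longrightarrow> f \<in> borel_measurable borel"
  by (rule borel_measurable_continuous_onI[OF box_continuous])

lemma box_lift_le: "box \<Lambda> f \<Longrightarrow> \<bar>m\<bar> \<le> 1/2 \<Longrightarrow> \<bar>lift f x u - m\<bar> \<le> 1"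
  using boxD(5)[of \<Lambda> f "(x + of_int (cr x u) * \<alpha>, u - S (cr x u) x)"] by (simp add: lift_def)

context
  fixes n :: nat and f :: "nat \<Rightarrow> real \<times> real \<Rightarrow> real" and m :: "nat \<Rightarrow> real" and \<Lambda> :: real
  assumes f: "\<And>i. i < n \<Longrightarrow> box \<Lambda> (f i)" and m: "\<And>i. i < n \<Longrightarrow> \<bar>m i\<bar> \<le> 1/2"
begin

lemma lift_le: "i < n \<Longrightarrow> \<bar>lift (f i) x u - m i\<bar> \<le> 1"
  by (rule box_lift_le[OF f m])

lemma sheared_le_1: "\<bar>sheared n f m t s z\<bar> \<le> 1"
  unfolding sheared_def by (rule abs_prod_le_1) (simp_all add: lift_le)

lemma sheared_lipschitz:
  assumes "regular (fst z)"
  shows "\<bar>sheared n f m t s z - sheared n f m t s' z\<bar> \<le> real n * (\<Lambda> + 4 / roof_min) * \<bar>s - s'\<bar>"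
proof -
  let ?l = "\<lambda>i s. lift (f i) (fst z) (snd z + t i - cdir n t i z * s)"
  have "\<bar>sheared n f m t s z - sheared n f m t s' z\<bar> \<le> (\<Sum>i<n. \<bar>(?l i s - m i) - (?l i s' - m i)\<bar>)"
    unfolding sheared_def by (rule abs_prod_diff_le) (simp_all add: lift_le)
  also have "\<dots> \<le> (\<Sum>i<n. (\<Lambda> + 4 / roof_min) * \<bar>s - s'\<bar>)"
  proof (rule sum_mono)
    fix i assume "i \<in> {..<n}"
    then have i: "i < n" by simp
    have l0: "0 \<le> \<Lambda> + 4 / roof_min" using boxD(1)[OF f[OF i]] roof_min(1) by simp
    have "\<bar>?l i s - ?l i s'\<bar> \<le> (\<Lambda> + 4 / roof_min) * \<bar>(snd z + t i - cdir n t i z * s) - (snd z + t i - cdir n t i z * s')\<bar>"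
      by (rule box_lift_lipschitz[OF f[OF i] assms])
    also have "\<dots> = (\<Lambda> + 4 / roof_min) * (\<bar>cdir n t i z\<bar> * \<bar>s - s'\<bar>)"
      by (simp add: abs_mult[symmetric] algebra_simps abs_minus_commute)
    also have "\<dots> \<le> (\<Lambda> + 4 / roof_min) * (1 * \<bar>s - s'\<bar>)"
      using cdir_le_1[OF i] l0 by (intro mult_left_mono mult_right_mono) auto
    finally show "\<bar>(?l i s - m i) - (?l i s' - m i)\<bar> \<le> (\<Lambda> + 4 / roof_min) * \<bar>s - s'\<bar>" by simp
  qed
  finally show ?thesis by (simp add: mult_ac)
qed

lemma sheared_measurable [measurable (raw)]:
  assumes [measurable]: "g \<in> borel_measurable L" "h \<in> borel_measurable L" "s \<in> borel_measurable L"
  shows "(\<lambda>w. sheared n f m t (s w) (g w, h w)) \<in> borel_measurable L"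
  unfolding sheared_def fst_conv snd_conv
proof (intro borel_measurable_prod borel_measurable_diff)
  fix i assume "i \<in> {..<n}"
  then have "f i \<in> borel_measurable borel" using f box_measurable by blast
  then show "(\<lambda>w. lift (f i) (g w) (h w + t i - cdir n t i (g w, h w) * s w)) \<in> borel_measurable L" by measurable
qed simp

text \<open>At a fixed height, \<open>slow_scale_average\<close> replaces \<open>F x\<close> by its
  average over the displacements \<open>s / P x\<close> (error \<open>4 * e\<close>);
  \<open>shears\<close> turns \<open>F (x + s / P x)\<close> into the product at the sheared times
  (error \<open>(n + 1) * \<Lambda> * e\<close>); and a Riemann sum of step \<open>d\<close>
  replaces the integral over \<open>s\<close>. The complement of \<open>G\<close> is charged once in
  the averaging and once in the comparison.\<close>

lemma shear_fibre:
  assumes n: "0 < n" and J: "0 < J" and d: "0 < d" and e: "0 < e" "e < 1" and f0: "box \<Lambda> f0"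
    and Gm [measurable]: "G \<in> sets borel" and G: "\<And>x. x \<in> G \<Longrightarrow> regular x"
    and shear: "\<And>x y. x \<in> G \<Longrightarrow> regular y \<Longrightarrow> \<bar>y - x\<bar> \<le> real J * d / spd n t x r \<Longrightarrow> shears n t r e x y"
  shows "\<bar>\<integral>x. (if regular x then f0 (x, r) * (sheared n f m t 0 (x, r) - (\<Sum>j<J. sheared n f m t (real j * d) (x, r)) / real J) else 0) \<partial>circ\<bar>
     \<le> 4 * e + (real n + 1) * \<Lambda> * e + real n * (\<Lambda> + 4 / roof_min) * d + 4 * measure circ (- G)"
proof -
  let ?R = "real J * d"
  let ?Y = "\<lambda>s x. sheared n f m t s (x, r)"
  define P where "P x = spd n t x r" for x
  \<comment> \<open>The value 0 at irregular points makes \<open>F\<close> periodic on the whole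
    line; \<open>lift_periodic\<close> is available at regular points.\<close>
  define F where "F x = (if regular x then f0 (x, r) * ?Y 0 x else 0)" for x
  define A where "A x = (if regular x then f0 (x, r) * ((\<Sum>j<J. ?Y (real j * d) x) / real J) else 0)" for x
  define B where "B x = (\<integral>s. F (x + s / P x) * indicator {0..?R} s \<partial>lborel) / ?R" for x
  have R: "?R > 0" using J d by simp
  have f0m [measurable]: "f0 \<in> borel_measurable borel" by (rule box_measurable[OF f0])
  have f0r [measurable]: "(\<lambda>x. f0 (x, r)) \<in> borel_measurable borel"
    by (rule measurable_compose[OF _ f0m]) (intro borel_measurable_Pair; simp)
  have Fm [measurable]: "F \<in> borel_measurable borel" unfolding F_def by measurable
  have Am [measurable]: "A \<in> borel_measurable borel" unfolding A_def by measurable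
  have Pm [measurable]: "P \<in> borel_measurable borel" unfolding P_def by measurable
  have P: "P x > 0" for x by (simp add: P_def spd_pos)
  have reg1: "regular (x + 1) \<longleftrightarrow> regular x" for x using regular_add_int[of x 1] by simp
  have Pp: "periodic1 P" unfolding periodic1_def
  proof
    fix x
    show "P (x + 1) = P x"
    proof (cases "regular x")
      case True
      then show ?thesis by (simp add: P_def spd_def vmax_def vel_periodic reg1)
    qed (simp add: P_def spd_def reg1)
  qed
  have f01: "\<bar>f0 z\<bar> \<le> 1" for z using boxD(5)[OF f0, of z] by linarith
  have FY: "\<bar>f0 z * sheared n f m t s w\<bar> \<le> 1" for z s w
    unfolding abs_mult using mult_mono[OF f01 sheared_le_1] by simp
  have F1: "\<bar>F x\<bar> \<le> 1" for x using FY[of "(x, r)" 0 "(x, r)"] by (simp add: F_def)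
  have Fp: "periodic1 F" unfolding periodic1_def
  proof
    fix x
    show "F (x + 1) = F x"
    proof (cases "regular x")
      case True
      have "lift (f i) (x + 1) (r + t i) = lift (f i) x (r + t i)" if "i < n" for i
        by (rule lift_periodic[OF True f[OF that]])
      then show ?thesis using True boxD(2)[OF f0, of x 1 r] by (simp add: F_def reg1 sheared_def)
    qed (simp add: F_def reg1)
  qed
  have 1: "\<bar>(\<integral>x. F x \<partial>circ) - (\<integral>x. B x \<partial>circ)\<bar> \<le> 4 * e + 2 * measure circ (- G)" unfolding B_def
  proof (rule slow_scale_average[OF Pm P Pp Fm F1 Fp R e Gm])
    fix y assume y: "y \<in> G"
    have "AE d in lborel. regular (y + (-1) * d)" by (rule AE_regular_diff) simp
    then show "AE d in lborel. 0 \<le> d \<and> d * P y \<le> ?R \<longrightarrow> \<bar>P (y - d) - P y\<bar> \<le> e * P y"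
    proof eventually_elim
      case (elim d)
      then have "regular (y - d)" by simp
      from shear[OF y this] show ?case using P[of y] by (auto simp: shears_def P_def[symmetric] field_simps)
    qed
  qed
  have Bm [measurable]: "B \<in> borel_measurable borel" unfolding B_def by measurable
  have B1: "\<bar>B x\<bar> \<le> 1" for x
  proof -
    have "\<bar>\<integral>s. F (x + s / P x) * indicator {0..?R} s \<partial>lborel\<bar> \<le> ?R - 0"
      by (rule bounded_integral_Icc) (use F1 R in auto)
    then show ?thesis unfolding B_def abs_divide using R by (subst divide_le_eq_1_pos) auto
  qed
  have A1: "\<bar>A x\<bar> \<le> 1" for x
  proof (cases "regular x")
    case True
    have "\<bar>\<Sum>j<J. ?Y (real j * d) x\<bar> \<le> (\<Sum>j<J. 1)" by (rule order_trans[OF sum_abs]) (intro sum_mono sheared_le_1)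
    then have "\<bar>(\<Sum>j<J. ?Y (real j * d) x) / real J\<bar> \<le> 1"
      unfolding abs_divide using J by (subst divide_le_eq_1_pos) auto
    from mult_mono[OF f01[of "(x, r)"] this] show ?thesis using True by (simp add: A_def abs_mult)
  qed (simp add: A_def)
  let ?\<kappa> = "(real n + 1) * \<Lambda> * e + real n * (\<Lambda> + 4 / roof_min) * d"
  have L0: "0 \<le> \<Lambda>" by (rule boxD(1)[OF f0])
  have k0: "0 \<le> ?\<kappa>" using L0 e d roof_min(1) by (intro add_nonneg_nonneg mult_nonneg_nonneg) auto
  have BA: "\<bar>B x - A x\<bar> \<le> ?\<kappa> + 2 * indicator (- G) x" for x
  proof (cases "x \<in> G")
    case False
    then show ?thesis using A1[of x] B1[of x] k0 by simp
  next
    case True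
    have rx: "regular x" by (rule G[OF True])
    have pw: "\<bar>F (x + s / P x) - f0 (x, r) * ?Y s x\<bar> \<le> (real n + 1) * \<Lambda> * e" if s: "0 \<le> s" "s \<le> ?R" and ry: "regular (x + s / P x)" for s
    proof -
      let ?y = "x + s / P x"
      have sP: "s / P x \<le> ?R / P x" "0 \<le> s / P x" using s P[of x] by (auto intro: divide_right_mono)
      have *: "\<bar>?y - x\<bar> \<le> e" "\<And>i. i < n \<Longrightarrow> \<bar>lift (f i) ?y (r + t i) - lift (f i) x (r + t i - vel x (r + t i) * (?y - x))\<bar> \<le> \<Lambda> * e"
        using shear[OF True ry] sP f by (auto simp: shears_def P_def)
      \<comment> \<open>With displacements measured in units of \<open>1 / P x\<close>, the flow
        time is the direction times \<open>s\<close>.\<close>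
      have c: "vel x (r + t i) * (?y - x) = cdir n t i (x, r) * s" for i using rx by (simp add: cdir_def P_def)
      have "\<bar>?Y 0 ?y - ?Y s x\<bar> \<le> (\<Sum>i<n. \<bar>(lift (f i) ?y (r + t i) - m i) - (lift (f i) x (r + t i - cdir n t i (x, r) * s) - m i)\<bar>)"
        unfolding sheared_def fst_conv snd_conv mult_zero_right diff_zero
        by (rule abs_prod_diff_le) (simp_all add: lift_le)
      also have "\<dots> \<le> (\<Sum>i<n. \<Lambda> * e)" using *(2) unfolding c by (intro sum_mono) simp
      finally have Yd: "\<bar>?Y 0 ?y - ?Y s x\<bar> \<le> real n * (\<Lambda> * e)" by simp
      have fd: "\<bar>f0 (?y, r) - f0 (x, r)\<bar> \<le> \<Lambda> * e" using boxD(4)[OF f0, of ?y r x r] mult_left_mono[OF *(1) L0] by simp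
      have "f0 (?y, r) * ?Y 0 ?y - f0 (x, r) * ?Y s x
        = (f0 (?y, r) - f0 (x, r)) * ?Y 0 ?y + f0 (x, r) * (?Y 0 ?y - ?Y s x)" by (simp add: algebra_simps)
      then have "\<bar>f0 (?y, r) * ?Y 0 ?y - f0 (x, r) * ?Y s x\<bar> \<le> \<bar>f0 (?y, r) - f0 (x, r)\<bar> * \<bar>?Y 0 ?y\<bar> + \<bar>f0 (x, r)\<bar> * \<bar>?Y 0 ?y - ?Y s x\<bar>"
        by (simp add: abs_mult[symmetric])
      also have "\<dots> \<le> (\<Lambda> * e) * 1 + 1 * (real n * (\<Lambda> * e))"
        using L0 e by (intro add_mono mult_mono fd sheared_le_1 f01 Yd) auto
      finally show ?thesis using ry by (simp add: F_def algebra_simps)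
    qed
    define D where "D = (\<integral>s. f0 (x, r) * ?Y s x * indicator {0..?R} s \<partial>lborel)"
    have Fi: "integrable lborel (\<lambda>s. F (x + s / P x) * indicator {0..?R} s)"
      by (rule bounded_integral_Icc) (use F1 in auto)
    have Di: "integrable lborel (\<lambda>s. f0 (x, r) * ?Y s x * indicator {0..?R} s)"
      by (rule bounded_integral_Icc) (use FY[of "(x, r)" _ "(x, r)"] in auto)
    have "\<bar>(\<integral>s. F (x + s / P x) * indicator {0..?R} s \<partial>lborel) - D\<bar> \<le> (real n + 1) * \<Lambda> * e * ?R"
    proof -
      have eq: "(\<integral>s. F (x + s / P x) * indicator {0..?R} s \<partial>lborel) - D
        = (\<integral>s. F (x + s / P x) * indicator {0..?R} s - f0 (x, r) * ?Y s x * indicator {0..?R} s \<partial>lborel)"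
        unfolding D_def by (rule Bochner_Integration.integral_diff[OF Fi Di, symmetric])
      have "\<bar>\<integral>s. F (x + s / P x) * indicator {0..?R} s - f0 (x, r) * ?Y s x * indicator {0..?R} s \<partial>lborel\<bar>
        \<le> (\<integral>s. \<bar>F (x + s / P x) * indicator {0..?R} s - f0 (x, r) * ?Y s x * indicator {0..?R} s\<bar> \<partial>lborel)"
        by (rule integral_abs_bound)
      moreover have "(\<integral>s. \<bar>F (x + s / P x) * indicator {0..?R} s - f0 (x, r) * ?Y s x * indicator {0..?R} s\<bar> \<partial>lborel)
        \<le> (\<integral>s. (real n + 1) * \<Lambda> * e * indicator {0..?R} s \<partial>lborel)"
      proof (rule integral_mono_AE)
        show "integrable lborel (\<lambda>s. (real n + 1) * \<Lambda> * e * indicator {0..?R} s)"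
          by (intro integrable_mult_right integrable_indicator_Icc)
        have "AE s in lborel. regular (x + (1 / P x) * s)" using P[of x] by (intro AE_regular_diff) simp
        then show "AE s in lborel. \<bar>F (x + s / P x) * indicator {0..?R} s - f0 (x, r) * ?Y s x * indicator {0..?R} s\<bar>
          \<le> (real n + 1) * \<Lambda> * e * indicator {0..?R} s"
        proof eventually_elim
          case (elim s)
          then have "regular (x + s / P x)" by simp
          then show ?case using pw[of s] by (auto simp: indicator_def)
        qed
      qed (use Fi Di in auto)
      moreover have "(\<integral>s. (real n + 1) * \<Lambda> * e * indicator {0..?R} s \<partial>lborel) = (real n + 1) * \<Lambda> * e * ?R"
        using R by simp
      ultimately show ?thesis unfolding eq by linarith
    qed
    moreover have "\<bar>D - f0 (x, r) * ((\<Sum>j<J. ?Y (real j * d) x) * d)\<bar> \<le> real n * (\<Lambda> + 4 / roof_min) * d * ?R"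
    proof -
      have "D = f0 (x, r) * (\<integral>s. ?Y s x * indicator {0..?R} s \<partial>lborel)" unfolding D_def mult.assoc by simp
      then have "D - f0 (x, r) * ((\<Sum>j<J. ?Y (real j * d) x) * d)
        = f0 (x, r) * ((\<integral>s. ?Y s x * indicator {0..?R} s \<partial>lborel) - (\<Sum>j<J. ?Y (real j * d) x) * d)"
        by (simp add: algebra_simps)
      then have "\<bar>D - f0 (x, r) * ((\<Sum>j<J. ?Y (real j * d) x) * d)\<bar>
        = \<bar>f0 (x, r)\<bar> * \<bar>(\<integral>s. ?Y s x * indicator {0..?R} s \<partial>lborel) - (\<Sum>j<J. ?Y (real j * d) x) * d\<bar>"
        by (simp add: abs_mult)
      also have "\<dots> \<le> 1 * (real n * (\<Lambda> + 4 / roof_min) * d * ?R)"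
        by (intro mult_mono f01 lipschitz_riemann_sum[OF _ d] sheared_lipschitz) (use rx in auto)
      finally show ?thesis by simp
    qed
    ultimately have "\<bar>(\<integral>s. F (x + s / P x) * indicator {0..?R} s \<partial>lborel) - f0 (x, r) * ((\<Sum>j<J. ?Y (real j * d) x) * d)\<bar> \<le> ?\<kappa> * ?R"
      unfolding distrib_right by linarith
    moreover have "(\<integral>s. F (x + s / P x) * indicator {0..?R} s \<partial>lborel) - f0 (x, r) * ((\<Sum>j<J. ?Y (real j * d) x) * d) = (B x - A x) * ?R"
      using R rx J d by (simp add: B_def A_def field_simps)
    ultimately have "\<bar>B x - A x\<bar> * ?R \<le> ?\<kappa> * ?R" using d by (simp add: abs_mult)
    then have "\<bar>B x - A x\<bar> \<le> ?\<kappa>" using R by (rule mult_right_le_imp_le)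
    then show ?thesis using True by simp
  qed
  have ci: "integrable circ h" if "h \<in> borel_measurable borel" "\<And>x. \<bar>h x\<bar> \<le> 1" for h :: "real \<Rightarrow> real"
    by (rule circ.integrable_const_bound[where B = 1]) (use that in auto)
  have Gc: "- G \<in> circ.events" using sets.compl_sets[OF Gm] by (simp add: Compl_eq_Diff_UNIV)
  have 2: "\<bar>(\<integral>x. B x \<partial>circ) - (\<integral>x. A x \<partial>circ)\<bar> \<le> ?\<kappa> + 2 * measure circ (- G)"
  proof -
    have eq: "(\<integral>x. B x \<partial>circ) - (\<integral>x. A x \<partial>circ) = (\<integral>x. B x - A x \<partial>circ)"
      by (rule Bochner_Integration.integral_diff[symmetric]) (intro ci Am Bm A1 B1)+
    have "\<bar>\<integral>x. B x - A x \<partial>circ\<bar> \<le> (\<integral>x. \<bar>B x - A x\<bar> \<partial>circ)" by (rule integral_abs_bound)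
    moreover have "(\<integral>x. \<bar>B x - A x\<bar> \<partial>circ) \<le> (\<integral>x. ?\<kappa> + 2 * indicator (- G) x \<partial>circ)"
    proof (rule integral_mono)
      show "integrable circ (\<lambda>x. \<bar>B x - A x\<bar>)"
        by (intro integrable_abs Bochner_Integration.integrable_diff ci Am Bm A1 B1)
      show "integrable circ (\<lambda>x. ?\<kappa> + 2 * indicator (- G) x)" by (rule circ.integral_affine_indicator(1)[OF Gc])
    qed (rule BA)
    ultimately show ?thesis unfolding eq circ.integral_affine_indicator(2)[OF Gc] by linarith
  qed
  have "(\<integral>x. (if regular x then f0 (x, r) * (?Y 0 x - (\<Sum>j<J. ?Y (real j * d) x) / real J) else 0) \<partial>circ)
    = (\<integral>x. F x - A x \<partial>circ)" by (rule Bochner_Integration.integral_cong) (auto simp: F_def A_def algebra_simps)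
  moreover have "(\<integral>x. F x - A x \<partial>circ) = (\<integral>x. F x \<partial>circ) - (\<integral>x. A x \<partial>circ)"
    by (rule Bochner_Integration.integral_diff) (intro ci Am Fm A1 F1)+
  ultimately show ?thesis using 1 2 by linarith
qed

text \<open>Integrate \<open>shear_fibre\<close> over the heights in the strip. The set
  \<open>G\<close> depends on the height, but integrating the measures of its complements gives at
  most the measure of the exceptional set \<open>Z\<close> in the suspension.\<close>

lemma shear_average:
  assumes n: "0 < n" and J: "0 < J" and d: "0 < d" and f0: "box \<Lambda> f0" and \<epsilon>: "\<epsilon> > 0"
  shows "\<forall>\<^sub>F t in far_filter n.
    \<bar>\<integral>z. f0 z * (sheared n f m t 0 z - (\<Sum>j<J. sheared n f m t (real j * d) z) / real J) \<partial>\<mu>\<bar>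
      \<le> real n * (\<Lambda> + 4 / roof_min) * d + \<epsilon>"
proof -
  have L0: "0 \<le> \<Lambda>" by (rule boxD(1)[OF f0])
  define q where "q = 4 + (real n + 1) * \<Lambda>"
  have q: "q \<ge> 4" using L0 by (simp add: q_def)
  define e where "e = min (1/2) (\<epsilon> / (2 * q))"
  have e: "0 < e" "e < 1" using q \<epsilon> by (auto simp: e_def)
  have eq: "q * e \<le> \<epsilon> / 2"
  proof -
    have "q * e \<le> q * (\<epsilon> / (2 * q))" using q by (intro mult_left_mono) (auto simp: e_def)
    also have "\<dots> = \<epsilon> / 2" using q by simp
    finally show ?thesis .
  qed
  \<comment> \<open>The exceptional set is a union of \<open>n + 1\<close> sets of measure at most
    \<open>e'\<close> and enters with the factor 4, which gives
    \<open>\<epsilon> / 2\<close>.\<close>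
  define e' where "e' = \<epsilon> / (8 * (real n + 1))"
  have e': "e' > 0" using \<epsilon> by (simp add: e'_def)
  have R: "real J * d > 0" using J d by simp
  obtain A k0 where A: "A > 0" and sp: "\<forall>k\<ge>k0. \<forall>\<eta>>0. \<exists>n1. \<forall>n0\<ge>n1. \<forall>t x r y.
    shearable n t k \<eta> n0 A x r \<longrightarrow> regular y \<longrightarrow> \<bar>y - x\<bar> \<le> real J * d / spd n t x r \<longrightarrow> shears n t r e x y"
    using shear_point[OF n R e] by (elim exE conjE) (rule that)
  obtain k \<eta> where k: "k \<ge> k0" and \<eta>: "\<eta> > 0"
    and gen: "\<And>t. ungeneric k \<eta> t \<le> e'"
    and gd: "\<And>n1. \<exists>n0\<ge>n1. \<exists>T. \<forall>t\<ge>T. ungood k \<eta> n0 A t \<le> e'"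
    using good_measure[OF A e', of k0] by auto
  obtain n1 where n1: "\<forall>n0\<ge>n1. \<forall>t x r y.
    shearable n t k \<eta> n0 A x r \<longrightarrow> regular y \<longrightarrow> \<bar>y - x\<bar> \<le> real J * d / spd n t x r \<longrightarrow> shears n t r e x y"
    using mp[OF spec[OF mp[OF spec[OF sp, of k] k], of \<eta>] \<eta>] by (elim exE) (rule that)
  obtain n0 T where n0: "n0 \<ge> n1"
    and T: "\<And>t. t \<ge> T \<Longrightarrow> ungood k \<eta> n0 A t \<le> e'" using gd[of n1] by blast
  have "\<bar>\<integral>z. f0 z * (sheared n f m t 0 z - (\<Sum>j<J. sheared n f m t (real j * d) z) / real J) \<partial>\<mu>\<bar>
      \<le> real n * (\<Lambda> + 4 / roof_min) * d + \<epsilon>"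
    if t: "gaps n (max T 0) t" "max T 0 \<le> t 0" for t
  proof -
    let ?Y = "sheared n f m t"
    define H where "H z = (if regular (fst z) then f0 z * (?Y 0 z - (\<Sum>j<J. ?Y (real j * d) z) / real J) else 0)" for z
    define Z where "Z = {z. \<not> (regular (fst z) \<and> (good k \<eta> n0 A (fst z) (snd z + t (n - 1)) \<and> (\<forall>i\<in>{..<n}. generic k \<eta> (fst z) (snd z + t i))))}"
    define \<kappa> where "\<kappa> = q * e + real n * (\<Lambda> + 4 / roof_min) * d"
    have k0: "0 \<le> \<kappa>" using L0 q e d roof_min(1) unfolding \<kappa>_def by (intro add_nonneg_nonneg mult_nonneg_nonneg) auto
    have Zm [measurable]: "Z \<in> sets borel"
    proof -
      have [measurable]: "fst \<in> borel_measurable (borel :: (real \<times> real) measure)" "snd \<in> borel_measurable (borel :: (real \<times> real) measure)"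
        by (simp_all add: borel_measurable_continuous_onI continuous_on_fst continuous_on_snd)
      have "{z \<in> space (borel :: (real \<times> real) measure). \<not> (regular (fst z) \<and> (good k \<eta> n0 A (fst z) (snd z + t (n - 1)) \<and> (\<forall>i\<in>{..<n}. generic k \<eta> (fst z) (snd z + t i))))} \<in> sets borel"
        by measurable
      then show ?thesis by (simp add: Z_def)
    qed
    have Hm: "H \<in> borel_measurable borel"
    proof -
      have [measurable]: "fst \<in> borel_measurable (borel :: (real \<times> real) measure)" "snd \<in> borel_measurable (borel :: (real \<times> real) measure)"
        by (simp_all add: borel_measurable_continuous_onI continuous_on_fst continuous_on_snd)
      have [measurable]: "(\<lambda>z. ?Y s z) \<in> borel_measurable borel" for s
        using sheared_measurable[of fst borel snd "\<lambda>_. s" t] by simp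
      have [measurable]: "f0 \<in> borel_measurable borel" by (rule box_measurable[OF f0])
      show ?thesis unfolding H_def by measurable
    qed
    have H1: "\<bar>H z\<bar> \<le> 2" for z
    proof -
      have "\<bar>\<Sum>j<J. ?Y (real j * d) z\<bar> \<le> (\<Sum>j<J. 1)" by (rule order_trans[OF sum_abs]) (intro sum_mono sheared_le_1)
      then have "\<bar>(\<Sum>j<J. ?Y (real j * d) z) / real J\<bar> \<le> 1"
        unfolding abs_divide using J by (subst divide_le_eq_1_pos) auto
      then have "\<bar>?Y 0 z - (\<Sum>j<J. ?Y (real j * d) z) / real J\<bar> \<le> 2" using sheared_le_1[of t 0 z] by linarith
      then have "\<bar>f0 z\<bar> * \<bar>?Y 0 z - (\<Sum>j<J. ?Y (real j * d) z) / real J\<bar> \<le> 1 * 2"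
        using boxD(5)[OF f0, of z] by (intro mult_mono) auto
      then show ?thesis by (simp add: H_def abs_mult)
    qed
    define W where "W z = \<kappa> + 4 * indicator Z z" for z :: "real \<times> real"
    have Wm: "W \<in> borel_measurable borel" unfolding W_def by measurable
    have W1: "\<bar>W z\<bar> \<le> \<kappa> + 4" for z using k0 by (simp add: W_def indicator_def)
    have fib: "\<bar>\<integral>x. H (x, r) \<partial>circ\<bar> \<le> (\<integral>x. W (x, r) \<partial>circ)" if r: "r \<in> strip" for r
    proof -
      define G where "G = {x. (x, r) \<notin> Z}"
      have Gm: "G \<in> sets borel"
      proof -
        have [measurable]: "(\<lambda>x::real. (x, r)) \<in> borel \<rightarrow>\<^sub>M borel" by (intro borel_measurable_Pair) measurable
        have "{x \<in> space borel. (x, r) \<notin> Z} \<in> sets borel" by measurable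
        then show ?thesis by (simp add: G_def)
      qed
      have Gc: "- G \<in> circ.events" using sets.compl_sets[OF Gm] by (simp add: Compl_eq_Diff_UNIV)
      have "(\<integral>x. W (x, r) \<partial>circ) = (\<integral>x. \<kappa> + 4 * indicator (- G) x \<partial>circ)"
        by (rule Bochner_Integration.integral_cong) (auto simp: W_def G_def indicator_def)
      then have W: "(\<integral>x. W (x, r) \<partial>circ) = \<kappa> + 4 * measure circ (- G)"
        by (simp add: circ.integral_affine_indicator(2)[OF Gc])
      have "\<bar>\<integral>x. (if regular x then f0 (x, r) * (?Y 0 (x, r) - (\<Sum>j<J. ?Y (real j * d) (x, r)) / real J) else 0) \<partial>circ\<bar>
        \<le> 4 * e + (real n + 1) * \<Lambda> * e + real n * (\<Lambda> + 4 / roof_min) * d + 4 * measure circ (- G)"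
      proof (rule shear_fibre[OF n J d e f0 Gm])
        show "regular x" if "x \<in> G" for x using that by (simp add: G_def Z_def)
        fix x y assume x: "x \<in> G" and y: "regular y" "\<bar>y - x\<bar> \<le> real J * d / spd n t x r"
        have "gaps n 0 t" by (rule gaps_mono[OF t(1)]) simp
        then have "shearable n t k \<eta> n0 A x r" using x r t(2) by (auto simp: shearable_def G_def Z_def)
        then show "shears n t r e x y"
          using n1[THEN spec, THEN mp, OF n0, THEN spec, THEN spec, THEN spec, THEN spec, of t x r y] y by blast
      qed
      then show ?thesis unfolding W H_def fst_conv \<kappa>_def q_def distrib_right by (simp add: mult.assoc)
    qed
    have "(\<integral>z. f0 z * (?Y 0 z - (\<Sum>j<J. ?Y (real j * d) z) / real J) \<partial>\<mu>) = (\<integral>z. indicator strip (snd z) * H z \<partial>\<mu>)"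
    proof (rule Bochner_Integration.integral_cong)
      fix z assume z: "z \<in> space \<mu>"
      obtain x r where xr: "z = (x, r)" by (cases z)
      then have "regular x" using z by (simp add: space_iff)
      moreover have "f0 (x, r) = 0" if "r \<notin> strip" by (rule boxD(3)[OF f0 that])
      ultimately show "f0 z * (?Y 0 z - (\<Sum>j<J. ?Y (real j * d) z) / real J) = indicator strip (snd z) * H z"
        unfolding xr H_def by (cases "r \<in> strip") (auto simp del: greaterThanLessThan_iff)
    qed simp
    also have "\<dots> = (\<integral>r. indicator strip r * (\<integral>x. H (x, r) \<partial>circ) \<partial>lborel)" by (rule strip_integral(1)[OF Hm H1])
    finally have 1: "(\<integral>z. f0 z * (?Y 0 z - (\<Sum>j<J. ?Y (real j * d) z) / real J) \<partial>\<mu>)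
      = (\<integral>r. indicator strip r * (\<integral>x. H (x, r) \<partial>circ) \<partial>lborel)" .
    have "\<bar>\<integral>r. indicator strip r * (\<integral>x. H (x, r) \<partial>circ) \<partial>lborel\<bar> \<le> (\<integral>r. \<bar>indicator strip r * (\<integral>x. H (x, r) \<partial>circ)\<bar> \<partial>lborel)"
      by (rule integral_abs_bound)
    also have "\<dots> \<le> (\<integral>r. indicator strip r * (\<integral>x. W (x, r) \<partial>circ) \<partial>lborel)"
    proof (rule integral_mono)
      show "integrable lborel (\<lambda>r. \<bar>indicator strip r * (\<integral>x. H (x, r) \<partial>circ)\<bar>)"
        by (rule integrable_abs[OF strip_integral(2)[OF Hm H1]])
      show "integrable lborel (\<lambda>r. indicator strip r * (\<integral>x. W (x, r) \<partial>circ))" by (rule strip_integral(2)[OF Wm W1])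
      fix r
      show "\<bar>indicator strip r * (\<integral>x. H (x, r) \<partial>circ)\<bar> \<le> indicator strip r * (\<integral>x. W (x, r) \<partial>circ)"
        using fib[of r] by (cases "r \<in> strip") (simp_all del: greaterThanLessThan_iff)
    qed
    also have "\<dots> = (\<integral>z. indicator strip (snd z) * W z \<partial>\<mu>)" by (rule strip_integral(1)[OF Wm W1, symmetric])
    also have "\<dots> \<le> (\<integral>z. \<kappa> + 4 * indicator (Z \<inter> \<Omega>) z \<partial>\<mu>)"
    proof (rule Bochner_Integration.integral_mono')
      have Zs: "Z \<inter> \<Omega> \<in> sets \<mu>" using Zm by (simp add: sets_mu)
      show "integrable \<mu> (\<lambda>z. \<kappa> + 4 * indicator (Z \<inter> \<Omega>) z)" by (rule integral_affine_indicator(1)[OF Zs])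
      fix z assume z: "z \<in> space \<mu>"
      then show "indicator strip (snd z) * W z \<le> \<kappa> + 4 * indicator (Z \<inter> \<Omega>) z"
        using k0 by (auto simp: W_def indicator_def)
      show "0 \<le> \<kappa> + 4 * indicator (Z \<inter> \<Omega>) z" using k0 by simp
    qed
    also have "\<dots> = \<kappa> + 4 * measure \<mu> (Z \<inter> \<Omega>)" by (rule integral_affine_indicator(2)) (use Zm in \<open>simp add: sets_mu\<close>)
    also have "measure \<mu> (Z \<inter> \<Omega>) \<le> (real n + 1) * e'"
    proof -
      have "Z \<inter> \<Omega> = {z \<in> \<Omega>. \<not> (good k \<eta> n0 A (fst z) (snd z + t (n - 1)) \<and> (\<forall>i\<in>{..<n}. generic k \<eta> (fst z) (snd z + t i)))}"
        by (auto simp: Z_def space_iff)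
      moreover have "measure \<mu> {z \<in> \<Omega>. \<not> (good k \<eta> n0 A (fst z) (snd z + t (n - 1)) \<and> (\<forall>i\<in>{..<n}. generic k \<eta> (fst z) (snd z + t i)))}
        \<le> (real (card {..<n}) + 1) * e'"
        by (rule bad_union_measure) (use gen T[of "t (n - 1)"] far_mono[OF t, of "n - 1"] n in auto)
      ultimately show ?thesis by simp
    qed
    also have "\<kappa> + 4 * ((real n + 1) * e') = \<kappa> + \<epsilon> / 2" by (simp add: e'_def field_simps)
    also have "\<dots> \<le> real n * (\<Lambda> + 4 / roof_min) * d + \<epsilon>" using eq by (simp add: \<kappa>_def)
    finally show ?thesis unfolding 1 by simp
  qed
  then show ?thesis unfolding eventually_far_filter by (intro exI[of _ "max T 0"]) blast
qed

end

end

section \<open>Decorrelation of box functions from a function at time 0\<close>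

context power_roof
begin

lemma box_mono: "box \<Lambda> f \<Longrightarrow> \<Lambda> \<le> \<Lambda>' \<Longrightarrow> box \<Lambda>' f"
proof -
  assume f: "box \<Lambda> f" and L: "\<Lambda> \<le> \<Lambda>'"
  have "\<bar>f (x, r) - f (y, s)\<bar> \<le> \<Lambda>' * (\<bar>x - y\<bar> + \<bar>r - s\<bar>)" for x r y s
    by (rule order_trans[OF boxD(4)[OF f]]) (use L in \<open>auto intro: mult_right_mono\<close>)
  then show ?thesis using f L by (auto simp: box_def)
qed

lemma box_centered:
  assumes f: "box \<Lambda> f"
  shows "f \<in> unit_bounded" "\<bar>\<integral>z. f z \<partial>\<mu>\<bar> \<le> 1/2"
    "(\<lambda>z. f z - (\<integral>z. f z \<partial>\<mu>)) \<in> unit_bounded" "(\<integral>z. f z - (\<integral>z. f z \<partial>\<mu>) \<partial>\<mu>) = 0"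
proof -
  have [measurable]: "f \<in> borel_measurable \<mu>" by (rule measurable_mu[OF box_measurable[OF f]])
  have f2: "\<bar>f z\<bar> \<le> 1/2" for z by (rule boxD(5)[OF f])
  show u: "f \<in> unit_bounded" by (rule unit_boundedI) (use f2 in \<open>auto intro: order_trans[OF f2]\<close>)
  have fi: "integrable \<mu> f" by (rule unit_boundedD(3)[OF u])
  have "\<bar>\<integral>z. f z \<partial>\<mu>\<bar> \<le> (\<integral>z. \<bar>f z\<bar> \<partial>\<mu>)" by (rule integral_abs_bound)
  also have "\<dots> \<le> (\<integral>z. 1/2 \<partial>\<mu>)" by (rule integral_mono) (use fi f2 in auto)
  also have "\<dots> = 1/2" using prob_space by (simp del: space_mu)
  finally show m: "\<bar>\<integral>z. f z \<partial>\<mu>\<bar> \<le> 1/2" .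
  show "(\<lambda>z. f z - (\<integral>z. f z \<partial>\<mu>)) \<in> unit_bounded"
  proof (rule unit_boundedI)
    show "\<bar>f z - (\<integral>z. f z \<partial>\<mu>)\<bar> \<le> 1" for z using f2[of z] m by linarith
  qed simp
  show "(\<integral>z. f z - (\<integral>z. f z \<partial>\<mu>) \<partial>\<mu>) = 0"
    using fi prob_space by (simp add: Bochner_Integration.integral_diff del: space_mu)
qed

lemma sheared_K:
  assumes f: "\<And>i. i < n \<Longrightarrow> box \<Lambda> (f i)" and z: "z \<in> \<Omega>"
  shows "sheared n f m t s z = (\<Prod>i<n. f i (K (t i - cdir n t i z * s) z) - m i)"
  unfolding sheared_def
proof (rule prod.cong[OF refl])
  fix i assume "i \<in> {..<n}"
  then have i: "i < n" by simp
  obtain x r where xr: "z = (x, r)" by (cases z)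
  show "lift (f i) (fst z) (snd z + t i - cdir n t i z * s) - m i = f i (K (t i - cdir n t i z * s) z) - m i"
    using lift_K[of "f i" x r "t i - cdir n t i z * s"] boxD(2)[OF f[OF i]] z
    unfolding xr by (simp add: algebra_simps)
qed

text \<open>Shearing replaces the product by its average over \<open>J\<close> sheared times, with a
  discretization error \<open>n * l * d = \<epsilon>/4\<close> and a remainder
  \<open>\<epsilon>/4\<close>. That average has \<open>L^1\<close> norm at most
  \<open>sqrt (2 * e) = \<epsilon>/4\<close>, because the products at \<open>s\<close> and
  \<open>s'\<close> decorrelate once \<open>\<bar>s - s'\<bar> >= S\<close>.\<close>

lemma far_box_decorrelation:
  assumes n: "0 < n" and f0: "box \<Lambda> f0" and f: "\<And>i. i < n \<Longrightarrow> box \<Lambda> (f i)"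
    and mix: "\<And>g. (\<And>i. i < n \<Longrightarrow> g i \<in> unit_bounded) \<Longrightarrow> mixes n g"
    and mix2: "\<And>g. g \<in> unit_bounded \<Longrightarrow> mixes 2 (\<lambda>_. g)" and \<epsilon>: "\<epsilon> > 0"
  shows "\<forall>\<^sub>F t in far_filter n. \<bar>\<integral>z. f0 z * (\<Prod>i<n. f i (K (t i) z) - (\<integral>z. f i z \<partial>\<mu>)) \<partial>\<mu>\<bar> \<le> \<epsilon>"
proof -
  define m where "m i = (\<integral>z. f i z \<partial>\<mu>)" for i
  define g where "g i z = f i z - m i" for i z
  have m2: "\<bar>m i\<bar> \<le> 1/2" if "i < n" for i unfolding m_def by (rule box_centered(2)[OF f[OF that]])
  have gu: "g i \<in> unit_bounded" "(\<integral>z. g i z \<partial>\<mu>) = 0" if "i < n" for i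
    using box_centered(3,4)[OF f[OF that]] by (simp_all add: g_def[abs_def] m_def)
  define l where "l = \<Lambda> + 4 / roof_min"
  have l: "l > 0" using boxD(1)[OF f0] roof_min(1) by (simp add: l_def add_nonneg_pos)
  define d where "d = \<epsilon> / (4 * real n * l)"
  have d: "d > 0" "real n * l * d = \<epsilon> / 4" using l n \<epsilon> by (auto simp: d_def)
  define e where "e = \<epsilon>\<^sup>2 / 32"
  have e: "e > 0" "sqrt (2 * e) = \<epsilon> / 4" using \<epsilon> by (auto simp: e_def real_sqrt_divide)
  have gl: "g i (K a z) = lift (f i) (fst z) (snd z + a) - m i" if "i < n" "z \<in> \<Omega>" for i a z
  proof -
    obtain x r where xr: "z = (x, r)" by (cases z)
    show ?thesis using lift_K[of "f i" x r a] boxD(2)[OF f[OF that(1)]] that(2) by (simp add: xr g_def)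
  qed
  have "\<exists>S>0. \<forall>s s'. S \<le> \<bar>s - s'\<bar> \<longrightarrow> (\<forall>\<^sub>F t in far_filter n.
     (\<integral>z. (\<Prod>i<n. g i (K (t i - cdir n t i z * s) z)) * (\<Prod>i<n. g i (K (t i - cdir n t i z * s') z)) \<partial>\<mu>) \<le> e)"
  proof (rule speed_decorrelation[where \<Lambda> = l])
    show "\<bar>g i (K a z) - g i (K b z)\<bar> \<le> l * \<bar>a - b\<bar>" if i: "i < n" and z: "z \<in> space \<mu>" for i z a b
    proof -
      have zO: "z \<in> \<Omega>" using z by simp
      then have "regular (fst z)" by (cases z) (simp add: space_iff)
      from box_lift_lipschitz[OF f[OF i] this, of "snd z + a" "snd z + b"]
      show ?thesis unfolding gl[OF i zO] by (simp add: l_def)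
    qed
    show "(\<lambda>z. g i (K (a z) z)) \<in> borel_measurable \<mu>" if i: "i < n" and [measurable]: "a \<in> borel_measurable \<mu>" for i a
    proof -
      have [measurable]: "f i \<in> borel_measurable borel" by (rule box_measurable[OF f[OF i]])
      have "(\<lambda>z. lift (f i) (fst z) (snd z + a z) - m i) \<in> borel_measurable \<mu>" by measurable
      then show ?thesis by (rule measurable_cong[THEN iffD1, rotated]) (simp add: gl[OF i])
    qed
  qed (use gu mix mix2 n e slow_cdir cdir_attained[OF n] in auto)
  then obtain S where S: "S > 0" and dec: "\<And>s s'. S \<le> \<bar>s - s'\<bar> \<Longrightarrow> \<forall>\<^sub>F t in far_filter n.
     (\<integral>z. (\<Prod>i<n. g i (K (t i - cdir n t i z * s) z)) * (\<Prod>i<n. g i (K (t i - cdir n t i z * s') z)) \<partial>\<mu>) \<le> e" by auto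
  \<comment> \<open>Indices that differ by \<open>q\<close> or more belong to values of
    \<open>s\<close> at distance at least \<open>S\<close>; \<open>J\<close> is so large that the
    band of width \<open>q\<close> does not matter.\<close>
  define q where "q = \<lceil>S / d\<rceil>"
  have q: "S / d \<le> of_int q" "0 < q" using S d by (auto simp: q_def)
  define J where "J = nat \<lceil>2 * of_int q / e\<rceil>"
  have qe: "0 < 2 * of_int q / e" using q e by simp
  then have Je: "2 * of_int q / e \<le> real J" unfolding J_def by linarith
  then have J: "J > 0" using qe by (cases J) auto
  have Jq: "2 * of_int q \<le> e * real J" using Je e by (simp add: field_simps)
  let ?Y = "sheared n f m"
  have Yint: "(\<integral>z. ?Y t s z * ?Y t s' z \<partial>\<mu>)
    = (\<integral>z. (\<Prod>i<n. g i (K (t i - cdir n t i z * s) z)) * (\<Prod>i<n. g i (K (t i - cdir n t i z * s') z)) \<partial>\<mu>)" for t s s'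
    by (rule Bochner_Integration.integral_cong) (use sheared_K[where f = f and n = n, OF f] in \<open>auto simp: g_def\<close>)
  have "\<forall>\<^sub>F t in far_filter n. \<forall>j<J. \<forall>l<J. q \<le> \<bar>int j - int l\<bar> \<longrightarrow> (\<integral>z. ?Y t (real j * d) z * ?Y t (real l * d) z \<partial>\<mu>) \<le> e"
  proof -
    have "\<forall>\<^sub>F t in far_filter n. q \<le> \<bar>int j - int l\<bar> \<longrightarrow> (\<integral>z. ?Y t (real j * d) z * ?Y t (real l * d) z \<partial>\<mu>) \<le> e" for j l :: nat
    proof (cases "q \<le> \<bar>int j - int l\<bar>")
      case True
      then have "real_of_int q \<le> \<bar>real j - real l\<bar>" by linarith
      then have "S / d \<le> \<bar>real j - real l\<bar>" using q(1) by linarith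
      then have "S \<le> \<bar>real j - real l\<bar> * d" using d by (simp add: field_simps)
      also have "\<dots> = \<bar>real j * d - real l * d\<bar>" using d by (simp add: left_diff_distrib[symmetric] abs_mult)
      finally show ?thesis unfolding Yint by (rule eventually_mono[OF dec]) (rule impI)
    qed simp
    then have "\<forall>\<^sub>F t in far_filter n. \<forall>j\<in>{..<J}. \<forall>l\<in>{..<J}. q \<le> \<bar>int j - int l\<bar> \<longrightarrow> (\<integral>z. ?Y t (real j * d) z * ?Y t (real l * d) z \<partial>\<mu>) \<le> e"
      by (intro eventually_ball_finite ballI) auto
    then show ?thesis by (rule eventually_mono) auto
  qed
  moreover have "\<forall>\<^sub>F t in far_filter n.
    \<bar>\<integral>z. f0 z * (?Y t 0 z - (\<Sum>j<J. ?Y t (real j * d) z) / real J) \<partial>\<mu>\<bar> \<le> real n * (\<Lambda> + 4 / roof_min) * d + \<epsilon>/4"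
    by (rule shear_average[OF f m2 n J d(1) f0]) (use \<epsilon> in auto)
  ultimately show ?thesis
  proof eventually_elim
    case (elim t)
    define av where "av z = (\<Sum>j<J. ?Y t (real j * d) z) / real J" for z
    have Yu: "?Y t s \<in> unit_bounded" for s
    proof (rule unit_boundedI)
      show "\<bar>?Y t s z\<bar> \<le> 1" for z by (rule sheared_le_1[OF f m2])
      show "?Y t s \<in> borel_measurable \<mu>"
        using sheared_measurable[where f = f and m = m and g = fst and h = snd and L = \<mu> and s = "\<lambda>_. s" and t = t, OF f m2] by simp
    qed
    have avi: "integrable \<mu> av" unfolding av_def
      by (intro integrable_divide Bochner_Integration.integrable_sum unit_boundedD(3)[OF Yu])
    have "(\<integral>z. \<bar>av z\<bar> \<partial>\<mu>) \<le> sqrt (2 * e)"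
      unfolding av_def by (rule decorrelated_average_le[OF J Yu _ _ Jq]) (use elim(1) e q in auto)
    moreover have "\<bar>\<integral>z. f0 z * (?Y t 0 z - av z) \<partial>\<mu>\<bar> \<le> \<epsilon>/2"
      using elim(2) unfolding av_def d(2)[unfolded l_def] by linarith
    ultimately have "\<bar>\<integral>z. f0 z * ?Y t 0 z \<partial>\<mu>\<bar> \<le> \<epsilon>"
      using integral_perturb_le[OF box_centered(1)[OF f0] Yu[of 0] avi] e(2) \<epsilon> by linarith
    moreover have "(\<integral>z. f0 z * ?Y t 0 z \<partial>\<mu>) = (\<integral>z. f0 z * (\<Prod>i<n. f i (K (t i) z) - (\<integral>z. f i z \<partial>\<mu>)) \<partial>\<mu>)"
      by (rule Bochner_Integration.integral_cong) (use sheared_K[where f = f and n = n, OF f] in \<open>auto simp: m_def\<close>)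
    ultimately show ?case by simp
  qed
qed

end

lemma interval_indicator_diff:
  fixes a b c :: real
  assumes "0 \<le> a" "a \<le> b" "0 \<le> c"
  shows "(\<integral>u. \<bar>indicator {a..b} u - indicator {0..<c} u\<bar> \<partial>lborel) \<le> a + \<bar>b - c\<bar>"
proof -
  have ii: "integrable lborel (indicator {p..q} :: real \<Rightarrow> real)" for p q :: real by (rule integrable_indicator_Icc)
  have "(\<integral>u. \<bar>indicator {a..b} u - indicator {0..<c} u\<bar> \<partial>lborel)
    \<le> (\<integral>u. indicator {0..a} u + indicator {min b c..max b c} u \<partial>lborel :: real)"
  proof (rule Bochner_Integration.integral_mono')
    show "integrable lborel (\<lambda>u. indicator {0..a} u + indicator {min b c..max b c} u :: real)"
      by (intro Bochner_Integration.integrable_add ii)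
    show "\<bar>indicator {a..b} u - indicator {0..<c} u\<bar> \<le> (indicator {0..a} u + indicator {min b c..max b c} u :: real)" for u
      using assms by (auto simp: indicator_def min_def max_def)
  qed simp
  also have "\<dots> = a + (max b c - min b c)" using assms by (subst Bochner_Integration.integral_add[OF ii ii]) simp
  also have "max b c - min b c = \<bar>b - c\<bar>" by auto
  finally show ?thesis .
qed

context power_roof
begin

subsection \<open>Ergodic averages and mixing\<close>

lemma S_nonneg: "regular x \<Longrightarrow> 0 \<le> S (int n) x"
proof -
  assume rx: "regular x"
  have "0 \<le> roof_min * real n" using roof_min(1) by simp
  also have "\<dots> \<le> S (int n) x" using S_mono[OF rx, of 0 "int n"] by simp
  finally show ?thesis .
qed

context
  fixes \<Lambda> :: real and f :: "real \<times> real \<Rightarrow> real"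
  assumes f: "box \<Lambda> f"
begin

definition mean :: real where "mean = (\<integral>z. f z \<partial>\<mu>)"

text \<open>Through integration over fibres, time averages of \<open>f\<close> become Birkhoff
  averages of this function, which is continuous on the circle although the roof is
  unbounded.\<close>

definition height :: "real \<Rightarrow> real" where "height x = (\<integral>v. f (x, v) \<partial>lborel)"

lemma f_measurable [measurable]: "f \<in> borel_measurable borel"
  by (rule box_measurable[OF f])

lemma f_fibre_measurable [measurable]: "(\<lambda>v. f (x, v - c)) \<in> borel_measurable borel"
  by (rule measurable_compose[OF _ f_measurable]) (intro borel_measurable_Pair; simp)

lemma f_fibre: "f (x, v) = indicator strip v * f (x, v)"
  using boxD(3)[OF f, of v x] by (cases "v \<in> strip") (simp_all del: greaterThanLessThan_iff)

lemma lift_half: "\<bar>lift f x u\<bar> \<le> 1/2"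
  unfolding lift_def by (rule boxD(5)[OF f])

lemma mean_half: "\<bar>mean\<bar> \<le> 1/2"
  unfolding mean_def by (rule box_centered(2)[OF f])

lemma integrable_lift:
  assumes [measurable]: "A \<in> sets borel" and A: "A \<subseteq> {p..q}"
  shows "integrable lborel (\<lambda>u. lift f x u * indicator A u)"
proof (rule Bochner_Integration.integrable_bound)
  show "integrable lborel (indicator {p..q} :: real \<Rightarrow> real)" by (rule integrable_indicator_Icc)
  have "\<bar>lift f x u\<bar> \<le> 1" for u using lift_half[of x u] by linarith
  then show "AE u in lborel. norm (lift f x u * indicator A u) \<le> norm (indicator {p..q} u :: real)"
    using A by (intro AE_I2) (auto simp: indicator_def)
qed measurable

lemma f_fibre_integrable: "integrable lborel (\<lambda>v. f (x, v))"
proof (rule Bochner_Integration.integrable_bound)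
  show "integrable lborel (indicator strip :: real \<Rightarrow> real)" by (rule integrable_real_indicator) (use roof_min(1) in auto)
  have "\<bar>f (x, v)\<bar> \<le> 1" for v using boxD(5)[OF f, of "(x, v)"] by linarith
  then show "AE v in lborel. norm (f (x, v)) \<le> norm (indicator strip v :: real)"
    by (intro AE_I2) (subst f_fibre, simp add: indicator_def)
  show "(\<lambda>v. f (x, v)) \<in> borel_measurable lborel" using f_fibre_measurable[of x 0] by simp
qed

lemma height_continuous: "continuous_on UNIV height"
proof -
  have "\<bar>height x - height y\<bar> \<le> \<Lambda> * roof_min * \<bar>x - y\<bar>" for x y
  proof -
    have eq: "height x - height y = (\<integral>v. f (x, v) - f (y, v) \<partial>lborel)"
      unfolding height_def by (rule Bochner_Integration.integral_diff[symmetric]) (rule f_fibre_integrable)+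
    have ii: "integrable lborel (\<lambda>v. \<Lambda> * \<bar>x - y\<bar> * indicator strip v)"
      by (intro integrable_mult_right integrable_real_indicator) (use roof_min(1) in auto)
    have "\<bar>\<integral>v. f (x, v) - f (y, v) \<partial>lborel\<bar> \<le> (\<integral>v. \<bar>f (x, v) - f (y, v)\<bar> \<partial>lborel)" by (rule integral_abs_bound)
    also have "\<dots> \<le> (\<integral>v. \<Lambda> * \<bar>x - y\<bar> * indicator strip v \<partial>lborel)"
    proof (rule Bochner_Integration.integral_mono'[OF ii])
      show "\<bar>f (x, v) - f (y, v)\<bar> \<le> \<Lambda> * \<bar>x - y\<bar> * indicator strip v" for v
        using boxD(4)[OF f, of x v y v] boxD(3)[OF f, of v] by (cases "v \<in> strip") auto
    qed (use boxD(1)[OF f] in simp)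
    also have "\<dots> \<le> \<Lambda> * roof_min * \<bar>x - y\<bar>"
    proof -
      have "\<Lambda> * \<bar>x - y\<bar> * (roof_min / 2) \<le> \<Lambda> * \<bar>x - y\<bar> * roof_min"
        using boxD(1)[OF f] roof_min(1) by (intro mult_left_mono) auto
      then show ?thesis using roof_min(1) by (simp add: mult_ac)
    qed
    finally show ?thesis unfolding eq .
  qed
  then have "lipschitz_on (\<Lambda> * roof_min) UNIV height"
    using boxD(1)[OF f] roof_min(1) by (intro lipschitz_onI) (auto simp: dist_real_def)
  then show ?thesis by (rule lipschitz_on_continuous_on)
qed

lemma height_periodic: "periodic1 height"
  using boxD(2)[OF f, of _ 1] by (simp add: periodic1_def height_def)

lemma height_mean: "(\<integral>x. height x \<partial>circ) = mean"
proof -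
  have f1: "\<bar>f z\<bar> \<le> 1" for z using boxD(5)[OF f, of z] by linarith
  have "mean = (\<integral>z. indicator strip (snd z) * f z \<partial>\<mu>)" unfolding mean_def
  proof (rule Bochner_Integration.integral_cong)
    show "f z = indicator strip (snd z) * f z" for z using f_fibre[of "fst z" "snd z"] by simp
  qed simp
  also have "\<dots> = (\<integral>x. (\<integral>r. indicator strip r * f (x, r) \<partial>lborel) \<partial>circ)"
    by (rule strip_integral(3)[OF f_measurable f1])
  also have "\<dots> = (\<integral>x. height x \<partial>circ)" unfolding height_def f_fibre[symmetric] ..
  finally show ?thesis ..
qed

text \<open>Between two crossings the flow runs up exactly one fibre, and the support of
  \<open>f\<close> fits below the roof.\<close>

lemma integral_lift_birkhoff:
  assumes rx: "regular x"
  shows "(\<integral>u. lift f x u * indicator {0..<S (int n) x} u \<partial>lborel) = (\<Sum>k<n. height (x + real k * \<alpha>))"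
proof (induction n)
  case (Suc n)
  let ?a = "S (int n) x" and ?b = "S (int (Suc n)) x" and ?p = "x + real n * \<alpha>"
  have p: "roof_min \<le> \<Phi> ?p" using roof_min(2) regular_nonint[OF rx, of "int n"] by simp
  have b: "?b = ?a + \<Phi> ?p" using birkhoff_Suc[of \<Phi> "int n" x] by (simp add: add.commute)
  have a0: "0 \<le> ?a" by (rule S_nonneg[OF rx])
  have ab: "?a \<le> ?b" using b p roof_min(1) by simp
  have ii: "integrable lborel (\<lambda>u. lift f x u * indicator {p..<q} u)" for p q :: real
    by (rule integrable_lift[where p = p and q = q]) auto
  have ind: "indicator {0..<?b} u = indicator {0..<?a} u + (indicator {?a..<?b} u :: real)" for u
    using a0 ab by (auto simp: indicator_def)
  have "(\<integral>u. lift f x u * indicator {0..<?b} u \<partial>lborel)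
    = (\<integral>u. lift f x u * indicator {0..<?a} u \<partial>lborel) + (\<integral>u. lift f x u * indicator {?a..<?b} u \<partial>lborel)"
    unfolding ind distrib_left by (rule Bochner_Integration.integral_add[OF ii ii])
  moreover have "lift f x u * indicator {?a..<?b} u = f (?p, u - ?a)" for u
  proof (cases "u \<in> {?a..<?b}")
    case True
    then have "cr x u = int n" using b by (intro cr_eqI[OF rx]) (auto simp: add.commute)
    then show ?thesis using True by (simp add: lift_def)
  next
    case False
    then have "u - ?a \<notin> {0<..<roof_min / 2}" using b p roof_min(1) by auto
    then show ?thesis using False boxD(3)[OF f] by simp
  qed
  moreover have "(\<integral>u. f (?p, u - ?a) \<partial>lborel) = height ?p"
    using lborel_integral_real_affine[of 1 "\<lambda>u. f (?p, u - ?a)" ?a] by (simp add: height_def)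
  ultimately show ?case using Suc.IH by simp
qed simp

text \<open>Compare the interval \<open>{r..r + T}\<close> with \<open>{0..<S n x}\<close>: as the
  roof has mean 1, \<open>S n x\<close> is expected to be near \<open>n\<close>. The term
  \<open>2 * r + 2\<close> pays for starting at height \<open>r\<close> and for rounding
  \<open>T\<close> to \<open>n\<close>, once in the interval and once in the mean.\<close>

lemma integral_lift_le:
  assumes rx: "regular x" and r: "0 \<le> r" and T: "0 \<le> T"
  defines "n \<equiv> nat \<lfloor>T\<rfloor>"
  shows "\<bar>\<integral>s. (lift f x (r + s) - mean) * indicator {0..T} s \<partial>lborel\<bar>
    \<le> 2 * r + 2 + \<bar>S (int n) x - real n\<bar> + \<bar>(\<Sum>k<n. height (x + real k * \<alpha>)) - real n * mean\<bar>"
proof -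
  let ?c = "S (int n) x"
  have nT: "real n \<le> T" "T \<le> real n + 1" using T unfolding n_def by linarith+
  have c0: "0 \<le> ?c" by (rule S_nonneg[OF rx])
  have ii: "integrable lborel (\<lambda>u. lift f x u * indicator {r..r + T} u)" "integrable lborel (\<lambda>u. lift f x u * indicator {0..<?c} u)"
    by (rule integrable_lift[where p = 0 and q = "r + T + ?c"]; use r T c0 in auto)+
  have mi: "integrable lborel (\<lambda>u. mean * indicator {r..r + T} u)"
    by (intro integrable_mult_right integrable_indicator_Icc)
  have "(\<integral>s. (lift f x (r + s) - mean) * indicator {0..T} s \<partial>lborel) = (\<integral>u. (lift f x u - mean) * indicator {r..r + T} u \<partial>lborel)"
  proof -
    have "indicator {r..r + T} (r + s) = (indicator {0..T} s :: real)" for s by (auto simp: indicator_def)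
    then show ?thesis using lborel_integral_real_affine[of 1 "\<lambda>u. (lift f x u - mean) * indicator {r..r + T} u" r] by simp
  qed
  also have "\<dots> = (\<integral>u. lift f x u * indicator {r..r + T} u - mean * indicator {r..r + T} u \<partial>lborel)"
    by (simp add: left_diff_distrib)
  also have "\<dots> = (\<integral>u. lift f x u * indicator {r..r + T} u \<partial>lborel) - mean * T"
    using T by (subst Bochner_Integration.integral_diff[OF ii(1) mi]) simp
  finally have 1: "(\<integral>s. (lift f x (r + s) - mean) * indicator {0..T} s \<partial>lborel)
    = (\<integral>u. lift f x u * indicator {r..r + T} u \<partial>lborel) - mean * T" .
  have "\<bar>(\<integral>u. lift f x u * indicator {r..r + T} u \<partial>lborel) - (\<integral>u. lift f x u * indicator {0..<?c} u \<partial>lborel)\<bar>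
    \<le> r + \<bar>(r + T) - ?c\<bar>"
  proof -
    have eq: "(\<integral>u. lift f x u * indicator {r..r + T} u \<partial>lborel) - (\<integral>u. lift f x u * indicator {0..<?c} u \<partial>lborel)
      = (\<integral>u. lift f x u * indicator {r..r + T} u - lift f x u * indicator {0..<?c} u \<partial>lborel)"
      by (rule Bochner_Integration.integral_diff[OF ii, symmetric])
    have "\<bar>\<integral>u. lift f x u * indicator {r..r + T} u - lift f x u * indicator {0..<?c} u \<partial>lborel\<bar>
      \<le> (\<integral>u. \<bar>lift f x u * indicator {r..r + T} u - lift f x u * indicator {0..<?c} u\<bar> \<partial>lborel)"
      by (rule integral_abs_bound)
    also have "\<dots> \<le> (\<integral>u. \<bar>indicator {r..r + T} u - indicator {0..<?c} u\<bar> \<partial>lborel)"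
    proof (rule Bochner_Integration.integral_mono')
      show "integrable lborel (\<lambda>u. \<bar>indicator {r..r + T} u - indicator {0..<?c} u\<bar> :: real)"
        by (intro integrable_abs Bochner_Integration.integrable_diff integrable_indicator_Icc integrable_real_indicator) (use c0 in auto)
      fix u
      have "\<bar>lift f x u\<bar> \<le> 1" using lift_half[of x u] by linarith
      then show "\<bar>lift f x u * indicator {r..r + T} u - lift f x u * indicator {0..<?c} u\<bar>
        \<le> \<bar>indicator {r..r + T} u - indicator {0..<?c} u\<bar>" by (simp add: indicator_def)
    qed simp
    also have "\<dots> \<le> r + \<bar>(r + T) - ?c\<bar>" by (rule interval_indicator_diff) (use r T c0 in auto)
    finally show ?thesis unfolding eq .
  qed
  moreover have "\<bar>mean * T - mean * real n\<bar> \<le> 1"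
  proof -
    have "\<bar>mean\<bar> * \<bar>T - real n\<bar> \<le> 1 * 1" using nT mean_half by (intro mult_mono) auto
    then show ?thesis by (simp add: right_diff_distrib[symmetric] abs_mult)
  qed
  ultimately show ?thesis unfolding 1 integral_lift_birkhoff[OF rx] mult.commute[of mean] using nT r by linarith
qed

text \<open>The sums of \<open>height\<close> equidistribute uniformly. For the roof only
  \<open>L^1\<close> convergence holds, and Markov's inequality gives \<open>S n x\<close> near
  \<open>n\<close> outside of a small set \<open>X\<close> of base points. Discarding heights above
  \<open>r0\<close> makes the part of the suspension over \<open>X\<close> small as well.\<close>

lemma ergodic_average:
  assumes \<epsilon>: "\<epsilon> > 0"
  shows "\<exists>T0>0. \<forall>T\<ge>T0. (\<integral>z. \<bar>\<integral>s. (lift f (fst z) (snd z + s) - mean) * indicator {0..T} s \<partial>lborel\<bar> \<partial>\<mu>) \<le> \<epsilon> * T"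
proof -
  \<comment> \<open>Outside of \<open>B\<close> the error is at most \<open>3 * e * T\<close>; the
    set \<open>B\<close> has measure at most \<open>2 * e\<close> and the error there is at most
    \<open>T\<close>.\<close>
  define e where "e = \<epsilon> / 5"
  have e: "e > 0" using \<epsilon> by (simp add: e_def)
  obtain r0 where r0: "r0 \<ge> 0" "measure \<mu> {z \<in> \<Omega>. r0 < snd z} \<le> e"
    using tail_measure[OF fst_snd_measurable_mu(2) e] by auto
  define r1 where "r1 = r0 + 1"
  have r1: "r1 > 0" using r0 by (simp add: r1_def)
  \<comment> \<open>Divided by the bound \<open>r1\<close> for the heights, so that the kept part
    over \<open>X\<close> has measure at most \<open>e\<close>.\<close>
  define e' where "e' = e / r1"
  have e': "e' > 0" using e r1 by (simp add: e'_def)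
  have ee: "e * e' > 0" using e e' by simp
  obtain n1 where n1: "\<And>n x. n \<ge> n1 \<Longrightarrow> \<bar>(\<Sum>k<n. height (x + real k * \<alpha>)) - real n * mean\<bar> \<le> e * real n"
    using uniform_equidistribution[OF irrational height_continuous height_periodic e] height_mean by auto
  obtain n2 where n2: "\<And>n. n \<ge> n2 \<Longrightarrow> (\<integral>x. \<bar>(\<Sum>k<n. roof0 (x + real k * \<alpha>)) - real n\<bar> \<partial>circ) \<le> e * e' * real n"
    using L1_equidistribution[OF irrational roof0_measurable roof0_periodic roof0_integral(1) roof0_L1_approx ee]
      roof0_integral(2) by auto
  define T0 where "T0 = real n1 + real n2 + 2 + (2 * r0 + 2) / e"
  have T0: "T0 > 0" using r0 e by (simp add: T0_def add_nonneg_pos)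
  have "(\<integral>z. \<bar>\<integral>s. (lift f (fst z) (snd z + s) - mean) * indicator {0..T} s \<partial>lborel\<bar> \<partial>\<mu>) \<le> \<epsilon> * T" if T: "T \<ge> T0" for T
  proof -
    define n where "n = nat \<lfloor>T\<rfloor>"
    have Tp: "T > 0" using T T0 by linarith
    have nT: "real n \<le> T" "T \<le> real n + 1" using Tp unfolding n_def by linarith+
    have Tr: "2 * r0 + 2 \<le> e * T"
    proof -
      have "(2 * r0 + 2) / e \<le> T" using T by (simp add: T0_def)
      then show ?thesis using e by (simp add: field_simps)
    qed
    have nn: "n \<ge> n1" "n \<ge> n2" "n > 0"
    proof -
      have "0 \<le> (2 * r0 + 2) / e" using r0 e by simp
      then have "real n1 + real n2 + 2 \<le> real n + 1" using T nT unfolding T0_def by linarith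
      then show "n \<ge> n1" "n \<ge> n2" "n > 0" by linarith+
    qed
    define q where "q x = \<bar>(\<Sum>k<n. roof0 (x + real k * \<alpha>)) - real n\<bar>" for x
    have [measurable]: "q \<in> borel_measurable borel" unfolding q_def by measurable
    have qS: "q x = \<bar>S (int n) x - real n\<bar>" if "regular x" for x
    proof -
      have "roof0 (x + real k * \<alpha>) = \<Phi> (x + real k * \<alpha>)" for k
        using regular_nonint[OF that, of "int k"] by (simp add: roof0_def)
      then show ?thesis by (simp add: q_def birkhoff_nat)
    qed
    define X where "X = {x \<in> {0..<1}. e * real n \<le> q x}"
    have Xm [measurable]: "X \<in> sets borel" unfolding X_def by measurable
    have Xe: "emeasure lborel X \<le> ennreal e'"
    proof -
      have qi: "integrable circ q"
        unfolding q_def using integral_circ_shift(2)[OF roof0_measurable roof0_periodic] roof0_integral(1)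
        by (intro integrable_abs Bochner_Integration.integrable_diff Bochner_Integration.integrable_sum) auto
      have "(e * real n) * measure circ {x \<in> space circ. e * real n \<le> q x} \<le> (\<integral>x. q x \<partial>circ)"
        using integral_Markov_inequality_measure[OF qi, of "{}" "e * real n"] e nn(3) by (simp add: q_def field_simps)
      also have "\<dots> \<le> (e * real n) * e'" using n2[OF nn(2)] by (simp add: q_def mult_ac)
      finally have "measure circ {x \<in> space circ. e * real n \<le> q x} \<le> e'" using e nn(3) by simp
      then have "emeasure circ {x \<in> space circ. e * real n \<le> q x} \<le> ennreal e'"
        unfolding circ.emeasure_eq_measure by (rule ennreal_leI)
      moreover have "emeasure circ {x \<in> space circ. e * real n \<le> q x} = emeasure lborel X"
        by (subst emeasure_circ) (auto simp: X_def intro!: arg_cong[where f = "emeasure lborel"])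
      ultimately show ?thesis by simp
    qed
    define B where "B = {z \<in> \<Omega>. r0 < snd z} \<union> {z \<in> \<Omega>. snd z < r1 \<and> (fst z, snd z + 0) \<in> X \<times> UNIV}"
    have XU: "X \<times> (UNIV :: real set) \<in> sets borel"
    proof -
      have "X \<times> (UNIV :: real set) \<in> sets (borel \<Otimes>\<^sub>M borel)" by (rule pair_measureI) simp_all
      then show ?thesis unfolding borel_prod .
    qed
    have Bs: "{z \<in> \<Omega>. r0 < snd z} \<in> sets \<mu>" "{z \<in> \<Omega>. snd z < r1 \<and> (fst z, snd z + 0) \<in> X \<times> UNIV} \<in> sets \<mu>"
    proof -
      show "{z \<in> \<Omega>. r0 < snd z} \<in> sets \<mu>" by (rule Collect_mu) measurable
      show "{z \<in> \<Omega>. snd z < r1 \<and> (fst z, snd z + 0) \<in> X \<times> UNIV} \<in> sets \<mu>" by (rule strip_sets[OF XU])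
    qed
    then have Bm: "B \<in> sets \<mu>" by (simp add: B_def)
    have "measure \<mu> B \<le> e + r1 * e'" unfolding B_def
    proof (rule order_trans[OF measure_Un_le[OF Bs]], rule add_mono)
      show "measure \<mu> {z \<in> \<Omega>. snd z < r1 \<and> (fst z, snd z + 0) \<in> X \<times> UNIV} \<le> r1 * e'"
        by (rule strip_measure_le) (use Xe XU r1 e' in auto)
    qed (rule r0(2))
    moreover have "r1 * e' = e" using r1 by (simp add: e'_def)
    ultimately have Bmu: "measure \<mu> B \<le> 2 * e" by simp
    have "(\<integral>z. \<bar>\<integral>s. (lift f (fst z) (snd z + s) - mean) * indicator {0..T} s \<partial>lborel\<bar> \<partial>\<mu>)
      \<le> (\<integral>z. 3 * e * T + T * indicator B z \<partial>\<mu>)"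
    proof (rule Bochner_Integration.integral_mono'[OF integral_affine_indicator(1)[OF Bm]])
      fix z assume z: "z \<in> space \<mu>"
      obtain x r where xr: "z = (x, r)" by (cases z)
      have rx: "regular x" and r: "0 \<le> r" and x01: "x \<in> {0..<1}" using z xr by (auto simp: space_iff)
      show "\<bar>\<integral>s. (lift f (fst z) (snd z + s) - mean) * indicator {0..T} s \<partial>lborel\<bar> \<le> 3 * e * T + T * indicator B z"
      proof (cases "z \<in> B")
        case True
        have l1: "\<bar>lift f x u - mean\<bar> \<le> 1" for u using lift_half[of x u] mean_half by linarith
        have "\<bar>\<integral>s. (lift f x (r + s) - mean) * indicator {0..T} s \<partial>lborel\<bar> \<le> T - 0"
          by (rule bounded_integral_Icc) (use l1 Tp in auto)
        moreover have "0 \<le> 3 * e * T" using e Tp by simp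
        moreover have "T * indicator B (x, r) = T" using True xr by simp
        ultimately show ?thesis unfolding xr fst_conv snd_conv by linarith
      next
        case False
        then have "r \<le> r0" "x \<notin> X" using z xr by (auto simp: B_def r1_def)
        then have "q x \<le> e * real n" using x01 by (auto simp: X_def)
        then have "\<bar>S (int n) x - real n\<bar> \<le> e * T" using qS[OF rx] mult_left_mono[OF nT(1), of e] e by linarith
        moreover have "\<bar>(\<Sum>k<n. height (x + real k * \<alpha>)) - real n * mean\<bar> \<le> e * T"
          using n1[OF nn(1), of x] mult_left_mono[OF nT(1), of e] e by linarith
        ultimately have "\<bar>\<integral>s. (lift f x (r + s) - mean) * indicator {0..T} s \<partial>lborel\<bar> \<le> 3 * (e * T)"
          using integral_lift_le[OF rx r, of T] Tp Tr \<open>r \<le> r0\<close> unfolding n_def[symmetric] by linarith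
        then show ?thesis using False xr by (simp add: mult.assoc)
      qed
    qed (use Tp e in auto)
    also have "\<dots> = 3 * e * T + T * measure \<mu> B" by (rule integral_affine_indicator(2)[OF Bm])
    also have "\<dots> \<le> 3 * e * T + T * (2 * e)" using Bmu Tp by (intro add_left_mono mult_left_mono) auto
    also have "\<dots> = \<epsilon> * T" by (simp add: e_def)
    finally show ?thesis .
  qed
  then show ?thesis using T0 by blast
qed

lemma f_K: "z \<in> \<Omega> \<Longrightarrow> f (K t z) = lift f (fst z) (snd z + t)"
  using lift_K[of f "fst z" "snd z" t] boxD(2)[OF f] by simp

lemma ergodic_sum:
  assumes d: "d > 0" "(\<Lambda> + 4 / roof_min) * d \<le> \<epsilon>" and \<epsilon>: "\<epsilon> > 0"
  shows "\<exists>J>0. (\<integral>z. \<bar>(\<Sum>j<J. f (K (real j * d) z) - mean) / real J\<bar> \<partial>\<mu>) \<le> 2 * \<epsilon>"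
proof -
  obtain T0 where T0: "T0 > 0"
    "\<And>T. T \<ge> T0 \<Longrightarrow> (\<integral>z. \<bar>\<integral>s. (lift f (fst z) (snd z + s) - mean) * indicator {0..T} s \<partial>lborel\<bar> \<partial>\<mu>) \<le> \<epsilon> * T"
    using ergodic_average[OF \<epsilon>] by blast
  define J where "J = nat \<lceil>T0 / d\<rceil>"
  have "0 < T0 / d" using T0 d by simp
  then have J: "J > 0" "T0 / d \<le> real J" unfolding J_def by linarith+
  define T where "T = real J * d"
  have T: "T > 0" "T \<ge> T0" using J d by (auto simp: T_def field_simps)
  define I where "I z = (\<integral>s. (lift f (fst z) (snd z + s) - mean) * indicator {0..T} s \<partial>lborel)" for z
  have fm [measurable]: "f \<in> borel_measurable \<mu>" by (rule measurable_mu[OF f_measurable])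
  have [measurable]: "I \<in> borel_measurable \<mu>" unfolding I_def by measurable
  have l1: "\<bar>lift f x u - mean\<bar> \<le> 1" for x u using lift_half[of x u] mean_half by linarith
  have pw: "\<bar>(\<Sum>j<J. f (K (real j * d) z) - mean) / real J - I z / T\<bar> \<le> \<epsilon>" if z: "z \<in> \<Omega>" for z
  proof -
    have rz: "regular (fst z)" using z by (cases z) (simp add: space_iff)
    have "\<bar>I z - (\<Sum>j<J. lift f (fst z) (snd z + real j * d) - mean) * d\<bar> \<le> (\<Lambda> + 4 / roof_min) * d * (real J * d)"
      unfolding I_def T_def
    proof (rule lipschitz_riemann_sum[OF _ d(1)])
      show "\<bar>(lift f (fst z) (snd z + s) - mean) - (lift f (fst z) (snd z + s') - mean)\<bar> \<le> (\<Lambda> + 4 / roof_min) * \<bar>s - s'\<bar>" for s s'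
        using box_lift_lipschitz[OF f rz, of "snd z + s" "snd z + s'"] by simp
    qed
    also have "\<dots> \<le> \<epsilon> * T" unfolding T_def[symmetric] using d(2) T by (intro mult_right_mono) auto
    finally have *: "\<bar>I z - (\<Sum>j<J. f (K (real j * d) z) - mean) * d\<bar> \<le> \<epsilon> * T" unfolding f_K[OF z] .
    have "(\<Sum>j<J. f (K (real j * d) z) - mean) / real J - I z / T = - ((I z - (\<Sum>j<J. f (K (real j * d) z) - mean) * d) / T)"
      using J d by (simp add: T_def field_simps)
    then have "\<bar>(\<Sum>j<J. f (K (real j * d) z) - mean) / real J - I z / T\<bar> = \<bar>I z - (\<Sum>j<J. f (K (real j * d) z) - mean) * d\<bar> / T"
      using T by (simp add: abs_divide)
    also have "\<dots> \<le> \<epsilon>" using * T by (simp add: field_simps)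
    finally show ?thesis .
  qed
  have I1: "\<bar>I z\<bar> \<le> T" for z
    unfolding I_def using bounded_integral_Icc(2)[of "\<lambda>s. lift f (fst z) (snd z + s) - mean" 0 T] l1 T by simp
  have Ii: "integrable \<mu> (\<lambda>z. \<bar>I z\<bar>)" by (rule integrable_const_bound[where B = T]) (use I1 in auto)
  have Ki: "integrable \<mu> (\<lambda>z. f (K t z))" for t
    by (rule unit_boundedD(3)[OF unit_bounded_K[OF box_centered(1)[OF f]]])
  have "(\<integral>z. \<bar>(\<Sum>j<J. f (K (real j * d) z) - mean) / real J\<bar> \<partial>\<mu>) \<le> (\<integral>z. \<epsilon> + \<bar>I z\<bar> / T \<partial>\<mu>)"
  proof (rule integral_mono)
    show "integrable \<mu> (\<lambda>z. \<bar>(\<Sum>j<J. f (K (real j * d) z) - mean) / real J\<bar>)"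
      by (intro integrable_abs integrable_divide Bochner_Integration.integrable_sum Bochner_Integration.integrable_diff Ki) simp
    show "integrable \<mu> (\<lambda>z. \<epsilon> + \<bar>I z\<bar> / T)" using Ii by simp
    fix z assume "z \<in> space \<mu>"
    then have "z \<in> \<Omega>" by simp
    moreover have "\<bar>I z\<bar> / T = \<bar>I z / T\<bar>" using T by simp
    ultimately show "\<bar>(\<Sum>j<J. f (K (real j * d) z) - mean) / real J\<bar> \<le> \<epsilon> + \<bar>I z\<bar> / T" using pw[of z] by linarith
  qed
  also have "\<dots> = \<epsilon> + (\<integral>z. \<bar>I z\<bar> \<partial>\<mu>) / T"
    using Ii prob_space by (simp add: Bochner_Integration.integral_add del: space_mu)
  also have "\<dots> \<le> \<epsilon> + \<epsilon>" using T0(2)[OF T(2)] T(1) by (simp add: I_def field_simps)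
  finally show ?thesis using J(1) by auto
qed

text \<open>A single velocity is its own maximum, so off a small set the direction is 1 or -1 and
  the sheared average is an ergodic average of \<open>f\<close>, running backwards or forwards from
  time \<open>t 0\<close>. Thus equidistribution alone starts the induction over the orders.\<close>

lemma far_box_decorrelation_1:
  assumes f0: "box \<Lambda> f0" and \<epsilon>: "\<epsilon> > 0"
  shows "\<forall>\<^sub>F t in far_filter 1. \<bar>\<integral>z. f0 z * (f (K (t 0) z) - mean) \<partial>\<mu>\<bar> \<le> \<epsilon>"
proof -
  define l where "l = \<Lambda> + 4 / roof_min"
  have l: "l > 0" using boxD(1)[OF f0] roof_min(1) by (simp add: l_def add_nonneg_pos)
  \<comment> \<open>The shear costs \<open>2 * e\<close>; the average costs \<open>5 * e\<close>,
    namely \<open>2 * e\<close> for each of the two directions and \<open>e\<close> for the points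
    with neither.\<close>
  define e where "e = \<epsilon> / 8"
  have e: "e > 0" using \<epsilon> by (simp add: e_def)
  define d where "d = e / l"
  have d: "d > 0" "l * d = e" using l e by (auto simp: d_def)
  obtain J where J: "J > 0" "(\<integral>z. \<bar>(\<Sum>j<J. f (K (real j * d) z) - mean) / real J\<bar> \<partial>\<mu>) \<le> 2 * e"
    using ergodic_sum[OF d(1) _ e] d(2) by (auto simp: l_def)
  define h where "h z = \<bar>(\<Sum>j<J. f (K (real j * d) z) - mean) / real J\<bar>" for z
  have fu: "f \<in> unit_bounded" by (rule box_centered(1)[OF f])
  have [measurable]: "f \<in> borel_measurable \<mu>" by (rule unit_boundedD(1)[OF fu])
  have Ki: "integrable \<mu> (\<lambda>z. f (K t z))" for t by (rule unit_boundedD(3)[OF unit_bounded_K[OF fu]])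
  have hi: "integrable \<mu> h" unfolding h_def
    by (intro integrable_abs integrable_divide Bochner_Integration.integrable_sum Bochner_Integration.integrable_diff Ki) simp
  let ?Y = "sheared 1 (\<lambda>_. f) (\<lambda>_. mean)"
  have Yu: "?Y t s \<in> unit_bounded" for t s
  proof (rule unit_boundedI)
    show "\<bar>?Y t s z\<bar> \<le> 1" for z by (rule sheared_le_1[OF f mean_half])
    show "?Y t s \<in> borel_measurable \<mu>"
      using sheared_measurable[where f = "\<lambda>_. f" and m = "\<lambda>_. mean" and n = 1 and g = fst and h = snd and L = \<mu> and s = "\<lambda>_. s" and t = t, OF f mean_half] by simp
  qed
  have Y: "?Y t s z = f (K (t 0 - cdir 1 t 0 z * s) z) - mean" if "z \<in> \<Omega>" for t s z
    using sheared_K[of 1 \<Lambda> "\<lambda>_. f" z "\<lambda>_. mean" t s] f that by simp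
  have ev1: "\<forall>\<^sub>F t in far_filter 1.
    \<bar>\<integral>z. f0 z * (?Y t 0 z - (\<Sum>j<J. ?Y t (real j * d) z) / real J) \<partial>\<mu>\<bar> \<le> real 1 * (\<Lambda> + 4 / roof_min) * d + e"
    by (rule shear_average[OF f mean_half _ J(1) d(1) f0 e]) simp
  have ev2: "\<forall>\<^sub>F t in far_filter 1. measure \<mu> {z \<in> space \<mu>. \<forall>i<1. \<bar>cdir 1 t i z\<bar> \<noteq> 1} < e"
    using order_tendstoD(2)[OF cdir_attained[of 1] e] by simp
  from ev1 ev2 show ?thesis
  proof eventually_elim
    case (elim t)
    define av where "av z = (\<Sum>j<J. ?Y t (real j * d) z) / real J" for z
    let ?Z = "{z \<in> space \<mu>. \<bar>cdir 1 t 0 z\<bar> \<noteq> 1}"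
    have [measurable]: "cdir 1 t 0 \<in> borel_measurable \<mu>" by (rule unit_boundedD(1)[OF cdir_unit_bounded]) simp
    have Zs: "?Z \<in> sets \<mu>" by measurable
    have Zm: "measure \<mu> ?Z \<le> e" using elim(2) by simp
    \<comment> \<open>For direction 1 the times \<open>t 0 - j * d\<close> are read in reverse
      order, as an ergodic sum that starts at the earliest of them.\<close>
    let ?t' = "t 0 - real (J - 1) * d"
    have avi: "integrable \<mu> av" unfolding av_def
      by (intro integrable_divide Bochner_Integration.integrable_sum unit_boundedD(3)[OF Yu])
    have av1: "\<bar>av z\<bar> \<le> 1" if "z \<in> \<Omega>" for z
    proof -
      have "\<bar>\<Sum>j<J. ?Y t (real j * d) z\<bar> \<le> (\<Sum>j<J. 1)"
        by (rule order_trans[OF sum_abs]) (intro sum_mono sheared_le_1[OF f mean_half])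
      then show ?thesis unfolding av_def abs_divide using J by (subst divide_le_eq_1_pos) auto
    qed
    have pw: "\<bar>av z\<bar> \<le> (h (K ?t' z) + h (K (t 0) z)) + (0 + 1 * indicator ?Z z)" if z: "z \<in> \<Omega>" for z
    proof -
      have h0: "0 \<le> h w" for w by (simp add: h_def)
      consider "\<bar>cdir 1 t 0 z\<bar> \<noteq> 1" | "cdir 1 t 0 z = 1" | "cdir 1 t 0 z = -1" by linarith
      then show ?thesis
      proof cases
        case 1
        then show ?thesis using av1[OF z] z h0[of "K ?t' z"] h0[of "K (t 0) z"] by simp
      next
        case 2
        have "(\<Sum>j<J. ?Y t (real j * d) z) = (\<Sum>j<J. f (K (t 0 - real j * d) z) - mean)" unfolding Y[OF z] 2 by simp
        also have "\<dots> = (\<Sum>j<J. f (K (t 0 - real (J - Suc j) * d) z) - mean)" by (rule sum.nat_diff_reindex[symmetric])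
        also have "\<dots> = (\<Sum>j<J. f (K (real j * d) (K ?t' z)) - mean)"
        proof (rule sum.cong[OF refl])
          fix j assume "j \<in> {..<J}"
          then have "t 0 - real (J - Suc j) * d = real j * d + ?t'" using J(1) by (simp add: of_nat_diff algebra_simps)
          then show "f (K (t 0 - real (J - Suc j) * d) z) - mean = f (K (real j * d) (K ?t' z)) - mean"
            by (simp only: K_flow_add[OF z])
        qed
        finally have "\<bar>av z\<bar> = h (K ?t' z)" by (simp add: av_def h_def)
        then show ?thesis using h0[of "K (t 0) z"] by (simp add: indicator_def)
      next
        case 3
        have "(\<Sum>j<J. ?Y t (real j * d) z) = (\<Sum>j<J. f (K (real j * d) (K (t 0) z)) - mean)"
          unfolding Y[OF z] 3 by (simp add: K_flow_add[OF z, symmetric] add.commute)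
        then have "\<bar>av z\<bar> = h (K (t 0) z)" by (simp add: av_def h_def)
        then show ?thesis using h0[of "K ?t' z"] by (simp add: indicator_def)
      qed
    qed
    have hm: "h \<in> borel_measurable \<mu>" using hi by simp
    have "(\<integral>z. \<bar>av z\<bar> \<partial>\<mu>) \<le> (\<integral>z. (h (K ?t' z) + h (K (t 0) z)) + (0 + 1 * indicator ?Z z) \<partial>\<mu>)"
      by (intro integral_mono Bochner_Integration.integrable_add integrable_K[OF hi] integral_affine_indicator(1)[OF Zs] integrable_abs avi)
        (use pw in simp)
    also have "\<dots> = ((\<integral>z. h z \<partial>\<mu>) + (\<integral>z. h z \<partial>\<mu>)) + (0 + 1 * measure \<mu> ?Z)"
      by (simp only: Bochner_Integration.integral_add Bochner_Integration.integrable_add integrable_K[OF hi]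
          integral_affine_indicator[OF Zs] integral_K[OF hm])
    also have "\<dots> \<le> 5 * e" using J(2) Zm by (simp add: h_def)
    finally have "(\<integral>z. \<bar>av z\<bar> \<partial>\<mu>) \<le> 5 * e" .
    moreover have "\<bar>\<integral>z. f0 z * (?Y t 0 z - av z) \<partial>\<mu>\<bar> \<le> 2 * e" using elim(1) d(2) by (simp add: av_def l_def)
    ultimately have "\<bar>\<integral>z. f0 z * ?Y t 0 z \<partial>\<mu>\<bar> \<le> \<epsilon>"
      using integral_perturb_le[OF box_centered(1)[OF f0] Yu[of t 0] avi] \<epsilon> unfolding e_def by linarith
    moreover have "(\<integral>z. f0 z * ?Y t 0 z \<partial>\<mu>) = (\<integral>z. f0 z * (f (K (t 0) z) - mean) \<partial>\<mu>)"
      by (rule Bochner_Integration.integral_cong) (use Y in auto)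
    ultimately show ?case by simp
  qed
qed


end

end

context power_roof
begin

subsection \<open>Density of box functions\<close>

text \<open>A cut-off function of the distance to \<open>D\<close>, the union of all integer
  translates of \<open>C\<close>. The number \<open>\<delta>\<close> is a lower bound for the
  distance from \<open>C\<close> to the complement of \<open>U\<close> and determines the Lipschitz
  constant.\<close>

lemma box_bump:
  assumes C: "compact C" and U: "open U" "C \<subseteq> U" "U \<subseteq> {0<..<1} \<times> strip"
  shows "\<exists>\<Lambda> f. box \<Lambda> f \<and> (\<forall>z\<in>C. f z = 1/2) \<and> (\<forall>z. fst z \<in> {0..<1} \<longrightarrow> z \<notin> U \<longrightarrow> f z = 0) \<and> (\<forall>z. 0 \<le> f z)"
proof (cases "C = {}")
  case True
  then show ?thesis by (intro exI[of _ 0] exI[of _ "\<lambda>_. 0"]) (simp add: box_def)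
next
  case False
  obtain \<delta> where \<delta>: "\<delta> > 0" "\<And>z w. z \<in> C \<Longrightarrow> w \<notin> U \<Longrightarrow> \<delta> \<le> dist z w"
  proof -
    have "\<exists>\<delta>>0. \<forall>z\<in>C. \<forall>w\<in>- U. \<delta> \<le> dist z w"
      by (rule separate_compact_closed[OF C]) (use U in \<open>auto simp: closed_Compl\<close>)
    then show thesis using that by blast
  qed
  define D where "D = {(x + of_int m, r) | x m r. (x, r) \<in> C}"
  define f where "f z = max 0 (1 - infdist z D / \<delta>) / 2" for z :: "real \<times> real"
  have D0: "D \<noteq> {}" using False by (auto simp: D_def)
  have dist_shift: "dist (a + c, r) (b + c, s) = dist (a, r) (b, s)" for a b c r s :: real
    by (simp add: dist_Pair_Pair dist_real_def)
  have le: "infdist (x + of_int m, r) D \<le> infdist (x, r) D" for x r and m :: int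
    unfolding infdist_notempty[OF D0, of "(x, r)"]
  proof (rule cINF_greatest[OF D0])
    fix c assume "c \<in> D"
    then obtain a l s where c: "c = (a + of_int l, s)" "(a, s) \<in> C" by (auto simp: D_def)
    then have "(a + of_int (l + m), s) \<in> D" unfolding D_def by blast
    then have "infdist (x + of_int m, r) D \<le> dist (x + of_int m, r) (a + of_int (l + m), s)" by (rule infdist_le)
    also have "\<dots> = dist (x, r) c" using dist_shift[of x "of_int m" r "a + of_int l" s] by (simp add: c add.assoc)
    finally show "infdist (x + of_int m, r) D \<le> dist (x, r) c" .
  qed
  have per: "f (x + of_int m, r) = f (x, r)" for x r and m :: int
    using le[of x m r] le[of "x + of_int m" "- m" r] by (simp add: f_def)
  have lip: "\<bar>f (x, r) - f (y, s)\<bar> \<le> (1 / \<delta>) * (\<bar>x - y\<bar> + \<bar>r - s\<bar>)" for x r y s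
  proof -
    have "dist (x, r) (y, s) \<le> \<bar>x - y\<bar> + \<bar>r - s\<bar>"
      unfolding dist_Pair_Pair dist_real_def by (rule order_trans[OF sqrt_sum_squares_le_sum_abs]) simp
    then have "\<bar>infdist (x, r) D - infdist (y, s) D\<bar> \<le> \<bar>x - y\<bar> + \<bar>r - s\<bar>"
      using infdist_triangle[of "(x, r)" D "(y, s)"] infdist_triangle[of "(y, s)" D "(x, r)"]
      by (simp add: dist_commute abs_le_iff)
    then have "\<bar>infdist (x, r) D / \<delta> - infdist (y, s) D / \<delta>\<bar> \<le> (1 / \<delta>) * (\<bar>x - y\<bar> + \<bar>r - s\<bar>)"
      using \<delta>(1) by (simp add: diff_divide_distrib[symmetric] abs_divide divide_right_mono)
    moreover have "\<bar>max 0 (1 - a) / 2 - max 0 (1 - b) / 2\<bar> \<le> \<bar>a - b\<bar>" for a b :: real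
      by (cases "a \<le> 1"; cases "b \<le> 1") (auto simp: max_def abs_if field_simps)
    ultimately show ?thesis unfolding f_def by (meson order_trans)
  qed
  have far: "f (x, r) = 0" if out: "\<And>m::int. (x - of_int m, r) \<notin> U" for x r
  proof -
    have "\<delta> \<le> infdist (x, r) D" unfolding infdist_notempty[OF D0]
    proof (rule cINF_greatest[OF D0])
      fix c assume "c \<in> D"
      then obtain a l s where c: "c = (a + of_int l, s)" "(a, s) \<in> C" by (auto simp: D_def)
      have "\<delta> \<le> dist (a, s) (x - of_int l, r)" by (rule \<delta>(2)[OF c(2) out])
      also have "\<dots> = dist (x, r) c"
        using dist_shift[of "x - of_int l" "of_int l" r a s] by (simp add: c(1) dist_commute)
      finally show "\<delta> \<le> dist (x, r) c" .
    qed
    then show ?thesis using \<delta>(1) by (simp add: f_def)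
  qed
  have "box (1 / \<delta>) f" unfolding box_def
  proof (intro conjI allI impI)
    show "f (x, r) = 0" if "r \<notin> strip" for x r by (rule far) (use U(3) that in blast)
    show "\<bar>f z\<bar> \<le> 1/2" for z
    proof -
      have "0 \<le> infdist z D / \<delta>" using \<delta>(1) infdist_nonneg[of z D] by simp
      then show ?thesis by (simp add: f_def)
    qed
  qed (use \<delta>(1) per lip in auto)
  moreover have "f z = 1/2" if "z \<in> C" for z
  proof -
    have "(fst z + of_int 0, snd z) \<in> D" unfolding D_def using that by (intro CollectI exI[of _ "fst z"] exI[of _ 0] exI[of _ "snd z"]) simp
    then show ?thesis by (simp add: f_def)
  qed
  moreover have "f z = 0" if z: "fst z \<in> {0..<1}" "z \<notin> U" for z
  proof -
    obtain x r where xr: "z = (x, r)" by (cases z)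
    \<comment> \<open>Different translates do not interfere: \<open>U\<close> lies over the open
      unit interval, so only \<open>m = 0\<close> can bring a point over \<open>{0..<1}\<close> into
      \<open>U\<close>.\<close>
    have "(x - of_int m, r) \<notin> U" for m :: int
    proof (cases "m = 0")
      case False
      then have "m \<le> -1 \<or> 1 \<le> m" by linarith
      then have "x - of_int m \<notin> {0<..<1}" using z xr by auto
      then show ?thesis using U(3) by blast
    qed (use z xr in simp)
    then show ?thesis unfolding xr by (rule far)
  qed
  moreover have "0 \<le> f z" for z by (simp add: f_def)
  ultimately show ?thesis by blast
qed

text \<open>Box functions vanish on the floor, so approximating a set that meets the floor requires
  the floor to be negligible.\<close>

lemma floor_null: "measure \<mu> {z \<in> \<Omega>. snd z = 0} = 0"
proof -
  have "emeasure \<mu> {z \<in> \<Omega>. snd z = 0} = (\<integral>\<^sup>+x. emeasure lborel {r. (x, r) \<in> {z \<in> \<Omega>. snd z = 0}} \<partial>circ)"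
    by (intro emeasure_mu Collect_mu) measurable
  also have "\<dots> = (\<integral>\<^sup>+x. 0 \<partial>circ)"
  proof (rule nn_integral_cong)
    fix x
    have "{r. (x, r) \<in> {z \<in> \<Omega>. snd z = 0}} \<subseteq> {0}" by auto
    then have "emeasure lborel {r. (x, r) \<in> {z \<in> \<Omega>. snd z = 0}} \<le> emeasure lborel {0::real}" by (intro emeasure_mono) auto
    then show "emeasure lborel {r. (x, r) \<in> {z \<in> \<Omega>. snd z = 0}} = 0" by simp
  qed
  finally show ?thesis by (simp add: measure_def)
qed

text \<open>Regularity of the image measure on the plane supplies a compact set inside
  \<open>B\<close> and an open set around it, both of nearly the same measure. The factor 2 turns a
  bump with maximum \<open>1/2\<close> into an approximate indicator.\<close>

lemma box_approx:
  assumes B: "B \<in> sets \<mu>" "\<And>z. z \<in> B \<Longrightarrow> snd z < roof_min / 2" and \<epsilon>: "\<epsilon> > 0"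
  shows "\<exists>\<Lambda> f. box \<Lambda> f \<and> (\<integral>z. \<bar>indicator B z - 2 * f z\<bar> \<partial>\<mu>) < \<epsilon>"
proof -
  define \<nu> where "\<nu> = distr \<mu> borel (\<lambda>z. z)"
  have idm: "(\<lambda>z. z) \<in> \<mu> \<rightarrow>\<^sub>M borel" by (rule measurable_mu) simp
  have \<nu>s: "sets \<nu> = sets borel" by (simp add: \<nu>_def)
  interpret \<nu>: prob_space \<nu> unfolding \<nu>_def by (rule prob_space_distr[OF idm])
  have \<nu>m: "measure \<nu> A = measure \<mu> (A \<inter> \<Omega>)" if "A \<in> sets borel" for A
    unfolding \<nu>_def using measure_distr[OF idm that] by simp
  have \<nu>f: "emeasure \<nu> (space \<nu>) \<noteq> \<infinity>" using \<nu>.emeasure_finite by simp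
  define B0 where "B0 = {z \<in> B. 0 < snd z}"
  have Bb: "B \<subseteq> \<Omega>" "B \<in> sets borel" using B(1) by (auto simp: sets_mu)
  have B0s: "B0 \<in> sets \<mu>"
  proof -
    have [measurable]: "B \<in> sets \<mu>" by (rule B(1))
    have "B0 = {z \<in> \<Omega>. z \<in> B \<and> 0 < snd z}" using Bb by (auto simp: B0_def)
    moreover have "{z \<in> \<Omega>. z \<in> B \<and> 0 < snd z} \<in> sets \<mu>" by (rule Collect_mu) measurable
    ultimately show ?thesis by simp
  qed
  have B0b: "B0 \<subseteq> \<Omega>" "B0 \<in> sets borel" using B0s by (auto simp: sets_mu)
  have B0Q: "B0 \<subseteq> {0<..<1} \<times> strip"
  proof
    fix z assume z: "z \<in> B0"
    obtain x r where xr: "z = (x, r)" by (cases z)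
    have "(x, r) \<in> \<Omega>" using z B0b xr by auto
    then have "regular x" "0 \<le> x" "x < 1" by (auto simp: space_iff)
    moreover from this have "x \<noteq> 0" using regular_nonint0[of x] by auto
    ultimately show "z \<in> {0<..<1} \<times> strip" using z B(2)[of z] xr by (auto simp: B0_def)
  qed
  have BB0: "measure \<mu> B \<le> measure \<mu> B0"
  proof -
    have F: "{z \<in> \<Omega>. snd z = 0} \<in> sets \<mu>" by (rule Collect_mu) measurable
    have "B \<subseteq> B0 \<union> {z \<in> \<Omega>. snd z = 0}"
    proof
      fix z assume z: "z \<in> B"
      then have "0 \<le> snd z" using Bb by (cases z) (auto simp: space_iff)
      then show "z \<in> B0 \<union> {z \<in> \<Omega>. snd z = 0}" using z Bb by (auto simp: B0_def)
    qed
    then have "measure \<mu> B \<le> measure \<mu> (B0 \<union> {z \<in> \<Omega>. snd z = 0})" using B0s F by (intro finite_measure_mono) auto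
    also have "\<dots> \<le> measure \<mu> B0 + 0" using measure_Un_le[OF B0s F] floor_null by simp
    finally show ?thesis by simp
  qed
  define e where "e = \<epsilon> / 4"
  have e: "e > 0" using \<epsilon> by (simp add: e_def)
  obtain C where C: "compact C" "C \<subseteq> B0" "measure \<nu> B0 \<le> measure \<nu> C + e"
  proof (cases "measure \<nu> B0 \<le> e")
    case True
    then show ?thesis using that[of "{}"] by simp
  next
    case False
    then have "ennreal (measure \<nu> B0 - e) < emeasure \<nu> B0"
      unfolding \<nu>.emeasure_eq_measure using e by (subst ennreal_less_iff) auto
    then obtain C where "C \<subseteq> B0" "compact C" "ennreal (measure \<nu> B0 - e) < emeasure \<nu> C"
      unfolding inner_regular[OF \<nu>s \<nu>f B0b(2)] less_SUP_iff by auto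
    moreover from this have "measure \<nu> B0 - e < measure \<nu> C"
      unfolding \<nu>.emeasure_eq_measure using False by (subst (asm) ennreal_less_iff) auto
    ultimately show ?thesis using that[of C] by simp
  qed
  have Cb: "C \<in> sets borel" using C(1) by (simp add: borel_compact)
  obtain U0 where U0: "open U0" "C \<subseteq> U0" "measure \<nu> U0 \<le> measure \<nu> C + e"
  proof -
    have "emeasure \<nu> C < ennreal (measure \<nu> C + e)"
      unfolding \<nu>.emeasure_eq_measure using e by (subst ennreal_less_iff) auto
    then obtain U where "C \<subseteq> U" "open U" "emeasure \<nu> U < ennreal (measure \<nu> C + e)"
      unfolding outer_regular[OF \<nu>s \<nu>f Cb] INF_less_iff by auto
    moreover from this have "measure \<nu> U < measure \<nu> C + e"
      unfolding \<nu>.emeasure_eq_measure by (subst (asm) ennreal_less_iff) auto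
    ultimately show ?thesis using that[of U] by simp
  qed
  define U where "U = U0 \<inter> ({0<..<1} \<times> strip)"
  have U: "open U" "C \<subseteq> U" "U \<subseteq> {0<..<1} \<times> strip" using U0 C(2) B0Q by (auto simp: U_def intro!: open_Int open_Times)
  obtain \<Lambda> f where f: "box \<Lambda> f" "\<And>z. z \<in> C \<Longrightarrow> f z = 1/2"
    "\<And>z. fst z \<in> {0..<1} \<Longrightarrow> z \<notin> U \<Longrightarrow> f z = 0" "\<And>z. 0 \<le> f z" using box_bump[OF C(1) U] by blast
  have CO: "C \<subseteq> \<Omega>" using C(2) B0b by blast
  have Cm: "C \<in> sets \<mu>" using Cb CO by (simp add: sets_mu)
  have Um: "U0 \<inter> \<Omega> \<in> sets \<mu>" using U0(1) by (simp add: sets_mu)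
  have BC: "B - C \<in> sets \<mu>" "U0 \<inter> \<Omega> - C \<in> sets \<mu>" using B(1) Cm Um by auto
  have ii: "integrable \<mu> (indicator (B - C) :: _ \<Rightarrow> real)" "integrable \<mu> (indicator (U0 \<inter> \<Omega> - C) :: _ \<Rightarrow> real)"
    using BC by (auto intro!: integrable_real_indicator simp: less_top[symmetric])
  have "(\<integral>z. \<bar>indicator B z - 2 * f z\<bar> \<partial>\<mu>) \<le> (\<integral>z. indicator (B - C) z + indicator (U0 \<inter> \<Omega> - C) z \<partial>\<mu>)"
  proof (rule Bochner_Integration.integral_mono')
    show "integrable \<mu> (\<lambda>z. indicator (B - C) z + indicator (U0 \<inter> \<Omega> - C) z :: real)"
      by (rule Bochner_Integration.integrable_add[OF ii])
    fix z assume z: "z \<in> space \<mu>"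
    then have x: "fst z \<in> {0..<1}" by (cases z) (auto simp: space_iff)
    have f1: "0 \<le> f z" "f z \<le> 1/2" using f(4)[of z] boxD(5)[OF f(1), of z] by auto
    show "\<bar>indicator B z - 2 * f z\<bar> \<le> indicator (B - C) z + indicator (U0 \<inter> \<Omega> - C) z"
    proof (cases "z \<in> C")
      case True
      moreover have "z \<in> B" using True C(2) by (auto simp: B0_def)
      ultimately show ?thesis using f(2)[OF True] by simp
    next
      case False
      show ?thesis
      proof (cases "z \<in> U")
        case True
        then have "z \<in> U0 \<inter> \<Omega> - C" using False z by (auto simp: U_def)
        then show ?thesis using f1 by (auto simp: indicator_def)
      next
        case nU: False
        then show ?thesis using f(3)[OF x nU] False by (auto simp: indicator_def)
      qed
    qed
  qed simp
  also have "\<dots> = measure \<mu> (B - C) + measure \<mu> (U0 \<inter> \<Omega> - C)"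
    using BC by (subst Bochner_Integration.integral_add[OF ii]) (simp add: sets.Int_space_eq2 del: space_mu)
  also have "\<dots> \<le> e + e"
  proof (rule add_mono)
    have "measure \<mu> (B - C) = measure \<mu> B - measure \<mu> C"
      by (rule finite_measure_Diff[OF B(1) Cm]) (use C(2) in \<open>auto simp: B0_def\<close>)
    moreover have "measure \<nu> B0 = measure \<mu> B0" "measure \<nu> C = measure \<mu> C"
      using \<nu>m[OF B0b(2)] \<nu>m[OF Cb] B0b CO by (simp_all add: Int_absorb2)
    ultimately show "measure \<mu> (B - C) \<le> e" using C(3) BB0 by linarith
    have "measure \<mu> (U0 \<inter> \<Omega> - C) = measure \<mu> (U0 \<inter> \<Omega>) - measure \<mu> C"
      by (rule finite_measure_Diff[OF Um Cm]) (use U0(2) CO in auto)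
    moreover have "measure \<nu> U0 = measure \<mu> (U0 \<inter> \<Omega>)" using U0(1) by (intro \<nu>m) simp
    ultimately show "measure \<mu> (U0 \<inter> \<Omega> - C) \<le> e" using U0(3) \<open>measure \<nu> C = measure \<mu> C\<close> by linarith
  qed
  finally show ?thesis using f(1) \<epsilon> by (intro exI[of _ \<Lambda>] exI[of _ f]) (simp add: e_def)
qed

lemma K_vertical: "(x, r) \<in> \<Omega> \<Longrightarrow> (x, r + t) \<in> \<Omega> \<Longrightarrow> K t (x, r) = (x, r + t)"
proof -
  assume "(x, r) \<in> \<Omega>" and rt: "(x, r + t) \<in> \<Omega>"
  then have rx: "regular x" "0 \<le> x" "x < 1" by (auto simp: space_iff)
  have "cr x (r + t) = 0" by (rule cr_0[OF rx(1)]) (use rt in \<open>auto simp: space_iff\<close>)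
  moreover have "frac x = x" using rx by (simp add: frac_eq)
  ultimately show ?thesis by (simp add: K_eq[OF rx(1)])
qed

text \<open>Box functions only see heights below \<open>roof_min / 2\<close>. Higher layers of this
  thickness are brought down by the flow, which acts on them as a vertical translation; this is the
  purpose of the hypothesis on \<open>K u\<close>. Finitely many layers exhaust the space up to
  small measure, and simple functions and limits follow.\<close>

lemma integrable_dense_induct:
  fixes P :: "(real \<times> real \<Rightarrow> real) \<Rightarrow> bool"
  assumes box: "\<And>\<Lambda> f. box \<Lambda> f \<Longrightarrow> P f"
    and flow: "\<And>g u. g \<in> borel_measurable \<mu> \<Longrightarrow> P g \<Longrightarrow> P (\<lambda>z. g (K u z))"
    and add: "\<And>g h. integrable \<mu> g \<Longrightarrow> integrable \<mu> h \<Longrightarrow> P g \<Longrightarrow> P h \<Longrightarrow> P (\<lambda>z. g z + h z)"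
    and scale: "\<And>g c. P g \<Longrightarrow> P (\<lambda>z. c * g z)"
    and lim: "\<And>g. integrable \<mu> g \<Longrightarrow>
      (\<And>\<epsilon>. \<epsilon> > 0 \<Longrightarrow> \<exists>h. integrable \<mu> h \<and> P h \<and> (\<integral>z. \<bar>g z - h z\<bar> \<partial>\<mu>) < \<epsilon>) \<Longrightarrow> P g"
    and g: "integrable \<mu> g"
  shows "P g"
proof -
  have ind: "integrable \<mu> (indicator A :: _ \<Rightarrow> real)" if "A \<in> sets \<mu>" for A
    using that by (auto intro!: integrable_real_indicator simp: less_top[symmetric])
  have cong: "P g" if "integrable \<mu> g" "integrable \<mu> h" "P h" "\<And>z. z \<in> \<Omega> \<Longrightarrow> g z = h z" for g h
  proof (rule lim[OF that(1)])
    fix \<epsilon> :: real assume "\<epsilon> > 0"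
    moreover have "(\<integral>z. \<bar>g z - h z\<bar> \<partial>\<mu>) = (\<integral>z. 0 \<partial>\<mu>)"
      by (rule Bochner_Integration.integral_cong) (use that(4) in auto)
    ultimately show "\<exists>h. integrable \<mu> h \<and> P h \<and> (\<integral>z. \<bar>g z - h z\<bar> \<partial>\<mu>) < \<epsilon>" using that by auto
  qed
  define w where "w = roof_min / 2"
  have w: "w > 0" using roof_min(1) by (simp add: w_def)
  have low: "P (indicator B)" if B: "B \<in> sets \<mu>" "\<And>z. z \<in> B \<Longrightarrow> snd z < w" for B
  proof (rule lim[OF ind[OF B(1)]])
    fix \<epsilon> :: real assume "\<epsilon> > 0"
    then obtain \<Lambda> f where f: "box \<Lambda> f" "(\<integral>z. \<bar>indicator B z - 2 * f z\<bar> \<partial>\<mu>) < \<epsilon>"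
      using box_approx[OF B(1)] B(2) unfolding w_def by blast
    then show "\<exists>h. integrable \<mu> h \<and> P h \<and> (\<integral>z. \<bar>indicator B z - h z\<bar> \<partial>\<mu>) < \<epsilon>"
      using unit_boundedD(3)[OF box_centered(1)[OF f(1)]] scale[OF box[OF f(1)], of 2]
      by (intro exI[of _ "\<lambda>z. 2 * f z"]) simp
  qed
  have layer: "P (indicator A)" if A: "A \<in> sets \<mu>" "\<And>z. z \<in> A \<Longrightarrow> real j * w \<le> snd z \<and> snd z < real j * w + w" for A j
  proof -
    define t where "t = real j * w"
    have t0: "0 \<le> t" using w by (simp add: t_def)
    \<comment> \<open>The layer \<open>A\<close> pushed down by \<open>t\<close>, so that
      \<open>A\<close> consists of the points which \<open>K (- t)\<close> takes to
      \<open>B\<close>.\<close>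
    define B where "B = {z \<in> space \<mu>. snd z < w \<and> (fst z, snd z + t) \<in> A}"
    have AO: "A \<subseteq> \<Omega>" "A \<in> sets borel" using A(1) by (auto simp: sets_mu)
    have Bs: "B \<in> sets \<mu>" unfolding B_def space_mu by (rule strip_sets[OF AO(2)])
    have Pb: "P (\<lambda>z. indicator B (K (- t) z))"
    proof (rule flow)
      show "P (indicator B)" using Bs by (rule low) (simp add: B_def)
    qed (use Bs in simp)
    show ?thesis
    proof (rule cong[OF ind[OF A(1)] integrable_K[OF ind[OF Bs]] Pb])
      fix z assume z: "z \<in> \<Omega>"
      obtain x r where xr: "z = (x, r)" by (cases z)
      have "z \<in> A \<longleftrightarrow> K (- t) z \<in> B"
      proof
        assume zA: "z \<in> A"
        then have r: "t \<le> r" "r < t + w" using A(2)[of z] xr by (auto simp: t_def)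
        have "(x, r + - t) \<in> \<Omega>" using z xr r t0 by (auto simp: space_iff)
        then have "K (- t) z = (x, r - t)" using K_vertical[of x r "- t"] z xr by simp
        moreover have "(x, r - t) \<in> \<Omega>" using \<open>(x, r + - t) \<in> \<Omega>\<close> by simp
        ultimately show "K (- t) z \<in> B" using r zA xr by (simp add: B_def)
      next
        assume kB: "K (- t) z \<in> B"
        obtain y s where ys: "K (- t) z = (y, s)" by (cases "K (- t) z")
        have "(y, s) \<in> \<Omega>" "(y, s + t) \<in> A" using kB ys by (auto simp: B_def)
        then have "K t (K (- t) z) = (y, s + t)" using K_vertical[of y s t] AO ys by auto
        moreover have "K t (K (- t) z) = z" using K_flow_add[OF z, of t "- t"] K_flow_0[OF z] by simp
        ultimately show "z \<in> A" using \<open>(y, s + t) \<in> A\<close> by simp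
      qed
      then show "indicator A z = (indicator B (K (- t) z) :: real)" by (simp add: indicator_def)
    qed
  qed
  have below: "P (indicator {z \<in> A. snd z < real j * w})" if A: "A \<in> sets \<mu>" for A j
  proof -
    have cut: "{z \<in> A. p \<le> snd z \<and> snd z < q} \<in> sets \<mu>" for p q
    proof -
      have c: "{z \<in> space \<mu>. p \<le> snd z \<and> snd z < q} \<in> sets \<mu>" by measurable
      have eq: "{z \<in> A. p \<le> snd z \<and> snd z < q} = A \<inter> {z \<in> space \<mu>. p \<le> snd z \<and> snd z < q}"
        using sets.sets_into_space[OF A] by auto
      show ?thesis unfolding eq by (rule sets.Int[OF A c])
    qed
    have cut0: "{z \<in> A. snd z < q} \<in> sets \<mu>" for q
    proof -
      have "0 \<le> snd z" if "z \<in> A" for z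
      proof -
        have "z \<in> \<Omega>" using sets.sets_into_space[OF A] that by auto
        then show ?thesis by (cases z) (simp add: space_iff)
      qed
      then have "{z \<in> A. snd z < q} = {z \<in> A. 0 \<le> snd z \<and> snd z < q}" by auto
      then show ?thesis using cut by simp
    qed
    show ?thesis
    proof (induction j)
      case 0
      show ?case by (rule low[OF cut0]) (use w in auto)
    next
      case (Suc j)
      let ?L = "{z \<in> A. real j * w \<le> snd z \<and> snd z < real j * w + w}"
      have eq: "indicator {z \<in> A. snd z < real (Suc j) * w}
        = (\<lambda>z. indicator {z \<in> A. snd z < real j * w} z + indicator ?L z :: real)"
        using w by (auto simp: fun_eq_iff indicator_def algebra_simps)
      have "P (indicator ?L)" by (rule layer[OF cut, of _ _ j]) simp
      then show ?case unfolding eq by (intro add ind cut cut0 Suc.IH)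
    qed
  qed
  have sets: "P (indicator A)" if A: "A \<in> sets \<mu>" for A
  proof (rule lim[OF ind[OF A]])
    fix \<epsilon> :: real assume \<epsilon>: "\<epsilon> > 0"
    then have "\<epsilon>/2 > 0" by simp
    from tail_measure[OF fst_snd_measurable_mu(2) this]
    obtain T where T: "measure \<mu> {z \<in> \<Omega>. T < snd z} \<le> \<epsilon>/2" by auto
    obtain j :: nat where "T / w < real j" using reals_Archimedean2 by blast
    then have j: "T < real j * w" using w by (simp add: field_simps)
    let ?B = "{z \<in> A. snd z < real j * w}"
    have "{z \<in> space \<mu>. snd z < real j * w} \<in> sets \<mu>" "{z \<in> space \<mu>. T < snd z} \<in> sets \<mu>" by measurable
    moreover have "?B = A \<inter> {z \<in> space \<mu>. snd z < real j * w}" using sets.sets_into_space[OF A] by auto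
    ultimately have Bs: "?B \<in> sets \<mu>" and Ts: "{z \<in> \<Omega>. T < snd z} \<in> sets \<mu>" using A by auto
    have "(\<integral>z. \<bar>indicator A z - indicator ?B z\<bar> \<partial>\<mu>) \<le> (\<integral>z. indicator {z \<in> \<Omega>. T < snd z} z \<partial>\<mu> :: real)"
    proof (rule Bochner_Integration.integral_mono'[OF ind[OF Ts]])
      fix z assume "z \<in> space \<mu>"
      then show "\<bar>indicator A z - indicator ?B z\<bar> \<le> (indicator {z \<in> \<Omega>. T < snd z} z :: real)"
        using j by (auto simp: indicator_def)
    qed simp
    also have "\<dots> = measure \<mu> {z \<in> \<Omega>. T < snd z}" using Ts by (simp add: sets.Int_space_eq2 del: space_mu)
    finally show "\<exists>h. integrable \<mu> h \<and> P h \<and> (\<integral>z. \<bar>indicator A z - h z\<bar> \<partial>\<mu>) < \<epsilon>"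
      using T \<epsilon> ind[OF Bs] below[OF A, of j] by (intro exI[of _ "indicator ?B"]) auto
  qed
  show "P g" using g
  proof (induction rule: integrable_induct)
    case (base A c)
    show ?case using scale[OF sets[OF base(1)], of c] by (simp add: mult.commute)
  next
    case (add g h)
    then show ?case by (intro assms(3))
  next
    case (lim g s)
    show ?case
    proof (rule assms(5)[OF lim.hyps(4)])
      fix \<epsilon> :: real assume \<epsilon>: "\<epsilon> > 0"
      have "(\<lambda>i. \<integral>z. \<bar>g z - s i z\<bar> \<partial>\<mu>) \<longlonglongrightarrow> (\<integral>z. 0 \<partial>\<mu>)"
      proof (rule integral_dominated_convergence[where w = "\<lambda>z. 3 * \<bar>g z\<bar>"])
        show "AE z in \<mu>. (\<lambda>i. \<bar>g z - s i z\<bar>) \<longlonglongrightarrow> 0"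
        proof (rule AE_I2)
          fix z assume "z \<in> space \<mu>"
          then have "(\<lambda>i. \<bar>g z - s i z\<bar>) \<longlonglongrightarrow> \<bar>g z - g z\<bar>" by (intro tendsto_intros lim.hyps(2))
          then show "(\<lambda>i. \<bar>g z - s i z\<bar>) \<longlonglongrightarrow> 0" by simp
        qed
        show "AE z in \<mu>. norm \<bar>g z - s i z\<bar> \<le> 3 * \<bar>g z\<bar>" for i
        proof (rule AE_I2)
          fix z assume "z \<in> space \<mu>"
          from lim.hyps(3)[OF this, of i] show "norm \<bar>g z - s i z\<bar> \<le> 3 * \<bar>g z\<bar>" by simp
        qed
      qed (use lim.hyps(1,4) in auto)
      then have "eventually (\<lambda>i. (\<integral>z. \<bar>g z - s i z\<bar> \<partial>\<mu>) < \<epsilon>) sequentially" using \<epsilon> by (intro order_tendstoD) simp_all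
      then obtain i where "(\<integral>z. \<bar>g z - s i z\<bar> \<partial>\<mu>) < \<epsilon>" by (auto simp: eventually_sequentially)
      then show "\<exists>h. integrable \<mu> h \<and> P h \<and> (\<integral>z. \<bar>g z - h z\<bar> \<partial>\<mu>) < \<epsilon>" using lim.hyps(1) lim.IH by blast
    qed
  qed
qed

subsection \<open>Mixing of all orders\<close>

text \<open>The assumption \<open>decor\<close> concerns an uncentred function in slot 0. In that
  form the product of the means is 0 because of slot 1. Centring slot 0 subtracts a constant, a
  constant slot drops out, and what remains is mixing of order \<open>n\<close>.\<close>

lemma mixes_box_step:
  assumes n: "0 < n" and mix: "\<And>g. (\<And>i. i < n \<Longrightarrow> g i \<in> unit_bounded) \<Longrightarrow> mixes n g"
    and f: "\<And>i. i < Suc n \<Longrightarrow> \<exists>\<Lambda>. box \<Lambda> (f i)"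
    and F: "\<And>i. i < Suc n \<Longrightarrow> F i = (\<lambda>z. f i z - (\<integral>z. f i z \<partial>\<mu>))"
    and decor: "\<And>\<Lambda> \<epsilon>. (\<And>i. i < Suc n \<Longrightarrow> box \<Lambda> (f i)) \<Longrightarrow> \<epsilon> > 0 \<Longrightarrow>
      \<forall>\<^sub>F t in far_filter n. \<bar>\<integral>z. f 0 z * (\<Prod>i<n. f (Suc i) (K (t i) z) - (\<integral>z. f (Suc i) z \<partial>\<mu>)) \<partial>\<mu>\<bar> \<le> \<epsilon>"
  shows "mixes (Suc n) F"
proof -
  obtain L where L: "\<And>i. i < Suc n \<Longrightarrow> box (L i) (f i)" using f by metis
  have fL: "box (Max (L ` {..n})) (f i)" if "i < Suc n" for i by (rule box_mono[OF L[OF that]]) (use that in auto)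
  have Fu: "F i \<in> unit_bounded" "(\<integral>z. F i z \<partial>\<mu>) = 0" if "i < Suc n" for i
    unfolding F[OF that] by (rule box_centered(3,4)[OF L[OF that]])+
  have fu: "f i \<in> unit_bounded" if "i < Suc n" for i by (rule box_centered(1)[OF L[OF that]])
  define G where "G = F(0 := f 0)"
  have "mixes (Suc n) G" unfolding mixes_def
  proof (intro allI impI)
    fix \<epsilon> :: real assume \<epsilon>: "\<epsilon> > 0"
    have mean0: "(\<Prod>i<Suc n. \<integral>z. G i z \<partial>\<mu>) = 0"
    proof (rule prod_zero)
      have "(\<integral>z. G 1 z \<partial>\<mu>) = 0" using Fu(2)[of 1] n by (simp add: G_def)
      then show "\<exists>i\<in>{..<Suc n}. (\<integral>z. G i z \<partial>\<mu>) = 0" using n by (intro bexI[of _ 1]) auto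
    qed simp
    have "\<epsilon>/2 > 0" using \<epsilon> by simp
    from decor[OF fL this] obtain T where T: "\<And>t. gaps n T t \<Longrightarrow> T \<le> t 0 \<Longrightarrow>
      \<bar>\<integral>z. f 0 z * (\<Prod>i<n. f (Suc i) (K (t i) z) - (\<integral>z. f (Suc i) z \<partial>\<mu>)) \<partial>\<mu>\<bar> \<le> \<epsilon>/2"
      unfolding eventually_far_filter by blast
    have "\<bar>corr (Suc n) G t\<bar> < \<epsilon>" if t: "gaps (Suc n) T t" for t
    proof -
      \<comment> \<open>Times relative to the first one: invariance of the measure allows slot 0 to
        be evaluated at time 0.\<close>
      define t' where "t' i = t (Suc i) - t 0" for i
      define H where "H z = f 0 z * (\<Prod>i<n. F (Suc i) (K (t' i) z))" for z
      have Hu: "H \<in> unit_bounded"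
        unfolding H_def by (intro unit_bounded_mult unit_bounded_prod unit_bounded_K fu Fu) auto
      have "corr (Suc n) G t = (\<integral>z. H (K (t 0) z) \<partial>\<mu>)" unfolding corr_def
      proof (rule Bochner_Integration.integral_cong[OF refl])
        fix z assume "z \<in> space \<mu>"
        then have z: "z \<in> \<Omega>" by simp
        have "K (t' i) (K (t 0) z) = K (t (Suc i)) z" for i
          using K_flow_add[OF z, of "t' i" "t 0"] by (simp add: t'_def)
        then show "(\<Prod>i<Suc n. G i (K (t i) z)) = H (K (t 0) z)"
          unfolding prod.lessThan_Suc_shift by (simp add: G_def H_def)
      qed
      also have "\<dots> = (\<integral>z. H z \<partial>\<mu>)" by (rule integral_K[OF unit_boundedD(1)[OF Hu]])
      also have "\<dots> = (\<integral>z. f 0 z * (\<Prod>i<n. f (Suc i) (K (t' i) z) - (\<integral>z. f (Suc i) z \<partial>\<mu>)) \<partial>\<mu>)" by (simp add: H_def F)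
      also have "\<bar>\<dots>\<bar> \<le> \<epsilon>/2"
      proof (rule T)
        show "gaps n T t'" using t by (auto simp: gaps_def t'_def)
        show "T \<le> t' 0" using t n by (auto simp: gaps_def t'_def)
      qed
      finally show ?thesis using \<epsilon> by simp
    qed
    then show "\<exists>T. \<forall>t. gaps (Suc n) T t \<longrightarrow> \<bar>corr (Suc n) G t - (\<Prod>i<Suc n. \<integral>z. G i z \<partial>\<mu>)\<bar> < \<epsilon>" unfolding mean0 by auto
  qed
  then have 1: "mixes (Suc n) (F(0 := f 0))" by (simp add: G_def)
  have one: "(\<lambda>_. 1) \<in> unit_bounded" by (rule unit_boundedI) auto
  have "mixes (Suc n) (F(0 := \<lambda>_. 1))"
  proof (rule mixes_remove_slot[where j = 0])
    show "(F(0 := \<lambda>_. 1)) i \<in> unit_bounded" if "i \<le> n" for i using Fu(1)[of i] one that by simp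
  qed (use mix in auto)
  then have 2: "mixes (Suc n) (F(0 := \<lambda>z. (- (\<integral>z. f 0 z \<partial>\<mu>)) * 1))"
    by (rule mixes_slot_scale[rotated -1]) (use Fu in auto)
  have "mixes (Suc n) (F(0 := \<lambda>z. f 0 z + (- (\<integral>z. f 0 z \<partial>\<mu>)) * 1))"
    by (rule mixes_slot_add[OF _ _ unit_boundedD(3)[OF fu] 1 _ 2]) (use Fu in auto)
  moreover have "F(0 := \<lambda>z. f 0 z + (- (\<integral>z. f 0 z \<partial>\<mu>)) * 1) = F" using F[of 0] by (auto simp: fun_eq_iff)
  ultimately show ?thesis by simp
qed

text \<open>A box function is a centred one plus a constant; the constant is covered by order
  \<open>n\<close>. Density of the functions built from boxes and their flow translates then gives
  all of \<open>unit_bounded\<close>, slot by slot.\<close>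

lemma mixes_step:
  assumes n: "0 < n" and mix: "\<And>g. (\<And>i. i < n \<Longrightarrow> g i \<in> unit_bounded) \<Longrightarrow> mixes n g"
    and decor: "\<And>f \<Lambda> \<epsilon>. (\<And>i. i < Suc n \<Longrightarrow> box \<Lambda> (f i)) \<Longrightarrow> \<epsilon> > 0 \<Longrightarrow>
      \<forall>\<^sub>F t in far_filter n. \<bar>\<integral>z. f 0 z * (\<Prod>i<n. f (Suc i) (K (t i) z) - (\<integral>z. f (Suc i) z \<partial>\<mu>)) \<partial>\<mu>\<bar> \<le> \<epsilon>"
    and F: "\<And>i. i < Suc n \<Longrightarrow> F i \<in> unit_bounded"
  shows "mixes (Suc n) F"
proof (rule mixes_slots[where \<A> = "{F. \<exists>\<Lambda> f. box \<Lambda> f \<and> F = (\<lambda>z. f z - (\<integral>z. f z \<partial>\<mu>))}" and \<B> = unit_bounded])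
  show "mixes (Suc n) F" if F: "\<And>i. i < Suc n \<Longrightarrow> F i \<in> {F. \<exists>\<Lambda> f. box \<Lambda> f \<and> F = (\<lambda>z. f z - (\<integral>z. f z \<partial>\<mu>))}" for F
  proof -
    have "\<exists>f. (\<exists>\<Lambda>. box \<Lambda> f) \<and> F i = (\<lambda>z. f z - (\<integral>z. f z \<partial>\<mu>))" if "i < Suc n" for i using F[OF that] by blast
    then obtain f where f: "\<And>i. i < Suc n \<Longrightarrow> (\<exists>\<Lambda>. box \<Lambda> (f i)) \<and> F i = (\<lambda>z. f i z - (\<integral>z. f i z \<partial>\<mu>))" by metis
    show ?thesis
    proof (rule mixes_box_step[where f = f, OF n mix])
      show "\<forall>\<^sub>F t in far_filter n. \<bar>\<integral>z. f 0 z * (\<Prod>i<n. f (Suc i) (K (t i) z) - (\<integral>z. f (Suc i) z \<partial>\<mu>)) \<partial>\<mu>\<bar> \<le> \<epsilon>"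
        if "\<And>i. i < Suc n \<Longrightarrow> box \<Lambda> (f i)" "\<epsilon> > 0" for \<Lambda> \<epsilon> using that by (rule decor)
    qed (use f in auto)
  qed
  show "{F. \<exists>\<Lambda> f. box \<Lambda> f \<and> F = (\<lambda>z. f z - (\<integral>z. f z \<partial>\<mu>))} \<subseteq> unit_bounded" using box_centered(3) by auto
  fix F j b
  assume j: "j < Suc n" and F: "\<And>i. i < Suc n \<Longrightarrow> i \<noteq> j \<Longrightarrow> F i \<in> unit_bounded"
    and A: "\<And>a. a \<in> {F. \<exists>\<Lambda> f. box \<Lambda> f \<and> F = (\<lambda>z. f z - (\<integral>z. f z \<partial>\<mu>))} \<Longrightarrow> mixes (Suc n) (F(j := a))"
    and b: "b \<in> unit_bounded"
  have one: "(\<lambda>_. 1) \<in> unit_bounded" by (rule unit_boundedI) auto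
  have const: "mixes (Suc n) (F(j := \<lambda>_. 1))"
  proof (rule mixes_remove_slot[where j = j])
    show "(F(j := \<lambda>_. 1)) i \<in> unit_bounded" if "i \<le> n" for i using F[of i] one that by simp
  qed (use mix j in auto)
  show "mixes (Suc n) (F(j := b))"
  proof (rule integrable_dense_induct[where P = "\<lambda>b. mixes (Suc n) (F(j := b))"])
    fix \<Lambda> f assume f: "box \<Lambda> f"
    let ?m = "\<integral>z. f z \<partial>\<mu>"
    have "mixes (Suc n) (F(j := \<lambda>z. f z - ?m))" by (rule A) (use f in blast)
    moreover have "mixes (Suc n) (F(j := \<lambda>z. ?m * 1))" by (rule mixes_slot_scale[OF j F const])
    ultimately have "mixes (Suc n) (F(j := \<lambda>z. (f z - ?m) + ?m * 1))"
      using box_centered(3)[OF f] by (intro mixes_slot_add[OF j F]) (auto intro: unit_boundedD(3))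
    then show "mixes (Suc n) (F(j := f))" by simp
  next
    show "mixes (Suc n) (F(j := \<lambda>z. g (K u z)))" if "g \<in> borel_measurable \<mu>" "mixes (Suc n) (F(j := g))" for g u
      by (rule mixes_slot_K[OF j F that])
    show "mixes (Suc n) (F(j := \<lambda>z. g z + h z))"
      if "integrable \<mu> g" "integrable \<mu> h" "mixes (Suc n) (F(j := g))" "mixes (Suc n) (F(j := h))" for g h
      by (rule mixes_slot_add[OF j F that(1,3,2,4)])
    show "mixes (Suc n) (F(j := \<lambda>z. c * g z))" if "mixes (Suc n) (F(j := g))" for g c
      by (rule mixes_slot_scale[OF j F that])
    show "mixes (Suc n) (F(j := g))" if "integrable \<mu> g"
      "\<And>\<epsilon>. \<epsilon> > 0 \<Longrightarrow> \<exists>h. integrable \<mu> h \<and> mixes (Suc n) (F(j := h)) \<and> (\<integral>z. \<bar>g z - h z\<bar> \<partial>\<mu>) < \<epsilon>" for g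
      by (rule mixes_slot_lim[OF j F that])
  qed (rule unit_boundedD(3)[OF b])
qed (use F in auto)

text \<open>Order 2 is settled before the induction because every step uses it next to the preceding
  order: it makes the autocorrelations of the single factors small.\<close>

lemma mixes_all:
  assumes "0 < n" "\<And>i. i < n \<Longrightarrow> f i \<in> unit_bounded"
  shows "mixes n f"
proof -
  have 1: "mixes 1 f" if "\<And>i. i < 1 \<Longrightarrow> f i \<in> unit_bounded" for f
    using mixes_one[of f] unit_boundedD(1)[OF that[of 0]] by simp
  have 2: "mixes (Suc 1) f" if "\<And>i. i < Suc 1 \<Longrightarrow> f i \<in> unit_bounded" for f
  proof (rule mixes_step[OF _ 1])
    fix f \<Lambda> and \<epsilon> :: real assume f: "\<And>i. i < Suc 1 \<Longrightarrow> box \<Lambda> (f i)" and \<epsilon>: "\<epsilon> > 0"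
    have "box \<Lambda> (f 0)" "box \<Lambda> (f 1)" using f by auto
    from far_box_decorrelation_1[OF this(2) this(1) \<epsilon>]
    show "\<forall>\<^sub>F t in far_filter 1. \<bar>\<integral>z. f 0 z * (\<Prod>i<1. f (Suc i) (K (t i) z) - (\<integral>z. f (Suc i) z \<partial>\<mu>)) \<partial>\<mu>\<bar> \<le> \<epsilon>"
      using mean_def[OF \<open>box \<Lambda> (f 1)\<close>] by simp
  qed (use that in auto)
  have "mixes (Suc m) f" if "\<And>i. i < Suc m \<Longrightarrow> f i \<in> unit_bounded" for m f using that
  proof (induction m arbitrary: f)
    case 0
    then show ?case using 1[of f] by simp
  next
    case (Suc m)
    show ?case
    proof (rule mixes_step[OF _ Suc.IH])
      fix f \<Lambda> and \<epsilon> :: real assume f: "\<And>i. i < Suc (Suc m) \<Longrightarrow> box \<Lambda> (f i)" and \<epsilon>: "\<epsilon> > 0"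
      show "\<forall>\<^sub>F t in far_filter (Suc m). \<bar>\<integral>z. f 0 z * (\<Prod>i<Suc m. f (Suc i) (K (t i) z) - (\<integral>z. f (Suc i) z \<partial>\<mu>)) \<partial>\<mu>\<bar> \<le> \<epsilon>"
      proof (rule far_box_decorrelation[where f = "\<lambda>i. f (Suc i)"])
        show "mixes 2 (\<lambda>_. g)" if "g \<in> unit_bounded" for g using 2[of "\<lambda>_. g"] that by (simp add: numeral_2_eq_2)
      qed (use f \<epsilon> Suc.IH in auto)
    qed (use Suc.prems in auto)
  qed
  from this[of "n - 1" f] assms show ?thesis by simp
qed

text \<open>An image under \<open>K s\<close> is a preimage under \<open>K (- s)\<close>, so the
  correlation is taken at the times \<open>- t i\<close>. These decrease with \<open>i\<close>, and
  the reversal \<open>k - 1 - i\<close> of the indices restores positive gaps.\<close>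

lemma mixing_of_all_orders: "mixing_of_all_orders \<mu> K"
  unfolding mixing_of_all_orders_def mixing_of_order_def
proof (intro allI impI conjI)
  show "prob_space \<mu>" by (rule prob_space_mu)
  show "measure_preserving_flow \<mu> K" unfolding measure_preserving_flow_def
    using K_flow_measurable K_flow_distr K_flow_0 K_flow_add by simp
  fix k :: nat and A :: "nat \<Rightarrow> (real \<times> real) set"
  assume k: "2 \<le> k" and A: "\<forall>i<k. A i \<in> sets \<mu>"
  define f where "f i = (indicator (A (k - 1 - i)) :: real \<times> real \<Rightarrow> real)" for i
  have fu: "f i \<in> unit_bounded" if "i < k" for i
  proof (rule unit_boundedI)
    have "A (k - 1 - i) \<in> sets \<mu>" using A k by simp
    then show "f i \<in> borel_measurable \<mu>" unfolding f_def by (rule borel_measurable_indicator)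
  qed (simp add: f_def indicator_def)
  have mix: "mixes k f" by (rule mixes_all) (use k fu in auto)
  have means: "(\<Prod>i<k. \<integral>z. f i z \<partial>\<mu>) = (\<Prod>i<k. measure \<mu> (A i))"
  proof -
    have "(\<integral>z. f i z \<partial>\<mu>) = measure \<mu> (A (k - Suc i))" if "i < k" for i
    proof -
      have "A (k - Suc i) \<in> sets \<mu>" using A k by simp
      then show ?thesis using that by (simp add: f_def sets.Int_space_eq2 del: space_mu)
    qed
    then have "(\<Prod>i<k. \<integral>z. f i z \<partial>\<mu>) = (\<Prod>i<k. measure \<mu> (A (k - Suc i)))" by (intro prod.cong) auto
    then show ?thesis using prod.nat_diff_reindex[of "\<lambda>i. measure \<mu> (A i)" k] by simp
  qed
  have corr_eq: "measure \<mu> (\<Inter>i<k. K (t i) ` A i) = corr k f (\<lambda>i. - t (k - 1 - i))" for t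
  proof -
    have AO: "A i \<subseteq> \<Omega>" if "i < k" for i using A that sets.sets_into_space by fastforce
    have im: "z \<in> K s ` A i \<longleftrightarrow> z \<in> \<Omega> \<and> K (- s) z \<in> A i" if i: "i < k" for z s i
    proof
      assume "z \<in> K s ` A i"
      then obtain y where y: "y \<in> A i" "z = K s y" by auto
      then have "y \<in> \<Omega>" using AO[OF i] by auto
      then show "z \<in> \<Omega> \<and> K (- s) z \<in> A i" using y K_flow_add[of y "- s" s] K_flow_0[of y] K_space[of y s] by simp
    next
      assume z: "z \<in> \<Omega> \<and> K (- s) z \<in> A i"
      then have "z = K s (K (- s) z)" using K_flow_add[of z s "- s"] K_flow_0[of z] by simp
      then show "z \<in> K s ` A i" using z by blast
    qed
    let ?X = "{z \<in> space \<mu>. \<forall>i\<in>{..<k}. K (- t i) z \<in> A i}"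
    have X: "(\<Inter>i<k. K (t i) ` A i) = ?X"
    proof (rule set_eqI)
      fix z
      have "z \<in> (\<Inter>i<k. K (t i) ` A i) \<longleftrightarrow> (\<forall>i<k. z \<in> \<Omega> \<and> K (- t i) z \<in> A i)"
        by (simp only: INT_iff Ball_def lessThan_iff im cong: imp_cong)
      also have "\<dots> \<longleftrightarrow> z \<in> ?X" using k by (auto dest: spec[of _ 0])
      finally show "z \<in> (\<Inter>i<k. K (t i) ` A i) \<longleftrightarrow> z \<in> ?X" .
    qed
    have "{z \<in> space \<mu>. K (- t i) z \<in> A i} \<in> sets \<mu>" if "i < k" for i
      using measurable_sets[OF K_flow_measurable[of "- t i"], of "A i"] A that by (simp add: vimage_def Int_def conj_commute)
    then have Xs: "?X \<in> sets \<mu>" by (intro sets.sets_Collect_finite_All') (use k in \<open>auto simp: lessThan_empty_iff\<close>)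
    have "measure \<mu> ?X = (\<integral>z. indicator ?X z \<partial>\<mu>)" using Xs by (simp add: sets.Int_space_eq2 del: space_mu)
    also have "\<dots> = corr k f (\<lambda>i. - t (k - 1 - i))" unfolding corr_def
    proof (rule Bochner_Integration.integral_cong[OF refl])
      fix z assume z: "z \<in> space \<mu>"
      have "(\<Prod>i<k. f i (K (- t (k - 1 - i)) z)) = (\<Prod>i<k. indicator (A (k - Suc i)) (K (- t (k - Suc i)) z))"
        by (simp add: f_def)
      also have "\<dots> = (\<Prod>i<k. indicator (A i) (K (- t i) z))" by (rule prod.nat_diff_reindex)
      also have "\<dots> = indicator ?X z" using z by (auto simp: indicator_def intro: prod_zero)
      finally show "indicator ?X z = (\<Prod>i<k. f i (K (- t (k - 1 - i)) z))" ..
    qed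
    finally show ?thesis unfolding X .
  qed
  show "((\<lambda>t. measure \<mu> (\<Inter>i<k. K (t i) ` A i)) \<longlongrightarrow> (\<Prod>i<k. measure \<mu> (A i)))
    (inf (filtercomap (\<lambda>t. MIN i\<in>{0<..<k}. t i - t (i - 1)) at_top)
      (principal {t. t 0 = 0 \<and> (\<forall>i\<in>{0<..<k}. t (i - 1) < t i)}))" unfolding tendsto_iff
  proof (intro allI impI)
    fix \<epsilon> :: real assume "\<epsilon> > 0"
    then obtain T where T: "\<And>t. gaps k T t \<Longrightarrow> \<bar>corr k f t - (\<Prod>i<k. \<integral>z. f i z \<partial>\<mu>)\<bar> < \<epsilon>"
      using mix unfolding mixes_def by blast
    have "dist (measure \<mu> (\<Inter>i<k. K (t i) ` A i)) (\<Prod>i<k. measure \<mu> (A i)) < \<epsilon>"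
      if t: "T \<le> (MIN i\<in>{0<..<k}. t i - t (i - 1))" for t
    proof -
      have "gaps k T (\<lambda>i. - t (k - 1 - i))" unfolding gaps_def
      proof (intro allI impI)
        fix i assume i: "Suc i < k"
        then have j: "k - 1 - i \<in> {0<..<k}" by auto
        have "(MIN i\<in>{0<..<k}. t i - t (i - 1)) \<le> t (k - 1 - i) - t (k - 1 - i - 1)"
          by (rule Min_le) (use j in blast)+
        moreover have "k - 1 - i - 1 = k - 1 - Suc i" by simp
        ultimately show "- t (k - 1 - i) + T \<le> - t (k - 1 - Suc i)" using t by simp
      qed
      from T[OF this] show ?thesis by (simp add: corr_eq means dist_real_def)
    qed
    then show "\<forall>\<^sub>F t in inf (filtercomap (\<lambda>t. MIN i\<in>{0<..<k}. t i - t (i - 1)) at_top)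
      (principal {t. t 0 = 0 \<and> (\<forall>i\<in>{0<..<k}. t (i - 1) < t i)}).
      dist (measure \<mu> (\<Inter>i<k. K (t i) ` A i)) (\<Prod>i<k. measure \<mu> (A i)) < \<epsilon>"
      unfolding eventually_inf_principal eventually_filtercomap_at_top_linorder by blast
  qed
qed

end

theorem theorem1:
  fixes \<alpha> \<gamma> N_plus N_minus :: real and \<Phi> :: "real \<Rightarrow> real"
  assumes "\<alpha> \<notin> \<rat>"
    and "0 < \<gamma>" and "\<gamma> < 1"
    and "\<And>x. x \<notin> \<int> \<Longrightarrow> \<Phi> (x + 1) = \<Phi> x"
    and "C2_on (- \<int>) \<Phi>"
    and "\<And>x. x \<notin> \<int> \<Longrightarrow> \<Phi> x > 0"
    and "(LINT x:{0<..<1}|lborel. \<Phi> x) = 1"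
    and "((\<lambda>x. deriv (deriv \<Phi>) x / \<bar>x\<bar> powr (- 2 - \<gamma>)) \<longlongrightarrow> N_plus) (at_right 0)"
    and "((\<lambda>x. deriv (deriv \<Phi>) x / \<bar>x\<bar> powr (- 2 - \<gamma>)) \<longlongrightarrow> N_minus) (at_left 0)"
    and "N_plus = N_minus" and "N_minus \<noteq> 0"
  shows "mixing_of_all_orders (suspension_measure \<alpha> \<Phi>) (special_flow \<alpha> \<Phi>)"
proof -
  interpret power_roof \<alpha> \<gamma> N_minus \<Phi> by unfold_locales (use assms in auto)
  show ?thesis by (rule mixing_of_all_orders)
qed

end
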